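(* For any radial $f\in L^2(\mathbb{R}^2,\mathrm{d}\boldsymbol x)$ we have $$\|e^{it\Delta}f(\boldsymbol x)\|_{L^4(\mathbb{R}^3,\mathrm{d}\boldsymbol x\,\mathrm{d}t)}\le2^{-1/2}\|f\|_{L^2(\mathbb{R}^2,\mathrm{d}\boldsymbol x)},$$ and equality is attained if and only if $f(\boldsymbol x)=Ae^{-B\|\boldsymbol x\|^2}$, where $A,B\in\mathbb{C}$ and $\mathrm{Re}\,B>0$.
   Context: $e^{it\Delta}f(\boldsymbol x)$ is the solution of the Schr\"odinger equation $\partial_t u=i\Delta u$ on $\mathbb{R}^2\times\mathbb{R}$ with $u(\boldsymbol x,0)=f(\boldsymbol x)$. Functions are complex valued. *)

theory Defs
  imports "HOL-Analysis.Analysis"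
begin

text \<open>
  Lebesgue norms are extended nonnegative reals, so that a bound on the norm includes the
  membership in the corresponding space.
\<close>

definition Lp_norm :: "real \<Rightarrow> 'a measure \<Rightarrow> ('a \<Rightarrow> complex) \<Rightarrow> ennreal" where
  "Lp_norm p M f =
    (let I = (\<integral>\<^sup>+ x. ennreal (norm (f x) powr p) \<partial>M)
     in if I = \<infinity> then \<infinity> else ennreal (enn2real I powr (1 / p)))"

definition Lp_space :: "real \<Rightarrow> 'a measure \<Rightarrow> ('a \<Rightarrow> complex) set" where
  "Lp_space p M = {f \<in> borel_measurable M. Lp_norm p M f < \<infinity>}"

text \<open>Elements of Lebesgue spaces are only determined almost everywhere, and so is radiality.\<close>

definition radial :: "('a::euclidean_space \<Rightarrow> complex) \<Rightarrow> bool" where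
  "radial f \<longleftrightarrow> (\<exists>g :: real \<Rightarrow> complex. AE x in lebesgue. f x = g (norm x))"

definition C1_fun :: "('a::euclidean_space \<Rightarrow> complex) \<Rightarrow> bool" where
  "C1_fun \<phi> \<longleftrightarrow> (\<forall>x. \<phi> differentiable at x) \<and>
     (\<forall>v. continuous_on UNIV (\<lambda>x. frechet_derivative \<phi> (at x) v))"

definition C2_fun :: "('a::euclidean_space \<Rightarrow> complex) \<Rightarrow> bool" where
  "C2_fun \<phi> \<longleftrightarrow> C1_fun \<phi> \<and> (\<forall>v. C1_fun (\<lambda>x. frechet_derivative \<phi> (at x) v))"

definition laplacian :: "('a::euclidean_space \<Rightarrow> complex) \<Rightarrow> 'a \<Rightarrow> complex" where
  "laplacian \<phi> x =
    (\<Sum>b\<in>Basis. frechet_derivative (\<lambda>y. frechet_derivative \<phi> (at y) b) (at x) b)"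

definition test_fun :: "('a::euclidean_space \<Rightarrow> complex) \<Rightarrow> bool" where
  "test_fun \<phi> \<longleftrightarrow> C2_fun \<phi> \<and> compact (closure {x. \<phi> x \<noteq> 0})"

text \<open>
  For initial data that are merely square integrable, the Schroedinger equation
  \<open>\<partial>\<^sub>t u = \<i> \<Delta> u\<close> is understood weakly in space, for a curve \<open>t \<mapsto> u(\<cdot>,t)\<close> that is continuous
  in \<open>L\<^sup>2\<close>. In this class the solution is unique up to null sets. A Borel function of \<open>(x, t)\<close>
  is asked for because the slices alone, being determined almost everywhere for each \<open>t\<close>,
  do not give a function that can be integrated over space-time.
\<close>

definition schroedinger_solution ::
    "('a::euclidean_space \<Rightarrow> complex) \<Rightarrow> ('a \<times> real \<Rightarrow> complex) \<Rightarrow> bool" where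
  "schroedinger_solution f u \<longleftrightarrow>
     u \<in> borel_measurable borel \<and>
     (\<forall>t. (\<lambda>x. u (x, t)) \<in> Lp_space 2 lebesgue) \<and>
     (\<forall>s. ((\<lambda>t. Lp_norm 2 lebesgue (\<lambda>x. u (x, t) - u (x, s))) \<longlongrightarrow> 0) (at s)) \<and>
     (AE x in lebesgue. u (x, 0) = f x) \<and>
     (\<forall>\<phi> t. test_fun \<phi> \<longrightarrow>
        ((\<lambda>\<tau>. LINT x|lebesgue. u (x, \<tau>) * \<phi> x) has_vector_derivative
           \<i> * (LINT x|lebesgue. u (x, t) * laplacian \<phi> x)) (at t))"

text \<open>The space-time function \<open>(x, t) \<mapsto> e\<^bsup>\<i>t\<Delta>\<^esup> f(x)\<close>.\<close>

definition schroedinger_flow ::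
    "('a::euclidean_space \<Rightarrow> complex) \<Rightarrow> 'a \<times> real \<Rightarrow> complex" where
  "schroedinger_flow f = (SOME u. schroedinger_solution f u)"

end

theory Submission
  imports Defs "HOL-Probability.Probability"
begin

text \<open>
  In the variable \<open>s = |x|\<^sup>2\<close> the plane carries \<open>\<pi>\<close> times Lebesgue measure on the half line, where
  the Laguerre functions \<open>\<phi>\<^sub>n(s) = e\<^bsup>-s/2\<^esup> L\<^sub>n(s)\<close> form an orthonormal basis (\<open>lagfun_orthonormal\<close>,
  \<open>lagfun_total\<close>). Put \<open>c = 1 + 4t\<^sup>2\<close> and \<open>\<omega> = (1 - 2\<i>t)/(1 + 2\<i>t)\<close>, a point of the unit circle. The
  Schroedinger evolution of \<open>\<phi>\<^sub>n(|x|\<^sup>2)\<close> is, up to a factor of modulus \<open>c\<^bsup>-1/2\<^esup>\<close> that does not depend on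
  \<open>n\<close>, the function \<open>\<omega>\<^sup>n \<phi>\<^sub>n(|x|\<^sup>2/c)\<close> (\<open>mode_lens\<close>, \<open>mode_weak_equation\<close>). Hence a radial datum with
  Laguerre coefficients \<open>a\<^sub>n\<close> has squared norm \<open>\<pi> \<Sum>|a\<^sub>n|\<^sup>2\<close> and evolves with
  \<open>|u|\<^sup>2 = |\<Sum> a\<^sub>n \<omega>\<^sup>n \<phi>\<^sub>n(s/c)|\<^sup>2 / c\<close>.

  The fourth power of \<open>|u|\<close> is the squared modulus of \<open>u\<^sup>2\<close>. The powers of \<open>\<omega>\<close> are orthogonal with
  respect to \<open>dt/c\<close> (\<open>omega_parseval\<close>), so that the terms \<open>a\<^sub>k a\<^sub>l \<phi>\<^sub>k \<phi>\<^sub>l\<close> of the square with different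
  \<open>N = k + l\<close> decouple. Within one \<open>N\<close> the linearisation \<open>L\<^sub>k(s/2) L\<^sub>l(s/2) = \<Sum>\<^sub>m D(k,l,m) L\<^sub>m(s)\<close>
  (\<open>laguerre_product\<close>) and Parseval in \<open>s\<close> give (\<open>partial_L4\<close>)

    \<open>\<integral>\<integral>|u|\<^sup>4 dx dt = \<pi>\<^sup>2/4 \<Sum>\<^sub>N \<Sum>\<^sub>m |\<Sum>\<^sub>k D(k,N-k,m) a\<^sub>k a\<^sub>N\<^sub>-\<^sub>k|\<^sup>2\<close>.

  The point is that for each \<open>N\<close> the matrix \<open>D(k,N-k,m)\<close> is doubly stochastic (\<open>linco_nonneg\<close>,
  \<open>sum_linco_row\<close>, \<open>sum_linco_column\<close>). By convexity of the square the right-hand side is therefore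
  at most \<open>\<pi>\<^sup>2/4 \<Sum>\<^sub>N \<Sum>\<^sub>k |a\<^sub>k a\<^sub>N\<^sub>-\<^sub>k|\<^sup>2 = \<pi>\<^sup>2/4 (\<Sum>|a\<^sub>n|\<^sup>2)\<^sup>2\<close>, which is a quarter of the fourth power of the
  norm of the datum. The loss is a sum of variances (\<open>linprod_deficit\<close>). Since \<open>D(k,N-k,0) > 0\<close>,
  equality forces \<open>a\<^sub>k a\<^sub>N\<^sub>-\<^sub>k\<close> to be independent of \<open>k\<close>, so that \<open>a\<close> is a geometric sequence; and the
  square summable geometric sequences are precisely the coefficients of the functions \<open>A e\<^bsup>-Bs\<^esup>\<close> with
  \<open>Re B > 0\<close>, the ratio being a Cayley transform of \<open>B\<close> (\<open>exp_lagfun_coeff\<close>).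

  Two analytic matters remain. Weak solutions are unique (\<open>weak_solution_unique\<close>): the
  mollifications of the difference of two solutions conserve their energy, which is zero at time
  zero. And the computation, done for finite sums, passes to the limit: Fatou's lemma transports the
  inequality together with the loss in a single degree \<open>N\<close> (\<open>flow_L4_le_deficit\<close>), while for
  geometric sequences the reverse inequality follows by applying the estimate to the tail of the
  series (\<open>flow_L4_geometric\<close>).
\<close>

section \<open>Laguerre polynomials\<close>

definition laguerre :: "nat \<Rightarrow> real poly" where
  "laguerre n = (\<Sum>k\<le>n. monom ((-1) ^ k * real (n choose k) / fact k) k)"

lemma coeff_laguerre: "coeff (laguerre n) k = (-1) ^ k * real (n choose k) / fact k"
proof -
  have "coeff (laguerre n) k
      = (\<Sum>i\<le>n. if i = k then (-1) ^ i * real (n choose i) / fact i else 0)"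
    unfolding laguerre_def coeff_sum by (intro sum.cong) (auto simp: coeff_monom)
  also have "\<dots> = (-1) ^ k * real (n choose k) / fact k"
    by (cases "k \<le> n") (auto simp: sum.delta binomial_eq_0)
  finally show ?thesis .
qed

lemma laguerre_0 [simp]: "laguerre 0 = 1"
  by (simp add: laguerre_def monom_0 one_pCons)

lemma poly_laguerre_0 [simp]: "poly (laguerre n) 0 = 1"
  by (simp add: poly_0_coeff_0 coeff_laguerre)

lemma coeff_laguerre_Suc:
  "real (Suc k) * coeff (laguerre n) (Suc k) = - ((-1) ^ k * real (n choose Suc k) / fact k)"
proof -
  have f: "fact (Suc k) = real (Suc k) * fact k" by simp
  have "real (Suc k) \<noteq> 0" by simp
  then show ?thesis unfolding coeff_laguerre f by (simp del: of_nat_Suc fact_Suc)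
qed

text \<open>
  Pascal's rule for the coefficients. Together with the value 1 at 0 this recurrence determines the
  Laguerre polynomials; their orthogonality and their product formula are both derived from it.
\<close>

lemma pderiv_laguerre_Suc:
  "pderiv (laguerre (Suc n)) = pderiv (laguerre n) - laguerre n"
proof (rule poly_eqI)
  fix k
  show "coeff (pderiv (laguerre (Suc n))) k = coeff (pderiv (laguerre n) - laguerre n) k"
    unfolding coeff_pderiv coeff_diff coeff_laguerre_Suc unfolding coeff_laguerre binomial_Suc_Suc of_nat_add
    by (simp add: field_simps)
qed

lemma pderiv_laguerre: "pderiv (laguerre n) = - (\<Sum>j<n. laguerre j)"
  by (induction n) (simp_all add: pderiv_laguerre_Suc)

text \<open>
  Laguerre's equation is what makes the explicit solutions below satisfy the Schroedinger equation.
  On coefficients it is the two-term recursion \<open>(k + 1)\<^sup>2 c\<^sub>k\<^sub>+\<^sub>1 = - (n - k) c\<^sub>k\<close>.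
\<close>

lemma laguerre_ode:
  "pCons 0 (pderiv (pderiv (laguerre n))) + pderiv (laguerre n) - pCons 0 (pderiv (laguerre n))
     + smult (real n) (laguerre n) = 0"
proof (rule poly_eqI)
  fix k
  have b: "real (Suc k) * real (n choose Suc k) = (real n - real k) * real (n choose k)"
  proof (cases "k \<le> n")
    case True
    have "Suc k * (n choose Suc k) = (n - k) * (n choose k)"
      by (simp only: binomial_absorption binomial_absorb_comp)
    with True show ?thesis by (metis of_nat_diff of_nat_mult)
  qed (simp add: binomial_eq_0)
  have "real (Suc k) * (real (Suc k) * coeff (laguerre n) (Suc k))
      = - ((-1) ^ k / fact k) * (real (Suc k) * real (n choose Suc k))"
    unfolding coeff_laguerre_Suc by simp
  also have "\<dots> = - ((real n - real k) * coeff (laguerre n) k)"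
    unfolding b coeff_laguerre by simp
  finally have c: "real (Suc k) * (real (Suc k) * coeff (laguerre n) (Suc k))
      = - ((real n - real k) * coeff (laguerre n) k)" .
  show "coeff (pCons 0 (pderiv (pderiv (laguerre n))) + pderiv (laguerre n)
      - pCons 0 (pderiv (laguerre n)) + smult (real n) (laguerre n)) k = coeff 0 k"
    using c by (cases k) (simp_all add: coeff_pderiv algebra_simps)
qed

section \<open>Linearising products of Laguerre polynomials\<close>

text \<open>
  In the classical notation this is the value at \<open>l\<close> of the binary Krawtchouk polynomial of degree
  \<open>m\<close> with parameter \<open>k + l\<close>.
\<close>

definition krawtchouk :: "nat \<Rightarrow> nat \<Rightarrow> nat \<Rightarrow> real" where
  "krawtchouk k l m = coeff ([:1, 1:] ^ k * [:1, -1:] ^ l) m"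

text \<open>
  The linearisation coefficients \<open>D(k,l,m)\<close> of Laguerre polynomials with halved argument. For fixed
  \<open>N = k + l\<close> they are the squared entries of an orthogonal matrix, that of the substitution
  \<open>(x, y) \<mapsto> ((x + y)/\<surd>2, (x - y)/\<surd>2)\<close> on the monomials \<open>x\<^sup>k y\<^sup>l / \<surd>(k! l!)\<close> of degree \<open>N\<close>: this is the
  conceptual reason for their being nonnegative and doubly stochastic.
\<close>

definition linco :: "nat \<Rightarrow> nat \<Rightarrow> nat \<Rightarrow> real" where
  "linco k l m = fact m * fact (k + l - m) / (2 ^ (k + l) * fact k * fact l) * (krawtchouk k l m)\<^sup>2"

lemma linco_nonneg: "linco k l m \<ge> 0"
  by (simp add: linco_def)

lemma krawtchouk_eq_0:
  assumes "k + l < m" shows "krawtchouk k l m = 0"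
proof -
  have "degree ([:1, 1::real:] ^ k * [:1, -1:] ^ l) \<le> k + l"
    by (rule order_trans[OF degree_mult_le]) (intro add_mono order_trans[OF degree_power_le], auto)
  with assms show ?thesis by (simp add: krawtchouk_def coeff_eq_0)
qed

lemma linco_eq_0: "k + l < m \<Longrightarrow> linco k l m = 0"
  by (simp add: linco_def krawtchouk_eq_0)

lemma krawtchouk_0 [simp]: "krawtchouk k l 0 = 1"
  by (simp add: krawtchouk_def flip: poly_0_coeff_0)

lemma krawtchouk_Suc_left:
  "krawtchouk (Suc k) l (Suc m) = krawtchouk k l (Suc m) + krawtchouk k l m"
proof -
  have "[:1, 1::real:] ^ Suc k * [:1, -1:] ^ l = [:1, 1:] * ([:1, 1:] ^ k * [:1, -1:] ^ l)"
    by (simp only: power_Suc mult_ac)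
  also have "\<dots> = [:1, 1:] ^ k * [:1, -1:] ^ l + pCons 0 ([:1, 1:] ^ k * [:1, -1:] ^ l)"
    by simp
  finally show ?thesis unfolding krawtchouk_def by simp
qed

lemma krawtchouk_Suc_right:
  "krawtchouk k (Suc l) (Suc m) = krawtchouk k l (Suc m) - krawtchouk k l m"
proof -
  have "[:1, 1::real:] ^ k * [:1, -1:] ^ Suc l = [:1, -1:] * ([:1, 1:] ^ k * [:1, -1:] ^ l)"
    by (simp only: power_Suc mult_ac)
  also have "\<dots> = [:1, 1:] ^ k * [:1, -1:] ^ l - pCons 0 ([:1, 1:] ^ k * [:1, -1:] ^ l)"
    by simp
  finally show ?thesis unfolding krawtchouk_def by simp
qed

lemma krawtchouk_add:
  "krawtchouk k (Suc l) m + krawtchouk (Suc k) l m = 2 * krawtchouk k l m"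
  by (cases m) (simp_all add: krawtchouk_Suc_left krawtchouk_Suc_right)

text \<open>
  The derivative of \<open>(1 + t)\<^sup>k\<^sup>+\<^sup>1 (1 - t)\<^sup>l\<^sup>+\<^sup>1\<close>, coefficient by coefficient.
\<close>

lemma krawtchouk_deriv:
  "real (Suc m) * krawtchouk (Suc k) (Suc l) (Suc m)
     = real (Suc k) * krawtchouk k (Suc l) m - real (Suc l) * krawtchouk (Suc k) l m"
proof -
  have "real (Suc m) * krawtchouk (Suc k) (Suc l) (Suc m)
      = coeff (pderiv ([:1, 1:] ^ Suc k * [:1, -1:] ^ Suc l)) m"
    by (simp add: krawtchouk_def coeff_pderiv)
  also have "pderiv ([:1, 1::real:] ^ Suc k * [:1, -1:] ^ Suc l)
      = smult (real (Suc k)) ([:1, 1:] ^ k * [:1, -1:] ^ Suc l)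
        - smult (real (Suc l)) ([:1, 1:] ^ Suc k * [:1, -1:] ^ l)"
    unfolding pderiv_mult pderiv_power_Suc
    by (simp only: pderiv_pCons pderiv_0 smult_smult mult_smult_left mult_smult_right mult_ac)
       (simp add: mult_ac)
  also have "coeff \<dots> m
     = real (Suc k) * krawtchouk k (Suc l) m - real (Suc l) * krawtchouk (Suc k) l m"
    by (simp add: krawtchouk_def)
  finally show ?thesis .
qed

text \<open>
  The two Pascal rules and the derivative rule express all values involved linearly through three
  neighbouring ones, \<open>A\<close>, \<open>a\<close>, \<open>b\<close>, with one linear relation between them; the claim is then an
  identity of quadratic forms. The weights are those that the factorials in \<open>linco\<close> produce in
  \<open>linco_Suc_Suc\<close>.
\<close>

lemma krawtchouk_square_identity:
  assumes "m + j = k + l"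
  shows "real (Suc m) * real (Suc j) * (krawtchouk (Suc k) (Suc l) (Suc m))\<^sup>2
    = real (Suc k) * real (Suc m) * (krawtchouk k (Suc l) (Suc m))\<^sup>2
      + real (Suc l) * real (Suc m) * (krawtchouk (Suc k) l (Suc m))\<^sup>2
      + real (Suc k) * real (Suc j) * (krawtchouk k (Suc l) m)\<^sup>2
      + real (Suc l) * real (Suc j) * (krawtchouk (Suc k) l m)\<^sup>2
      - 4 * real (Suc k) * real (Suc l) * (krawtchouk k l m)\<^sup>2"
proof -
  define A a b where "A = krawtchouk (Suc k) (Suc l) (Suc m)"
    and "a = krawtchouk k (Suc l) m" and "b = krawtchouk (Suc k) l m"
  define K L M J where "K = real (Suc k)" and "L = real (Suc l)" and "M = real (Suc m)"
    and "J = real (Suc j)"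
  have a': "krawtchouk k (Suc l) (Suc m) = A - a"
    by (simp add: A_def a_def krawtchouk_Suc_left)
  have b': "krawtchouk (Suc k) l (Suc m) = A + b"
    by (simp add: A_def b_def krawtchouk_Suc_right)
  \<comment> \<open>By \<open>krawtchouk_add\<close>, since \<open>(1 - t) + (1 + t) = 2\<close>.\<close>
  have c: "4 * (krawtchouk k l m)\<^sup>2 = (a + b)\<^sup>2"
    unfolding a_def b_def krawtchouk_add by (simp add: power_mult_distrib)
  have d: "M * A = K * a - L * b"
    unfolding A_def a_def b_def M_def K_def L_def by (rule krawtchouk_deriv)
  have J: "J = K + L - M"
    using assms by (simp add: J_def K_def L_def M_def flip: of_nat_add)
  have "M * J * A\<^sup>2 = (M * A) * ((K + L) * A - M * A)"
    unfolding J by (simp add: algebra_simps power2_eq_square)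
  also have "\<dots> = (K * a - L * b) * ((K + L) * A - (K * a - L * b))"
    unfolding d ..
  also have "\<dots> = A * ((K + L) * (M * A)) - 2 * (M * A) * (K * a - L * b) + (K + L) * (K * a\<^sup>2 + L * b\<^sup>2)
      - K * L * (a + b)\<^sup>2"
    unfolding d by (simp add: algebra_simps power2_eq_square)
  also have "\<dots> = K * M * (A - a)\<^sup>2 + L * M * (A + b)\<^sup>2 + K * J * a\<^sup>2 + L * J * b\<^sup>2 - K * L * (a + b)\<^sup>2"
    unfolding J by (simp add: algebra_simps power2_eq_square)
  also have "K * L * (a + b)\<^sup>2 = 4 * K * L * (krawtchouk k l m)\<^sup>2"
    using c by simp
  finally show ?thesis
    unfolding a' b' A_def[symmetric] a_def[symmetric] b_def[symmetric] K_def[symmetric] L_def[symmetric]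
        M_def[symmetric] J_def[symmetric] .
qed

text \<open>
  For the generating function \<open>\<Sum> D(k,l,m) x\<^sup>k y\<^sup>l T\<^sup>m\<close> this recurrence means that its denominator is
  \<open>1 - s - (s - x y) T\<close> with \<open>s = (x + y)/2\<close>. The derivatives of \<open>L\<^sub>k(y/2) L\<^sub>l(y/2)\<close> obey a matching
  recurrence, see \<open>pderiv_linsum_Suc_Suc\<close>; this is how squares of Krawtchouk values enter the
  product formula.
\<close>

lemma linco_Suc_Suc:
  "linco (Suc k) (Suc l) (Suc m)
    = (linco k (Suc l) (Suc m) + linco (Suc k) l (Suc m)) / 2
      + (linco k (Suc l) m + linco (Suc k) l m) / 2 - linco k l m"
proof -
  consider "m \<le> k + l" | "m = Suc (k + l)" | "Suc (k + l) < m" by linarith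
  then show ?thesis
  proof cases
    case 1
    then obtain j where j: "m + j = k + l" using le_Suc_ex by metis
    \<comment> \<open>The factor that all six coefficients share; \<open>krawtchouk_square_identity\<close> is multiplied by
      it.\<close>
    define C where "C = fact m * fact j / (2 ^ Suc (Suc (k + l)) * fact (Suc k) * fact (Suc l) :: real)"
    have e: "Suc k + Suc l - Suc m = Suc j" "k + Suc l - Suc m = j" "Suc k + l - Suc m = j"
      "k + Suc l - m = Suc j" "Suc k + l - m = Suc j" "k + l - m = j"
      using j by auto
    have p: "(2::real) ^ (Suc k + Suc l) = 2 ^ Suc (Suc (k + l))" "(2::real) ^ (k + Suc l) = 2 ^ Suc (k + l)"
      "(2::real) ^ (Suc k + l) = 2 ^ Suc (k + l)" by simp_all
    have f: "fact (Suc n) = real (Suc n) * fact n" for n by simp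
    have nz: "fact n \<noteq> (0::real)" "real (Suc n) \<noteq> 0" for n by simp_all
    have "linco (Suc k) (Suc l) (Suc m)
        = C * (real (Suc m) * real (Suc j) * (krawtchouk (Suc k) (Suc l) (Suc m))\<^sup>2)"
      unfolding linco_def e p C_def f[of m] f[of j] by (simp add: field_simps del: of_nat_Suc fact_Suc)
    also have "\<dots> = C * (real (Suc k) * real (Suc m) * (krawtchouk k (Suc l) (Suc m))\<^sup>2)
      + C * (real (Suc l) * real (Suc m) * (krawtchouk (Suc k) l (Suc m))\<^sup>2)
      + C * (real (Suc k) * real (Suc j) * (krawtchouk k (Suc l) m)\<^sup>2)
      + C * (real (Suc l) * real (Suc j) * (krawtchouk (Suc k) l m)\<^sup>2)
      - C * (4 * real (Suc k) * real (Suc l) * (krawtchouk k l m)\<^sup>2)"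
      unfolding krawtchouk_square_identity[OF j] by (simp only: ring_distribs)
    also have "C * (real (Suc k) * real (Suc m) * (krawtchouk k (Suc l) (Suc m))\<^sup>2) = linco k (Suc l) (Suc m) / 2"
      unfolding linco_def e p C_def f[of m] f[of k] using nz by (simp add: field_simps del: of_nat_Suc fact_Suc)
    also have "C * (real (Suc l) * real (Suc m) * (krawtchouk (Suc k) l (Suc m))\<^sup>2) = linco (Suc k) l (Suc m) / 2"
      unfolding linco_def e p C_def f[of m] f[of l] using nz by (simp add: field_simps del: of_nat_Suc fact_Suc)
    also have "C * (real (Suc k) * real (Suc j) * (krawtchouk k (Suc l) m)\<^sup>2) = linco k (Suc l) m / 2"
      unfolding linco_def e p C_def f[of j] f[of k] using nz by (simp add: field_simps del: of_nat_Suc fact_Suc)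
    also have "C * (real (Suc l) * real (Suc j) * (krawtchouk (Suc k) l m)\<^sup>2) = linco (Suc k) l m / 2"
      unfolding linco_def e p C_def f[of j] f[of l] using nz by (simp add: field_simps del: of_nat_Suc fact_Suc)
    also have "C * (4 * real (Suc k) * real (Suc l) * (krawtchouk k l m)\<^sup>2) = linco k l m"
      unfolding linco_def e C_def f[of k] f[of l] using nz by (simp add: field_simps del: of_nat_Suc fact_Suc)
    finally show ?thesis by (simp add: add_divide_distrib)
  next
    case 2
    \<comment> \<open>At the upper end \<open>Suc m = Suc k + Suc l\<close> only the leading coefficients of the generating
      polynomials are left, and these differ by sign.\<close>
    define A where "A = krawtchouk (Suc k) (Suc l) (Suc m)"
    have z: "krawtchouk k (Suc l) (Suc m) = 0" "krawtchouk (Suc k) l (Suc m) = 0"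
      "linco k (Suc l) (Suc m) = 0" "linco (Suc k) l (Suc m) = 0" "linco k l m = 0"
      using 2 by (auto simp: krawtchouk_eq_0 linco_eq_0)
    have a: "krawtchouk k (Suc l) m = A" "krawtchouk (Suc k) l m = - A"
      using z krawtchouk_Suc_left[of k "Suc l" m] krawtchouk_Suc_right[of "Suc k" l m] by (simp_all add: A_def)
    have e: "Suc k + Suc l - Suc m = 0" "k + Suc l - m = 0" "Suc k + l - m = 0" using 2 by auto
    have p: "(2::real) ^ (Suc k + Suc l) = 2 ^ Suc (Suc (k + l))" "(2::real) ^ (k + Suc l) = 2 ^ Suc (k + l)"
      "(2::real) ^ (Suc k + l) = 2 ^ Suc (k + l)" by simp_all
    have f: "fact (Suc n) = real (Suc n) * fact n" for n by simp
    have s: "real (Suc m) = real (Suc k) + real (Suc l)" using 2 by simp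
    have "linco (Suc k) (Suc l) (Suc m) = linco k (Suc l) m / 2 + linco (Suc k) l m / 2"
      unfolding linco_def a e p A_def[symmetric] f s by (simp add: divide_simps) (simp add: algebra_simps)
    then show ?thesis by (simp add: z add_divide_distrib)
  qed (simp add: linco_eq_0)
qed

lemma linco_Suc_Suc_0:
  "linco (Suc k) (Suc l) 0 = (linco k (Suc l) 0 + linco (Suc k) l 0) / 2"
proof -
  have f: "fact (Suc n) = real (Suc n) * fact n" for n by simp
  have g: "fact (Suc (Suc (k + l))) = (real (Suc k) + real (Suc l)) * fact (Suc (k + l))" by simp
  have nz: "fact n \<noteq> (0::real)" "real (Suc n) \<noteq> 0" for n by simp_all
  have "linco (Suc k) (Suc l) 0
      = (real (Suc k) + real (Suc l)) * fact (Suc (k + l)) / (2 ^ Suc (Suc (k + l)) * (real (Suc k) * fact k) * (real (Suc l) * fact l))"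
    by (simp add: linco_def g[simplified])
  also have "\<dots> = (fact (Suc (k + l)) / (2 ^ Suc (k + l) * fact k * (real (Suc l) * fact l))
      + fact (Suc (k + l)) / (2 ^ Suc (k + l) * (real (Suc k) * fact k) * fact l)) / 2"
    using nz by (simp add: divide_simps del: of_nat_Suc fact_Suc) (simp add: algebra_simps del: of_nat_Suc fact_Suc)
  also have "\<dots> = (linco k (Suc l) 0 + linco (Suc k) l 0) / 2"
    by (simp add: linco_def)
  finally show ?thesis .
qed

lemma krawtchouk_right_0: "krawtchouk k 0 m = real (k choose m)"
proof (induction k arbitrary: m)
  case 0
  show ?case by (cases m) (simp_all add: krawtchouk_def)
next
  case (Suc k)
  show ?case by (cases m) (simp_all add: Suc.IH krawtchouk_Suc_left)
qed

lemma krawtchouk_left_0: "krawtchouk 0 l m = (-1) ^ m * real (l choose m)"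
proof (induction l arbitrary: m)
  case 0
  show ?case by (cases m) (simp_all add: krawtchouk_def)
next
  case (Suc l)
  show ?case by (cases m) (simp_all add: Suc.IH krawtchouk_Suc_right algebra_simps)
qed

lemma linco_right_0: "linco k 0 m = real (k choose m) / 2 ^ k"
proof (cases "m \<le> k")
  case True
  then have "real (k choose m) = fact k / (fact m * fact (k - m))" by (rule binomial_fact)
  then have "fact m * fact (k - m) * real (k choose m) / fact k = 1" by simp
  then show ?thesis
    by (simp add: linco_def krawtchouk_right_0 power2_eq_square field_simps)
qed (simp add: linco_eq_0 binomial_eq_0)

lemma linco_left_0: "linco 0 l m = real (l choose m) / 2 ^ l"
proof -
  have "linco 0 l m = linco l 0 m"
    by (simp add: linco_def krawtchouk_left_0 krawtchouk_right_0 power_mult_distrib flip: power_mult)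
  then show ?thesis by (simp add: linco_right_0)
qed

lemma linco_at_0: "linco k l 0 > 0"
  by (simp add: linco_def)

text \<open>
  The expansion that is shown to equal \<open>L\<^sub>k(y/2) L\<^sub>l(y/2)\<close>.
\<close>

definition linsum :: "nat \<Rightarrow> nat \<Rightarrow> real poly" where
  "linsum k l = (\<Sum>m\<le>k + l. smult (linco k l m) (laguerre m))"

lemma sum_linco_extend:
  assumes "k + l \<le> M"
  shows "(\<Sum>m\<le>k + l. smult (linco k l m) (F m)) = (\<Sum>m\<le>M. smult (linco k l m) (F m))"
  using assms by (intro sum.mono_neutral_left) (auto simp: linco_eq_0)

lemma smult_sum_right: "smult c (\<Sum>i\<in>A. f i) = (\<Sum>i\<in>A. smult c (f i))"
  by (rule poly_eqI) (simp add: coeff_sum sum_distrib_left)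

lemma pderiv_linsum:
  assumes "k + l \<le> M"
  shows "pderiv (linsum k l) = (\<Sum>m\<le>M. smult (linco k l m) (pderiv (laguerre m)))"
proof -
  have "pderiv (linsum k l) = (\<Sum>m\<le>k + l. smult (linco k l m) (pderiv (laguerre m)))"
    unfolding linsum_def by (rule poly_eqI) (simp add: coeff_pderiv coeff_sum sum_distrib_left mult_ac)
  also have "\<dots> = (\<Sum>m\<le>M. smult (linco k l m) (pderiv (laguerre m)))"
    using assms by (rule sum_linco_extend)
  finally show ?thesis .
qed

lemma linsum_extend:
  assumes "k + l \<le> M"
  shows "linsum k l = (\<Sum>m\<le>M. smult (linco k l m) (laguerre m))"
  using assms unfolding linsum_def by (rule sum_linco_extend)

lemma pderiv_linsum_Suc:
  assumes "k + l \<le> Suc M"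
  shows "pderiv (linsum k l) = (\<Sum>m\<le>M. smult (linco k l (Suc m)) (pderiv (laguerre (Suc m))))"
proof -
  have "pderiv (linsum k l) = (\<Sum>m\<le>Suc M. smult (linco k l m) (pderiv (laguerre m)))"
    using assms by (rule pderiv_linsum)
  also have "\<dots> = (\<Sum>m\<le>M. smult (linco k l (Suc m)) (pderiv (laguerre (Suc m))))"
    by (subst sum.atMost_Suc_shift) simp
  finally show ?thesis .
qed

lemma sum_linco_pderiv_shift:
  assumes "k + l \<le> M"
  shows "(\<Sum>m\<le>M. smult (linco k l m) (pderiv (laguerre (Suc m)))) = pderiv (linsum k l) - linsum k l"
  unfolding pderiv_linsum[OF assms] unfolding linsum_extend[OF assms] pderiv_laguerre_Suc smult_diff_right sum_subtractf ..

text \<open>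
  Because of \<open>L\<^sub>m\<^sub>+\<^sub>1' = L\<^sub>m' - L\<^sub>m\<close>, a shift of the index \<open>m\<close> in the recurrence for \<open>linco\<close> turns into
  an extra term without derivative. The outcome is the recurrence that the product rule gives for
  the derivative of \<open>L\<^sub>k\<^sub>+\<^sub>1(y/2) L\<^sub>l\<^sub>+\<^sub>1(y/2)\<close>.
\<close>

lemma pderiv_linsum_Suc_Suc:
  "pderiv (linsum (Suc k) (Suc l))
     = pderiv (linsum k (Suc l)) + pderiv (linsum (Suc k) l) - pderiv (linsum k l)
       - smult (1/2) (linsum k (Suc l) + linsum (Suc k) l) + linsum k l"
proof -
  define M where "M = Suc (k + l)"
  have "pderiv (linsum (Suc k) (Suc l))
      = (\<Sum>m\<le>M. smult (linco (Suc k) (Suc l) (Suc m)) (pderiv (laguerre (Suc m))))"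
    by (rule pderiv_linsum_Suc) (simp add: M_def)
  also have "\<dots> = smult (1/2) (\<Sum>m\<le>M. smult (linco k (Suc l) (Suc m)) (pderiv (laguerre (Suc m))))
    + smult (1/2) (\<Sum>m\<le>M. smult (linco (Suc k) l (Suc m)) (pderiv (laguerre (Suc m))))
    + smult (1/2) (\<Sum>m\<le>M. smult (linco k (Suc l) m) (pderiv (laguerre (Suc m))))
    + smult (1/2) (\<Sum>m\<le>M. smult (linco (Suc k) l m) (pderiv (laguerre (Suc m))))
    - (\<Sum>m\<le>M. smult (linco k l m) (pderiv (laguerre (Suc m))))"
    unfolding smult_sum_right smult_smult sum.distrib[symmetric] sum_subtractf[symmetric]
      smult_add_left[symmetric] smult_diff_left[symmetric] linco_Suc_Suc
    by (intro sum.cong arg_cong2[where f = smult]) (simp_all add: field_simps)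
  also have "\<dots> = smult (1/2) (pderiv (linsum k (Suc l))) + smult (1/2) (pderiv (linsum (Suc k) l))
    + smult (1/2) (pderiv (linsum k (Suc l)) - linsum k (Suc l))
    + smult (1/2) (pderiv (linsum (Suc k) l) - linsum (Suc k) l)
    - (pderiv (linsum k l) - linsum k l)"
    by (simp add: sum_linco_pderiv_shift pderiv_linsum_Suc[symmetric] M_def del: sum.atMost_Suc)
  also have "\<dots> = pderiv (linsum k (Suc l)) + pderiv (linsum (Suc k) l) - pderiv (linsum k l)
       - smult (1/2) (linsum k (Suc l) + linsum (Suc k) l) + linsum k l"
    by (rule poly_eqI) (simp add: field_simps)
  finally show ?thesis .
qed

lemma linco_Suc_right_0: "linco (Suc k) 0 (Suc m) = (linco k 0 (Suc m) + linco k 0 m) / 2"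
  by (simp add: linco_right_0 field_simps)

lemma linco_Suc_left_0: "linco 0 (Suc l) (Suc m) = (linco 0 l (Suc m) + linco 0 l m) / 2"
  by (simp add: linco_left_0 field_simps)

lemma pderiv_linsum_Suc_0:
  "pderiv (linsum (Suc k) 0) = pderiv (linsum k 0) - smult (1/2) (linsum k 0)"
proof -
  have "pderiv (linsum (Suc k) 0) = (\<Sum>m\<le>k. smult (linco (Suc k) 0 (Suc m)) (pderiv (laguerre (Suc m))))"
    by (rule pderiv_linsum_Suc) simp
  also have "\<dots> = smult (1/2) (\<Sum>m\<le>k. smult (linco k 0 (Suc m)) (pderiv (laguerre (Suc m))))
    + smult (1/2) (\<Sum>m\<le>k. smult (linco k 0 m) (pderiv (laguerre (Suc m))))"
    unfolding smult_sum_right smult_smult sum.distrib[symmetric]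
      smult_add_left[symmetric] linco_Suc_right_0
    by (intro sum.cong arg_cong2[where f = smult]) (simp_all add: field_simps)
  also have "\<dots> = smult (1/2) (pderiv (linsum k 0)) + smult (1/2) (pderiv (linsum k 0) - linsum k 0)"
    by (simp add: sum_linco_pderiv_shift pderiv_linsum_Suc[symmetric] del: sum.atMost_Suc)
  also have "\<dots> = pderiv (linsum k 0) - smult (1/2) (linsum k 0)"
    by (rule poly_eqI) (simp add: field_simps)
  finally show ?thesis .
qed

lemma linsum_0_eq: "linsum 0 l = linsum l 0"
  by (simp add: linsum_def linco_left_0 linco_right_0)

lemma sum_linco_Suc:
  assumes "k + l \<le> M"
  shows "(\<Sum>m\<le>M. linco k l (Suc m)) = (\<Sum>m\<le>k + l. linco k l m) - linco k l 0"
proof -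
  have "(\<Sum>m\<le>k + l. linco k l m) = (\<Sum>m\<le>Suc M. linco k l m)"
    using assms by (intro sum.mono_neutral_left) (auto simp: linco_eq_0)
  also have "\<dots> = linco k l 0 + (\<Sum>m\<le>M. linco k l (Suc m))"
    by (rule sum.atMost_Suc_shift)
  finally show ?thesis by simp
qed

text \<open>
  This is the product formula at the point 0, where all Laguerre polynomials have the value 1. It is
  derived from the recurrence beforehand because it supplies the constant of integration there.
\<close>

lemma sum_linco_row: "(\<Sum>m\<le>k + l. linco k l m) = 1"
proof (induction "k + l" arbitrary: k l rule: less_induct)
  case less
  have ext: "(\<Sum>m\<le>M. linco k l m) = (\<Sum>m\<le>k + l. linco k l m)" if "k + l \<le> M" for k l M
    using that by (intro sum.mono_neutral_right) (auto simp: linco_eq_0)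
  have b: "(\<Sum>m\<le>k. linco k 0 m) = 1" for k
  proof -
    have "(\<Sum>m\<le>k. real (k choose m)) = 2 ^ k"
      using choose_row_sum[of k] by (metis of_nat_numeral of_nat_power of_nat_sum)
    then show ?thesis by (simp add: linco_right_0 flip: sum_divide_distrib)
  qed
  show ?case
  proof (cases k)
    case 0
    then show ?thesis using b[of l] by (simp add: linco_left_0 linco_right_0)
  next
    case k: (Suc k')
    show ?thesis
    proof (cases l)
      case 0
      then show ?thesis using b[of k] by simp
    next
      case l: (Suc l')
      define M where "M = Suc (k' + l')"
      have "(\<Sum>m\<le>k + l. linco k l m) = linco k l 0 + (\<Sum>m\<le>M. linco k l (Suc m))"
        unfolding k l M_def by (subst sum.atMost_Suc_shift[symmetric]) simp
      also have "(\<Sum>m\<le>M. linco k l (Suc m))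
          = ((\<Sum>m\<le>M. linco k' l (Suc m)) + (\<Sum>m\<le>M. linco k l' (Suc m))) / 2
          + ((\<Sum>m\<le>M. linco k' l m) + (\<Sum>m\<le>M. linco k l' m)) / 2 - (\<Sum>m\<le>M. linco k' l' m)"
        unfolding k l linco_Suc_Suc
        by (simp add: sum.distrib sum_subtractf add_divide_distrib sum_divide_distrib del: sum.atMost_Suc)
      also have "(\<Sum>m\<le>M. linco k' l (Suc m)) = 1 - linco k' l 0"
        using less[of k' l] by (subst sum_linco_Suc) (auto simp: k l M_def)
      also have "(\<Sum>m\<le>M. linco k l' (Suc m)) = 1 - linco k l' 0"
        using less[of k l'] by (subst sum_linco_Suc) (auto simp: k l M_def)
      also have "(\<Sum>m\<le>M. linco k' l m) = 1"
        using less[of k' l] ext[of k' l M] by (simp add: k l M_def)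
      also have "(\<Sum>m\<le>M. linco k l' m) = 1"
        using less[of k l'] ext[of k l' M] by (simp add: k l M_def)
      also have "(\<Sum>m\<le>M. linco k' l' m) = 1"
        using less[of k' l'] ext[of k' l' M] by (simp add: k l M_def)
      also have "linco k l 0 = (linco k' l 0 + linco k l' 0) / 2"
        unfolding k l by (rule linco_Suc_Suc_0)
      finally show ?thesis by (simp add: field_simps)
    qed
  qed
qed

lemma poly_eqI_pderiv:
  fixes p q :: "real poly"
  assumes "pderiv p = pderiv q" "poly p 0 = poly q 0"
  shows "p = q"
proof -
  have "pderiv (p - q) = 0" using assms by (simp add: pderiv_diff)
  then obtain c where c: "p - q = [:c:]"
    by (metis pderiv_eq_0_iff degree_eq_zeroE)
  have "poly (p - q) 0 = 0" using assms by simp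
  then have "p - q = 0" unfolding c by simp
  then show ?thesis by simp
qed

text \<open>
  Both sides have the value 1 at 0, so it suffices to compare derivatives. These obey the same
  recurrence in \<open>k\<close> and \<open>l\<close>, whose terms agree by induction on \<open>k + l\<close>.
\<close>

theorem laguerre_product:
  "pcompose (laguerre k * laguerre l) [:0, 1/2:] = linsum k l"
proof (induction "k + l" arbitrary: k l rule: less_induct)
  case less
  define R where "R k l = pcompose (laguerre k * laguerre l) [:0, 1/2:]" for k l
  have dR: "pderiv (R k l) = smult (1/2) (pcompose (pderiv (laguerre k) * laguerre l + laguerre k * pderiv (laguerre l)) [:0, 1/2:])" for k l
    by (simp add: R_def pderiv_pcompose pderiv_mult pderiv_pCons algebra_simps)
  have R0: "poly (R k l) 0 = 1" for k l by (simp add: R_def poly_pcompose)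
  have l0: "poly (linsum k l) 0 = 1" for k l
    using sum_linco_row[of k l] by (simp add: linsum_def poly_sum)
  have R_IH: "R k' l' = linsum k' l'" if "k' + l' < k + l" for k' l'
    using less that by (simp add: R_def)
  have Rc: "R k l = R l k" for k l by (simp add: R_def mult.commute)
  have one: "pderiv (R (Suc k') 0) = pderiv (linsum (Suc k') 0)" if "R k' 0 = linsum k' 0" for k'
  proof -
    have "pderiv (R (Suc k') 0) = pderiv (R k' 0) - smult (1/2) (R k' 0)"
      unfolding dR unfolding R_def pderiv_laguerre_Suc
      by (intro poly_eq_poly_eq_iff[THEN iffD1] ext) (simp add: poly_pcompose algebra_simps)
    then show ?thesis by (simp add: that pderiv_linsum_Suc_0)
  qed
  have "R k l = linsum k l"
  proof (rule poly_eqI_pderiv)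
    show "poly (R k l) 0 = poly (linsum k l) 0" by (simp add: R0 l0)
    show "pderiv (R k l) = pderiv (linsum k l)"
    proof (cases k)
      case 0
      show ?thesis
      proof (cases l)
        case (Suc l')
        then show ?thesis using one[of l'] R_IH[of 0 l'] \<open>k = 0\<close> by (simp add: Rc[of 0] linsum_0_eq)
      qed (simp add: \<open>k = 0\<close> R_def linsum_def linco_left_0 pcompose_1)
    next
      case k: (Suc k')
      show ?thesis
      proof (cases l)
        case 0
        then show ?thesis using one[of k'] R_IH[of k' 0] k by simp
      next
        case l: (Suc l')
        have "pderiv (R k l) = pderiv (R k' l) + pderiv (R k l') - pderiv (R k' l')
          - smult (1/2) (R k' l + R k l') + R k' l'"
          unfolding k l dR unfolding R_def pderiv_laguerre_Suc
          by (intro poly_eq_poly_eq_iff[THEN iffD1] ext) (simp add: poly_pcompose algebra_simps)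
        also have "\<dots> = pderiv (linsum k l)"
          unfolding k l pderiv_linsum_Suc_Suc using k l by (simp add: R_IH)
        finally show ?thesis .
      qed
    qed
  qed
  then show ?case by (simp add: R_def)
qed

text \<open>
  In the recurrence for \<open>linco\<close>, lowering \<open>k\<close> and lowering \<open>l\<close> both lead to the sum over the next
  lower antidiagonal, up to the boundary terms with \<open>k = 0\<close> or \<open>l = 0\<close>, which satisfy a recurrence
  of their own.
\<close>

lemma sum_linco_column_rec:
  "(\<Sum>k\<le>Suc (Suc N). linco k (Suc (Suc N) - k) (Suc m))
    = (\<Sum>k\<le>Suc N. linco k (Suc N - k) (Suc m)) + (\<Sum>k\<le>Suc N. linco k (Suc N - k) m)
      - (\<Sum>k\<le>N. linco k (N - k) m)"
proof -
  have hd: "(\<Sum>k\<le>Suc N. linco k (Suc N - k) m) = linco 0 (Suc N) m + (\<Sum>k\<le>N. linco (Suc k) (N - k) m)" for m N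
    by (subst sum.atMost_Suc_shift) simp
  have tl: "(\<Sum>k\<le>Suc N. linco k (Suc N - k) m) = (\<Sum>k\<le>N. linco k (Suc (N - k)) m) + linco (Suc N) 0 m" for m N
    by (simp add: Suc_diff_le)
  have "(\<Sum>k\<le>Suc (Suc N). linco k (Suc (Suc N) - k) (Suc m))
      = linco 0 (Suc (Suc N)) (Suc m) + (\<Sum>k\<le>Suc N. linco (Suc k) (Suc N - k) (Suc m))"
    by (rule hd)
  also have "(\<Sum>k\<le>Suc N. linco (Suc k) (Suc N - k) (Suc m))
      = (\<Sum>k\<le>N. linco (Suc k) (Suc (N - k)) (Suc m)) + linco (Suc (Suc N)) 0 (Suc m)"
    by (simp add: Suc_diff_le)
  also have "(\<Sum>k\<le>N. linco (Suc k) (Suc (N - k)) (Suc m))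
      = ((\<Sum>k\<le>N. linco k (Suc (N - k)) (Suc m)) + (\<Sum>k\<le>N. linco (Suc k) (N - k) (Suc m))) / 2
        + ((\<Sum>k\<le>N. linco k (Suc (N - k)) m) + (\<Sum>k\<le>N. linco (Suc k) (N - k) m)) / 2
        - (\<Sum>k\<le>N. linco k (N - k) m)"
    unfolding linco_Suc_Suc by (simp add: sum.distrib sum_subtractf add_divide_distrib sum_divide_distrib)
  finally show ?thesis
    using hd[of N m] hd[of N "Suc m"] tl[of N m] tl[of N "Suc m"]
    by (simp add: linco_Suc_right_0 linco_Suc_left_0 field_simps del: sum.atMost_Suc)
qed

text \<open>
  The generating function of \<open>linco\<close> is the inverse of \<open>1 - s - (s - x y) T\<close> with \<open>s = (x + y)/2\<close>.
  For \<open>x = y\<close> this denominator is \<open>(1 - x)(1 - x T)\<close>, and the coefficient of \<open>x\<^sup>N T\<^sup>m\<close> in its inverse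
  is 1 for \<open>m \<le> N\<close> and 0 otherwise.
\<close>

lemma sum_linco_column:
  "(\<Sum>k\<le>N. linco k (N - k) m) = (if m \<le> N then 1 else 0)"
proof (induction m arbitrary: N)
  case 0
  have "linco k (N - k) 0 = real (N choose k) / 2 ^ N" if "k \<le> N" for k
    using that by (simp add: linco_def binomial_fact)
  then have "(\<Sum>k\<le>N. linco k (N - k) 0) = (\<Sum>k\<le>N. real (N choose k)) / 2 ^ N"
    by (simp add: sum_divide_distrib)
  also have "(\<Sum>k\<le>N. real (N choose k)) = 2 ^ N"
    using choose_row_sum[of N] by (metis of_nat_numeral of_nat_power of_nat_sum)
  finally show ?case by simp
next
  case (Suc m)
  show ?case
  \<comment> \<open>The recurrence reaches back two steps in \<open>N\<close>, so \<open>N = 0\<close> and \<open>N = 1\<close> are checked by hand.\<close>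
  proof (induction N rule: nat_less_induct)
    case (1 N)
    consider "N = 0" | "N = 1" | N' where "N = Suc (Suc N')"
      by (metis One_nat_def not0_implies_Suc)
    then show ?case
    proof cases
      case 1
      then show ?thesis by (simp add: linco_eq_0)
    next
      case 2
      then show ?thesis
        by (cases m) (auto simp: linco_eq_0 linco_right_0 linco_left_0)
    next
      case 3
      then have "(\<Sum>k\<le>Suc N'. linco k (Suc N' - k) (Suc m)) = (if Suc m \<le> Suc N' then 1 else 0)"
        using "1" by blast
      then show ?thesis
        unfolding 3 sum_linco_column_rec Suc.IH by auto
    qed
  qed
qed

section \<open>The quartic form on sequences\<close>

text \<open>
  The coefficient of \<open>\<phi>\<^sub>m\<close> in the part of degree \<open>N\<close> of the square of the Laguerre series with
  coefficients \<open>a\<close>; see \<open>lagprod_expand\<close>.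
\<close>

definition linprod :: "(nat \<Rightarrow> complex) \<Rightarrow> nat \<Rightarrow> nat \<Rightarrow> complex" where
  "linprod a N m = (\<Sum>k\<le>N. of_real (linco k (N - k) m) * (a k * a (N - k)))"

text \<open>
  The second moment is the square of the mean plus the variance. Keeping the variance, instead of
  only its sign, is what decides the case of equality.
\<close>

lemma weighted_variance:
  fixes w :: "nat \<Rightarrow> real" and c :: "nat \<Rightarrow> complex"
  assumes "(\<Sum>k\<le>N. w k) = 1"
  defines "\<mu> \<equiv> \<Sum>k\<le>N. of_real (w k) * c k"
  shows "(\<Sum>k\<le>N. w k * (cmod (c k))\<^sup>2) = (cmod \<mu>)\<^sup>2 + (\<Sum>k\<le>N. w k * (cmod (c k - \<mu>))\<^sup>2)"
proof -
  have e: "(cmod (z - \<mu>))\<^sup>2 = (cmod z)\<^sup>2 - 2 * Re (cnj \<mu> * z) + (cmod \<mu>)\<^sup>2" for z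
    unfolding cmod_power2 by (simp add: power2_eq_square algebra_simps)
  have "(\<Sum>k\<le>N. w k * (cmod (c k - \<mu>))\<^sup>2)
      = (\<Sum>k\<le>N. w k * (cmod (c k))\<^sup>2) - 2 * (\<Sum>k\<le>N. w k * Re (cnj \<mu> * c k)) + (\<Sum>k\<le>N. w k) * (cmod \<mu>)\<^sup>2"
    unfolding e by (simp add: algebra_simps sum.distrib sum_subtractf sum_distrib_left sum_distrib_right)
  also have "(\<Sum>k\<le>N. w k * Re (cnj \<mu> * c k)) = Re (\<Sum>k\<le>N. cnj \<mu> * (of_real (w k) * c k))"
    unfolding Re_sum by (intro sum.cong refl) (simp add: algebra_simps)
  also have "(\<Sum>k\<le>N. cnj \<mu> * (of_real (w k) * c k)) = cnj \<mu> * \<mu>"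
    unfolding sum_distrib_left[symmetric] \<mu>_def[symmetric] ..
  also have "Re (cnj \<mu> * \<mu>) = (cmod \<mu>)\<^sup>2"
    unfolding cmod_power2 by (simp add: power2_eq_square)
  finally show ?thesis using assms(1) by simp
qed

text \<open>
  As the rows of \<open>linco\<close> sum to 1, the left-hand side may be spread over all \<open>m\<close>. As the columns sum
  to 1, each \<open>m\<close> then carries a second moment with respect to probability weights.
\<close>

lemma linprod_deficit:
  "(\<Sum>k\<le>N. (cmod (a k * a (N - k)))\<^sup>2)
     = (\<Sum>m\<le>N. (cmod (linprod a N m))\<^sup>2)
       + (\<Sum>m\<le>N. \<Sum>k\<le>N. linco k (N - k) m * (cmod (a k * a (N - k) - linprod a N m))\<^sup>2)"
proof -
  have row: "(\<Sum>m\<le>N. linco k (N - k) m) = 1" if "k \<le> N" for k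
    using sum_linco_row[of k "N - k"] that by simp
  have "(\<Sum>k\<le>N. (cmod (a k * a (N - k)))\<^sup>2)
      = (\<Sum>k\<le>N. \<Sum>m\<le>N. linco k (N - k) m * (cmod (a k * a (N - k)))\<^sup>2)"
    by (intro sum.cong refl) (simp add: row flip: sum_distrib_right)
  also have "\<dots> = (\<Sum>m\<le>N. \<Sum>k\<le>N. linco k (N - k) m * (cmod (a k * a (N - k)))\<^sup>2)"
    by (rule sum.swap)
  also have "\<dots> = (\<Sum>m\<le>N. (cmod (linprod a N m))\<^sup>2
      + (\<Sum>k\<le>N. linco k (N - k) m * (cmod (a k * a (N - k) - linprod a N m))\<^sup>2))"
    unfolding linprod_def
    by (intro sum.cong refl weighted_variance) (simp add: sum_linco_column)
  finally show ?thesis by (simp add: sum.distrib)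
qed

lemma linprod_le: "(\<Sum>m\<le>N. (cmod (linprod a N m))\<^sup>2) \<le> (\<Sum>k\<le>N. (cmod (a k * a (N - k)))\<^sup>2)"
  unfolding linprod_deficit by (simp add: sum_nonneg linco_nonneg)

text \<open>
  All variances vanish, and for \<open>m = 0\<close> all weights are positive.
\<close>

lemma linprod_eqD:
  assumes "(\<Sum>m\<le>N. (cmod (linprod a N m))\<^sup>2) = (\<Sum>k\<le>N. (cmod (a k * a (N - k)))\<^sup>2)" "k \<le> N"
  shows "a k * a (N - k) = a 0 * a N"
proof -
  have "(\<Sum>m\<le>N. \<Sum>k\<le>N. linco k (N - k) m * (cmod (a k * a (N - k) - linprod a N m))\<^sup>2) = 0"
    using assms(1) linprod_deficit[of a N] by simp
  then have "(\<Sum>k\<le>N. linco k (N - k) 0 * (cmod (a k * a (N - k) - linprod a N 0))\<^sup>2) = 0"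
    by (subst (asm) sum_nonneg_eq_0_iff) (auto intro!: sum_nonneg simp: linco_nonneg)
  then have "linco k (N - k) 0 * (cmod (a k * a (N - k) - linprod a N 0))\<^sup>2 = 0" if "k \<le> N" for k
    using that by (subst (asm) sum_nonneg_eq_0_iff) (auto simp: linco_nonneg)
  then have "a k * a (N - k) = linprod a N 0" if "k \<le> N" for k
    using that linco_at_0[of k "N - k"] by fastforce
  from this[OF assms(2)] this[of 0] show ?thesis by simp
qed

text \<open>
  The products \<open>a\<^sub>k a\<^sub>N\<^sub>-\<^sub>k\<close> of a geometric sequence do not depend on \<open>k\<close>, so they equal their averages.
\<close>

lemma linprod_geometric:
  "(\<Sum>m\<le>N. (cmod (linprod (\<lambda>n. c * z ^ n) N m))\<^sup>2)
     = (\<Sum>k\<le>N. (cmod (c * z ^ k * (c * z ^ (N - k))))\<^sup>2)"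
proof -
  have e: "c * z ^ k * (c * z ^ (N - k)) = c\<^sup>2 * z ^ N" if "k \<le> N" for k
    using that by (simp add: power2_eq_square flip: power_add)
  have "linprod (\<lambda>n. c * z ^ n) N m = c\<^sup>2 * z ^ N" if "m \<le> N" for m
  proof -
    have "linprod (\<lambda>n. c * z ^ n) N m = of_real (\<Sum>k\<le>N. linco k (N - k) m) * (c\<^sup>2 * z ^ N)"
      unfolding linprod_def by (simp add: e sum_distrib_right)
    then show ?thesis using that by (simp add: sum_linco_column)
  qed
  then show ?thesis by (simp add: e)
qed

lemma geometric_if_products_eq:
  fixes a :: "nat \<Rightarrow> complex"
  assumes "\<And>N k. k \<le> N \<Longrightarrow> a k * a (N - k) = a 0 * a N"
  obtains c z where "\<And>n. a n = c * z ^ n"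
proof (cases "a 0 = 0")
  case True
  have "a k = 0" for k
    using assms[of k "k + k"] True by simp
  then show ?thesis by (intro that[of 0 0]) simp
next
  case False
  have "a n = a 0 * (a 1 / a 0) ^ n" for n
  proof (induction n)
    case (Suc n)
    have "a 0 * a (Suc n) = a 1 * a n" using assms[of 1 "Suc n"] by simp
    then show ?case using False Suc.IH by (simp add: field_simps)
  qed simp
  then show ?thesis by (rule that)
qed

section \<open>Square integrable functions\<close>

text \<open>
  The square of the \<open>L\<^sup>2\<close> norm; being extended valued, it can be estimated before integrability is
  known.
\<close>

definition nsq :: "'a measure \<Rightarrow> ('a \<Rightarrow> complex) \<Rightarrow> ennreal" where
  "nsq M f = (\<integral>\<^sup>+ x. ennreal ((cmod (f x))\<^sup>2) \<partial>M)"

lemma borel_measurable_cnj [measurable]: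
  "f \<in> borel_measurable M \<Longrightarrow> (\<lambda>x. cnj (f x)) \<in> borel_measurable M"
  by (rule borel_measurable_continuous_on[where f = cnj]) (auto intro: continuous_intros)

lemma cmod_sum_sq_le: "(cmod (a + b))\<^sup>2 \<le> 2 * (cmod a)\<^sup>2 + 2 * (cmod b)\<^sup>2"
proof -
  have "(cmod (a + b))\<^sup>2 \<le> (cmod a + cmod b)\<^sup>2" by (intro power_mono norm_triangle_ineq) simp
  also have "\<dots> \<le> 2 * (cmod a)\<^sup>2 + 2 * (cmod b)\<^sup>2"
    using sum_squares_bound[of "cmod a" "cmod b"] by (simp add: power2_sum)
  finally show ?thesis .
qed

lemma nsq_cong_AE:
  "(AE x in M. f x = g x) \<Longrightarrow> nsq M f = nsq M g"
  unfolding nsq_def by (intro nn_integral_cong_AE) auto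

lemma nsq_minus: "nsq M (\<lambda>x. - f x) = nsq M f"
  by (simp add: nsq_def)

lemma nsq_diff_commute: "nsq M (\<lambda>x. f x - g x) = nsq M (\<lambda>x. g x - f x)"
  by (simp add: nsq_def norm_minus_commute)

lemma nsq_cmult:
  assumes [measurable]: "f \<in> borel_measurable M"
  shows "nsq M (\<lambda>x. c * f x) = ennreal ((cmod c)\<^sup>2) * nsq M f"
  by (simp add: nsq_def norm_mult power_mult_distrib ennreal_mult nn_integral_cmult)

lemma nsq_add_le:
  assumes [measurable]: "f \<in> borel_measurable M" "g \<in> borel_measurable M"
  shows "nsq M (\<lambda>x. f x + g x) \<le> 2 * nsq M f + 2 * nsq M g"
proof -
  have "nsq M (\<lambda>x. f x + g x) \<le> (\<integral>\<^sup>+ x. 2 * ennreal ((cmod (f x))\<^sup>2) + 2 * ennreal ((cmod (g x))\<^sup>2) \<partial>M)"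
    unfolding nsq_def
  proof (intro nn_integral_mono)
    fix x
    have "ennreal ((cmod (f x + g x))\<^sup>2) \<le> ennreal (2 * (cmod (f x))\<^sup>2 + 2 * (cmod (g x))\<^sup>2)"
      by (intro ennreal_leI cmod_sum_sq_le)
    then show "ennreal ((cmod (f x + g x))\<^sup>2) \<le> 2 * ennreal ((cmod (f x))\<^sup>2) + 2 * ennreal ((cmod (g x))\<^sup>2)"
      by (simp add: ennreal_mult)
  qed
  also have "\<dots> = 2 * nsq M f + 2 * nsq M g"
    by (simp add: nsq_def nn_integral_add nn_integral_cmult)
  finally show ?thesis .
qed

lemma nsq_add_finite:
  assumes [measurable]: "f \<in> borel_measurable M" "g \<in> borel_measurable M"
    and "nsq M f < top" "nsq M g < top"
  shows "nsq M (\<lambda>x. f x + g x) < top"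
  using nsq_add_le[OF assms(1,2)] assms(3,4)
  by (auto simp: ennreal_mult_less_top intro: le_less_trans)

lemma nsq_diff_le:
  assumes [measurable]: "f \<in> borel_measurable M" "g \<in> borel_measurable M"
  shows "nsq M (\<lambda>x. f x - g x) \<le> 2 * nsq M f + 2 * nsq M g"
  using nsq_add_le[of f M "\<lambda>x. - g x"] by (simp add: nsq_minus)

lemma nsq_diff_finite:
  assumes [measurable]: "f \<in> borel_measurable M" "g \<in> borel_measurable M"
    and "nsq M f < top" "nsq M g < top"
  shows "nsq M (\<lambda>x. f x - g x) < top"
  using nsq_diff_le[OF assms(1,2)] assms(3,4)
  by (auto simp: ennreal_mult_less_top intro: le_less_trans)

lemma nsq_cmult_finite:
  assumes [measurable]: "f \<in> borel_measurable M" and "nsq M f < top"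
  shows "nsq M (\<lambda>x. c * f x) < top"
  using assms by (simp add: nsq_cmult ennreal_mult_less_top)

lemma nsq_sum_finite:
  assumes "\<And>n. n \<in> J \<Longrightarrow> f n \<in> borel_measurable M" "\<And>n. n \<in> J \<Longrightarrow> nsq M (f n) < top"
  shows "nsq M (\<lambda>x. \<Sum>n\<in>J. f n x) < top"
  using assms
proof (induction J rule: infinite_finite_induct)
  case (insert n J)
  then have "nsq M (\<lambda>x. f n x + (\<Sum>n\<in>J. f n x)) < top" by (intro nsq_add_finite) auto
  with insert show ?case by simp
qed (simp_all add: nsq_def)

lemma nn_integral_mult_nsq_le:
  assumes [measurable]: "f \<in> borel_measurable M" "g \<in> borel_measurable M"
  shows "(\<integral>\<^sup>+ x. ennreal (cmod (f x) * cmod (g x)) \<partial>M)\<^sup>2 \<le> nsq M f * nsq M g"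
  using Cauchy_Schwarz_nn_integral[of "\<lambda>x. ennreal (cmod (f x))" M "\<lambda>x. ennreal (cmod (g x))"]
  by (simp add: nsq_def ennreal_mult ennreal_power)

lemma integrable_mult_nsq:
  assumes [measurable]: "f \<in> borel_measurable M" "g \<in> borel_measurable M"
    and "nsq M f < top" "nsq M g < top"
  shows "integrable M (\<lambda>x. f x * g x)"
proof (rule integrableI_bounded)
  have "(\<integral>\<^sup>+ x. ennreal (cmod (f x) * cmod (g x)) \<partial>M)\<^sup>2 < top"
    using nn_integral_mult_nsq_le[OF assms(1,2)] assms(3,4)
    by (auto simp: ennreal_mult_less_top intro: le_less_trans)
  then show "(\<integral>\<^sup>+ x. ennreal (norm (f x * g x)) \<partial>M) < \<infinity>"
    by (cases "(\<integral>\<^sup>+ x. ennreal (cmod (f x) * cmod (g x)) \<partial>M) = 0")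
       (auto simp: norm_mult power2_eq_square ennreal_mult_less_top)
qed simp

lemma nsq_cnj: "nsq M (\<lambda>x. cnj (f x)) = nsq M f"
  by (simp add: nsq_def)

lemma integral_mult_nsq_le:
  assumes [measurable]: "f \<in> borel_measurable M" "g \<in> borel_measurable M"
    and "nsq M f < top" "nsq M g < top"
  shows "ennreal ((cmod (\<integral>x. f x * g x \<partial>M))\<^sup>2) \<le> nsq M f * nsq M g"
proof -
  have "ennreal (cmod (\<integral>x. f x * g x \<partial>M)) \<le> (\<integral>\<^sup>+ x. ennreal (cmod (f x) * cmod (g x)) \<partial>M)"
    using integral_norm_bound_ennreal[OF integrable_mult_nsq[OF assms]] by (simp add: norm_mult)
  then have "ennreal (cmod (\<integral>x. f x * g x \<partial>M)) ^ 2 \<le> (\<integral>\<^sup>+ x. ennreal (cmod (f x) * cmod (g x)) \<partial>M) ^ 2"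
    by (intro power_mono) auto
  also have "\<dots> \<le> nsq M f * nsq M g" by (rule nn_integral_mult_nsq_le) auto
  finally show ?thesis by (simp add: ennreal_power)
qed

lemma tendsto_ennreal_sq_0D:
  fixes z :: "'a \<Rightarrow> complex"
  assumes "((\<lambda>x. ennreal ((cmod (z x))\<^sup>2)) \<longlongrightarrow> 0) F"
  shows "(z \<longlongrightarrow> 0) F"
proof -
  have "((\<lambda>x. (cmod (z x))\<^sup>2) \<longlongrightarrow> 0) F"
    using assms tendsto_ennreal_iff[where F = F and f = "\<lambda>x. (cmod (z x))\<^sup>2" and x = 0] by simp
  then have "((\<lambda>x. sqrt ((cmod (z x))\<^sup>2)) \<longlongrightarrow> sqrt 0) F" by (rule tendsto_real_sqrt)
  then show ?thesis by (simp add: tendsto_norm_zero_iff)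
qed

lemma tendsto_ennreal_mult_const_0:
  fixes f :: "'a \<Rightarrow> ennreal"
  assumes "(f \<longlongrightarrow> 0) F" "c < top"
  shows "((\<lambda>x. f x * c) \<longlongrightarrow> 0) F"
  using ennreal_tendsto_cmult[OF _ assms(1), of c] assms(2) by (simp add: mult.commute)

text \<open>
  By the Cauchy-Schwarz inequality, convergence in \<open>L\<^sup>2\<close> implies weak convergence.
\<close>

lemma tendsto_integral_mult_nsq:
  assumes [measurable]: "\<And>i. F i \<in> borel_measurable M" "f \<in> borel_measurable M" "g \<in> borel_measurable M"
    and "\<And>i. nsq M (F i) < top" "nsq M f < top" "nsq M g < top"
    and lim: "((\<lambda>i. nsq M (\<lambda>x. F i x - f x)) \<longlongrightarrow> 0) A"
  shows "((\<lambda>i. \<integral>x. F i x * g x \<partial>M) \<longlongrightarrow> (\<integral>x. f x * g x \<partial>M)) A"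
proof -
  have le: "ennreal ((cmod ((\<integral>x. F i x * g x \<partial>M) - (\<integral>x. f x * g x \<partial>M)))\<^sup>2) \<le> nsq M (\<lambda>x. F i x - f x) * nsq M g" for i
  proof -
    have "(\<integral>x. F i x * g x \<partial>M) - (\<integral>x. f x * g x \<partial>M) = (\<integral>x. (F i x - f x) * g x \<partial>M)"
      unfolding left_diff_distrib
      by (rule Bochner_Integration.integral_diff[symmetric]; intro integrable_mult_nsq assms)
    then show ?thesis
      using integral_mult_nsq_le[of "\<lambda>x. F i x - f x" M g] by (simp add: assms nsq_diff_finite)
  qed
  have "((\<lambda>i. ennreal ((cmod ((\<integral>x. F i x * g x \<partial>M) - (\<integral>x. f x * g x \<partial>M)))\<^sup>2)) \<longlongrightarrow> 0) A"
    by (rule tendsto_sandwich[OF _ _ tendsto_const tendsto_ennreal_mult_const_0[OF lim assms(6)]])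
       (use le in auto)
  then show ?thesis by (subst LIM_zero_iff[symmetric]) (rule tendsto_ennreal_sq_0D)
qed

lemma nsq_eq_integral:
  assumes [measurable]: "f \<in> borel_measurable M" and "nsq M f < top"
  shows "complex_of_real (enn2real (nsq M f)) = (\<integral>x. f x * cnj (f x) \<partial>M)"
proof -
  have "(\<integral>x. f x * cnj (f x) \<partial>M) = (\<integral>x. complex_of_real ((cmod (f x))\<^sup>2) \<partial>M)"
    by (simp only: complex_norm_square)
  also have "\<dots> = complex_of_real (\<integral>x. (cmod (f x))\<^sup>2 \<partial>M)" by (rule integral_complex_of_real)
  also have "(\<integral>x. (cmod (f x))\<^sup>2 \<partial>M) = enn2real (nsq M f)"
    unfolding nsq_def by (rule integral_eq_nn_integral) auto
  finally show ?thesis by simp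
qed

text \<open>
  The theorem of Pythagoras, for orthogonal functions of equal norm: it is applied to the Laguerre
  functions on the half line and to the powers of a function with values in the unit circle.
\<close>

lemma nsq_orthogonal_sum:
  fixes e :: "nat \<Rightarrow> 'a \<Rightarrow> complex"
  assumes [measurable]: "\<And>n. e n \<in> borel_measurable M" and fin: "\<And>n. nsq M (e n) < top"
    and orth: "\<And>m n. (\<integral>x. e m x * cnj (e n x) \<partial>M) = (if m = n then of_real C else 0)"
    and J: "finite J"
  shows "nsq M (\<lambda>x. \<Sum>n\<in>J. c n * e n x) = ennreal (C * (\<Sum>n\<in>J. (cmod (c n))\<^sup>2))"
proof -
  let ?S = "\<lambda>x. \<Sum>n\<in>J. c n * e n x"
  have f: "nsq M ?S < top" by (intro nsq_sum_finite nsq_cmult_finite fin) auto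
  have i: "integrable M (\<lambda>x. c m * cnj (c n) * (e m x * cnj (e n x)))" for m n
    by (intro integrable_mult_right integrable_mult_nsq) (auto simp: nsq_cnj fin)
  have "complex_of_real (enn2real (nsq M ?S)) = (\<integral>x. ?S x * cnj (?S x) \<partial>M)"
    by (rule nsq_eq_integral) (use f in auto)
  also have "\<dots> = (\<integral>x. (\<Sum>m\<in>J. \<Sum>n\<in>J. c m * cnj (c n) * (e m x * cnj (e n x))) \<partial>M)"
    by (simp add: sum_product mult_ac)
  also have "\<dots> = (\<Sum>m\<in>J. \<Sum>n\<in>J. c m * cnj (c n) * (if m = n then of_real C else 0))"
    by (simp add: i orth del: integral_mult_right_zero) (simp add: orth)
  also have "\<dots> = (\<Sum>m\<in>J. of_real (C * (cmod (c m))\<^sup>2))"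
    using J by (intro sum.cong refl) (simp add: if_distrib sum.delta' complex_norm_square mult_ac cong: if_cong del: of_real_power)
  also have "\<dots> = of_real (C * (\<Sum>n\<in>J. (cmod (c n))\<^sup>2))" by (simp add: sum_distrib_left)
  finally have "enn2real (nsq M ?S) = C * (\<Sum>n\<in>J. (cmod (c n))\<^sup>2)" using of_real_eq_iff by blast
  then show ?thesis using f by (metis ennreal_enn2real)
qed

lemma bessel_identity:
  fixes e :: "nat \<Rightarrow> 'a \<Rightarrow> complex"
  assumes [measurable]: "\<And>n. e n \<in> borel_measurable M" "f \<in> borel_measurable M"
    and fin: "\<And>n. nsq M (e n) < top" "nsq M f < top"
    and orth: "\<And>m n. (\<integral>x. e m x * cnj (e n x) \<partial>M) = (if m = n then 1 else 0)"
    and a: "\<And>n. a n = (\<integral>x. f x * cnj (e n x) \<partial>M)"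
  shows "nsq M (\<lambda>x. f x - (\<Sum>n<K. a n * e n x)) = ennreal (enn2real (nsq M f) - (\<Sum>n<K. (cmod (a n))\<^sup>2))"
    and "(\<Sum>n<K. (cmod (a n))\<^sup>2) \<le> enn2real (nsq M f)"
proof -
  let ?S = "\<lambda>x. \<Sum>n<K. a n * e n x"
  have fS: "nsq M ?S < top" by (intro nsq_sum_finite nsq_cmult_finite fin) auto
  have fd: "nsq M (\<lambda>x. f x - ?S x) < top" by (intro nsq_diff_finite fS fin) auto
  have S: "(\<integral>x. ?S x * cnj (?S x) \<partial>M) = of_real (\<Sum>n<K. (cmod (a n))\<^sup>2)"
    using nsq_eq_integral[of ?S M] fS nsq_orthogonal_sum[of e M 1 "{..<K}" a] fin orth
    by (simp add: sum_nonneg)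
  have if': "integrable M (\<lambda>x. f x * cnj (e n x))" for n
    by (intro integrable_mult_nsq) (auto simp: nsq_cnj fin)
  have "(\<integral>x. f x * cnj (?S x) \<partial>M) = (\<integral>x. (\<Sum>n<K. cnj (a n) * (f x * cnj (e n x))) \<partial>M)"
    by (simp add: sum_distrib_left mult_ac)
  also have "\<dots> = (\<Sum>n<K. cnj (a n) * a n)" by (simp add: if' a)
  also have "\<dots> = of_real (\<Sum>n<K. (cmod (a n))\<^sup>2)"
    by (simp add: complex_norm_square mult.commute del: of_real_power)
  finally have fS': "(\<integral>x. f x * cnj (?S x) \<partial>M) = of_real (\<Sum>n<K. (cmod (a n))\<^sup>2)" .
  have "(\<integral>x. ?S x * cnj (f x) \<partial>M) = (\<integral>x. cnj (f x * cnj (?S x)) \<partial>M)"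
    by (simp add: mult.commute)
  also have "\<dots> = cnj (\<integral>x. f x * cnj (?S x) \<partial>M)" by (rule integral_bounded_linear[OF bounded_linear_cnj], intro integrable_mult_nsq; use fS fin in \<open>simp add: nsq_cnj nsq_cnj[of M ?S, simplified]\<close>)
  finally have Sf: "(\<integral>x. ?S x * cnj (f x) \<partial>M) = of_real (\<Sum>n<K. (cmod (a n))\<^sup>2)"
    unfolding fS' by simp
  have "complex_of_real (enn2real (nsq M (\<lambda>x. f x - ?S x))) = (\<integral>x. (f x - ?S x) * cnj (f x - ?S x) \<partial>M)"
    by (rule nsq_eq_integral) (use fd in auto)
  also have "\<dots> = (\<integral>x. f x * cnj (f x) - f x * cnj (?S x) - ?S x * cnj (f x) + ?S x * cnj (?S x) \<partial>M)"
    by (intro Bochner_Integration.integral_cong refl) (simp add: algebra_simps)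
  also have "\<dots> = (\<integral>x. f x * cnj (f x) \<partial>M) - (\<integral>x. f x * cnj (?S x) \<partial>M) - (\<integral>x. ?S x * cnj (f x) \<partial>M) + (\<integral>x. ?S x * cnj (?S x) \<partial>M)"
  proof -
    have "integrable M (\<lambda>x. f x * cnj (f x))" "integrable M (\<lambda>x. f x * cnj (?S x))"
      "integrable M (\<lambda>x. ?S x * cnj (f x))" "integrable M (\<lambda>x. ?S x * cnj (?S x))"
      using fS fin by (intro integrable_mult_nsq; simp add: nsq_cnj nsq_cnj[of M ?S, simplified])+
    then show ?thesis
      by (simp only: Bochner_Integration.integral_add Bochner_Integration.integral_diff
          Bochner_Integration.integrable_diff Bochner_Integration.integrable_add)
  qed
  also have "\<dots> = of_real (enn2real (nsq M f) - (\<Sum>n<K. (cmod (a n))\<^sup>2))"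
    unfolding S fS' Sf using nsq_eq_integral[of f M] fin by simp
  finally have *: "enn2real (nsq M (\<lambda>x. f x - ?S x)) = enn2real (nsq M f) - (\<Sum>n<K. (cmod (a n))\<^sup>2)"
    using of_real_eq_iff by blast
  then show "nsq M (\<lambda>x. f x - ?S x) = ennreal (enn2real (nsq M f) - (\<Sum>n<K. (cmod (a n))\<^sup>2))"
    using fd by (metis ennreal_enn2real)
  show "(\<Sum>n<K. (cmod (a n))\<^sup>2) \<le> enn2real (nsq M f)"
    using * enn2real_nonneg[of "nsq M (\<lambda>x. f x - ?S x)"] by simp
qed

text \<open>
  The norm is lower semicontinuous under pointwise convergence.
\<close>

lemma nsq_Fatou:
  assumes [measurable]: "\<And>j. F j \<in> borel_measurable M" "f \<in> borel_measurable M"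
    and lim: "AE x in M. (\<lambda>j. F j x) \<longlonglongrightarrow> f x"
    and bound: "eventually (\<lambda>j. nsq M (F j) \<le> C) sequentially"
  shows "nsq M f \<le> C"
proof -
  have "nsq M f = (\<integral>\<^sup>+ x. liminf (\<lambda>j. ennreal ((cmod (F j x))\<^sup>2)) \<partial>M)"
    unfolding nsq_def
  proof (rule nn_integral_cong_AE, use lim in eventually_elim)
    fix x assume "(\<lambda>j. F j x) \<longlonglongrightarrow> f x"
    then have "(\<lambda>j. ennreal ((cmod (F j x))\<^sup>2)) \<longlonglongrightarrow> ennreal ((cmod (f x))\<^sup>2)"
      by (intro tendsto_ennrealI tendsto_intros)
    then show "ennreal ((cmod (f x))\<^sup>2) = liminf (\<lambda>j. ennreal ((cmod (F j x))\<^sup>2))"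
      by (intro lim_imp_Liminf[symmetric]) simp_all
  qed
  also have "\<dots> \<le> liminf (\<lambda>j. nsq M (F j))"
    unfolding nsq_def by (rule nn_integral_liminf) simp
  also have "\<dots> \<le> liminf (\<lambda>j. C)" by (intro Liminf_mono bound)
  also have "\<dots> = C" by (simp add: Liminf_const)
  finally show ?thesis .
qed

text \<open>
  Pointwise convergence without loss of norm is convergence in \<open>L\<^sup>2\<close>. Fatou's lemma is applied to the
  nonnegative functions \<open>2|F\<^sub>j|\<^sup>2 + 2|f|\<^sup>2 - |F\<^sub>j - f|\<^sup>2\<close>, whose limit \<open>4|f|\<^sup>2\<close> has the integral \<open>4C\<close>.
\<close>

lemma nsq_tendsto_0_if_norms_eq:
  assumes [measurable]: "\<And>j. F j \<in> borel_measurable M" "f \<in> borel_measurable M"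
    and lim: "\<And>x. (\<lambda>j. F j x) \<longlonglongrightarrow> f x"
    and eq: "\<And>j. nsq M (F j) = ennreal C" "nsq M f = ennreal C"
  shows "(\<lambda>j. nsq M (\<lambda>x. F j x - f x)) \<longlonglongrightarrow> 0"
proof -
  define G where "G j x = ennreal (2 * (cmod (F j x))\<^sup>2 + 2 * (cmod (f x))\<^sup>2 - (cmod (F j x - f x))\<^sup>2)" for j x
  have nn: "(cmod (F j x - f x))\<^sup>2 \<le> 2 * (cmod (F j x))\<^sup>2 + 2 * (cmod (f x))\<^sup>2" for j x
    using cmod_sum_sq_le[of "F j x" "- f x"] by simp
  have fin: "nsq M (\<lambda>x. F j x - f x) < top" for j
    by (intro nsq_diff_finite) (auto simp: eq)
  have split: "ennreal (2 * a + 2 * b - c) + ennreal c = 2 * ennreal a + 2 * ennreal b"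
    if "c \<le> 2 * a + 2 * b" "0 \<le> a" "0 \<le> b" "0 \<le> c" for a b c :: real
  proof -
    have "ennreal (2 * a + 2 * b - c) + ennreal c = ennreal (2 * a + 2 * b)"
      using that by (subst ennreal_plus[symmetric]) auto
    also have "\<dots> = 2 * ennreal a + 2 * ennreal b"
      using that by (simp add: ennreal_mult)
    finally show ?thesis .
  qed
  have int: "(\<integral>\<^sup>+ x. G j x \<partial>M) = 4 * ennreal C - nsq M (\<lambda>x. F j x - f x)" for j
  proof -
    have "(\<integral>\<^sup>+ x. G j x \<partial>M) + nsq M (\<lambda>x. F j x - f x) = (\<integral>\<^sup>+ x. G j x + ennreal ((cmod (F j x - f x))\<^sup>2) \<partial>M)"
      unfolding nsq_def G_def by (simp add: nn_integral_add)
    also have "\<dots> = (\<integral>\<^sup>+ x. 2 * ennreal ((cmod (F j x))\<^sup>2) + 2 * ennreal ((cmod (f x))\<^sup>2) \<partial>M)"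
      unfolding G_def using nn by (intro nn_integral_cong split) auto
    also have "\<dots> = 2 * nsq M (F j) + 2 * nsq M f"
      by (simp add: nsq_def nn_integral_add nn_integral_cmult)
    also have "\<dots> = 4 * ennreal C" unfolding eq by (simp flip: distrib_right)
    finally show ?thesis using fin[of j] by (metis ennreal_add_diff_cancel_right less_irrefl)
  qed
  have "4 * ennreal C = (\<integral>\<^sup>+ x. liminf (\<lambda>j. G j x) \<partial>M)"
  proof -
    have "(\<integral>\<^sup>+ x. liminf (\<lambda>j. G j x) \<partial>M) = (\<integral>\<^sup>+ x. 4 * ennreal ((cmod (f x))\<^sup>2) \<partial>M)"
    proof (rule nn_integral_cong)
      fix x
      have "(\<lambda>j. G j x) \<longlonglongrightarrow> ennreal (2 * (cmod (f x))\<^sup>2 + 2 * (cmod (f x))\<^sup>2 - (cmod (f x - f x))\<^sup>2)"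
        unfolding G_def by (intro tendsto_ennrealI tendsto_intros lim)
      then show "liminf (\<lambda>j. G j x) = 4 * ennreal ((cmod (f x))\<^sup>2)"
        by (simp add: lim_imp_Liminf ennreal_mult)
    qed
    then show ?thesis by (simp add: nn_integral_cmult flip: nsq_def eq(2))
  qed
  also have "\<dots> \<le> liminf (\<lambda>j. \<integral>\<^sup>+ x. G j x \<partial>M)"
    by (rule nn_integral_liminf) (simp add: G_def)
  finally have le: "4 * ennreal C \<le> liminf (\<lambda>j. \<integral>\<^sup>+ x. G j x \<partial>M)" .
  have C: "4 * ennreal C = ennreal (4 * max 0 C)"
    by (cases "C \<ge> 0") (simp_all add: ennreal_mult max_def ennreal_neg)
  show ?thesis
  proof (rule order_tendstoI)
    fix e :: ennreal assume "0 < e"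
    show "\<forall>\<^sub>F j in sequentially. nsq M (\<lambda>x. F j x - f x) < e"
    proof (cases "C > 0")
      case False
      then have "nsq M (\<lambda>x. F j x - f x) = 0" for j
        using nsq_diff_le[of "F j" M f] by (simp add: eq ennreal_neg)
      then show ?thesis using \<open>0 < e\<close> by simp
    next
      case True
      define e' where "e' = min e (4 * ennreal C)"
      have e': "0 < e'" "e' \<le> 4 * ennreal C" "e' \<le> e"
        using True \<open>0 < e\<close> by (auto simp: e'_def ennreal_zero_less_mult_iff)
      have "4 * ennreal C - e' < 4 * ennreal C"
        using e' C using True by (intro ennreal_between) auto
      also note le
      finally have "\<forall>\<^sub>F j in sequentially. 4 * ennreal C - e' < (\<integral>\<^sup>+ x. G j x \<partial>M)"
        by (rule less_LiminfD)
      then show ?thesis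
      proof eventually_elim
        case (elim j)
        then have "4 * ennreal C - e' < 4 * ennreal C - nsq M (\<lambda>x. F j x - f x)" by (simp add: int)
        then have "nsq M (\<lambda>x. F j x - f x) < e'"
          by (meson ennreal_minus_mono leI not_less order_refl)
        with e' show ?case by simp
      qed
    qed
  qed simp
qed

section \<open>The half line\<close>

text \<open>
  Lebesgue measure on \<open>[0, \<infinity>)\<close>, as a measure on all real numbers, so that functions need not be cut
  off at 0.
\<close>

definition half :: "real measure" where
  "half = density lborel (\<lambda>s. ennreal (indicator {0..} s))"

lemma sets_half [simp, measurable_cong]: "sets half = sets borel"
  by (simp add: half_def)

lemma space_half [simp]: "space half = UNIV"
  by (simp add: half_def)

lemma nn_integral_half:
  assumes [measurable]: "F \<in> borel_measurable borel"
  shows "(\<integral>\<^sup>+ s. F s \<partial>half) = (\<integral>\<^sup>+ s. F s * indicator {0..} s \<partial>lborel)"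
  unfolding half_def by (subst nn_integral_density) (auto simp: mult.commute ennreal_indicator)

lemma integrable_half_iff:
  fixes F :: "real \<Rightarrow> 'b::{banach, second_countable_topology}"
  assumes [measurable]: "F \<in> borel_measurable borel"
  shows "integrable half F \<longleftrightarrow> integrable lborel (\<lambda>s. indicator {0..} s *\<^sub>R F s)"
  unfolding half_def by (subst integrable_density) auto

lemma integral_half:
  fixes F :: "real \<Rightarrow> 'b::{banach, second_countable_topology}"
  assumes [measurable]: "F \<in> borel_measurable borel"
  shows "(\<integral>s. F s \<partial>half) = (\<integral>s. indicator {0..} s *\<^sub>R F s \<partial>lborel)"
  unfolding half_def by (subst integral_density) auto

lemma AE_half: "(AE s in half. P s) \<longleftrightarrow> (AE s in lborel. 0 \<le> s \<longrightarrow> P s)"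
  unfolding half_def by (subst AE_density) (auto simp: indicator_def)

lemma sigma_finite_half: "sigma_finite_measure half"
  unfolding half_def by (subst sigma_finite_measure.sigma_finite_iff_density_finite[OF sigma_finite_lborel]) auto

lemma integrable_half_power_exp:
  assumes r: "0 < r"
  shows "integrable half (\<lambda>s. s ^ k * exp (- (r * s)))"
proof (rule integrableI_bounded)
  have "(\<integral>\<^sup>+ s. ennreal (norm (s ^ k * exp (- (r * s)))) \<partial>half)
      = (\<integral>\<^sup>+ s. ennreal (fact k / r ^ Suc k) * ennreal (erlang_density k r s * s ^ 0) \<partial>lborel)"
    using r by (subst nn_integral_half)
      (auto intro!: nn_integral_cong simp: erlang_density_def ennreal_mult[symmetric] indicator_def field_simps)
  also have "\<dots> = ennreal (fact k / r ^ Suc k) * (\<integral>\<^sup>+ s. ennreal (erlang_density k r s * s ^ 0) \<partial>lborel)"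
    by (rule nn_integral_cmult) simp
  also have "\<dots> < \<infinity>"
    unfolding nn_integral_erlang_ith_moment[OF r] by (simp add: ennreal_mult_less_top)
  finally show "(\<integral>\<^sup>+ s. ennreal (norm (s ^ k * exp (- (r * s)))) \<partial>half) < \<infinity>" .
qed simp

lemma tendsto_power_exp_at_top:
  assumes r: "0 < r"
  shows "((\<lambda>s::real. s ^ k * exp (- (r * s))) \<longlongrightarrow> 0) at_top"
proof -
  have "((\<lambda>s. ((r * s) ^ k / exp (r * s)) / r ^ k) \<longlongrightarrow> 0 / r ^ k) at_top"
    using r by (intro tendsto_intros filterlim_compose[OF tendsto_power_div_exp_0]
        filterlim_tendsto_pos_mult_at_top[OF tendsto_const r filterlim_ident]) auto
  then show ?thesis using r by (simp add: power_mult_distrib exp_minus field_simps)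
qed

lemma borel_measurable_exp_poly [measurable]:
  "(\<lambda>s. exp (- (c * of_real s)) * of_real (poly p s) :: complex) \<in> borel_measurable borel"
  by (intro borel_measurable_continuous_onI continuous_intros)

lemma poly_exp_expand:
  "exp (- (c * of_real s)) * of_real (poly p s)
     = (\<Sum>i\<le>degree p. of_real (coeff p i) * (exp (- (c * of_real s)) * (of_real s) ^ i))" for c :: complex
  by (simp add: poly_altdef sum_distrib_left mult_ac)

lemma integrable_exp_poly:
  assumes "0 < Re c"
  shows "integrable half (\<lambda>s. exp (- (c * of_real s)) * of_real (poly p s) :: complex)"
  unfolding poly_exp_expand
proof (intro Bochner_Integration.integrable_sum integrable_mult_right)
  fix i
  have "integrable half (\<lambda>s. s ^ i * exp (- (Re c * s)))"
    by (rule integrable_half_power_exp[OF assms])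
  then show "integrable half (\<lambda>s. exp (- (c * of_real s)) * (of_real s) ^ i :: complex)"
    by (rule Bochner_Integration.integrable_bound)
       (auto simp: norm_mult norm_power abs_mult power_abs intro!: borel_measurable_continuous_onI continuous_intros)
qed

lemma tendsto_exp_poly_at_top:
  assumes "0 < Re c"
  shows "((\<lambda>s. exp (- (c * of_real s)) * of_real (poly p s) :: complex) \<longlongrightarrow> 0) at_top"
  unfolding poly_exp_expand
proof (intro tendsto_null_sum tendsto_mult_right_zero)
  fix i
  have "((\<lambda>s. cmod (exp (- (c * of_real s)) * (of_real s) ^ i)) \<longlongrightarrow> 0) at_top"
  proof (rule Lim_transform_eventually[OF tendsto_power_exp_at_top[OF assms, of i]])
    show "\<forall>\<^sub>F s in at_top. s ^ i * exp (- (Re c * s)) = cmod (exp (- (c * of_real s)) * (of_real s) ^ i)"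
      using eventually_ge_at_top[of 0] by eventually_elim (simp add: norm_mult norm_power)
  qed
  then show "((\<lambda>s. exp (- (c * of_real s)) * (of_real s) ^ i :: complex) \<longlongrightarrow> 0) at_top"
    by (rule tendsto_norm_zero_cancel)
qed

definition laplace_poly :: "complex \<Rightarrow> real poly \<Rightarrow> complex" where
  "laplace_poly c p = (\<integral>s. exp (- (c * of_real s)) * of_real (poly p s) \<partial>half)"

lemma laplace_poly_add:
  "0 < Re c \<Longrightarrow> laplace_poly c (p + q) = laplace_poly c p + laplace_poly c q"
  unfolding laplace_poly_def poly_add of_real_add distrib_left
  by (rule Bochner_Integration.integral_add) (erule integrable_exp_poly)+

lemma laplace_poly_minus: "laplace_poly c (- p) = - laplace_poly c p"
  by (simp add: laplace_poly_def)

lemma laplace_poly_sum: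
  "0 < Re c \<Longrightarrow> laplace_poly c (\<Sum>i\<in>A. f i) = (\<Sum>i\<in>A. laplace_poly c (f i))"
  unfolding laplace_poly_def poly_sum of_real_sum sum_distrib_left
  by (rule Bochner_Integration.integral_sum) (rule integrable_exp_poly)

text \<open>
  Integration by parts on the half line.
\<close>

lemma laplace_poly_pderiv:
  assumes c: "0 < Re c"
  shows "c * laplace_poly c p = of_real (poly p 0) + laplace_poly c (pderiv p)"
proof -
  let ?e = "\<lambda>s::real. exp (- (c * of_real s)) :: complex"
  define F where "F s = - (?e s * of_real (poly p s))" for s
  define f where "f s = c * (?e s * of_real (poly p s)) - ?e s * of_real (poly (pderiv p) s)" for s
  have int: "integrable half f"
    unfolding f_def by (intro Bochner_Integration.integrable_diff integrable_mult_right integrable_exp_poly c)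
  have [measurable]: "f \<in> borel_measurable borel" unfolding f_def by measurable
  have "(LBINT s=0..\<infinity>. f s) = 0 - F 0"
  proof (rule interval_integral_FTC_integrable)
    fix s :: real
    have "((\<lambda>z. exp (- (c * z))) has_field_derivative (- c) * exp (- (c * of_real s))) (at (of_real s))"
      by (auto intro!: derivative_eq_intros)
    then have e: "(?e has_vector_derivative (- c) * ?e s) (at s)"
      by (rule has_vector_derivative_real_field)
    have p: "((\<lambda>s. complex_of_real (poly p s)) has_vector_derivative of_real (poly (pderiv p) s)) (at s)"
      by (intro has_vector_derivative_of_real poly_DERIV[THEN has_field_derivative_at_within])
    show "(F has_vector_derivative f s) (at s)"
      unfolding F_def f_def
      by (rule has_vector_derivative_eq_rhs[OF has_vector_derivative_minus[OF has_vector_derivative_mult[OF e p]]])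
         (simp add: algebra_simps)
    show "isCont f s" unfolding f_def by (intro continuous_intros)
  next
    have "integrable lborel (\<lambda>s. indicator {0<..} s *\<^sub>R (indicator {0..} s *\<^sub>R f s))"
      using int by (intro integrable_mult_indicator[of "{0<..}"]) (simp_all add: integrable_half_iff)
    also have "(\<lambda>s. indicator {0<..} s *\<^sub>R (indicator {0..} s *\<^sub>R f s)) = (\<lambda>s. indicator (einterval 0 \<infinity>) s *\<^sub>R f s)"
      by (auto simp: indicator_def einterval_def)
    finally show "set_integrable lborel (einterval 0 \<infinity>) f"
      unfolding set_integrable_def .
  next
    have "(F \<longlongrightarrow> F 0) (at_right 0)"
      unfolding F_def by (intro tendsto_intros)
    then show "((F \<circ> real_of_ereal) \<longlongrightarrow> F 0) (at_right 0)"
      unfolding comp_def zero_ereal_def by (subst at_right_ereal, subst filterlim_filtermap) simp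
  next
    have "(F \<longlongrightarrow> 0) at_top"
      unfolding F_def using tendsto_minus[OF tendsto_exp_poly_at_top[OF c, of p]] by simp
    then show "((F \<circ> real_of_ereal) \<longlongrightarrow> 0) (at_left \<infinity>)"
      unfolding comp_def by (simp add: at_left_PInf filterlim_filtermap)
  qed simp
  also have "(LBINT s=0..\<infinity>. f s) = (\<integral>s. f s \<partial>half)"
  proof -
    have "(LBINT s=0..\<infinity>. f s) = (\<integral>s. indicator {0<..} s *\<^sub>R f s \<partial>lborel)"
      by (simp add: interval_lebesgue_integral_def set_lebesgue_integral_def einterval_def greaterThan_def)
    also have "\<dots> = (\<integral>s. indicator {0..} s *\<^sub>R f s \<partial>lborel)"
    proof (rule integral_cong_AE)
      show "AE s in lborel. indicator {0<..} s *\<^sub>R f s = indicator {0..} s *\<^sub>R f s"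
        using AE_lborel_singleton[of "0::real"] by eventually_elim (auto simp: indicator_def)
    qed simp_all
    finally show ?thesis by (simp add: integral_half)
  qed
  also have "(\<integral>s. f s \<partial>half) = c * laplace_poly c p - laplace_poly c (pderiv p)"
    unfolding f_def laplace_poly_def
    by (subst Bochner_Integration.integral_diff) (auto intro!: integrable_mult_right integrable_exp_poly c)
  finally show ?thesis by (simp add: F_def algebra_simps)
qed

text \<open>
  Integration by parts turns \<open>L\<^sub>n\<^sub>+\<^sub>1' = L\<^sub>n' - L\<^sub>n\<close> into the statement that the Laplace transforms form
  a geometric sequence.
\<close>

lemma laplace_poly_laguerre:
  assumes c: "0 < Re c"
  shows "laplace_poly c (laguerre n) = (1 / c) * (1 - 1 / c) ^ n"
proof -
  have c0: "c \<noteq> 0" using c by auto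
  show ?thesis
  proof (induction n)
    case 0
    have "c * laplace_poly c 1 = 1 + laplace_poly c 0"
      using laplace_poly_pderiv[OF c, of 1] by simp
    also have "laplace_poly c 0 = 0" by (simp add: laplace_poly_def)
    finally show ?case using c0 by (simp add: field_simps)
  next
    case (Suc n)
    have "c * laplace_poly c (laguerre (Suc n)) = 1 + laplace_poly c (pderiv (laguerre n) + (- laguerre n))"
      using laplace_poly_pderiv[OF c, of "laguerre (Suc n)"] by (simp add: pderiv_laguerre_Suc)
    also have "\<dots> = c * laplace_poly c (laguerre n) - laplace_poly c (laguerre n)"
      using laplace_poly_pderiv[OF c, of "laguerre n"]
      by (simp only: laplace_poly_add[OF c] laplace_poly_minus) simp
    finally have "laplace_poly c (laguerre (Suc n)) = (1 - 1 / c) * laplace_poly c (laguerre n)"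
      using c0 by (simp add: field_simps)
    then show ?case by (simp add: Suc.IH)
  qed
qed

text \<open>
  Integration by parts gives 1, the boundary term, minus the inner products of lower total degree
  that arise from \<open>L\<^sub>n' = - \<Sum>\<^sub>j\<^sub><\<^sub>n L\<^sub>j\<close>. By induction precisely one of these is 1 when \<open>m \<noteq> n\<close>, and none
  when \<open>m = n\<close>.
\<close>

lemma laguerre_orthonormal:
  "laplace_poly 1 (laguerre m * laguerre n) = (if m = n then 1 else 0)"
proof (induction "m + n" arbitrary: m n rule: less_induct)
  case less
  have one: "0 < Re (1::complex)" by simp
  have "laplace_poly 1 (laguerre m * laguerre n)
      = 1 + laplace_poly 1 (pderiv (laguerre m * laguerre n))"
    using laplace_poly_pderiv[OF one, of "laguerre m * laguerre n"] by simp
  also have "pderiv (laguerre m * laguerre n)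
      = - (\<Sum>j<m. laguerre j * laguerre n) + (- (\<Sum>j<n. laguerre m * laguerre j))"
    by (simp add: pderiv_mult pderiv_laguerre sum_distrib_left sum_distrib_right mult_ac)
  also have "laplace_poly 1 \<dots> = - (\<Sum>j<m. laplace_poly 1 (laguerre j * laguerre n))
      - (\<Sum>j<n. laplace_poly 1 (laguerre m * laguerre j))"
    by (simp only: laplace_poly_add[OF one] laplace_poly_minus laplace_poly_sum[OF one]) simp
  also have "(\<Sum>j<m. laplace_poly 1 (laguerre j * laguerre n)) = (\<Sum>j<m. if j = n then 1 else 0)"
    by (intro sum.cong refl less) auto
  also have "(\<Sum>j<n. laplace_poly 1 (laguerre m * laguerre j)) = (\<Sum>j<n. if m = j then 1 else 0)"
    by (intro sum.cong refl less) auto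
  finally show ?case by auto
qed

definition lagfun :: "nat \<Rightarrow> real \<Rightarrow> complex" where
  "lagfun n s = exp (- of_real (s / 2)) * of_real (poly (laguerre n) s)"

lemma borel_measurable_lagfun [measurable]: "lagfun n \<in> borel_measurable borel"
  unfolding lagfun_def by (intro borel_measurable_continuous_onI continuous_intros) auto

lemma exp_half_sq: "exp (- complex_of_real (s / 2)) * exp (- complex_of_real (s / 2)) = exp (- of_real s)"
proof -
  have "- complex_of_real (s / 2) + - complex_of_real (s / 2) = - of_real s" by (simp add: field_simps)
  then show ?thesis by (simp only: exp_add[symmetric])
qed

lemma cnj_lagfun [simp]: "cnj (lagfun n s) = lagfun n s"
  by (simp add: lagfun_def exp_cnj)

lemma lagfun_mult: "lagfun m s * lagfun n s = exp (- (1 * of_real s)) * of_real (poly (laguerre m * laguerre n) s)"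
proof -
  have "lagfun m s * lagfun n s = (exp (- complex_of_real (s / 2)) * exp (- complex_of_real (s / 2)))
     * of_real (poly (laguerre m * laguerre n) s)"
    by (simp add: lagfun_def mult_ac)
  then show ?thesis unfolding exp_half_sq by simp
qed

lemma lagfun_orthonormal:
  "(\<integral>s. lagfun m s * cnj (lagfun n s) \<partial>half) = (if m = n then 1 else 0)"
  using laguerre_orthonormal[of m n] by (simp add: lagfun_mult laplace_poly_def del: poly_mult)

lemma nsq_exp_poly_finite:
  assumes "0 < Re c"
  shows "nsq half (\<lambda>s. exp (- (c * of_real s)) * of_real (poly p s)) < top"
proof -
  have e: "cmod (exp (- (c * of_real s)) * of_real (poly p s)) ^ 2
      = cmod (exp (- (of_real (2 * Re c) * of_real s)) * of_real (poly (p * p) s))" for s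
  proof -
    have "exp (- (2 * Re c * s)) = exp (- (Re c * s)) * exp (- (Re c * s))" by (simp flip: exp_add)
    then show ?thesis by (simp add: norm_mult power_mult_distrib power2_eq_square)
  qed
  show ?thesis
    unfolding nsq_def e
    using integrable_exp_poly[of "of_real (2 * Re c)" "p * p"] assms
    by (simp add: integrable_iff_bounded)
qed

lemma nsq_lagfun_finite: "nsq half (lagfun n) < top"
  using nsq_exp_poly_finite[of "1/2" "laguerre n"] by (simp add: lagfun_def [abs_def])

lemma nsq_exp:
  assumes "0 < Re B"
  shows "nsq half (\<lambda>s. exp (- (B * of_real s))) = ennreal (1 / (2 * Re B))"
proof -
  have fin: "nsq half (\<lambda>s. exp (- (B * of_real s))) < top"
    using nsq_exp_poly_finite[OF assms, of 1] by simp
  have e: "exp (- (B * of_real s)) * cnj (exp (- (B * of_real s)))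
      = exp (- (of_real (2 * Re B) * of_real s)) * of_real (poly (laguerre 0) s)" for s :: real
  proof -
    have "- (B * of_real s) + cnj (- (B * of_real s)) = - (of_real (2 * Re B) * of_real s)"
      by (simp add: complex_eq_iff)
    then show ?thesis by (simp only: exp_cnj exp_add[symmetric]) simp
  qed
  have "complex_of_real (enn2real (nsq half (\<lambda>s. exp (- (B * of_real s)))))
     = laplace_poly (of_real (2 * Re B)) (laguerre 0)"
    unfolding laplace_poly_def e[symmetric] by (rule nsq_eq_integral) (use fin in \<open>auto intro!: borel_measurable_continuous_onI continuous_intros\<close>)
  also have "\<dots> = of_real (1 / (2 * Re B))"
    using assms by (subst laplace_poly_laguerre) auto
  finally have "enn2real (nsq half (\<lambda>s. exp (- (B * of_real s)))) = 1 / (2 * Re B)"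
    using of_real_eq_iff by blast
  then show ?thesis using fin by (metis ennreal_enn2real)
qed

text \<open>
  The product of the exponential and the Laguerre function is \<open>e\<^bsup>-(B + 1/2)s\<^esup> L\<^sub>n(s)\<close>. The ratio is the
  Cayley transform \<open>(2B - 1)/(2B + 1)\<close>, which maps the right half-plane onto the unit disc: so the
  Gaussians in the plane correspond to the square summable geometric sequences.
\<close>

lemma exp_lagfun_coeff:
  assumes "0 < Re B"
  shows "(\<integral>s. exp (- (B * of_real s)) * cnj (lagfun n s) \<partial>half)
     = 1 / (B + 1/2) * ((B - 1/2) / (B + 1/2)) ^ n"
proof -
  have e: "exp (- (B * of_real s)) * cnj (lagfun n s)
      = exp (- ((B + 1/2) * of_real s)) * of_real (poly (laguerre n) s)" for s
  proof -
    have "- (B * of_real s) + - complex_of_real (s / 2) = - ((B + 1/2) * of_real s)"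
      by (simp add: algebra_simps)
    then show ?thesis
      unfolding cnj_lagfun unfolding lagfun_def mult.assoc[symmetric] exp_add[symmetric] by simp
  qed
  have nz: "B + 1/2 \<noteq> 0" using assms by (auto simp: complex_eq_iff)
  have "(\<integral>s. exp (- (B * of_real s)) * cnj (lagfun n s) \<partial>half) = laplace_poly (B + 1/2) (laguerre n)"
    unfolding e laplace_poly_def ..
  also have "\<dots> = 1 / (B + 1/2) * (1 - 1 / (B + 1/2)) ^ n"
    using assms by (intro laplace_poly_laguerre) auto
  also have "1 - 1 / (B + 1/2) = (B - 1/2) / (B + 1/2)"
  proof -
    have "(B - 1/2) / (B + 1/2) = ((B + 1/2) - 1) / (B + 1/2)" by simp
    then show ?thesis unfolding diff_divide_distrib using nz by simp
  qed
  finally show ?thesis .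
qed

lemma cayley_norm:
  assumes "0 < Re B"
  shows "1 - (cmod ((B - 1/2) / (B + 1/2)))\<^sup>2 = 2 * Re B / (cmod (B + 1/2))\<^sup>2"
    and "cmod ((B - 1/2) / (B + 1/2)) < 1"
proof -
  have nz: "cmod (B + 1/2) \<noteq> 0" using assms by (auto simp: complex_eq_iff)
  have d: "(cmod (B + 1/2))\<^sup>2 - (cmod (B - 1/2))\<^sup>2 = 2 * Re B"
    unfolding cmod_power2 by (simp add: power2_eq_square algebra_simps)
  have aux: "1 - (y / x)\<^sup>2 = t / x\<^sup>2" if "x\<^sup>2 - y\<^sup>2 = t" "x \<noteq> 0" for x y t :: real
    using that(2) unfolding that(1)[symmetric] by (simp add: power_divide diff_divide_distrib)
  show *: "1 - (cmod ((B - 1/2) / (B + 1/2)))\<^sup>2 = 2 * Re B / (cmod (B + 1/2))\<^sup>2"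
    unfolding norm_divide by (rule aux[OF d nz])
  have "2 * Re B / (cmod (B + 1/2))\<^sup>2 > 0" using assms nz by simp
  then have "(cmod ((B - 1/2) / (B + 1/2)))\<^sup>2 < 1" using * by linarith
  then show "cmod ((B - 1/2) / (B + 1/2)) < 1"
    by (metis abs_norm_cancel abs_square_less_1)
qed

lemma gaussian_laguerre_sums:
  assumes "0 < Re B"
  defines "b \<equiv> \<lambda>n. 1 / (B + 1/2) * ((B - 1/2) / (B + 1/2)) ^ n"
  shows "(\<lambda>n. (cmod (b n))\<^sup>2) sums (1 / (2 * Re B))"
proof -
  define z where "z = (B - 1/2) / (B + 1/2)"
  have nz: "cmod (B + 1/2) \<noteq> 0" using assms by (auto simp: complex_eq_iff)
  have "(\<lambda>n. (1 / (cmod (B + 1/2))\<^sup>2) * ((cmod z)\<^sup>2) ^ n) sums ((1 / (cmod (B + 1/2))\<^sup>2) * (1 / (1 - (cmod z)\<^sup>2)))"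
    using cayley_norm(2)[OF assms(1)] by (intro sums_mult geometric_sums) (simp add: z_def abs_square_less_1)
  also have "(1 / (cmod (B + 1/2))\<^sup>2) * (1 / (1 - (cmod z)\<^sup>2)) = 1 / (2 * Re B)"
    unfolding z_def cayley_norm(1)[OF assms(1)] using nz by simp
  finally show ?thesis
    by (simp add: b_def z_def norm_mult norm_divide norm_power power_mult_distrib power_divide flip: power_mult)
       (simp add: mult.commute)
qed

text \<open>
  Bessel's identity gives the error of the partial sums. It tends to 0 because the squared
  coefficients, a geometric series, sum to the squared norm of the exponential; completeness of the
  Laguerre functions is not presupposed.
\<close>

lemma gaussian_laguerre_expansion:
  assumes "0 < Re B"
  shows "(\<lambda>K. nsq half (\<lambda>s. exp (- (B * of_real s))
      - (\<Sum>n<K. (1 / (B + 1/2) * ((B - 1/2) / (B + 1/2)) ^ n) * lagfun n s))) \<longlonglongrightarrow> 0"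
proof -
  let ?b = "\<lambda>n. 1 / (B + 1/2) * ((B - 1/2) / (B + 1/2)) ^ n"
  have "nsq half (\<lambda>s. exp (- (B * of_real s)) - (\<Sum>n<K. ?b n * lagfun n s))
      = ennreal (enn2real (nsq half (\<lambda>s. exp (- (B * of_real s)))) - (\<Sum>n<K. (cmod (?b n))\<^sup>2))" for K
  proof (rule bessel_identity(1)[where e = lagfun])
    show "(\<lambda>s. exp (- (B * complex_of_real s))) \<in> borel_measurable half"
      unfolding measurable_cong_sets[OF sets_half refl]
      by (intro borel_measurable_continuous_onI continuous_intros)
    show "nsq half (\<lambda>s. exp (- (B * of_real s))) < top"
      by (simp add: nsq_exp[OF assms])
  qed (simp_all only: nsq_lagfun_finite lagfun_orthonormal exp_lagfun_coeff[OF assms] borel_measurable_lagfun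
      measurable_cong_sets[OF sets_half refl])
  then have eq: "nsq half (\<lambda>s. exp (- (B * of_real s)) - (\<Sum>n<K. ?b n * lagfun n s))
      = ennreal (1 / (2 * Re B) - (\<Sum>n<K. (cmod (?b n))\<^sup>2))" for K
    using assms by (simp add: nsq_exp)
  have "(\<lambda>K. ennreal (1 / (2 * Re B) - (\<Sum>n<K. (cmod (?b n))\<^sup>2))) \<longlonglongrightarrow> ennreal (1 / (2 * Re B) - 1 / (2 * Re B))"
    using gaussian_laguerre_sums[OF assms] unfolding sums_def
    by (intro tendsto_ennrealI tendsto_intros)
  then show ?thesis unfolding eq by simp
qed

text \<open>
  The positive and the negative part of \<open>g\<close> have the same integral. Normalised, they are the
  densities of two probability measures with the same characteristic function, which coincide by
  Levy's uniqueness theorem.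
\<close>

lemma fourier_zero_imp_AE_zero:
  fixes g :: "real \<Rightarrow> real"
  assumes M: "sets M = sets borel" and g: "integrable M g"
    and zero: "\<And>t. (\<integral>s. of_real (g s) * iexp (t * s) \<partial>M) = 0"
  shows "AE s in M. g s = 0"
proof -
  note [measurable_cong] = M
  have [measurable]: "g \<in> borel_measurable borel"
    using borel_measurable_integrable[OF g] by (simp add: measurable_cong_sets[OF M refl])
  define c where "c = (\<integral>s. max 0 (g s) \<partial>M)"
  have ip: "integrable M (\<lambda>s. max 0 (g s))" and im: "integrable M (\<lambda>s. max 0 (- g s))"
    using g by auto
  have g0: "(\<integral>s. g s \<partial>M) = 0"
  proof -
    have "complex_of_real (\<integral>s. g s \<partial>M) = 0"
      using zero[of 0] by (simp flip: integral_complex_of_real)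
    then show ?thesis by simp
  qed
  have cm: "c = (\<integral>s. max 0 (- g s) \<partial>M)"
  proof -
    have "(\<integral>s. max 0 (g s) \<partial>M) - (\<integral>s. max 0 (- g s) \<partial>M) = (\<integral>s. max 0 (g s) - max 0 (- g s) \<partial>M)"
      using ip im by simp
    also have "\<dots> = (\<integral>s. g s \<partial>M)" by (intro Bochner_Integration.integral_cong) auto
    finally show ?thesis using g0 by (simp add: c_def)
  qed
  have c0: "0 \<le> c" unfolding c_def by simp
  show ?thesis
  proof (cases "c = 0")
    case True
    have "AE s in M. max 0 (g s) = 0"
      using True ip by (subst integral_nonneg_eq_0_iff_AE[symmetric]) (auto simp: c_def)
    moreover have "AE s in M. max 0 (- g s) = 0"
      using True im cm by (subst integral_nonneg_eq_0_iff_AE[symmetric]) auto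
    ultimately show ?thesis by eventually_elim auto
  next
    case False
    with c0 have c: "0 < c" by simp
    define P where "P h = density M (\<lambda>s. ennreal (max 0 (h s) / c))" for h
    have P: "real_distribution (P h)" if [measurable]: "h \<in> borel_measurable borel"
      and "integrable M (\<lambda>s. max 0 (h s))" "c = (\<integral>s. max 0 (h s) \<partial>M)" for h
    proof -
      have "emeasure (P h) (space (P h)) = (\<integral>\<^sup>+ s. ennreal (max 0 (h s) / c) \<partial>M)"
        unfolding P_def by (simp add: emeasure_density)
      also have "\<dots> = ennreal (\<integral>s. max 0 (h s) / c \<partial>M)"
        using c that by (intro nn_integral_eq_integral) auto
      also have "\<dots> = 1" using c that(3) by simp
      finally have "emeasure (P h) (space (P h)) = 1" .
      then show ?thesis
        by (auto simp: real_distribution_def real_distribution_axioms_def P_def M intro!: prob_spaceI)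
    qed
    have ch: "char (P h) t = (\<integral>s. of_real (max 0 (h s) / c) * iexp (t * s) \<partial>M)"
      if [measurable]: "h \<in> borel_measurable borel" for h t
      unfolding char_def P_def using c
      by (subst integral_density) (auto simp: scaleR_conv_of_real)
    have ii: "integrable M (\<lambda>s. of_real (max 0 (h s) / c) * iexp (t * s))"
      if [measurable]: "h \<in> borel_measurable borel" and "integrable M (\<lambda>s. max 0 (h s))" for h t
      by (rule Bochner_Integration.integrable_bound[of M "\<lambda>s. max 0 (h s) / c"])
         (use that c in \<open>auto simp: norm_mult norm_divide simp del: of_real_mult of_real_divide\<close>)
    have "char (P g) = char (P (\<lambda>s. - g s))"
    proof
      fix t
      have "char (P g) t - char (P (\<lambda>s. - g s)) t
          = (\<integral>s. of_real (max 0 (g s) / c) * iexp (t * s) - of_real (max 0 (- g s) / c) * iexp (t * s) \<partial>M)"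
        unfolding ch[OF \<open>g \<in> borel_measurable borel\<close>] ch[OF borel_measurable_uminus[OF \<open>g \<in> borel_measurable borel\<close>]]
        by (rule Bochner_Integration.integral_diff[symmetric]; rule ii) (use ip im in auto)
      also have "\<dots> = (\<integral>s. of_real (g s) * iexp (t * s) * of_real (1 / c) \<partial>M)"
        by (intro Bochner_Integration.integral_cong refl) (auto simp: max_def field_simps)
      also have "\<dots> = 0" using zero[of t] by (simp del: of_real_divide)
      finally show "char (P g) t = char (P (\<lambda>s. - g s)) t" by simp
    qed
    then have "P g = P (\<lambda>s. - g s)"
      using P[of g] P[of "\<lambda>s. - g s"] ip im cm by (intro Levy_uniqueness) (auto simp: c_def)
    then have "AE s in M. ennreal (max 0 (g s) / c) = ennreal (max 0 (- g s) / c)"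
      unfolding P_def
    proof (subst (asm) finite_density_unique)
      have "(\<integral>\<^sup>+ s. ennreal (max 0 (g s) / c) \<partial>M) = ennreal (\<integral>s. max 0 (g s) / c \<partial>M)"
        using c ip by (intro nn_integral_eq_integral) auto
      then show "(\<integral>\<^sup>+ s. ennreal (max 0 (g s) / c) \<partial>M) \<noteq> \<infinity>" by simp
    qed auto
    then show ?thesis
    proof eventually_elim
      case (elim s)
      then have "max 0 (g s) / c = max 0 (- g s) / c" using c by (subst (asm) ennreal_inj) auto
      then show ?case using c by (auto simp: max_def split: if_splits)
    qed
  qed
qed

text \<open>
  A function \<open>w\<close> orthogonal to all Laguerre functions is orthogonal to all decaying exponentials, as
  these are limits of combinations of Laguerre functions. So its Laplace transform vanishes on the
  right half-plane, and on the line \<open>Re B = 1\<close> the Laplace transform is the Fourier transform of the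
  integrable function \<open>w(s) e\<^bsup>-s\<^esup>\<close>.
\<close>

theorem lagfun_total:
  assumes [measurable]: "w \<in> borel_measurable borel" and fin: "nsq half w < top"
    and zero: "\<And>n. (\<integral>s. w s * lagfun n s \<partial>half) = 0"
  shows "AE s in half. w s = 0"
proof -
  have m[measurable]: "(\<lambda>s. exp (- (B * complex_of_real s))) \<in> borel_measurable borel" for B
    by (intro borel_measurable_continuous_onI continuous_intros)
  \<comment> \<open>Orthogonality passes from the partial sums of the exponential to the exponential itself.\<close>
  have ez: "(\<integral>s. w s * exp (- (B * of_real s)) \<partial>half) = 0" if "0 < Re B" for B
  proof (rule LIMSEQ_unique[OF _ tendsto_const])
    let ?F = "\<lambda>K s. \<Sum>n<K. (1 / (B + 1/2) * ((B - 1/2) / (B + 1/2)) ^ n) * lagfun n s"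
    have "(\<lambda>K. \<integral>s. ?F K s * w s \<partial>half) \<longlonglongrightarrow> (\<integral>s. exp (- (B * of_real s)) * w s \<partial>half)"
    proof (rule tendsto_integral_mult_nsq)
      show "(\<lambda>K. nsq half (\<lambda>s. ?F K s - exp (- (B * of_real s)))) \<longlonglongrightarrow> 0"
        using gaussian_laguerre_expansion[OF that] by (subst nsq_diff_commute)
      show "nsq half (?F K) < top" for K
        by (intro nsq_sum_finite nsq_cmult_finite nsq_lagfun_finite) auto
      show "nsq half (\<lambda>s. exp (- (B * of_real s))) < top"
        using that by (simp add: nsq_exp)
    qed (use fin in auto)
    moreover have "(\<integral>s. ?F K s * w s \<partial>half) = 0" for K
    proof -
      have "integrable half (\<lambda>s. c * (w s * lagfun n s))" for n c
        by (intro integrable_mult_right integrable_mult_nsq) (auto simp: fin nsq_lagfun_finite)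
      then have "(\<integral>s. (\<Sum>n<K. (1 / (B + 1/2) * ((B - 1/2) / (B + 1/2)) ^ n) * (w s * lagfun n s)) \<partial>half) = 0"
        by (subst Bochner_Integration.integral_sum) (auto simp: zero)
      also have "(\<lambda>s. \<Sum>n<K. (1 / (B + 1/2) * ((B - 1/2) / (B + 1/2)) ^ n) * (w s * lagfun n s)) = (\<lambda>s. ?F K s * w s)"
        unfolding sum_distrib_right by (intro ext sum.cong refl) (simp only: mult_ac)
      finally show ?thesis .
    qed
    ultimately show "(\<lambda>K. 0) \<longlonglongrightarrow> (\<integral>s. w s * exp (- (B * of_real s)) \<partial>half)"
      by (simp add: mult.commute)
  qed
  \<comment> \<open>The factor \<open>e\<^bsup>-s\<^esup>\<close> makes the square integrable \<open>w\<close> integrable; the values of the Laplace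
    transform at \<open>B = 1 - \<i>t\<close> give the Fourier transform of \<open>g\<close>.\<close>
  define g where "g s = w s * exp (- (1 * of_real s))" for s :: real
  have [measurable]: "g \<in> borel_measurable borel" unfolding g_def by measurable
  have gi: "integrable half g" unfolding g_def
    by (rule integrable_mult_nsq) (use fin nsq_exp_poly_finite[of 1 1] in auto)
  have gz: "(\<integral>s. g s * iexp (t * s) \<partial>half) = 0" for t
  proof -
    have "g s * iexp (t * s) = w s * exp (- ((1 - \<i> * of_real t) * of_real s))" for s
    proof -
      have "- (1 * of_real s) + \<i> * of_real (t * s) = - ((1 - \<i> * of_real t) * complex_of_real s)"
        by (simp add: algebra_simps)
      then show ?thesis unfolding g_def mult.assoc exp_add[symmetric] by simp
    qed
    then show ?thesis using ez[of "1 - \<i> * of_real t"] by simp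
  qed
  have gi': "integrable half (\<lambda>s. g s * iexp (t * s))" for t
    by (rule Bochner_Integration.integrable_bound[OF gi]) (auto simp: norm_mult)
  have gcz: "(\<integral>s. cnj (g s) * iexp (t * s) \<partial>half) = 0" for t
  proof -
    have "(\<integral>s. cnj (g s) * iexp (t * s) \<partial>half) = (\<integral>s. cnj (g s * iexp (- t * s)) \<partial>half)"
      by (simp add: exp_cnj)
    also have "\<dots> = cnj (\<integral>s. g s * iexp (- t * s) \<partial>half)" by (rule Bochner_Integration.integral_cnj)
    also have "\<dots> = 0" using gz[of "- t"] by simp
    finally show ?thesis .
  qed
  have gci': "integrable half (\<lambda>s. cnj (g s) * iexp (t * s))" for t
    by (rule Bochner_Integration.integrable_bound[OF gi]) (auto simp: norm_mult)
  \<comment> \<open>The frequencies \<open>t\<close> and \<open>- t\<close> together give the transforms of the real and imaginary parts.\<close>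
  have re: "(\<integral>s. of_real (Re (g s)) * iexp (t * s) \<partial>half) = 0" for t
  proof -
    have "of_real (Re (g s)) * iexp (t * s) = (g s * iexp (t * s) + cnj (g s) * iexp (t * s)) / 2" for s
      by (simp add: complex_add_cnj flip: distrib_right)
    then have "(\<integral>s. of_real (Re (g s)) * iexp (t * s) \<partial>half)
        = ((\<integral>s. g s * iexp (t * s) \<partial>half) + (\<integral>s. cnj (g s) * iexp (t * s) \<partial>half)) / 2"
      using Bochner_Integration.integral_add[OF gi'[of t] gci'[of t]] by (simp only: integral_divide_zero)
    then show ?thesis unfolding gz gcz by simp
  qed
  have im: "(\<integral>s. of_real (Im (g s)) * iexp (t * s) \<partial>half) = 0" for t
  proof -
    have "of_real (Im (g s)) * iexp (t * s) = (g s * iexp (t * s) - cnj (g s) * iexp (t * s)) / (2 * \<i>)" for s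
    proof -
      have "of_real (Im z) * e = (z * e - cnj z * e) / (2 * \<i>)" for z e
      proof -
        have "of_real (Im z) * e * (2 * \<i>) = z * e - cnj z * e"
          by (simp add: complex_eq_iff algebra_simps)
        then show ?thesis by (subst nonzero_eq_divide_eq) simp_all
      qed
      then show ?thesis .
    qed
    then have "(\<integral>s. of_real (Im (g s)) * iexp (t * s) \<partial>half)
        = ((\<integral>s. g s * iexp (t * s) \<partial>half) - (\<integral>s. cnj (g s) * iexp (t * s) \<partial>half)) / (2 * \<i>)"
      using Bochner_Integration.integral_diff[OF gi'[of t] gci'[of t]] by (simp only: integral_divide_zero)
    then show ?thesis unfolding gz gcz by simp
  qed
  have "AE s in half. Re (g s) = 0"
    by (rule fourier_zero_imp_AE_zero[OF sets_half]) (use gi re in auto)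
  moreover have "AE s in half. Im (g s) = 0"
    by (rule fourier_zero_imp_AE_zero[OF sets_half]) (use gi im in auto)
  ultimately show ?thesis
  proof eventually_elim
    case (elim s)
    then have "g s = 0" by (simp add: complex_eq_iff)
    then show ?case by (simp add: g_def)
  qed
qed

section \<open>Radial functions in the plane\<close>

abbreviation plane :: "(real ^ 2) measure" where "plane \<equiv> lborel"

lemma emeasure_norm_sq_le:
  "emeasure plane {x. (norm x)\<^sup>2 \<le> b} = ennreal (pi * max 0 b)"
proof (cases "0 \<le> b")
  case True
  have "{x::real^2. (norm x)\<^sup>2 \<le> b} = cball 0 (sqrt b)"
    using True by (auto simp: real_le_rsqrt sqrt_le_D real_sqrt_le_iff dest: real_le_rsqrt)
      (metis norm_ge_zero power_mono real_sqrt_pow2)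
  then show ?thesis
    using True by (simp add: emeasure_cball unit_ball_vol_2)
next
  case False
  then have "{x::real^2. (norm x)\<^sup>2 \<le> b} = {}"
    by (auto simp: not_le intro: less_le_trans)
  then show ?thesis using False by simp
qed

text \<open>
  A disc of squared radius \<open>b\<close> has area \<open>\<pi> b\<close>, and half-lines \<open>(-\<infinity>, b]\<close> determine a measure.
\<close>

lemma distr_norm_sq:
  "distr plane borel (\<lambda>x. (norm x)\<^sup>2) = density half (\<lambda>_. ennreal pi)"
proof (rule measure_eqI_generator_eq[where E = "range atMost" and \<Omega> = UNIV and A = "\<lambda>i. {..real i}"])
  show "Int_stable (range atMost :: real set set)"
    by (auto simp: Int_stable_def)
  have b: "sigma_sets UNIV (range atMost) = sets (borel :: real measure)"
    unfolding borel_eq_atMost by simp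
  show "sets (distr plane borel (\<lambda>x. (norm x)\<^sup>2)) = sigma_sets UNIV (range atMost)"
    "sets (density half (\<lambda>_. ennreal pi)) = sigma_sets UNIV (range atMost)"
    unfolding b by simp_all
  have d: "emeasure (distr plane borel (\<lambda>x. (norm x)\<^sup>2)) {..b} = ennreal (pi * max 0 b)" for b
    using emeasure_norm_sq_le[of b] by (simp add: emeasure_distr vimage_def)
  have h: "emeasure (density half (\<lambda>_. ennreal pi)) {..b} = ennreal (pi * max 0 b)" for b
  proof -
    have "emeasure (density half (\<lambda>_. ennreal pi)) {..b} = (\<integral>\<^sup>+ s. ennreal pi * indicator {..b} s \<partial>half)"
      by (simp add: emeasure_density)
    also have "\<dots> = ennreal pi * (\<integral>\<^sup>+ s. indicator {..b} s \<partial>half)"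
      by (simp add: nn_integral_cmult)
    also have "(\<integral>\<^sup>+ s. indicator {..b} s \<partial>half) = (\<integral>\<^sup>+ s. indicator {0..b} s \<partial>lborel)"
    proof -
      have "indicator {..b} s * indicator {0..} s = (indicator {0..b} s :: ennreal)" for s
        by (auto split: split_indicator)
      then show ?thesis by (subst nn_integral_half) simp_all
    qed
    also have "\<dots> = ennreal (max 0 b)" by (simp add: max_def)
    finally show ?thesis by (simp add: ennreal_mult)
  qed
  fix X assume "X \<in> range (atMost :: real \<Rightarrow> real set)"
  then show "emeasure (distr plane borel (\<lambda>x. (norm x)\<^sup>2)) X = emeasure (density half (\<lambda>_. ennreal pi)) X"
    using d h by auto
next
  show "(\<Union>i. {..real i}) = UNIV"
    by (auto intro: real_arch_simple)
  show "emeasure (distr plane borel (\<lambda>x. (norm x)\<^sup>2)) {..real i} \<noteq> \<infinity>" for i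
    using emeasure_norm_sq_le[of "real i"] by (simp add: emeasure_distr vimage_def)
qed auto

lemma nn_integral_norm_sq:
  assumes [measurable]: "F \<in> borel_measurable borel"
  shows "(\<integral>\<^sup>+ x. F ((norm x)\<^sup>2) \<partial>plane) = ennreal pi * (\<integral>\<^sup>+ s. F s \<partial>half)"
proof -
  have "(\<integral>\<^sup>+ x. F ((norm x)\<^sup>2) \<partial>plane) = (\<integral>\<^sup>+ s. F s \<partial>distr plane borel (\<lambda>x. (norm x)\<^sup>2))"
    by (simp add: nn_integral_distr)
  also have "\<dots> = ennreal pi * (\<integral>\<^sup>+ s. F s \<partial>half)"
    unfolding distr_norm_sq by (simp add: nn_integral_density nn_integral_cmult)
  finally show ?thesis .
qed

lemma nsq_norm_sq:
  assumes [measurable]: "F \<in> borel_measurable borel"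
  shows "nsq plane (\<lambda>x. F ((norm x)\<^sup>2)) = ennreal pi * nsq half F"
  unfolding nsq_def by (rule nn_integral_norm_sq) simp

lemma AE_norm_sq:
  assumes "AE s in half. P s"
  shows "AE x in plane. P ((norm x)\<^sup>2)"
proof -
  obtain N where N: "{s. \<not> P s} \<subseteq> N" "emeasure half N = 0" "N \<in> sets half"
    using AE_E[OF assms] by auto
  then have [measurable]: "N \<in> sets borel" by simp
  have "(\<integral>\<^sup>+ x. indicator N ((norm x)\<^sup>2) \<partial>plane) = ennreal pi * (\<integral>\<^sup>+ s. indicator N s \<partial>half)"
    by (rule nn_integral_norm_sq) simp
  also have "\<dots> = 0" using N by simp
  finally have "AE x in plane. (indicator N ((norm x)\<^sup>2) :: ennreal) = 0"
    by (subst (asm) nn_integral_0_iff_AE) auto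
  then show ?thesis
    by (rule eventually_mono) (use N(1) in \<open>auto simp: indicator_def split: if_splits\<close>)
qed

lemma AE_half_if_AE_norm_sq:
  assumes [measurable]: "Measurable.pred borel P" and "AE x in plane. P ((norm x)\<^sup>2)"
  shows "AE s in half. P s"
proof -
  have "ennreal pi * (\<integral>\<^sup>+ s. indicator {s. \<not> P s} s \<partial>half) = (\<integral>\<^sup>+ x. indicator {s. \<not> P s} ((norm x)\<^sup>2) \<partial>plane)"
    by (rule nn_integral_norm_sq[symmetric]) simp
  also have "\<dots> = 0"
    using assms(2) by (subst nn_integral_0_iff_AE) (auto simp: indicator_def)
  finally have "(\<integral>\<^sup>+ s. indicator {s. \<not> P s} s \<partial>half) = 0" by simp
  then have "AE s in half. indicator {s. \<not> P s} s = (0::ennreal)"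
    by (subst (asm) nn_integral_0_iff_AE) auto
  then show ?thesis by eventually_elim (auto simp: indicator_def split: if_splits)
qed

lemma nn_integral_half_scale:
  assumes [measurable]: "F \<in> borel_measurable borel" and c: "0 < c"
  shows "(\<integral>\<^sup>+ s. F (s / c) \<partial>half) = ennreal c * (\<integral>\<^sup>+ s. F s \<partial>half)"
proof -
  have "(\<integral>\<^sup>+ s. F (s / c) \<partial>half) = (\<integral>\<^sup>+ s. F (s / c) * indicator {0..} s \<partial>lborel)"
    by (rule nn_integral_half) simp
  also have "\<dots> = ennreal \<bar>c\<bar> * (\<integral>\<^sup>+ s. F ((0 + c * s) / c) * indicator {0..} (0 + c * s) \<partial>lborel)"
    using c by (intro nn_integral_real_affine) auto
  also have "\<dots> = ennreal c * (\<integral>\<^sup>+ s. F s \<partial>half)"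
    using c by (simp add: nn_integral_half indicator_def zero_le_mult_iff)
  finally show ?thesis .
qed

lemma AE_half_scale:
  assumes "AE s in half. P s" and c: "0 < c"
  shows "AE s in half. P (s / c)"
proof -
  obtain N where N: "{s. \<not> P s} \<subseteq> N" "emeasure half N = 0" "N \<in> sets half"
    using AE_E[OF assms(1)] by auto
  then have [measurable]: "N \<in> sets borel" by simp
  have "(\<integral>\<^sup>+ s. indicator N (s / c) \<partial>half) = ennreal c * (\<integral>\<^sup>+ s. indicator N s \<partial>half)"
    by (rule nn_integral_half_scale[OF _ c]) simp
  also have "\<dots> = 0" using N by simp
  finally have "AE s in half. (indicator N (s / c) :: ennreal) = 0"
    by (subst (asm) nn_integral_0_iff_AE) auto
  then show ?thesis
    by (rule eventually_mono) (use N(1) in \<open>auto simp: indicator_def split: if_splits\<close>)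
qed

lemma AE_lborel_scaleR:
  fixes P :: "'a::euclidean_space \<Rightarrow> bool"
  assumes "AE x in lborel. P x" "c \<noteq> 0"
  shows "AE x in lborel. P (c *\<^sub>R x)"
proof -
  obtain N where N: "{x. \<not> P x} \<subseteq> N" "emeasure lborel N = 0" "N \<in> sets lborel"
    using AE_E[OF assms(1)] by auto
  have "AE x in lborel. x \<notin> N" using N by (intro AE_not_in null_setsI)
  then have "AE x in density (distr lborel borel (\<lambda>x. 0 + c *\<^sub>R x)) (\<lambda>_. ennreal (\<bar>c\<bar> ^ DIM('a))). x \<notin> N"
    by (subst lborel_affine[OF assms(2), of "0::'a", symmetric])
  then have "AE x in distr lborel borel (\<lambda>x. 0 + c *\<^sub>R x :: 'a). x \<notin> N"
    using assms(2) by (simp add: AE_density)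
  then have "AE x in distr lborel borel (\<lambda>x. c *\<^sub>R x :: 'a). x \<notin> N"
    by (simp only: add_0)
  then have "AE x in lborel. c *\<^sub>R x \<notin> N"
    by (rule AE_distrD[rotated]) simp
  then show ?thesis by (rule eventually_mono) (use N(1) in auto)
qed

lemma borel_representative_complex:
  fixes f :: "'a \<Rightarrow> complex"
  assumes [measurable]: "f \<in> borel_measurable (completion M)"
  obtains g where "g \<in> borel_measurable M" "AE x in M. f x = g x"
proof -
  obtain r where r: "r \<in> borel_measurable M" "AE x in M. Re (f x) = r x"
    using completion_ex_borel_measurable_real[of "\<lambda>x. Re (f x)" M] by auto
  obtain i where i: "i \<in> borel_measurable M" "AE x in M. Im (f x) = i x"
    using completion_ex_borel_measurable_real[of "\<lambda>x. Im (f x)" M] by auto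
  show thesis
  proof (rule that[of "\<lambda>x. Complex (r x) (i x)"])
    show "(\<lambda>x. Complex (r x) (i x)) \<in> borel_measurable M"
      using r(1) i(1) by (subst borel_measurable_complex_iff) simp
    show "AE x in M. f x = Complex (r x) (i x)"
      using r(2) i(2) by eventually_elim (simp add: complex_eq_iff)
  qed
qed

text \<open>
  The profile \<open>g\<close> given by radiality need not be measurable, so the values of a Borel version of \<open>f\<close>
  on one ray are taken instead. By Fubini's theorem for \<open>(s, y) \<mapsto> \<surd>s y\<close> there is a ray that meets
  the exceptional null set in a null set only, and along it \<open>g\<close> agrees almost everywhere with a
  Borel function.
\<close>

theorem radial_profile:
  fixes f :: "real ^ 2 \<Rightarrow> complex"
  assumes "f \<in> borel_measurable lebesgue" "radial f"
  obtains H where "H \<in> borel_measurable borel" "AE x in plane. f x = H ((norm x)\<^sup>2)"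
proof -
  obtain f0 where "f0 \<in> borel_measurable plane" and f0: "AE x in plane. f x = f0 x"
    using borel_representative_complex[OF assms(1)] by blast
  then have [measurable]: "f0 \<in> borel_measurable borel" by simp
  obtain g where "AE x in lebesgue. f x = g (norm x)"
    using assms(2) unfolding radial_def by blast
  then have "AE x in plane. f x = g (norm x)" by (simp add: AE_completion_iff)
  with f0 have fg: "AE x in plane. f0 x = g (norm x)" by eventually_elim simp
  obtain Z where Z: "{x. \<not> f0 x = g (norm x)} \<subseteq> Z" "emeasure plane Z = 0" "Z \<in> sets plane"
    using AE_E[OF fg] by auto
  have [measurable]: "Z \<in> sets borel" using Z by simp
  have aeZ: "AE x in plane. x \<notin> Z" using Z by (intro AE_not_in null_setsI)
  interpret half: sigma_finite_measure half by (rule sigma_finite_half)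
  interpret hp: pair_sigma_finite half plane ..
  have "AE s in half. AE y in plane. sqrt s *\<^sub>R y \<notin> Z"
  proof -
    have "AE s in half. s \<noteq> 0 \<and> 0 \<le> s"
      unfolding AE_half using AE_lborel_singleton[of "0::real"] by eventually_elim auto
    then show ?thesis
      by eventually_elim (auto intro!: AE_lborel_scaleR[OF aeZ])
  qed
  then have "AE y in plane. AE s in half. sqrt s *\<^sub>R y \<notin> Z"
    by (subst (asm) hp.AE_commute) (measurable)
  moreover have "AE y in plane. y \<noteq> 0" by (rule AE_lborel_singleton)
  ultimately have "AE y in plane. y \<noteq> 0 \<and> (AE s in half. sqrt s *\<^sub>R y \<notin> Z)"
    by eventually_elim simp
  then have "\<exists>y::real^2. y \<noteq> 0 \<and> (AE s in half. sqrt s *\<^sub>R y \<notin> Z)"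
    by (rule eventually_happens'[rotated]) (simp add: ae_filter_eq_bot_iff)
  then obtain y :: "real^2" where y: "y \<noteq> 0" "AE s in half. sqrt s *\<^sub>R y \<notin> Z" by blast
  \<comment> \<open>The point of the ray through \<open>y\<close> whose squared norm is \<open>s\<close>.\<close>
  define H where "H s = f0 (sqrt (s / (norm y)\<^sup>2) *\<^sub>R y)" for s
  have "AE s in half. sqrt (s / (norm y)\<^sup>2) *\<^sub>R y \<notin> Z"
    using y by (intro AE_half_scale) auto
  from AE_norm_sq[OF this] aeZ f0 have "AE x in plane. f x = H ((norm x)\<^sup>2)"
  proof eventually_elim
    case (elim x)
    have n: "norm (sqrt ((norm x)\<^sup>2 / (norm y)\<^sup>2) *\<^sub>R y) = norm x"
      using y(1) by (simp add: real_sqrt_divide)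
    have "f0 (sqrt ((norm x)\<^sup>2 / (norm y)\<^sup>2) *\<^sub>R y) = g (norm (sqrt ((norm x)\<^sup>2 / (norm y)\<^sup>2) *\<^sub>R y))"
      using elim(1) Z(1) by blast
    then have "H ((norm x)\<^sup>2) = g (norm x)"
      unfolding n H_def .
    with elim Z(1) show ?case by auto
  qed
  moreover have "H \<in> borel_measurable borel" unfolding H_def by measurable
  ultimately show thesis by (rule that[rotated])
qed

section \<open>Smooth bumps\<close>

lemma DERIV_max_power:
  "((\<lambda>s::real. (max 0 s) ^ Suc (Suc n)) has_real_derivative real (Suc (Suc n)) * (max 0 s) ^ Suc n) (at s)"
proof -
  consider "s < 0" | "s > 0" | "s = 0" by linarith
  then show ?thesis
  proof cases
    case 1
    have "((\<lambda>s::real. 0) has_real_derivative 0) (at s)" by simp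
    then have "((\<lambda>s::real. (max 0 s) ^ Suc (Suc n)) has_real_derivative 0) (at s)"
      by (rule has_field_derivative_transform_within_open[where S = "{..<0}"]) (use 1 in auto)
    then show ?thesis using 1 by simp
  next
    case 2
    have "((\<lambda>s::real. s ^ Suc (Suc n)) has_real_derivative real (Suc (Suc n)) * s ^ Suc n) (at s)"
      using DERIV_pow[of "Suc (Suc n)" s] by simp
    then have "((\<lambda>s::real. (max 0 s) ^ Suc (Suc n)) has_real_derivative real (Suc (Suc n)) * s ^ Suc n) (at s)"
      by (rule has_field_derivative_transform_within_open[where S = "{0<..}"]) (use 2 in auto)
    then show ?thesis using 2 by (simp add: max_def)
  next
    case 3
    have "((\<lambda>h::real. (max 0 h) ^ Suc (Suc n) / h) \<longlongrightarrow> 0) (at 0)"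
    proof (rule tendsto_rabs_zero_cancel, rule tendsto_sandwich[where f = "\<lambda>_. 0" and h = "\<lambda>h. \<bar>h\<bar> ^ Suc n"])
      show "\<forall>\<^sub>F h::real in at 0. \<bar>(max 0 h) ^ Suc (Suc n) / h\<bar> \<le> \<bar>h\<bar> ^ Suc n"
      proof (intro always_eventually allI)
        fix h :: real
        show "\<bar>(max 0 h) ^ Suc (Suc n) / h\<bar> \<le> \<bar>h\<bar> ^ Suc n"
        proof (cases "h > 0")
          case True
          then show ?thesis by (simp add: max_absorb2 abs_mult)
        next
          case False
          then have "(max 0 h) ^ Suc (Suc n) / h = 0" by (simp add: max_absorb1)
          then show ?thesis by (simp only: abs_zero zero_le_power abs_ge_zero)
        qed
      qed
      have "((\<lambda>h::real. \<bar>h\<bar> ^ Suc n) \<longlongrightarrow> \<bar>0\<bar> ^ Suc n) (at 0)" by (intro tendsto_intros)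
      then show "((\<lambda>h::real. \<bar>h\<bar> ^ Suc n) \<longlongrightarrow> 0) (at 0)" by simp
    qed simp_all
    then show ?thesis using 3 by (simp add: DERIV_def)
  qed
qed

text \<open>
  The cube is the lowest power of the positive part that is twice continuously differentiable. The
  derivatives stay elementary, and the support is the ball of radius \<open>1/\<surd>k\<close>.
\<close>

definition bump :: "real \<Rightarrow> 'a::euclidean_space \<Rightarrow> real" where
  "bump k z = (max 0 (1 - k * (norm z)\<^sup>2)) ^ 3"

text \<open>
  The Laplacian of \<open>bump\<close>, as \<open>test_fun_bump\<close> shows.
\<close>

definition lap_bump :: "real \<Rightarrow> 'a::euclidean_space \<Rightarrow> real" where
  "lap_bump k z = 24 * k\<^sup>2 * (norm z)\<^sup>2 * max 0 (1 - k * (norm z)\<^sup>2)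
     - 6 * k * real DIM('a) * (max 0 (1 - k * (norm z)\<^sup>2))\<^sup>2"

lemma has_derivative_max_power:
  fixes c :: "'a::euclidean_space"
  shows "((\<lambda>y. (max 0 (1 - k * (norm (y - c))\<^sup>2)) ^ Suc (Suc n)) has_derivative
     (\<lambda>h. real (Suc (Suc n)) * (max 0 (1 - k * (norm (y - c))\<^sup>2)) ^ Suc n * (- 2 * k * ((y - c) \<bullet> h)))) (at y)"
proof -
  have g: "((\<lambda>y. 1 - k * ((y - c) \<bullet> (y - c))) has_derivative (\<lambda>h. - 2 * k * ((y - c) \<bullet> h))) (at y)"
    by (auto intro!: derivative_eq_intros simp: inner_commute algebra_simps)
  have "((\<lambda>y. (max 0 (1 - k * ((y - c) \<bullet> (y - c)))) ^ Suc (Suc n)) has_derivative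
     (\<lambda>h. (real (Suc (Suc n)) * (max 0 (1 - k * ((y - c) \<bullet> (y - c)))) ^ Suc n) * (- 2 * k * ((y - c) \<bullet> h)))) (at y)"
    using has_derivative_compose[OF g has_field_derivative_imp_has_derivative[OF DERIV_max_power[of n "1 - k * ((y - c) \<bullet> (y - c))"]]]
    by simp
  then show ?thesis by (simp only: power2_norm_eq_inner)
qed

lemma frechet_derivativeI:
  "(f has_derivative D) (at x) \<Longrightarrow> frechet_derivative f (at x) v = D v"
  by (metis frechet_derivative_at)

lemma C1_funI:
  assumes "\<And>x. (\<phi> has_derivative D x) (at x)" "\<And>v. continuous_on UNIV (\<lambda>x. D x v)"
  shows "C1_fun \<phi>"
  unfolding C1_fun_def
  using assms frechet_derivativeI[OF assms(1)] by (auto simp: differentiable_def)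

lemma bump_derivative:
  fixes c :: "'a::euclidean_space"
  shows "((\<lambda>y. complex_of_real (bump k (y - c))) has_derivative
    (\<lambda>h. of_real (- 6 * k * (max 0 (1 - k * (norm (y - c))\<^sup>2))\<^sup>2 * ((y - c) \<bullet> h)))) (at y)"
  unfolding bump_def
  using has_derivative_max_power[of k c 1 y]
  by (intro has_derivative_of_real) (simp add: numeral_3_eq_3 numeral_2_eq_2 algebra_simps)

lemma bump_derivative2:
  fixes c :: "'a::euclidean_space"
  shows "((\<lambda>y. complex_of_real (- 6 * k * (max 0 (1 - k * (norm (y - c))\<^sup>2))\<^sup>2 * ((y - c) \<bullet> v))) has_derivative
    (\<lambda>h. of_real (24 * k\<^sup>2 * max 0 (1 - k * (norm (y - c))\<^sup>2) * ((y - c) \<bullet> h) * ((y - c) \<bullet> v)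
      - 6 * k * (max 0 (1 - k * (norm (y - c))\<^sup>2))\<^sup>2 * (h \<bullet> v)))) (at y)"
proof (rule has_derivative_of_real)
  have 1: "((\<lambda>y. (max 0 (1 - k * (norm (y - c))\<^sup>2))\<^sup>2) has_derivative
     (\<lambda>h. - 4 * k * max 0 (1 - k * (norm (y - c))\<^sup>2) * ((y - c) \<bullet> h))) (at y)"
    using has_derivative_max_power[of k c 0 y] by (simp add: numeral_2_eq_2 algebra_simps)
  have 2: "((\<lambda>y. (y - c) \<bullet> v) has_derivative (\<lambda>h. h \<bullet> v)) (at y)"
    by (auto intro!: derivative_eq_intros)
  show "((\<lambda>y. - 6 * k * (max 0 (1 - k * (norm (y - c))\<^sup>2))\<^sup>2 * ((y - c) \<bullet> v)) has_derivative
    (\<lambda>h. 24 * k\<^sup>2 * max 0 (1 - k * (norm (y - c))\<^sup>2) * ((y - c) \<bullet> h) * ((y - c) \<bullet> v)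
      - 6 * k * (max 0 (1 - k * (norm (y - c))\<^sup>2))\<^sup>2 * (h \<bullet> v))) (at y)"
    using has_derivative_mult_right[OF has_derivative_mult[OF 1 2], of "- 6 * k"]
    by (simp add: algebra_simps power2_eq_square)
qed

lemma test_fun_bump:
  fixes c :: "'a::euclidean_space"
  assumes "0 < k"
  shows "test_fun (\<lambda>y. complex_of_real (bump k (y - c)))"
    and "laplacian (\<lambda>y. complex_of_real (bump k (y - c))) x = of_real (lap_bump k (x - c))"
proof -
  let ?f = "\<lambda>y. complex_of_real (bump k (y - c))"
  have fd: "(\<lambda>y. frechet_derivative ?f (at y) v) = (\<lambda>y. of_real (- 6 * k * (max 0 (1 - k * (norm (y - c))\<^sup>2))\<^sup>2 * ((y - c) \<bullet> v)))" for v
    by (rule ext, rule frechet_derivativeI[OF bump_derivative])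
  have "C2_fun ?f"
    unfolding C2_fun_def fd
    by (intro conjI allI C1_funI[OF bump_derivative] C1_funI[OF bump_derivative2])
       (intro continuous_intros)+
  moreover have "bounded {y. ?f y \<noteq> 0}"
  proof (rule bounded_subset[OF bounded_cball[of c "sqrt (1 / k)"]], safe)
    fix y assume "complex_of_real (bump k (y - c)) \<noteq> 0"
    then have "k * (norm (y - c))\<^sup>2 < 1" by (auto simp: bump_def max_def split: if_splits)
    then have "(norm (y - c))\<^sup>2 \<le> 1 / k" using assms by (simp add: field_simps)
    then show "y \<in> cball c (sqrt (1 / k))"
      by (simp add: dist_norm norm_minus_commute real_le_rsqrt)
  qed
  ultimately show "test_fun ?f" by (simp add: test_fun_def compact_closure)
  have "laplacian ?f x = (\<Sum>b\<in>Basis. of_real (24 * k\<^sup>2 * max 0 (1 - k * (norm (x - c))\<^sup>2) * ((x - c) \<bullet> b) * ((x - c) \<bullet> b)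
      - 6 * k * (max 0 (1 - k * (norm (x - c))\<^sup>2))\<^sup>2 * (b \<bullet> b)))"
    unfolding laplacian_def fd by (intro sum.cong refl frechet_derivativeI[OF bump_derivative2])
  also have "\<dots> = of_real (24 * k\<^sup>2 * max 0 (1 - k * (norm (x - c))\<^sup>2) * (\<Sum>b\<in>Basis. ((x - c) \<bullet> b) * ((x - c) \<bullet> b))
      - 6 * k * (max 0 (1 - k * (norm (x - c))\<^sup>2))\<^sup>2 * (\<Sum>b\<in>Basis. (b::'a) \<bullet> b))"
    by (simp only: of_real_sum[symmetric] sum_subtractf sum_distrib_left mult.assoc)
  also have "(\<Sum>b\<in>Basis. ((x - c) \<bullet> b) * ((x - c) \<bullet> b)) = (norm (x - c))\<^sup>2"
    unfolding power2_norm_eq_inner by (rule euclidean_inner[symmetric])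
  also have "(\<Sum>b\<in>Basis. (b::'a) \<bullet> b) = real DIM('a)" by simp
  finally show "laplacian ?f x = of_real (lap_bump k (x - c))"
    by (simp add: lap_bump_def mult_ac)
qed

lemma bump_minus [simp]: "bump k (- z) = bump k z" and lap_bump_minus [simp]: "lap_bump k (- z) = lap_bump k z"
  by (simp_all add: bump_def lap_bump_def)

lemma bump_nonneg: "0 \<le> bump k z"
  by (simp add: bump_def)

lemma continuous_bump: "continuous_on UNIV (bump k)" and continuous_lap_bump: "continuous_on UNIV (lap_bump k)"
  unfolding bump_def[abs_def] lap_bump_def[abs_def] by (intro continuous_intros)+

lemma bump_eq_0: "1 \<le> k * (norm z)\<^sup>2 \<Longrightarrow> bump k z = 0" and lap_bump_eq_0: "1 \<le> k * (norm z)\<^sup>2 \<Longrightarrow> lap_bump k z = 0"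
  by (simp_all add: bump_def lap_bump_def)

text \<open>
  Evenness is what makes the product of two mollifications symmetric in \<open>mollify_product_real\<close>. The
  other two conditions make a kernel integrable and square integrable.
\<close>

definition even_kernel :: "('a::euclidean_space \<Rightarrow> real) \<Rightarrow> bool" where
  "even_kernel \<eta> \<longleftrightarrow> continuous_on UNIV \<eta> \<and> (\<forall>z. \<eta> (- z) = \<eta> z) \<and> (\<exists>R. \<forall>z. R \<le> norm z \<longrightarrow> \<eta> z = 0)"

lemma one_le_mult_norm_sq:
  assumes "0 < k" "sqrt (1 / k) \<le> norm z" shows "1 \<le> k * (norm z)\<^sup>2"
proof -
  have "1 / k \<le> (norm z)\<^sup>2" using assms by (metis real_sqrt_le_iff real_sqrt_abs abs_norm_cancel)
  then show ?thesis using assms by (simp add: field_simps)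
qed

lemma even_kernel_bump: "0 < k \<Longrightarrow> even_kernel (bump k)"
  unfolding even_kernel_def using continuous_bump
  by (auto intro!: exI[of _ "sqrt (1 / k)"] bump_eq_0 one_le_mult_norm_sq)

lemma even_kernel_lap_bump: "0 < k \<Longrightarrow> even_kernel (lap_bump k)"
  unfolding even_kernel_def using continuous_lap_bump
  by (auto intro!: exI[of _ "sqrt (1 / k)"] lap_bump_eq_0 one_le_mult_norm_sq)

lemma even_kernel_measurable: "even_kernel \<eta> \<Longrightarrow> \<eta> \<in> borel_measurable borel"
  unfolding even_kernel_def by (blast intro: borel_measurable_continuous_onI)

lemma even_kernel_flip: "even_kernel \<eta> \<Longrightarrow> \<eta> (x - y) = \<eta> (y - x)"
  unfolding even_kernel_def by (metis minus_diff_eq)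

lemma even_kernel_bounded:
  assumes "even_kernel \<eta>"
  obtains C R where "\<And>z. \<bar>\<eta> z\<bar> \<le> C * indicator (cball 0 R) z" "0 \<le> C"
proof -
  obtain R where R: "\<And>z. R \<le> norm z \<Longrightarrow> \<eta> z = 0"
    using assms unfolding even_kernel_def by blast
  have "compact (\<eta> ` cball 0 R)"
    using assms unfolding even_kernel_def
    by (intro compact_continuous_image) (auto intro: continuous_on_subset)
  then obtain C where C: "\<And>z. z \<in> cball 0 R \<Longrightarrow> \<bar>\<eta> z\<bar> \<le> C"
    using compact_imp_bounded bounded_iff by (metis image_eqI real_norm_def)
  show thesis
  proof (rule that[of "max 0 C" R])
    fix z show "\<bar>\<eta> z\<bar> \<le> max 0 C * indicator (cball 0 R) z"
      using C[of z] R[of z] by (auto simp: indicator_def)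
  qed simp
qed

lemma nn_integral_lborel_reflect:
  fixes f :: "'a::euclidean_space \<Rightarrow> ennreal"
  assumes [measurable]: "f \<in> borel_measurable borel"
  shows "(\<integral>\<^sup>+ x. f (t - x) \<partial>lborel) = (\<integral>\<^sup>+ x. f x \<partial>lborel)"
proof -
  have "(\<integral>\<^sup>+ x. f x \<partial>lborel) = (\<integral>\<^sup>+ x. f x \<partial>density (distr lborel borel (\<lambda>x. t + (- 1) *\<^sub>R x)) (\<lambda>_. ennreal (\<bar>- 1\<bar> ^ DIM('a))))"
    by (subst lborel_affine[of "- 1" t]) simp_all
  then show ?thesis by (simp add: nn_integral_density nn_integral_distr)
qed

lemma integral_lborel_reflect:
  fixes f :: "'a::euclidean_space \<Rightarrow> 'b::{banach, second_countable_topology}"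
  assumes [measurable]: "f \<in> borel_measurable borel"
  shows "(\<integral>x. f (t - x) \<partial>lborel) = (\<integral>x. f x \<partial>lborel)"
proof -
  have "(\<integral>x. f x \<partial>lborel) = (\<integral>x. f x \<partial>density (distr lborel borel (\<lambda>x. t + (- 1) *\<^sub>R x)) (\<lambda>_. ennreal (\<bar>- 1\<bar> ^ DIM('a))))"
    by (subst lborel_affine[of "- 1" t]) simp_all
  also have "\<dots> = (\<integral>x. f x \<partial>density (distr lborel borel (\<lambda>x. t + (- 1) *\<^sub>R x)) (\<lambda>_. ennreal 1))"
    by simp
  also have "\<dots> = (\<integral>x. f (t - x) \<partial>lborel)"
    by (subst integral_density) (simp_all add: integral_distr)
  finally show ?thesis by simp
qed

lemma even_kernel_integral_finite:
  assumes "even_kernel \<eta>"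
  shows "(\<integral>\<^sup>+ z. ennreal \<bar>\<eta> z\<bar> \<partial>lborel) < top" "nsq lborel (\<lambda>z. of_real (\<eta> (z - x))) < top"
    "(\<integral>\<^sup>+ y. ennreal \<bar>\<eta> (y - x)\<bar> \<partial>lborel) = (\<integral>\<^sup>+ z. ennreal \<bar>\<eta> z\<bar> \<partial>lborel)"
    "(\<integral>\<^sup>+ x. ennreal \<bar>\<eta> (y - x)\<bar> \<partial>lborel) = (\<integral>\<^sup>+ z. ennreal \<bar>\<eta> z\<bar> \<partial>lborel)"
proof -
  have [measurable]: "\<eta> \<in> borel_measurable borel" using assms by (rule even_kernel_measurable)
  obtain C R where C: "\<And>z. \<bar>\<eta> z\<bar> \<le> C * indicator (cball 0 R) z" "0 \<le> C"
    using even_kernel_bounded[OF assms] by blast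
  have "(\<integral>\<^sup>+ z. ennreal \<bar>\<eta> z\<bar> \<partial>lborel) \<le> (\<integral>\<^sup>+ (z::'a). ennreal C * indicator (cball 0 R) z \<partial>lborel)"
  proof (intro nn_integral_mono)
    fix z
    show "ennreal \<bar>\<eta> z\<bar> \<le> ennreal C * indicator (cball 0 R) z"
      using C(1)[of z] C(2) by (auto simp: indicator_def intro: ennreal_leI)
  qed
  also have "\<dots> < top"
    using emeasure_compact_finite[OF compact_cball[of "0::'a" R]]
    by (simp add: nn_integral_cmult_indicator ennreal_mult_less_top)
  finally show "(\<integral>\<^sup>+ z. ennreal \<bar>\<eta> z\<bar> \<partial>lborel) < top" .
  show y: "(\<integral>\<^sup>+ x. ennreal \<bar>\<eta> (y - x)\<bar> \<partial>lborel) = (\<integral>\<^sup>+ z. ennreal \<bar>\<eta> z\<bar> \<partial>lborel)" for y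
    by (rule nn_integral_lborel_reflect) simp
  then show "(\<integral>\<^sup>+ y. ennreal \<bar>\<eta> (y - x)\<bar> \<partial>lborel) = (\<integral>\<^sup>+ z. ennreal \<bar>\<eta> z\<bar> \<partial>lborel)"
    using even_kernel_flip[OF assms, of _ x] by simp
  have "nsq lborel (\<lambda>z. of_real (\<eta> (z - x))) \<le> (\<integral>\<^sup>+ z. ennreal (C\<^sup>2) * indicator (cball x R) z \<partial>lborel)"
    unfolding nsq_def
  proof (intro nn_integral_mono)
    fix z
    have "\<bar>\<eta> (z - x)\<bar> ^ 2 \<le> (C * indicator (cball 0 R) (z - x)) ^ 2"
      by (intro power_mono C) simp
    then show "ennreal ((cmod (complex_of_real (\<eta> (z - x))))\<^sup>2) \<le> ennreal (C\<^sup>2) * indicator (cball x R) z"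
      using C(2) by (auto simp: indicator_def dist_norm norm_minus_commute intro: ennreal_leI)
  qed
  also have "\<dots> < top"
    using emeasure_compact_finite[OF compact_cball[of x R]]
    by (simp add: nn_integral_cmult_indicator ennreal_mult_less_top)
  finally show "nsq lborel (\<lambda>z. of_real (\<eta> (z - x))) < top" .
qed

section \<open>Regularised energy\<close>

text \<open>
  The kernel is evaluated at \<open>y - x\<close> so that the mollification is the pairing of \<open>v\<close> with a
  translated test function, as in the weak form of the equation.
\<close>

definition mollify :: "('a::euclidean_space \<Rightarrow> complex) \<Rightarrow> ('a \<Rightarrow> real) \<Rightarrow> 'a \<Rightarrow> complex" where
  "mollify v \<eta> x = (\<integral>y. v y * of_real (\<eta> (y - x)) \<partial>lborel)"

lemma mollify_integrable:
  assumes [measurable]: "v \<in> borel_measurable borel" and "nsq lborel v < top" "even_kernel \<eta>"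
  shows "integrable lborel (\<lambda>y. v y * of_real (\<eta> (y - x)))"
proof -
  have [measurable]: "\<eta> \<in> borel_measurable borel" using assms by (intro even_kernel_measurable)
  show ?thesis
    by (intro integrable_mult_nsq) (use assms even_kernel_integral_finite in auto)
qed

lemma borel_measurable_mollify [measurable]:
  assumes [measurable]: "v \<in> borel_measurable borel" "\<eta> \<in> borel_measurable borel"
  shows "mollify v \<eta> \<in> borel_measurable borel"
  unfolding mollify_def by measurable

text \<open>
  By \<open>2|v(y)||v(z)| \<le> |v(y)|\<^sup>2 + |v(z)|\<^sup>2\<close> the triple integral splits into two that can be evaluated
  by translation invariance. Its finiteness justifies the interchanges of integrals below.
\<close>

lemma mollify_triple_bound:
  fixes v :: "'a::euclidean_space \<Rightarrow> complex"
  assumes [measurable]: "v \<in> borel_measurable borel" and l: "even_kernel l" and h: "even_kernel \<eta>"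
  shows "(\<integral>\<^sup>+ x. (\<integral>\<^sup>+ y. (\<integral>\<^sup>+ z. ennreal (cmod (v y) * cmod (v z) * \<bar>l (y - x)\<bar> * \<bar>\<eta> (z - x)\<bar>) \<partial>lborel) \<partial>lborel) \<partial>lborel)
    \<le> nsq lborel v * (\<integral>\<^sup>+ z. ennreal \<bar>l z\<bar> \<partial>lborel) * (\<integral>\<^sup>+ z. ennreal \<bar>\<eta> z\<bar> \<partial>lborel)"
proof -
  have [measurable]: "l \<in> borel_measurable borel" "\<eta> \<in> borel_measurable borel"
    using l h by (auto intro: even_kernel_measurable)
  let ?L = "\<integral>\<^sup>+ z. ennreal \<bar>l z\<bar> \<partial>lborel" and ?H = "\<integral>\<^sup>+ z. ennreal \<bar>\<eta> z\<bar> \<partial>lborel"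
  have A: "(\<integral>\<^sup>+ x. (\<integral>\<^sup>+ y. ennreal ((cmod (v y))\<^sup>2) * ennreal \<bar>l (y - x)\<bar> \<partial>lborel) \<partial>lborel) = nsq lborel v * (\<integral>\<^sup>+ z. ennreal \<bar>l z\<bar> \<partial>lborel)"
    if [measurable]: "l \<in> borel_measurable borel" and "even_kernel l" for l
  proof -
    have "(\<integral>\<^sup>+ x. (\<integral>\<^sup>+ y. ennreal ((cmod (v y))\<^sup>2) * ennreal \<bar>l (y - x)\<bar> \<partial>lborel) \<partial>lborel)
      = (\<integral>\<^sup>+ y. (\<integral>\<^sup>+ x. ennreal ((cmod (v y))\<^sup>2) * ennreal \<bar>l (y - x)\<bar> \<partial>lborel) \<partial>lborel)"
      by (rule lborel_pair.Fubini'[symmetric]) measurable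
    also have "\<dots> = (\<integral>\<^sup>+ y. ennreal ((cmod (v y))\<^sup>2) * (\<integral>\<^sup>+ z. ennreal \<bar>l z\<bar> \<partial>lborel) \<partial>lborel)"
      by (simp add: nn_integral_cmult even_kernel_integral_finite(4)[OF that(2)])
    finally show ?thesis by (simp add: nn_integral_multc nsq_def)
  qed
  have B: "(\<integral>\<^sup>+ x. (\<integral>\<^sup>+ y. (\<integral>\<^sup>+ z. ennreal ((cmod (v y))\<^sup>2) * ennreal \<bar>l (y - x)\<bar> * ennreal \<bar>\<eta> (z - x)\<bar> \<partial>lborel) \<partial>lborel) \<partial>lborel)
     = nsq lborel v * ?L * ?H"
    using A[of l] l
    by (simp add: nn_integral_cmult nn_integral_multc even_kernel_integral_finite(3)[OF h])
  have C: "(\<integral>\<^sup>+ x. (\<integral>\<^sup>+ y. (\<integral>\<^sup>+ z. ennreal \<bar>l (y - x)\<bar> * (ennreal ((cmod (v z))\<^sup>2) * ennreal \<bar>\<eta> (z - x)\<bar>) \<partial>lborel) \<partial>lborel) \<partial>lborel)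
     = nsq lborel v * ?L * ?H"
  proof -
    define W where "W x = (\<integral>\<^sup>+ z. ennreal ((cmod (v z))\<^sup>2) * ennreal \<bar>\<eta> (z - x)\<bar> \<partial>lborel)" for x
    have [measurable]: "W \<in> borel_measurable borel" unfolding W_def by measurable
    have "(\<integral>\<^sup>+ x. (\<integral>\<^sup>+ y. (\<integral>\<^sup>+ z. ennreal \<bar>l (y - x)\<bar> * (ennreal ((cmod (v z))\<^sup>2) * ennreal \<bar>\<eta> (z - x)\<bar>) \<partial>lborel) \<partial>lborel) \<partial>lborel)
      = (\<integral>\<^sup>+ x. (\<integral>\<^sup>+ y. ennreal \<bar>l (y - x)\<bar> * W x \<partial>lborel) \<partial>lborel)"
      unfolding W_def by (simp add: nn_integral_cmult)
    also have "\<dots> = (\<integral>\<^sup>+ x. ?L * W x \<partial>lborel)"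
      by (simp add: nn_integral_multc even_kernel_integral_finite(3)[OF l])
    also have "\<dots> = ?L * (\<integral>\<^sup>+ x. W x \<partial>lborel)" by (simp add: nn_integral_cmult)
    also have "(\<integral>\<^sup>+ x. W x \<partial>lborel) = nsq lborel v * ?H" unfolding W_def using A[of \<eta>] h by simp
    finally show ?thesis by (simp add: mult_ac)
  qed
  have "2 * (\<integral>\<^sup>+ x. (\<integral>\<^sup>+ y. (\<integral>\<^sup>+ z. ennreal (cmod (v y) * cmod (v z) * \<bar>l (y - x)\<bar> * \<bar>\<eta> (z - x)\<bar>) \<partial>lborel) \<partial>lborel) \<partial>lborel)
     = (\<integral>\<^sup>+ x. (\<integral>\<^sup>+ y. (\<integral>\<^sup>+ z. 2 * ennreal (cmod (v y) * cmod (v z) * \<bar>l (y - x)\<bar> * \<bar>\<eta> (z - x)\<bar>) \<partial>lborel) \<partial>lborel) \<partial>lborel)"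
    by (simp add: nn_integral_cmult)
  also have "\<dots> \<le> (\<integral>\<^sup>+ x. (\<integral>\<^sup>+ y. (\<integral>\<^sup>+ z. ennreal ((cmod (v y))\<^sup>2) * ennreal \<bar>l (y - x)\<bar> * ennreal \<bar>\<eta> (z - x)\<bar>
       + ennreal \<bar>l (y - x)\<bar> * (ennreal ((cmod (v z))\<^sup>2) * ennreal \<bar>\<eta> (z - x)\<bar>) \<partial>lborel) \<partial>lborel) \<partial>lborel)"
  proof (intro nn_integral_mono)
    fix x y z
    have "2 * (cmod (v y) * cmod (v z) * \<bar>l (y - x)\<bar> * \<bar>\<eta> (z - x)\<bar>)
      \<le> ((cmod (v y))\<^sup>2 + (cmod (v z))\<^sup>2) * (\<bar>l (y - x)\<bar> * \<bar>\<eta> (z - x)\<bar>)"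
      using mult_right_mono[OF sum_squares_bound[of "cmod (v y)" "cmod (v z)"], of "\<bar>l (y - x)\<bar> * \<bar>\<eta> (z - x)\<bar>"]
      by (simp add: mult_ac)
    then have "ennreal (2 * (cmod (v y) * cmod (v z) * \<bar>l (y - x)\<bar> * \<bar>\<eta> (z - x)\<bar>))
      \<le> ennreal ((cmod (v y))\<^sup>2 * \<bar>l (y - x)\<bar> * \<bar>\<eta> (z - x)\<bar> + \<bar>l (y - x)\<bar> * ((cmod (v z))\<^sup>2 * \<bar>\<eta> (z - x)\<bar>))"
      by (intro ennreal_leI) (simp add: algebra_simps)
    then show "2 * ennreal (cmod (v y) * cmod (v z) * \<bar>l (y - x)\<bar> * \<bar>\<eta> (z - x)\<bar>)
      \<le> ennreal ((cmod (v y))\<^sup>2) * ennreal \<bar>l (y - x)\<bar> * ennreal \<bar>\<eta> (z - x)\<bar>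
       + ennreal \<bar>l (y - x)\<bar> * (ennreal ((cmod (v z))\<^sup>2) * ennreal \<bar>\<eta> (z - x)\<bar>)"
      by (simp add: ennreal_mult)
  qed
  also have "\<dots> = nsq lborel v * ?L * ?H + nsq lborel v * ?L * ?H"
    using B C by (simp add: nn_integral_add)
  also have "\<dots> = 2 * (nsq lborel v * ?L * ?H)" by (simp add: mult_2)
  finally show ?thesis
    by (subst (asm) ennreal_mult_le_mult_iff) auto
qed

lemma cmod_mollify_le:
  fixes v :: "'a::euclidean_space \<Rightarrow> complex"
  shows "ennreal (cmod (mollify v \<eta> x)) \<le> (\<integral>\<^sup>+ y. ennreal (cmod (v y) * \<bar>\<eta> (y - x)\<bar>) \<partial>lborel)"
proof (cases "integrable lborel (\<lambda>y. v y * of_real (\<eta> (y - x)))")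
  case True
  then show ?thesis
    unfolding mollify_def using integral_norm_bound_ennreal[OF True] by (simp add: norm_mult)
next
  case False
  then show ?thesis by (simp add: mollify_def not_integrable_integral_eq)
qed

lemma nn_integral_mollify_product:
  fixes v :: "'a::euclidean_space \<Rightarrow> complex"
  assumes [measurable]: "v \<in> borel_measurable borel" and l: "even_kernel l" and h: "even_kernel \<eta>"
  shows "(\<integral>\<^sup>+ x. ennreal (cmod (mollify v l x) * cmod (mollify v \<eta> x)) \<partial>lborel)
    \<le> nsq lborel v * ((\<integral>\<^sup>+ z. ennreal \<bar>l z\<bar> \<partial>lborel) * (\<integral>\<^sup>+ z. ennreal \<bar>\<eta> z\<bar> \<partial>lborel))"
proof -
  have [measurable]: "l \<in> borel_measurable borel" "\<eta> \<in> borel_measurable borel"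
    using l h by (auto intro: even_kernel_measurable)
  have "(\<integral>\<^sup>+ x. ennreal (cmod (mollify v l x) * cmod (mollify v \<eta> x)) \<partial>lborel)
    \<le> (\<integral>\<^sup>+ x. (\<integral>\<^sup>+ y. (\<integral>\<^sup>+ z. ennreal (cmod (v y) * cmod (v z) * \<bar>l (y - x)\<bar> * \<bar>\<eta> (z - x)\<bar>) \<partial>lborel) \<partial>lborel) \<partial>lborel)"
  proof (intro nn_integral_mono)
    fix x
    have "ennreal (cmod (mollify v l x) * cmod (mollify v \<eta> x))
      \<le> (\<integral>\<^sup>+ y. ennreal (cmod (v y) * \<bar>l (y - x)\<bar>) \<partial>lborel) * (\<integral>\<^sup>+ z. ennreal (cmod (v z) * \<bar>\<eta> (z - x)\<bar>) \<partial>lborel)"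
      unfolding ennreal_mult[OF norm_ge_zero norm_ge_zero] by (intro mult_mono cmod_mollify_le) auto
    also have "\<dots> = (\<integral>\<^sup>+ y. (\<integral>\<^sup>+ z. ennreal (cmod (v y) * \<bar>l (y - x)\<bar>) * ennreal (cmod (v z) * \<bar>\<eta> (z - x)\<bar>) \<partial>lborel) \<partial>lborel)"
      by (simp add: nn_integral_cmult nn_integral_multc)
    also have "\<dots> = (\<integral>\<^sup>+ y. (\<integral>\<^sup>+ z. ennreal (cmod (v y) * cmod (v z) * \<bar>l (y - x)\<bar> * \<bar>\<eta> (z - x)\<bar>) \<partial>lborel) \<partial>lborel)"
      by (intro nn_integral_cong) (simp add: mult_ac flip: ennreal_mult)
    finally show "ennreal (cmod (mollify v l x) * cmod (mollify v \<eta> x))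
      \<le> (\<integral>\<^sup>+ y. (\<integral>\<^sup>+ z. ennreal (cmod (v y) * cmod (v z) * \<bar>l (y - x)\<bar> * \<bar>\<eta> (z - x)\<bar>) \<partial>lborel) \<partial>lborel)" .
  qed
  also have "\<dots> \<le> nsq lborel v * (\<integral>\<^sup>+ z. ennreal \<bar>l z\<bar> \<partial>lborel) * (\<integral>\<^sup>+ z. ennreal \<bar>\<eta> z\<bar> \<partial>lborel)"
    by (rule mollify_triple_bound) (use assms in auto)
  finally show ?thesis by (simp add: mult.assoc)
qed

lemma integral_product:
  fixes a :: "'a::euclidean_space \<Rightarrow> complex" and b :: "'b::euclidean_space \<Rightarrow> complex"
  assumes "integrable lborel a" "integrable lborel b"
  shows "(\<integral>p. a (fst p) * b (snd p) \<partial>lborel) = (\<integral>y. a y \<partial>lborel) * (\<integral>z. b z \<partial>lborel)"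
proof -
  note [measurable] = borel_measurable_integrable[OF assms(1)] borel_measurable_integrable[OF assms(2)]
  have "integrable (lborel \<Otimes>\<^sub>M lborel) (\<lambda>p. a (fst p) * b (snd p))"
  proof (rule lborel_pair.Fubini_integrable)
    show "integrable lborel (\<lambda>x. \<integral>y. norm (a (fst (x, y)) * b (snd (x, y))) \<partial>lborel)"
      using assms by (simp add: norm_mult)
    show "AE x in lborel. integrable lborel (\<lambda>y. a (fst (x, y)) * b (snd (x, y)))"
      using assms by simp
  qed measurable
  from lborel_pair.integral_fst'[OF this]
  have "(\<integral>y. (\<integral>z. a y * b z \<partial>lborel) \<partial>lborel) = (\<integral>p. a (fst p) * b (snd p) \<partial>(lborel \<Otimes>\<^sub>M lborel))"
    by simp
  then show ?thesis by (simp add: lborel_prod)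
qed

text \<open>
  The integral is a sesquilinear form in \<open>v\<close> with the real kernel
  \<open>k(y, z) = \<integral> l(y - x) \<eta>(z - x) dx\<close>. The reflection \<open>x \<mapsto> y + z - x\<close> shows that the kernel is
  symmetric, whence the form is Hermitian. For a mollifier and its Laplacian this is the
  self-adjointness of the Laplacian, obtained without differentiating \<open>v\<close>.
\<close>

lemma mollify_product_real:
  fixes v :: "'a::euclidean_space \<Rightarrow> complex"
  assumes [measurable]: "v \<in> borel_measurable borel" and fin: "nsq lborel v < top"
    and l: "even_kernel l" and h: "even_kernel \<eta>"
  shows "Im (\<integral>x. mollify v l x * cnj (mollify v \<eta> x) \<partial>lborel) = 0"
proof -
  have [measurable]: "l \<in> borel_measurable borel" "\<eta> \<in> borel_measurable borel"
    using l h by (auto intro: even_kernel_measurable)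
  define F where "F x p = v (fst p) * of_real (l (fst p - x)) * cnj (v (snd p) * of_real (\<eta> (snd p - x)))"
    for x and p :: "'a \<times> 'a"
  define I where "I = (\<integral>x. mollify v l x * cnj (mollify v \<eta> x) \<partial>lborel)"
  have q: "(\<lambda>q :: 'a \<times> 'a \<times> 'a. fst q) \<in> borel_measurable (lborel \<Otimes>\<^sub>M lborel)"
    "(\<lambda>q :: 'a \<times> 'a \<times> 'a. fst (snd q)) \<in> borel_measurable (lborel \<Otimes>\<^sub>M lborel)"
    "(\<lambda>q :: 'a \<times> 'a \<times> 'a. snd (snd q)) \<in> borel_measurable (lborel \<Otimes>\<^sub>M lborel)"
    unfolding lborel_prod measurable_lborel2
    by (intro borel_measurable_continuous_onI continuous_intros)+
  have "case_prod F = (\<lambda>q. v (fst (snd q)) * of_real (l (fst (snd q) - fst q))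
      * cnj (v (snd (snd q)) * of_real (\<eta> (snd (snd q) - fst q))))"
    by (simp add: F_def fun_eq_iff)
  also have "\<dots> \<in> borel_measurable (lborel \<Otimes>\<^sub>M lborel)"
    by (intro borel_measurable_times borel_measurable_cnj measurable_compose[OF _ assms(1)] q
        measurable_compose[OF measurable_compose[OF borel_measurable_diff[OF q(2) q(1)] \<open>l \<in> _\<close>], of complex_of_real]
        measurable_compose[OF measurable_compose[OF borel_measurable_diff[OF q(3) q(1)] \<open>\<eta> \<in> _\<close>], of complex_of_real])
       auto
  finally have [measurable]: "case_prod F \<in> borel_measurable (lborel \<Otimes>\<^sub>M lborel)" .
  have "(\<integral>\<^sup>+ q. ennreal (norm (case_prod F q)) \<partial>(lborel \<Otimes>\<^sub>M lborel))
      = (\<integral>\<^sup>+ x. (\<integral>\<^sup>+ p. ennreal (norm (F x p)) \<partial>lborel) \<partial>lborel)"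
    using lborel.nn_integral_fst[of "\<lambda>q. ennreal (norm (case_prod F q))" lborel] by simp
  also have "\<dots> = (\<integral>\<^sup>+ x. (\<integral>\<^sup>+ y. (\<integral>\<^sup>+ z. ennreal (cmod (v y) * cmod (v z) * \<bar>l (y - x)\<bar> * \<bar>\<eta> (z - x)\<bar>) \<partial>lborel) \<partial>lborel) \<partial>lborel)"
  proof (intro nn_integral_cong)
    fix x
    have "(\<integral>\<^sup>+ p. ennreal (norm (F x p)) \<partial>lborel) = (\<integral>\<^sup>+ p. ennreal (norm (F x p)) \<partial>(lborel \<Otimes>\<^sub>M lborel))"
      by (simp add: lborel_prod)
    also have "\<dots> = (\<integral>\<^sup>+ y. (\<integral>\<^sup>+ z. ennreal (norm (F x (y, z))) \<partial>lborel) \<partial>lborel)"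
      by (rule lborel.nn_integral_fst[symmetric]) (simp add: F_def)
    finally show "(\<integral>\<^sup>+ p. ennreal (norm (F x p)) \<partial>lborel)
      = (\<integral>\<^sup>+ y. (\<integral>\<^sup>+ z. ennreal (cmod (v y) * cmod (v z) * \<bar>l (y - x)\<bar> * \<bar>\<eta> (z - x)\<bar>) \<partial>lborel) \<partial>lborel)"
      by (simp add: F_def norm_mult mult_ac)
  qed
  also have "\<dots> < \<infinity>"
    by (rule le_less_trans[OF mollify_triple_bound[OF assms(1) l h]])
       (use fin even_kernel_integral_finite(1)[OF l] even_kernel_integral_finite(1)[OF h] in \<open>simp add: ennreal_mult_less_top\<close>)
  finally have Fi: "integrable (lborel \<Otimes>\<^sub>M lborel) (case_prod F)"
    by (intro integrableI_bounded) auto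
  have "(\<integral>p. F x p \<partial>lborel) = mollify v l x * cnj (mollify v \<eta> x)" for x
  proof -
    have "(\<integral>p. F x p \<partial>lborel) = (\<integral>y. v y * of_real (l (y - x)) \<partial>lborel) * (\<integral>z. cnj (v z * of_real (\<eta> (z - x))) \<partial>lborel)"
      unfolding F_def
      by (rule integral_product) (intro integrable_cnj mollify_integrable assms)+
    also have "(\<integral>z. cnj (v z * of_real (\<eta> (z - x))) \<partial>lborel) = cnj (mollify v \<eta> x)"
      unfolding mollify_def by (rule Bochner_Integration.integral_cnj)
    finally show ?thesis by (simp add: mollify_def)
  qed
  then have "I = (\<integral>x. (\<integral>p. F x p \<partial>lborel) \<partial>lborel)" by (simp add: I_def)
  also have "\<dots> = (\<integral>p. (\<integral>x. F x p \<partial>lborel) \<partial>lborel)"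
    by (rule lborel_pair.Fubini_integral[OF Fi, symmetric])
  finally have I1: "I = (\<integral>p. (\<integral>x. F x p \<partial>lborel) \<partial>lborel)" .
  have sym: "cnj (\<integral>x. F x (z, y) \<partial>lborel) = (\<integral>x. F x (y, z) \<partial>lborel)" for y z
  proof -
    have "cnj (\<integral>x. F x (z, y) \<partial>lborel) = (\<integral>x. cnj (F x (z, y)) \<partial>lborel)"
      by (rule Bochner_Integration.integral_cnj[symmetric])
    also have "\<dots> = (\<integral>x. cnj (F ((y + z) - x) (z, y)) \<partial>lborel)"
      by (rule integral_lborel_reflect[symmetric]) (simp add: F_def)
    also have "\<dots> = (\<integral>x. F x (y, z) \<partial>lborel)"
    proof (intro Bochner_Integration.integral_cong refl)
      fix x
      have "l (z - (y + z - x)) = l (y - x)" "\<eta> (y - (y + z - x)) = \<eta> (z - x)"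
        using even_kernel_flip[OF l, of x y] even_kernel_flip[OF h, of x z] by (simp_all add: algebra_simps)
      then show "cnj (F ((y + z) - x) (z, y)) = F x (y, z)"
        by (simp add: F_def mult_ac)
    qed
    finally show ?thesis .
  qed
  have "cnj I = (\<integral>p. cnj (\<integral>x. F x p \<partial>lborel) \<partial>lborel)"
    unfolding I1 by (rule Bochner_Integration.integral_cnj[symmetric])
  also have "\<dots> = (\<integral>p. cnj (\<integral>x. F x p \<partial>lborel) \<partial>(lborel \<Otimes>\<^sub>M lborel))"
    by (simp add: lborel_prod)
  also have "\<dots> = (\<integral>(y, z). cnj (\<integral>x. F x (z, y) \<partial>lborel) \<partial>(lborel \<Otimes>\<^sub>M lborel))"
    by (rule lborel_pair.integral_product_swap[symmetric]) (simp add: F_def)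
  also have "\<dots> = (\<integral>(y, z). (\<integral>x. F x (y, z) \<partial>lborel) \<partial>(lborel \<Otimes>\<^sub>M lborel))"
    unfolding sym ..
  also have "\<dots> = I" unfolding I1 by (simp add: lborel_prod case_prod_unfold)
  finally show ?thesis unfolding I_def[symmetric] by (simp add: complex_eq_iff)
qed

section \<open>Uniqueness of weak solutions\<close>

text \<open>
  Continuity in \<open>L\<^sup>2\<close> bounds the norm near each time, and a compact interval of times needs finitely
  many bounds.
\<close>

lemma locally_bounded_nsq:
  fixes w :: "'a::euclidean_space \<times> real \<Rightarrow> complex"
  assumes [measurable]: "w \<in> borel_measurable borel"
    and fin: "\<And>t. nsq lborel (\<lambda>x. w (x, t)) < top"
    and cont: "\<And>s. ((\<lambda>t. nsq lborel (\<lambda>x. w (x, t) - w (x, s))) \<longlongrightarrow> 0) (at s)"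
  shows "\<exists>C. C < top \<and> (\<forall>t\<in>{a..b}. nsq lborel (\<lambda>x. w (x, t)) \<le> C)"
proof -
  have "\<exists>U C. open U \<and> s \<in> U \<and> C < top \<and> (\<forall>t\<in>U. nsq lborel (\<lambda>x. w (x, t)) \<le> C)" for s
  proof -
    have "\<forall>\<^sub>F t in at s. nsq lborel (\<lambda>x. w (x, t) - w (x, s)) < 1"
      using order_tendstoD(2)[OF cont, of 1 s] by simp
    then obtain U where U: "open U" "s \<in> U" "\<And>t. t \<in> U \<Longrightarrow> t \<noteq> s \<Longrightarrow> nsq lborel (\<lambda>x. w (x, t) - w (x, s)) < 1"
      unfolding eventually_at_topological by auto
    define C where "C = 2 + 2 * nsq lborel (\<lambda>x. w (x, s))"
    have "nsq lborel (\<lambda>x. w (x, t)) \<le> C" if "t \<in> U" for t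
    proof -
      have "nsq lborel (\<lambda>x. w (x, t) - w (x, s)) \<le> 1"
        using U(3)[of t] that by (cases "t = s") (auto simp: nsq_def)
      have "nsq lborel (\<lambda>x. w (x, t)) = nsq lborel (\<lambda>x. (w (x, t) - w (x, s)) + w (x, s))" by simp
      also have "\<dots> \<le> 2 * nsq lborel (\<lambda>x. w (x, t) - w (x, s)) + 2 * nsq lborel (\<lambda>x. w (x, s))"
        by (rule nsq_add_le) measurable
      also have "\<dots> \<le> 2 * 1 + 2 * nsq lborel (\<lambda>x. w (x, s))"
        by (intro add_mono mult_left_mono order_refl \<open>_ \<le> 1\<close>) simp
      finally show ?thesis by (simp add: C_def)
    qed
    moreover have "C < top" using fin[of s] by (simp add: C_def ennreal_mult_less_top)
    ultimately show ?thesis using U by blast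
  qed
  then obtain U C where U: "\<And>s. open (U s)" "\<And>s. s \<in> U s" "\<And>s. C s < (top::ennreal)"
    "\<And>s t. t \<in> U s \<Longrightarrow> nsq lborel (\<lambda>x. w (x, t)) \<le> C s"
    by metis
  obtain S where S: "finite S" "{a..b} \<subseteq> (\<Union>s\<in>S. U s)"
    using compactE_image[OF compact_Icc, of UNIV U a b] U by (metis UNIV_I UN_I subsetI)
  show ?thesis
  proof (intro exI[of _ "\<Sum>s\<in>S. C s"] conjI ballI)
    show "(\<Sum>s\<in>S. C s) < top" using S(1) by induction (use U(3) in auto)
    fix t assume "t \<in> {a..b}"
    then obtain s where s: "s \<in> S" "t \<in> U s" using S by blast
    have "nsq lborel (\<lambda>x. w (x, t)) \<le> C s" using U(4) s by blast
    also have "\<dots> \<le> (\<Sum>s\<in>S. C s)" using S(1) s(1) by (intro member_le_sum) auto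
    finally show "nsq lborel (\<lambda>x. w (x, t)) \<le> (\<Sum>s\<in>S. C s)" .
  qed
qed

lemma isCont_mollify:
  fixes w :: "'a::euclidean_space \<times> real \<Rightarrow> complex"
  assumes [measurable]: "w \<in> borel_measurable borel"
    and fin: "\<And>t. nsq lborel (\<lambda>x. w (x, t)) < top"
    and cont: "\<And>s. ((\<lambda>t. nsq lborel (\<lambda>x. w (x, t) - w (x, s))) \<longlongrightarrow> 0) (at s)"
    and h: "even_kernel \<eta>"
  shows "isCont (\<lambda>t. mollify (\<lambda>y. w (y, t)) \<eta> x) s"
proof -
  have [measurable]: "\<eta> \<in> borel_measurable borel" using h by (rule even_kernel_measurable)
  show ?thesis
    unfolding isCont_def mollify_def
    by (rule tendsto_integral_mult_nsq[OF _ _ _ fin fin even_kernel_integral_finite(2)[OF h] cont]) measurable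
qed

text \<open>
  Let \<open>g\<close> and \<open>m\<close> be the mollifications of \<open>w\<close> with \<open>\<eta>\<close> and \<open>l\<close>. Pointwise the derivative of \<open>|g|\<^sup>2\<close>
  in time is \<open>2 Re (\<i> m cnj g)\<close>, and its integral over space vanishes because \<open>\<integral> m cnj g\<close> is real.
  The fundamental theorem of calculus is used pointwise in space and the integral over space is
  taken afterwards, so that no derivative has to be moved into an integral over the whole space.
\<close>

lemma regularised_energy_conserved:
  fixes w :: "'a::euclidean_space \<times> real \<Rightarrow> complex"
  assumes [measurable]: "w \<in> borel_measurable borel"
    and fin: "\<And>t. nsq lborel (\<lambda>x. w (x, t)) < top"
    and cont: "\<And>s. ((\<lambda>t. nsq lborel (\<lambda>x. w (x, t) - w (x, s))) \<longlongrightarrow> 0) (at s)"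
    and h: "even_kernel \<eta>" and l: "even_kernel l"
    and deriv: "\<And>x t. ((\<lambda>\<tau>. mollify (\<lambda>y. w (y, \<tau>)) \<eta> x) has_vector_derivative
       \<i> * mollify (\<lambda>y. w (y, t)) l x) (at t)"
    and ab: "a \<le> b"
  shows "(\<integral>x. (cmod (mollify (\<lambda>y. w (y, b)) \<eta> x))\<^sup>2 - (cmod (mollify (\<lambda>y. w (y, a)) \<eta> x))\<^sup>2 \<partial>lborel) = 0"
proof -
  have [measurable]: "l \<in> borel_measurable borel" "\<eta> \<in> borel_measurable borel"
    using l h by (auto intro: even_kernel_measurable)
  define g where "g t x = mollify (\<lambda>y. w (y, t)) \<eta> x" for t x
  define m where "m t x = mollify (\<lambda>y. w (y, t)) l x" for t x
  \<comment> \<open>The derivative of \<open>|g|\<^sup>2\<close> in time, cut off to the time interval in order to be integrable over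
    space-time.\<close>
  define f where "f t x = 2 * Re (\<i> * m t x * cnj (g t x)) * indicator {a..b} t" for t x
  have gm[measurable]: "(\<lambda>p. g (fst p) (snd p)) \<in> borel_measurable (lborel \<Otimes>\<^sub>M lborel)"
    and mm[measurable]: "(\<lambda>p. m (fst p) (snd p)) \<in> borel_measurable (lborel \<Otimes>\<^sub>M lborel)"
    unfolding g_def m_def mollify_def by measurable
  have [measurable]: "case_prod f \<in> borel_measurable (lborel \<Otimes>\<^sub>M lborel)"
    using gm mm unfolding f_def case_prod_unfold by measurable
  have FTC: "(\<integral>t. f t x \<partial>lborel) = (cmod (g b x))\<^sup>2 - (cmod (g a x))\<^sup>2" for x
    unfolding f_def
  proof (rule integral_FTC_Icc_real[OF ab])
    fix t
    have d: "((\<lambda>\<tau>. g \<tau> x) has_vector_derivative \<i> * m t x) (at t)"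
      unfolding g_def m_def by (rule deriv)
    have "((\<lambda>\<tau>. g \<tau> x * cnj (g \<tau> x)) has_vector_derivative (g t x * cnj (\<i> * m t x) + \<i> * m t x * cnj (g t x))) (at t)"
      by (intro has_vector_derivative_mult d has_vector_derivative_cnj)
    then have "((\<lambda>\<tau>. Re (g \<tau> x * cnj (g \<tau> x))) has_vector_derivative Re (g t x * cnj (\<i> * m t x) + \<i> * m t x * cnj (g t x))) (at t)"
      by (rule bounded_linear.has_vector_derivative[OF bounded_linear_Re])
    also have "(\<lambda>\<tau>. Re (g \<tau> x * cnj (g \<tau> x))) = (\<lambda>\<tau>. (cmod (g \<tau> x))\<^sup>2)"
      unfolding complex_norm_square[symmetric] by simp
    also have "Re (g t x * cnj (\<i> * m t x) + \<i> * m t x * cnj (g t x)) = 2 * Re (\<i> * m t x * cnj (g t x))"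
      by (simp add: algebra_simps)
    finally show "((\<lambda>\<tau>. (cmod (g \<tau> x))\<^sup>2) has_real_derivative 2 * Re (\<i> * m t x * cnj (g t x))) (at t)"
      unfolding has_real_derivative_iff_has_vector_derivative .
    show "isCont (\<lambda>t. 2 * Re (\<i> * m t x * cnj (g t x))) t"
      unfolding g_def m_def
      by (intro continuous_intros bounded_linear.isCont[OF bounded_linear_Re] isCont_mollify[OF assms(1) fin cont] h l)
  qed
  obtain C where C: "C < top" "\<And>t. t \<in> {a..b} \<Longrightarrow> nsq lborel (\<lambda>x. w (x, t)) \<le> C"
    using locally_bounded_nsq[OF assms(1) fin cont] by metis
  define K where "K = (\<integral>\<^sup>+ z. ennreal \<bar>l z\<bar> \<partial>lborel) * (\<integral>\<^sup>+ z. ennreal \<bar>\<eta> z\<bar> \<partial>lborel)"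
  have K: "K < top"
    using even_kernel_integral_finite(1)[OF l] even_kernel_integral_finite(1)[OF h]
    by (simp add: K_def ennreal_mult_less_top)
  have prod: "(\<integral>\<^sup>+ x. ennreal (cmod (m t x) * cmod (g t x)) \<partial>lborel) \<le> C * K" if "t \<in> {a..b}" for t
  proof -
    have "(\<integral>\<^sup>+ x. ennreal (cmod (m t x) * cmod (g t x)) \<partial>lborel) \<le> nsq lborel (\<lambda>x. w (x, t)) * K"
      unfolding m_def g_def K_def by (rule nn_integral_mollify_product[OF _ l h]) measurable
    also have "\<dots> \<le> C * K" by (intro mult_right_mono C that) simp
    finally show ?thesis .
  qed
  have "(\<integral>\<^sup>+ p. ennreal (norm (case_prod f p)) \<partial>(lborel \<Otimes>\<^sub>M lborel))
      = (\<integral>\<^sup>+ t. (\<integral>\<^sup>+ x. ennreal (norm (f t x)) \<partial>lborel) \<partial>lborel)"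
    using lborel.nn_integral_fst[of "\<lambda>q. ennreal (norm (case_prod f q))" lborel] by simp
  also have "\<dots> \<le> (\<integral>\<^sup>+ t. (2 * (C * K)) * indicator {a..b} t \<partial>lborel)"
  proof (intro nn_integral_mono)
    fix t
    show "(\<integral>\<^sup>+ x. ennreal (norm (f t x)) \<partial>lborel) \<le> (2 * (C * K)) * indicator {a..b} t"
    proof (cases "t \<in> {a..b}")
      case True
      have [measurable]: "m t \<in> borel_measurable borel" "g t \<in> borel_measurable borel"
        unfolding m_def[abs_def] g_def[abs_def] by measurable
      have "(\<integral>\<^sup>+ x. ennreal (norm (f t x)) \<partial>lborel) \<le> (\<integral>\<^sup>+ x. 2 * ennreal (cmod (m t x) * cmod (g t x)) \<partial>lborel)"
      proof (intro nn_integral_mono)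
        fix x
        have "\<bar>Re (\<i> * m t x * cnj (g t x))\<bar> \<le> cmod (m t x) * cmod (g t x)"
          using abs_Re_le_cmod[of "\<i> * m t x * cnj (g t x)"] by (simp add: norm_mult)
        then have "norm (f t x) \<le> 2 * (cmod (m t x) * cmod (g t x))"
          using True by (simp add: f_def abs_mult)
        then have "ennreal (norm (f t x)) \<le> ennreal (2 * (cmod (m t x) * cmod (g t x)))" by (rule ennreal_leI)
        then show "ennreal (norm (f t x)) \<le> 2 * ennreal (cmod (m t x) * cmod (g t x))"
          by (simp add: ennreal_mult)
      qed
      also have "\<dots> = 2 * (\<integral>\<^sup>+ x. ennreal (cmod (m t x) * cmod (g t x)) \<partial>lborel)"
        by (rule nn_integral_cmult) measurable
      also have "\<dots> \<le> 2 * (C * K)" by (intro mult_left_mono prod True) simp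
      finally show ?thesis using True by simp
    qed (simp add: f_def)
  qed
  also have "\<dots> < \<infinity>"
    using C(1) K ab by (simp add: nn_integral_cmult_indicator ennreal_mult_less_top)
  finally have fi: "integrable (lborel \<Otimes>\<^sub>M lborel) (case_prod f)"
    by (intro integrableI_bounded) auto
  have zero: "(\<integral>x. f t x \<partial>lborel) = 0" for t
  proof (cases "t \<in> {a..b}")
    case True
    have [measurable]: "m t \<in> borel_measurable borel" "g t \<in> borel_measurable borel"
      unfolding m_def[abs_def] g_def[abs_def] by measurable
    have "integrable lborel (\<lambda>x. m t x * cnj (g t x))"
    proof (rule integrableI_bounded)
      have "(\<integral>\<^sup>+ x. ennreal (norm (m t x * cnj (g t x))) \<partial>lborel) \<le> C * K"
        using prod[OF True] by (simp add: norm_mult)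
      also have "\<dots> < \<infinity>" using C K by (simp add: ennreal_mult_less_top)
      finally show "(\<integral>\<^sup>+ x. ennreal (norm (m t x * cnj (g t x))) \<partial>lborel) < \<infinity>" .
    qed measurable
    moreover have "(\<integral>x. f t x \<partial>lborel) = (\<integral>x. - 2 * Im (m t x * cnj (g t x)) \<partial>lborel)"
      using True by (intro Bochner_Integration.integral_cong) (simp_all add: f_def)
    moreover have "(\<integral>x. - 2 * Im (h x) \<partial>lborel) = - 2 * Im (\<integral>x. h x \<partial>lborel)"
      if "integrable lborel h" for h :: "'a \<Rightarrow> complex"
      using that by simp
    ultimately have "(\<integral>x. f t x \<partial>lborel) = - 2 * Im (\<integral>x. m t x * cnj (g t x) \<partial>lborel)"
      by (simp only:)
    then show ?thesis
      using mollify_product_real[OF _ fin l h, of t] unfolding m_def g_def by simp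
  qed (simp add: f_def)
  have "(\<integral>x. (cmod (g b x))\<^sup>2 - (cmod (g a x))\<^sup>2 \<partial>lborel) = (\<integral>x. (\<integral>t. f t x \<partial>lborel) \<partial>lborel)"
    unfolding FTC ..
  also have "\<dots> = (\<integral>t. (\<integral>x. f t x \<partial>lborel) \<partial>lborel)"
    by (rule lborel_pair.Fubini_integral[OF fi])
  also have "\<dots> = 0" unfolding zero by simp
  finally show ?thesis unfolding g_def .
qed

lemma mollify_eq_0:
  assumes "AE y in lborel. v y = 0"
  shows "mollify v \<eta> x = 0"
  unfolding mollify_def using assms by (intro integral_eq_zero_AE) (auto elim: eventually_mono)

lemma mollify_zero_all_times:
  fixes w :: "'a::euclidean_space \<times> real \<Rightarrow> complex"
  assumes [measurable]: "w \<in> borel_measurable borel"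
    and fin: "\<And>t. nsq lborel (\<lambda>x. w (x, t)) < top"
    and cont: "\<And>s. ((\<lambda>t. nsq lborel (\<lambda>x. w (x, t) - w (x, s))) \<longlongrightarrow> 0) (at s)"
    and h: "even_kernel \<eta>" and l: "even_kernel l"
    and deriv: "\<And>x t. ((\<lambda>\<tau>. mollify (\<lambda>y. w (y, \<tau>)) \<eta> x) has_vector_derivative
       \<i> * mollify (\<lambda>y. w (y, t)) l x) (at t)"
    and zero: "AE x in lborel. w (x, 0) = 0"
  shows "AE x in lborel. mollify (\<lambda>y. w (y, t)) \<eta> x = 0"
proof -
  have [measurable]: "\<eta> \<in> borel_measurable borel" using h by (rule even_kernel_measurable)
  let ?g = "\<lambda>t x. mollify (\<lambda>y. w (y, t)) \<eta> x"
  have z: "?g 0 x = 0" for x by (rule mollify_eq_0[OF zero])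
  have "(\<integral>x. (cmod (?g t x))\<^sup>2 \<partial>lborel) = 0"
    using regularised_energy_conserved[OF assms(1-6), of 0 t] regularised_energy_conserved[OF assms(1-6), of t 0]
    by (cases "0 \<le> t") (simp_all add: z)
  moreover have "integrable lborel (\<lambda>x. (cmod (?g t x))\<^sup>2)"
  proof (rule integrableI_bounded)
    have "(\<integral>\<^sup>+ x. ennreal (norm ((cmod (?g t x))\<^sup>2)) \<partial>lborel) \<le> nsq lborel (\<lambda>x. w (x, t)) *
      ((\<integral>\<^sup>+ z. ennreal \<bar>\<eta> z\<bar> \<partial>lborel) * (\<integral>\<^sup>+ z. ennreal \<bar>\<eta> z\<bar> \<partial>lborel))"
      using nn_integral_mollify_product[OF _ h h, of "\<lambda>y. w (y, t)"] by (simp add: power2_eq_square)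
    also have "\<dots> < \<infinity>"
      using fin[of t] even_kernel_integral_finite(1)[OF h] by (simp add: ennreal_mult_less_top)
    finally show "(\<integral>\<^sup>+ x. ennreal (norm ((cmod (?g t x))\<^sup>2)) \<partial>lborel) < \<infinity>" .
  qed simp
  ultimately have "AE x in lborel. (cmod (?g t x))\<^sup>2 = 0"
    by (subst (asm) integral_nonneg_eq_0_iff_AE) auto
  then show ?thesis by eventually_elim simp
qed

text \<open>
  The positive and the negative part of \<open>h\<close> are densities of two measures that agree on boxes, hence
  everywhere.
\<close>

lemma AE_zero_if_box_integrals_zero:
  fixes h :: "'a::euclidean_space \<Rightarrow> real"
  assumes [measurable]: "h \<in> borel_measurable borel"
    and int: "\<And>l u. integrable lborel (\<lambda>x. h x * indicator (box l u) x)"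
    and zero: "\<And>l u. (\<integral>x. h x * indicator (box l u) x \<partial>lborel) = 0"
  shows "AE x in lborel. h x = 0"
proof -
  define D where "D g = density lborel (\<lambda>x. ennreal (max 0 (g x)))" for g :: "'a \<Rightarrow> real"
  have em: "emeasure (D g) (box l u) = ennreal (\<integral>x. max 0 (g x * indicator (box l u) x) \<partial>lborel)"
    if [measurable]: "g \<in> borel_measurable borel" and "integrable lborel (\<lambda>x. g x * indicator (box l u) x)" for g l u
  proof -
    have "emeasure (D g) (box l u) = (\<integral>\<^sup>+ x. ennreal (max 0 (g x)) * indicator (box l u) x \<partial>lborel)"
      unfolding D_def by (simp add: emeasure_density)
    also have "\<dots> = (\<integral>\<^sup>+ x. ennreal (max 0 (g x * indicator (box l u) x)) \<partial>lborel)"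
      by (intro nn_integral_cong) (auto simp: indicator_def)
    also have "\<dots> = ennreal (\<integral>x. max 0 (g x * indicator (box l u) x) \<partial>lborel)"
      by (rule nn_integral_eq_integral) (use that in auto)
    finally show ?thesis .
  qed
  have "D h = D (\<lambda>x. - h x)"
  proof (rule measure_eqI_generator_eq)
    let ?E = "range (\<lambda>(a, b). box a b::'a set)"
    show "Int_stable ?E" by (auto simp: Int_stable_def box_Int_box)
    show "?E \<subseteq> Pow UNIV" "sets (D h) = sigma_sets UNIV ?E" "sets (D (\<lambda>x. - h x)) = sigma_sets UNIV ?E"
      by (simp_all add: borel_eq_box D_def)
    let ?A = "\<lambda>n::nat. box (- (real n *\<^sub>R One)) (real n *\<^sub>R One) :: 'a set"
    show "range ?A \<subseteq> ?E" "(\<Union>i. ?A i) = UNIV"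
      unfolding UN_box_eq_UNIV by auto
    show "emeasure (D h) (?A i) \<noteq> \<infinity>" for i using em[of h] int by simp
    show "emeasure (D h) X = emeasure (D (\<lambda>x. - h x)) X" if X: "X \<in> ?E" for X
    proof -
      obtain l u where [simp]: "X = box l u" using X by auto
      let ?h = "\<lambda>x. h x * indicator (box l u) x"
      have "(\<integral>x. max 0 (?h x) \<partial>lborel) - (\<integral>x. max 0 (- ?h x) \<partial>lborel) = (\<integral>x. max 0 (?h x) - max 0 (- ?h x) \<partial>lborel)"
        using int[of l u] by (intro Bochner_Integration.integral_diff[symmetric]) auto
      also have "\<dots> = (\<integral>x. ?h x \<partial>lborel)" by (intro Bochner_Integration.integral_cong) auto
      finally have "(\<integral>x. max 0 (?h x) \<partial>lborel) = (\<integral>x. max 0 (- ?h x) \<partial>lborel)"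
        using zero[of l u] by simp
      then show ?thesis using em[of h l u] em[of "\<lambda>x. - h x" l u] int[of l u] by simp
    qed
  qed
  then have "AE x in lborel. ennreal (max 0 (h x)) = ennreal (max 0 (- h x))"
    unfolding D_def by (intro sigma_finite_measure.density_unique[OF sigma_finite_lborel]) auto
  then show ?thesis
    by eventually_elim (auto simp: max_def split: if_splits)
qed

lemma integral_bump_pos:
  assumes "0 < k" shows "0 < (\<integral>z. bump k (z::'a::euclidean_space) \<partial>lborel)" "integrable lborel (bump k :: 'a \<Rightarrow> real)"
proof -
  have [measurable]: "bump k \<in> borel_measurable (borel :: 'a measure)"
    using even_kernel_measurable[OF even_kernel_bump[OF assms]] .
  show i: "integrable lborel (bump k :: 'a \<Rightarrow> real)"
    using even_kernel_integral_finite(1)[OF even_kernel_bump[OF assms], where 'a='a]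
    by (intro integrableI_bounded) auto
  have "(\<integral>z. bump k (z::'a) \<partial>lborel) \<noteq> 0"
  proof
    assume "(\<integral>z. bump k (z::'a) \<partial>lborel) = 0"
    then have "AE z in lborel. bump k (z::'a) = 0"
      using i by (subst (asm) integral_nonneg_eq_0_iff_AE) (auto simp: bump_nonneg)
    then have "AE z in lborel. z \<notin> ball (0::'a) (1 / sqrt k)"
    proof eventually_elim
      case (elim z)
      show ?case
      proof
        assume "z \<in> ball 0 (1 / sqrt k)"
        then have "norm z < 1 / sqrt k" by simp
        then have "(norm z)\<^sup>2 < (1 / sqrt k)\<^sup>2" by (intro power_strict_mono) auto
        then have "k * (norm z)\<^sup>2 < 1" using assms by (simp add: power_divide field_simps)
        with elim show False by (simp add: bump_def)
      qed
    qed
    then have "ball (0::'a) (1 / sqrt k) \<in> null_sets lborel"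
      by (subst AE_iff_null_sets) auto
    then have "emeasure lborel (ball (0::'a) (1 / sqrt k)) = 0" by auto
    then show False using assms unit_ball_vol_pos[of "real DIM('a)"] by (simp add: emeasure_ball)
  qed
  moreover have "0 \<le> (\<integral>z. bump k (z::'a) \<partial>lborel)" by (simp add: bump_nonneg)
  ultimately show "0 < (\<integral>z. bump k (z::'a) \<partial>lborel)" by simp
qed

text \<open>
  Away from the boundary of the box the limit is attained: the bump around \<open>y\<close> eventually lies
  inside or outside the box.
\<close>

lemma mollified_box_tendsto:
  fixes y :: "'a::euclidean_space"
  defines "k \<equiv> \<lambda>j. (real (Suc j))\<^sup>2"
  assumes "y \<notin> cbox l u - box l u"
  shows "(\<lambda>j. (\<integral>x. indicator (box l u) x * bump (k j) (y - x) \<partial>lborel) / (\<integral>z. bump (k j) (z::'a) \<partial>lborel))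
     \<longlonglongrightarrow> indicator (box l u) y"
proof -
  have kp: "0 < k j" for j by (simp add: k_def)
  have mb[measurable]: "bump (k j) \<in> borel_measurable (borel :: 'a measure)" for j
    using even_kernel_measurable[OF even_kernel_bump[OF kp]] .
  have far: "bump (k j) (y - x) = 0" if "r \<le> dist y x" "1 / r \<le> real (Suc j)" "0 < r" for j x r
  proof (rule bump_eq_0)
    have "1 \<le> r * real (Suc j)" using that by (simp add: field_simps)
    also have "\<dots> \<le> norm (y - x) * real (Suc j)"
      using that by (intro mult_right_mono) (auto simp: dist_norm)
    finally have "1\<^sup>2 \<le> (norm (y - x) * real (Suc j))\<^sup>2" by (intro power_mono) auto
    then show "1 \<le> k j * (norm (y - x))\<^sup>2" by (simp add: k_def power_mult_distrib mult.commute)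
  qed
  have ev: "\<forall>\<^sub>F j in sequentially. 1 / r \<le> real (Suc j)" for r :: real
    by (meson eventually_sequentiallyI real_arch_simple order_trans of_nat_mono le_SucI)
  consider "y \<in> box l u" | "y \<notin> cbox l u" "y \<notin> box l u" using assms box_subset_cbox by blast
  then show ?thesis
  proof cases
    case 1
    then obtain r where r: "0 < r" "ball y r \<subseteq> box l u" using open_box open_contains_ball by blast
    have "\<forall>\<^sub>F j in sequentially. (\<integral>x. indicator (box l u) x * bump (k j) (y - x) \<partial>lborel) / (\<integral>z. bump (k j) (z::'a) \<partial>lborel) = 1"
      using ev[of r]
    proof eventually_elim
      case (elim j)
      have "(\<integral>x. indicator (box l u) x * bump (k j) (y - x) \<partial>lborel) = (\<integral>x. bump (k j) (y - x) \<partial>lborel)"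
      proof (intro Bochner_Integration.integral_cong refl)
        fix x
        show "indicator (box l u) x * bump (k j) (y - x) = bump (k j) (y - x)"
        proof (cases "x \<in> ball y r")
          case True
          then have "x \<in> box l u" using r by blast
          then show ?thesis by simp
        qed (use far[of r x j] elim r in \<open>simp add: not_less\<close>)
      qed
      also have "\<dots> = (\<integral>z. bump (k j) (z::'a) \<partial>lborel)"
        by (rule integral_lborel_reflect) simp
      finally show ?case using integral_bump_pos(1)[OF kp[of j], where 'a='a] by simp
    qed
    then show ?thesis using 1 by (simp add: tendsto_eventually)
  next
    case 2
    have "open (- cbox l u)" by (simp add: closed_cbox open_Compl)
    then obtain r where r: "0 < r" "ball y r \<subseteq> - cbox l u" using 2 open_contains_ball by blast
    have "\<forall>\<^sub>F j in sequentially. (\<integral>x. indicator (box l u) x * bump (k j) (y - x) \<partial>lborel) / (\<integral>z. bump (k j) (z::'a) \<partial>lborel) = 0"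
      using ev[of r]
    proof eventually_elim
      case (elim j)
      have "(\<integral>x. indicator (box l u) x * bump (k j) (y - x) \<partial>lborel) = (\<integral>(x::'a). 0 \<partial>lborel)"
      proof (intro Bochner_Integration.integral_cong refl)
        fix x
        show "indicator (box l u) x * bump (k j) (y - x) = 0"
        proof (cases "x \<in> ball y r")
          case True
          then have "x \<notin> box l u" using r box_subset_cbox[of l u] by blast
          then show ?thesis by simp
        qed (use far[of r x j] elim r in \<open>simp add: not_less\<close>)
      qed
      then show ?case by simp
    qed
    then show ?thesis using 2 by (simp add: tendsto_eventually)
  qed
qed

text \<open>
  Fubini's theorem moves the mollification from \<open>w\<close> to the indicator function of the box. The
  mollified indicators are uniformly bounded, have a common bounded support, and converge off the
  boundary of the box, a null set.
\<close>

lemma box_integral_zero_if_mollify_zero: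
  fixes w :: "'a::euclidean_space \<Rightarrow> complex"
  assumes [measurable]: "w \<in> borel_measurable borel" and fin: "nsq lborel w < top"
    and zero: "\<And>k. 0 < k \<Longrightarrow> AE x in lborel. mollify w (bump k) x = 0"
  shows "integrable lborel (\<lambda>y. w y * indicator (box l u) y)"
    and "(\<integral>y. w y * indicator (box l u) y \<partial>lborel) = 0"
proof -
  have ind: "nsq lborel (\<lambda>y. indicator A y) < top" if "bounded A" "A \<in> sets borel" for A :: "'a set"
  proof -
    have "nsq lborel (\<lambda>y. indicator A y) = (\<integral>\<^sup>+ y. indicator A y \<partial>lborel)"
      unfolding nsq_def by (intro nn_integral_cong) (auto simp: indicator_def)
    also have "\<dots> < top"
      using that emeasure_bounded_finite[OF that(1)] by simp
    finally show ?thesis .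
  qed
  show "integrable lborel (\<lambda>y. w y * indicator (box l u) y)"
    by (intro integrable_mult_nsq ind) (auto simp: fin)
  define k where "k j = (real (Suc j))\<^sup>2" for j
  have kp: "0 < k j" for j by (simp add: k_def)
  have mb[measurable]: "bump (k j) \<in> borel_measurable (borel :: 'a measure)" for j
    using even_kernel_measurable[OF even_kernel_bump[OF kp]] .
  define c where "c j = (\<integral>z. bump (k j) (z::'a) \<partial>lborel)" for j
  have c: "0 < c j" for j unfolding c_def by (rule integral_bump_pos[OF kp])
  define Q where "Q j y = (\<integral>x. indicator (box l u) x * bump (k j) (y - x) \<partial>lborel)" for j y
  have [measurable]: "Q j \<in> borel_measurable borel" for j unfolding Q_def by measurable
  have bi: "integrable lborel (\<lambda>x. bump (k j) (y - x))" for j and y :: 'a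
  proof (rule integrableI_bounded)
    show "(\<integral>\<^sup>+ x. ennreal (norm (bump (k j) (y - x))) \<partial>lborel) < \<infinity>"
      using even_kernel_integral_finite(1,4)[OF even_kernel_bump[OF kp[of j], where 'a='a]] by simp
  qed measurable
  have Qint: "integrable lborel (\<lambda>x. indicator (box l u) x * bump (k j) (y - x))" for j y
    using integrable_mult_indicator[OF _ bi[of j y], of "box l u"] by simp
  have Q0: "0 \<le> Q j y" for j y unfolding Q_def by (auto intro!: integral_nonneg_AE simp: bump_nonneg)
  have Q1: "Q j y \<le> c j" for j y
  proof -
    have "Q j y \<le> (\<integral>x. bump (k j) (y - x) \<partial>lborel)"
      unfolding Q_def by (rule integral_mono[OF Qint bi]) (auto simp: indicator_def bump_nonneg)
    also have "\<dots> = c j" unfolding c_def by (rule integral_lborel_reflect) simp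
    finally show ?thesis .
  qed
  obtain R where R: "box l u \<subseteq> cball 0 R" using bounded_subset_ballD[OF bounded_box, of l u 0] ball_subset_cball by blast
  have Qfar: "Q j y = 0" if "y \<notin> cball 0 (R + 1)" for j y
  proof -
    have "indicator (box l u) x * bump (k j) (y - x) = 0" for x
    proof (cases "x \<in> box l u")
      case True
      then have "norm x \<le> R" using R by auto
      then have "1 \<le> norm (y - x)" using that norm_triangle_ineq2[of y x] by simp
      then have "1 \<le> (norm (y - x))\<^sup>2" by (simp add: one_le_power)
      moreover have "1 \<le> k j" by (simp add: k_def one_le_power)
      ultimately have "1 * 1 \<le> k j * (norm (y - x))\<^sup>2" by (intro mult_mono) auto
      then show ?thesis by (simp add: bump_eq_0)
    qed simp
    then show ?thesis unfolding Q_def by (simp only: Bochner_Integration.integral_zero)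
  qed
  \<comment> \<open>\<open>Q j\<close> is the mollified indicator function, up to the normalisation \<open>c j\<close>.\<close>
  have wQ: "(\<integral>y. w y * of_real (Q j y) \<partial>lborel) = 0" for j
  proof -
    define F where "F x y = indicator (box l u) x *\<^sub>R (w y * of_real (bump (k j) (y - x)))" for x y
    have [measurable]: "case_prod F \<in> borel_measurable (lborel \<Otimes>\<^sub>M lborel)"
      unfolding F_def by measurable
    let ?L = "\<integral>\<^sup>+ z. ennreal \<bar>bump (k j) (z::'a)\<bar> \<partial>lborel"
    note fins = even_kernel_integral_finite[OF even_kernel_bump[OF kp[of j], where 'a='a]]
    have "(\<integral>\<^sup>+ p. ennreal (norm (case_prod F p)) \<partial>(lborel \<Otimes>\<^sub>M lborel))
        = (\<integral>\<^sup>+ x. (\<integral>\<^sup>+ y. ennreal (norm (F x y)) \<partial>lborel) \<partial>lborel)"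
      using lborel.nn_integral_fst[of "\<lambda>q. ennreal (norm (case_prod F q))" lborel] by simp
    also have "\<dots> \<le> (\<integral>\<^sup>+ x. (\<integral>\<^sup>+ y. ennreal ((cmod (w y))\<^sup>2) * ennreal \<bar>bump (k j) (y - x)\<bar>
        + indicator (box l u) x * ennreal \<bar>bump (k j) (y - x)\<bar> \<partial>lborel) \<partial>lborel)"
    proof (intro nn_integral_mono)
      fix x y
      have "cmod (w y) \<le> (cmod (w y))\<^sup>2 + 1"
        using sum_squares_bound[of "cmod (w y)" 1] norm_ge_zero[of "w y"] by (simp del: norm_ge_zero)
      then have "cmod (w y) * \<bar>bump (k j) (y - x)\<bar> \<le> ((cmod (w y))\<^sup>2 + 1) * \<bar>bump (k j) (y - x)\<bar>"
        by (intro mult_right_mono) auto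
      then have "ennreal (cmod (w y) * \<bar>bump (k j) (y - x)\<bar>)
         \<le> ennreal ((cmod (w y))\<^sup>2 * \<bar>bump (k j) (y - x)\<bar> + \<bar>bump (k j) (y - x)\<bar>)"
        by (intro ennreal_leI) (simp add: algebra_simps)
      then have "ennreal (cmod (w y) * \<bar>bump (k j) (y - x)\<bar>)
         \<le> ennreal ((cmod (w y))\<^sup>2) * ennreal \<bar>bump (k j) (y - x)\<bar> + ennreal \<bar>bump (k j) (y - x)\<bar>"
        by (simp add: ennreal_mult)
      then show "ennreal (norm (F x y)) \<le> ennreal ((cmod (w y))\<^sup>2) * ennreal \<bar>bump (k j) (y - x)\<bar>
        + indicator (box l u) x * ennreal \<bar>bump (k j) (y - x)\<bar>"
        by (auto simp: F_def norm_mult indicator_def)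
    qed
    also have "\<dots> = (\<integral>\<^sup>+ x. (\<integral>\<^sup>+ y. ennreal ((cmod (w y))\<^sup>2) * ennreal \<bar>bump (k j) (y - x)\<bar> \<partial>lborel) \<partial>lborel)
       + (\<integral>\<^sup>+ x. indicator (box l u) x * ?L \<partial>lborel)"
      by (simp add: nn_integral_add nn_integral_cmult fins(3))
    also have "(\<integral>\<^sup>+ x. (\<integral>\<^sup>+ y. ennreal ((cmod (w y))\<^sup>2) * ennreal \<bar>bump (k j) (y - x)\<bar> \<partial>lborel) \<partial>lborel)
      = (\<integral>\<^sup>+ y. (\<integral>\<^sup>+ x. ennreal ((cmod (w y))\<^sup>2) * ennreal \<bar>bump (k j) (y - x)\<bar> \<partial>lborel) \<partial>lborel)"
      by (rule lborel_pair.Fubini'[symmetric]) measurable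
    also have "\<dots> = nsq lborel w * ?L"
      by (simp add: nn_integral_cmult nn_integral_multc nsq_def fins(4))
    also have "nsq lborel w * ?L + (\<integral>\<^sup>+ x. indicator (box l u) x * ?L \<partial>lborel) < \<infinity>"
      using fin fins(1) emeasure_bounded_finite[OF bounded_box[of l u]]
      by (simp add: nn_integral_multc ennreal_mult_less_top)
    finally have Fi: "integrable (lborel \<Otimes>\<^sub>M lborel) (case_prod F)"
      by (intro integrableI_bounded) auto
    have "(\<integral>y. w y * of_real (Q j y) \<partial>lborel) = (\<integral>y. (\<integral>x. F x y \<partial>lborel) \<partial>lborel)"
    proof (intro Bochner_Integration.integral_cong refl)
      fix y
      have "w y * of_real (Q j y) = w y * (\<integral>x. complex_of_real (indicator (box l u) x * bump (k j) (y - x)) \<partial>lborel)"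
        unfolding Q_def by (simp only: integral_complex_of_real)
      also have "\<dots> = (\<integral>x. F x y \<partial>lborel)"
        unfolding integral_mult_right_zero[symmetric]
        by (intro Bochner_Integration.integral_cong) (auto simp: F_def indicator_def)
      finally show "w y * of_real (Q j y) = (\<integral>x. F x y \<partial>lborel)" .
    qed
    also have "\<dots> = (\<integral>x. (\<integral>y. F x y \<partial>lborel) \<partial>lborel)"
      by (rule lborel_pair.Fubini_integral[OF Fi])
    also have "\<dots> = (\<integral>x. indicator (box l u) x *\<^sub>R mollify w (bump (k j)) x \<partial>lborel)"
      by (simp add: F_def mollify_def)
    also have "\<dots> = 0"
      using zero[OF kp[of j]] by (intro integral_eq_zero_AE) (auto elim: eventually_mono)
    finally show ?thesis .
  qed
  have "(\<lambda>j. \<integral>y. w y * of_real (Q j y / c j) \<partial>lborel) \<longlonglongrightarrow> (\<integral>y. w y * indicator (box l u) y \<partial>lborel)"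
  proof (rule integral_dominated_convergence[where w = "\<lambda>y. cmod (w y * indicator (cball 0 (R + 1)) y)"])
    show "integrable lborel (\<lambda>y. cmod (w y * indicator (cball 0 (R + 1)) y))"
      by (intro integrable_norm integrable_mult_nsq ind borel_measurable_indicator) (auto simp: fin)
    have "AE y in lborel. y \<notin> cbox l u - box l u"
      using negligible_frontier_interval[of l u] 
      by (intro AE_not_in) (simp add: negligible_iff_null_sets null_sets_completion_iff)
    then show "AE y in lborel. (\<lambda>j. w y * of_real (Q j y / c j)) \<longlonglongrightarrow> w y * indicator (box l u) y"
    proof eventually_elim
      case (elim y)
      have "(\<lambda>j. Q j y / c j) \<longlonglongrightarrow> indicator (box l u) y"
        using mollified_box_tendsto[OF elim] unfolding Q_def c_def k_def .
      then have "(\<lambda>j. w y * of_real (Q j y / c j)) \<longlonglongrightarrow> w y * of_real (indicator (box l u) y)"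
        by (intro tendsto_intros)
      then show ?case by (cases "y \<in> box l u") simp_all
    qed
    show "AE y in lborel. norm (w y * of_real (Q j y / c j)) \<le> cmod (w y * indicator (cball 0 (R + 1)) y)" for j
    proof (intro AE_I2)
      fix y
      show "norm (w y * of_real (Q j y / c j)) \<le> cmod (w y * indicator (cball 0 (R + 1)) y)"
      proof (cases "y \<in> cball 0 (R + 1)")
        case True
        have "\<bar>Q j y / c j\<bar> \<le> 1" using Q0[of j y] Q1[of j y] c[of j] by simp
        then have "cmod (w y) * \<bar>Q j y / c j\<bar> \<le> cmod (w y) * 1" by (intro mult_left_mono) auto
        then show ?thesis using True by (simp add: norm_mult norm_divide)
      qed (simp add: Qfar)
    qed
  qed measurable
  moreover have "(\<integral>y. w y * of_real (Q j y / c j) \<partial>lborel) = 0" for j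
    using wQ[of j] by simp
  ultimately show "(\<integral>y. w y * indicator (box l u) y \<partial>lborel) = 0"
    by (simp only: LIMSEQ_const_iff)
qed

lemma AE_zero_if_mollify_zero:
  fixes w :: "'a::euclidean_space \<Rightarrow> complex"
  assumes [measurable]: "w \<in> borel_measurable borel" and fin: "nsq lborel w < top"
    and zero: "\<And>k. 0 < k \<Longrightarrow> AE x in lborel. mollify w (bump k) x = 0"
  shows "AE x in lborel. w x = 0"
proof -
  note box = box_integral_zero_if_mollify_zero[OF assms]
  have re: "(\<lambda>x. Re (w x) * indicator (box l u) x) = (\<lambda>x. Re (w x * indicator (box l u) x))"
    and im: "(\<lambda>x. Im (w x) * indicator (box l u) x) = (\<lambda>x. Im (w x * indicator (box l u) x))" for l u
    by (auto simp: indicator_def)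
  have "AE x in lborel. Re (w x) = 0"
  proof (rule AE_zero_if_box_integrals_zero)
    show "integrable lborel (\<lambda>x. Re (w x) * indicator (box l u) x)" for l u
      unfolding re by (intro integrable_Re box)
    show "(\<integral>x. Re (w x) * indicator (box l u) x \<partial>lborel) = 0" for l u
    proof -
      have "(\<integral>x. Re (w x * indicator (box l u) x) \<partial>lborel) = Re (\<integral>x. w x * indicator (box l u) x \<partial>lborel)"
        by (rule integral_Re[OF box(1)])
      then show ?thesis unfolding re by (simp only: box(2) zero_complex.sel)
    qed
  qed simp
  moreover have "AE x in lborel. Im (w x) = 0"
  proof (rule AE_zero_if_box_integrals_zero)
    show "integrable lborel (\<lambda>x. Im (w x) * indicator (box l u) x)" for l u
      unfolding im by (intro integrable_Im box)
    show "(\<integral>x. Im (w x) * indicator (box l u) x \<partial>lborel) = 0" for l u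
    proof -
      have "(\<integral>x. Im (w x * indicator (box l u) x) \<partial>lborel) = Im (\<integral>x. w x * indicator (box l u) x \<partial>lborel)"
        by (rule integral_Im[OF box(1)])
      then show ?thesis unfolding im by (simp only: box(2) zero_complex.sel)
    qed
  qed simp
  ultimately show ?thesis by eventually_elim (simp add: complex_eq_iff)
qed

lemma powr_two_norm: "norm z powr 2 = (norm z)\<^sup>2"
  by (cases "z = 0") (simp_all add: powr_numeral)

lemma Lp_norm_2_lebesgue:
  "Lp_norm 2 lebesgue g = (if nsq lborel g = top then top else ennreal (sqrt (enn2real (nsq lborel g))))"
  unfolding Lp_norm_def powr_two_norm nn_integral_completion nsq_def
  by (simp add: Let_def powr_half_sqrt)

lemma Lp_norm_2_power2: "(Lp_norm 2 lebesgue g)\<^sup>2 = nsq lborel g"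
  unfolding Lp_norm_2_lebesgue by (auto simp: ennreal_power less_top power2_eq_square ennreal_mult[symmetric])

lemma Lp_space_2_iff:
  "g \<in> borel_measurable lebesgue \<Longrightarrow> g \<in> Lp_space 2 lebesgue \<longleftrightarrow> nsq lborel g < top"
  unfolding Lp_space_def Lp_norm_2_lebesgue by (auto simp: less_top)

lemma Lp_norm_2_tendsto_0_iff:
  "((\<lambda>t. Lp_norm 2 lebesgue (g t)) \<longlongrightarrow> 0) F \<longleftrightarrow> ((\<lambda>t. nsq lborel (g t)) \<longlongrightarrow> 0) F"
proof
  assume "((\<lambda>t. Lp_norm 2 lebesgue (g t)) \<longlongrightarrow> 0) F"
  then have "((\<lambda>t. Lp_norm 2 lebesgue (g t) * Lp_norm 2 lebesgue (g t)) \<longlongrightarrow> 0 * 0) F"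
    by (intro tendsto_mult_ennreal) auto
  then show "((\<lambda>t. nsq lborel (g t)) \<longlongrightarrow> 0) F"
    by (simp flip: power2_eq_square add: Lp_norm_2_power2)
next
  assume *: "((\<lambda>t. nsq lborel (g t)) \<longlongrightarrow> 0) F"
  show "((\<lambda>t. Lp_norm 2 lebesgue (g t)) \<longlongrightarrow> 0) F"
  proof (rule order_tendstoI)
    fix e :: ennreal assume e: "0 < e"
    then have "0 < e\<^sup>2" by (simp add: power2_eq_square ennreal_zero_less_mult_iff)
    from order_tendstoD(2)[OF * this] show "\<forall>\<^sub>F t in F. Lp_norm 2 lebesgue (g t) < e"
    proof eventually_elim
      case (elim t)
      then show ?case unfolding Lp_norm_2_power2[symmetric]
        by (metis not_le power_mono zero_le)
    qed
  qed simp
qed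

lemma C1_fun_continuous:
  assumes "C1_fun \<phi>" shows "continuous_on UNIV \<phi>"
  using assms unfolding C1_fun_def
  by (auto intro!: continuous_at_imp_continuous_on differentiable_imp_continuous_within)

lemma test_fun_continuous:
  assumes "test_fun \<phi>" shows "continuous_on UNIV \<phi>" "continuous_on UNIV (laplacian \<phi>)"
proof -
  have C: "C1_fun \<phi>" "C1_fun (\<lambda>x. frechet_derivative \<phi> (at x) v)" for v
    using assms unfolding test_fun_def C2_fun_def by auto
  show "continuous_on UNIV \<phi>" by (rule C1_fun_continuous[OF C(1)])
  show "continuous_on UNIV (laplacian \<phi>)"
    unfolding laplacian_def[abs_def] using C(2)
    by (intro continuous_on_sum) (auto simp: C1_fun_def)
qed

text \<open>
  Tested against a translated bump, the weak equation for the difference \<open>w\<close> of two solutions is a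
  differential equation in time for a mollification of \<open>w\<close>. The energy of the mollification is
  conserved and vanishes at time 0.
\<close>

theorem weak_solution_unique:
  fixes f :: "'a::euclidean_space \<Rightarrow> complex"
  assumes u: "schroedinger_solution f u" and u': "schroedinger_solution f u'"
  shows "AE x in lborel. u (x, t) = u' (x, t)"
proof -
  have [measurable]: "u \<in> borel_measurable borel" "u' \<in> borel_measurable borel"
    using u u' by (auto simp: schroedinger_solution_def)
  have leb: "(\<lambda>x. v (x, t)) \<in> borel_measurable lebesgue" if [measurable]: "v \<in> borel_measurable borel" for v :: "'a \<times> real \<Rightarrow> complex" and t
    by (intro measurable_completion) measurable
  have fu: "nsq lborel (\<lambda>x. u (x, t)) < top" and fu': "nsq lborel (\<lambda>x. u' (x, t)) < top" for t
    using u u' Lp_space_2_iff[OF leb] by (auto simp: schroedinger_solution_def)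
  define w where "w p = u p - u' p" for p
  have [measurable]: "w \<in> borel_measurable borel" unfolding w_def by measurable
  have fin: "nsq lborel (\<lambda>x. w (x, t)) < top" for t
    unfolding w_def by (intro nsq_diff_finite fu fu') measurable
  have cu: "((\<lambda>t. nsq lborel (\<lambda>x. u (x, t) - u (x, s))) \<longlongrightarrow> 0) (at s)"
    and cu': "((\<lambda>t. nsq lborel (\<lambda>x. u' (x, t) - u' (x, s))) \<longlongrightarrow> 0) (at s)" for s
    using u u' by (auto simp: schroedinger_solution_def Lp_norm_2_tendsto_0_iff)
  have cont: "((\<lambda>t. nsq lborel (\<lambda>x. w (x, t) - w (x, s))) \<longlongrightarrow> 0) (at s)" for s
  proof (rule tendsto_sandwich[OF _ _ tendsto_const])
    show "\<forall>\<^sub>F t in at s. nsq lborel (\<lambda>x. w (x, t) - w (x, s))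
       \<le> nsq lborel (\<lambda>x. u (x, t) - u (x, s)) * 2 + nsq lborel (\<lambda>x. u' (x, t) - u' (x, s)) * 2"
    proof (intro always_eventually allI)
      fix t
      have "nsq lborel (\<lambda>x. w (x, t) - w (x, s)) = nsq lborel (\<lambda>x. (u (x, t) - u (x, s)) - (u' (x, t) - u' (x, s)))"
        by (simp add: w_def algebra_simps)
      also have "\<dots> \<le> 2 * nsq lborel (\<lambda>x. u (x, t) - u (x, s)) + 2 * nsq lborel (\<lambda>x. u' (x, t) - u' (x, s))"
        by (rule nsq_diff_le) measurable
      finally show "nsq lborel (\<lambda>x. w (x, t) - w (x, s))
       \<le> nsq lborel (\<lambda>x. u (x, t) - u (x, s)) * 2 + nsq lborel (\<lambda>x. u' (x, t) - u' (x, s)) * 2"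
        by (simp add: mult.commute)
    qed
    show "((\<lambda>t. nsq lborel (\<lambda>x. u (x, t) - u (x, s)) * 2 + nsq lborel (\<lambda>x. u' (x, t) - u' (x, s)) * 2) \<longlongrightarrow> 0) (at s)"
      using tendsto_add[OF tendsto_ennreal_mult_const_0[OF cu, of 2] tendsto_ennreal_mult_const_0[OF cu', of 2]] by simp
  qed simp
  have zero: "AE x in lborel. w (x, 0) = 0"
  proof -
    have "AE x in lborel. u (x, 0) = f x" "AE x in lborel. u' (x, 0) = f x"
      using u u' by (auto simp: schroedinger_solution_def AE_completion_iff)
    then show ?thesis by eventually_elim (simp add: w_def)
  qed
  have moll: "mollify (\<lambda>y. w (y, t)) \<eta> x = (LINT y|lebesgue. u (y, t) * of_real (\<eta> (y - x))) - (LINT y|lebesgue. u' (y, t) * of_real (\<eta> (y - x)))"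
    if "even_kernel \<eta>" for \<eta> x t
  proof -
    have [measurable]: "\<eta> \<in> borel_measurable borel" using that by (rule even_kernel_measurable)
    have "mollify (\<lambda>y. w (y, t)) \<eta> x = (\<integral>y. u (y, t) * of_real (\<eta> (y - x)) - u' (y, t) * of_real (\<eta> (y - x)) \<partial>lborel)"
      by (simp add: mollify_def w_def left_diff_distrib)
    also have "\<dots> = (\<integral>y. u (y, t) * of_real (\<eta> (y - x)) \<partial>lborel) - (\<integral>y. u' (y, t) * of_real (\<eta> (y - x)) \<partial>lborel)"
      by (intro Bochner_Integration.integral_diff mollify_integrable fu fu' that) measurable
    finally show ?thesis by (subst (1 2) integral_completion) measurable
  qed
  show ?thesis
  proof -
    have "AE x in lborel. w (x, t) = 0"
    proof (rule AE_zero_if_mollify_zero[OF _ fin])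
      fix k :: real assume k: "0 < k"
      show "AE x in lborel. mollify (\<lambda>y. w (y, t)) (bump k) x = 0"
      proof (rule mollify_zero_all_times[OF _ fin cont even_kernel_bump[OF k] even_kernel_lap_bump[OF k] _ zero])
        fix x t
        have "((\<lambda>\<tau>. (LINT y|lebesgue. u (y, \<tau>) * of_real (bump k (y - x))) - (LINT y|lebesgue. u' (y, \<tau>) * of_real (bump k (y - x))))
          has_vector_derivative \<i> * (LINT y|lebesgue. u (y, t) * laplacian (\<lambda>y. complex_of_real (bump k (y - x))) y)
            - \<i> * (LINT y|lebesgue. u' (y, t) * laplacian (\<lambda>y. complex_of_real (bump k (y - x))) y)) (at t)"
          using u u' test_fun_bump(1)[OF k, of x]
          by (intro has_vector_derivative_diff) (auto simp: schroedinger_solution_def)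
        then show "((\<lambda>\<tau>. mollify (\<lambda>y. w (y, \<tau>)) (bump k) x) has_vector_derivative
           \<i> * mollify (\<lambda>y. w (y, t)) (lap_bump k) x) (at t)"
          unfolding moll[OF even_kernel_bump[OF k]] moll[OF even_kernel_lap_bump[OF k]] test_fun_bump(2)[OF k]
          by (simp add: right_diff_distrib)
      qed measurable
    qed measurable
    then show ?thesis by eventually_elim (simp add: w_def)
  qed
qed

text \<open>
  This makes the space-time norms of a solution independent of the choice that defines
  \<open>schroedinger_flow\<close>.
\<close>

lemma weak_solution_unique_spacetime:
  fixes f :: "'a::euclidean_space \<Rightarrow> complex"
  assumes u: "schroedinger_solution f u" and u': "schroedinger_solution f u'"
  shows "AE p in lborel. u p = u' p"
proof -
  have [measurable]: "u \<in> borel_measurable borel" "u' \<in> borel_measurable borel"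
    using u u' by (auto simp: schroedinger_solution_def)
  have m: "{p \<in> space (lborel \<Otimes>\<^sub>M lborel). u (fst p, snd p) = u' (fst p, snd p)} \<in> sets (lborel \<Otimes>\<^sub>M lborel)"
    by measurable
  have "AE t in lborel. AE x in lborel. u (x, t) = u' (x, t)"
    by (intro AE_I2 weak_solution_unique[OF u u'])
  then have "AE x in lborel. AE t in lborel. u (x, t) = u' (x, t)"
    by (subst lborel_pair.AE_commute[where P = "\<lambda>x t. u (x, t) = u' (x, t)", OF m])
  then have "AE p in lborel \<Otimes>\<^sub>M lborel. u p = u' p"
    by (intro lborel_pair.AE_pair_measure) (use m in auto)
  then show ?thesis unfolding lborel_prod .
qed

section \<open>Integration by parts against test functions\<close>

lemma frechet_derivative_zero_on_open:
  assumes "open S" "x \<in> S" "\<And>y. y \<in> S \<Longrightarrow> f y = 0"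
  shows "frechet_derivative f (at x) v = 0"
proof -
  have "((\<lambda>_. 0) has_derivative (\<lambda>_. 0)) (at x)" by simp
  then have "(f has_derivative (\<lambda>_. 0)) (at x)"
    by (rule has_derivative_transform_within_open[OF _ assms(1,2)]) (use assms(3) in auto)
  then show ?thesis by (rule frechet_derivativeI)
qed

lemma test_fun_support:
  fixes \<phi> :: "'a::euclidean_space \<Rightarrow> complex"
  assumes "test_fun \<phi>"
  obtains R where "0 < R" "\<And>x. R < norm x \<Longrightarrow> \<phi> x = 0"
    "\<And>x v. R < norm x \<Longrightarrow> frechet_derivative \<phi> (at x) v = 0"
    "\<And>x v w. R < norm x \<Longrightarrow> frechet_derivative (\<lambda>y. frechet_derivative \<phi> (at y) v) (at x) w = 0"
proof -
  have "bounded {x. \<phi> x \<noteq> 0}"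
    using assms by (simp add: test_fun_def compact_closure)
  then obtain R where R: "0 < R" "\<And>x. \<phi> x \<noteq> 0 \<Longrightarrow> norm x \<le> R"
    unfolding bounded_pos by blast
  have o: "open {x::'a. R < norm x}" by (intro open_Collect_less continuous_intros)
  have 0: "\<phi> x = 0" if "R < norm x" for x using R(2)[of x] that by auto
  have 1: "frechet_derivative \<phi> (at x) v = 0" if "R < norm x" for x v
    by (rule frechet_derivative_zero_on_open[OF o]) (use that 0 in auto)
  have 2: "frechet_derivative (\<lambda>y. frechet_derivative \<phi> (at y) v) (at x) w = 0" if "R < norm x" for x v w
    by (rule frechet_derivative_zero_on_open[OF o]) (use that 1 in auto)
  show thesis by (rule that[OF R(1) 0 1 2])
qed

lemma integral_lborel_cbox:
  fixes f :: "'a::euclidean_space \<Rightarrow> complex"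
  assumes "continuous_on UNIV f" and "\<And>x. x \<notin> cbox l u \<Longrightarrow> f x = 0"
  shows "integrable lborel f" "(\<integral>x. f x \<partial>lborel) = integral (cbox l u) f"
proof -
  have e: "(\<lambda>x. indicator (cbox l u) x *\<^sub>R f x) = f" using assms(2) by (auto simp: indicator_def)
  have "integrable lborel (\<lambda>x. indicator (cbox l u) x *\<^sub>R f x)"
    by (rule borel_integrable_compact) (use assms(1) in \<open>auto intro: continuous_on_subset\<close>)
  then show i: "integrable lborel f" unfolding e .
  have "set_integrable lborel (cbox l u) f" unfolding set_integrable_def e by (rule i)
  from set_borel_integral_eq_integral(2)[OF this]
  show "(\<integral>x. f x \<partial>lborel) = integral (cbox l u) f"
    unfolding set_lebesgue_integral_def e .
qed

lemma norm_le_imp_cbox: "norm x \<le> R \<Longrightarrow> x \<in> cbox (- R *\<^sub>R One) (R *\<^sub>R One)" for x :: "'a::euclidean_space"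
  using Basis_le_norm[of _ x] by (fastforce simp: mem_box abs_le_iff)

lemma integral_lborel_translate:
  fixes f :: "'a::euclidean_space \<Rightarrow> complex"
  assumes [measurable]: "f \<in> borel_measurable borel"
  shows "(\<integral>x. f (x + t) \<partial>lborel) = (\<integral>x. f x \<partial>lborel)"
proof -
  have "(\<integral>x. f x \<partial>lborel) = (\<integral>x. f x \<partial>distr lborel borel ((+) t))"
    by (simp only: lborel_distr_plus)
  also have "\<dots> = (\<integral>x. f (x + t) \<partial>lborel)"
    by (subst integral_distr) (simp_all add: add.commute)
  finally show ?thesis by simp
qed

text \<open>
  By translation invariance \<open>\<integral> h(x + s b) dx\<close> does not depend on \<open>s\<close>; its derivative at \<open>s = 0\<close> is
  \<open>\<integral> h'\<close>.
\<close>

lemma integral_directional_derivative_zero: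
  fixes h :: "'a::euclidean_space \<Rightarrow> complex"
  assumes h: "continuous_on UNIV h" and h': "continuous_on UNIV h'"
    and deriv: "\<And>x. ((\<lambda>s. h (x + s *\<^sub>R b)) has_vector_derivative h' x) (at 0)"
    and supp: "\<And>x. R < norm x \<Longrightarrow> h x = 0" "\<And>x. R < norm x \<Longrightarrow> h' x = 0"
  shows "(\<integral>x. h' x \<partial>lborel) = 0"
proof -
  \<comment> \<open>The larger radius keeps the support inside the box for all translations with \<open>|s| \<le> 1\<close>.\<close>
  define R' where "R' = R + norm b"
  let ?l = "- R' *\<^sub>R One :: 'a" and ?u = "R' *\<^sub>R One :: 'a"
  have out: "R < norm (x + s *\<^sub>R b)" if "x \<notin> cbox ?l ?u" "\<bar>s\<bar> \<le> 1" for x s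
  proof -
    have "R' < norm x" using that(1) norm_le_imp_cbox[of x R'] by (meson not_le)
    moreover have "norm (s *\<^sub>R b) \<le> norm b" using that(2) by (simp add: mult_left_le_one_le)
    ultimately show ?thesis using norm_diff_ineq[of x "s *\<^sub>R b"] by (simp add: R'_def)
  qed
  have [measurable]: "h \<in> borel_measurable borel" by (rule borel_measurable_continuous_onI[OF h])
  have hs: "continuous_on UNIV (\<lambda>x. h (x + s *\<^sub>R b))" for s
    by (intro continuous_on_compose2[OF h] continuous_intros) auto
  have const: "integral (cbox ?l ?u) (\<lambda>x. h (x + s *\<^sub>R b)) = (\<integral>x. h x \<partial>lborel)" if "s \<in> {-1..1}" for s
  proof -
    have "integral (cbox ?l ?u) (\<lambda>x. h (x + s *\<^sub>R b)) = (\<integral>x. h (x + s *\<^sub>R b) \<partial>lborel)"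
      by (rule integral_lborel_cbox(2)[OF hs, symmetric]) (use out supp that in auto)
    then show ?thesis by (simp add: integral_lborel_translate)
  qed
  have "((\<lambda>s. integral (cbox ?l ?u) (\<lambda>x. h (x + s *\<^sub>R b))) has_vector_derivative
     integral (cbox ?l ?u) (\<lambda>x. h' (x + 0 *\<^sub>R b))) (at 0 within {-1..1})"
  proof (rule leibniz_rule_vector_derivative)
    fix s x
    have "((\<lambda>r. h ((x + s *\<^sub>R b) + r *\<^sub>R b)) has_vector_derivative h' (x + s *\<^sub>R b)) (at (s - s))"
      using deriv[of "x + s *\<^sub>R b"] by simp
    then have "(((\<lambda>r. h ((x + s *\<^sub>R b) + r *\<^sub>R b)) \<circ> (\<lambda>r. r - s)) has_vector_derivative 1 *\<^sub>R h' (x + s *\<^sub>R b)) (at s)"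
      by (intro vector_diff_chain_at) (auto intro!: derivative_eq_intros)
    then have "((\<lambda>r. h (x + r *\<^sub>R b)) has_vector_derivative h' (x + s *\<^sub>R b)) (at s)"
      by (simp add: comp_def algebra_simps)
    then show "((\<lambda>r. h (x + r *\<^sub>R b)) has_vector_derivative h' (x + s *\<^sub>R b)) (at s within {-1..1})"
      by (rule has_vector_derivative_at_within)
  next
    show "(\<lambda>x. h (x + s *\<^sub>R b)) integrable_on cbox ?l ?u" for s
      by (intro integrable_continuous continuous_on_subset[OF hs]) auto
    show "continuous_on ({-1..1} \<times> cbox ?l ?u) (\<lambda>(s, x). h' (x + s *\<^sub>R b))"
      unfolding case_prod_unfold by (intro continuous_on_compose2[OF h'] continuous_intros) auto
  qed auto
  then have "((\<lambda>s. integral (cbox ?l ?u) (\<lambda>x. h (x + s *\<^sub>R b))) has_vector_derivative integral (cbox ?l ?u) h') (at 0 within {-1..1})"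
    by simp
  then have "((\<lambda>s. \<integral>x. h x \<partial>lborel) has_vector_derivative integral (cbox ?l ?u) h') (at 0 within {-1..1})"
    by (rule has_vector_derivative_transform[rotated 2]) (use const in auto)
  moreover have "((\<lambda>s::real. \<integral>x. h x \<partial>lborel) has_vector_derivative 0) (at 0 within {-1..1})"
    by (rule has_vector_derivative_const)
  moreover have "at (0::real) within {-1..1} \<noteq> bot"
    by (subst at_within_Icc_at) auto
  ultimately have "integral (cbox ?l ?u) h' = 0"
    by (metis vector_derivative_within)
  moreover have "(\<integral>x. h' x \<partial>lborel) = integral (cbox ?l ?u) h'"
    by (rule integral_lborel_cbox(2)[OF h']) (use out[of _ 0] supp in auto)
  ultimately show ?thesis by simp
qed

lemma directional_frechet:
  assumes "f differentiable at x"
  shows "((\<lambda>s. f (x + s *\<^sub>R b)) has_vector_derivative frechet_derivative f (at x) b) (at 0)"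
proof -
  have f: "(f has_derivative frechet_derivative f (at x)) (at (x + 0 *\<^sub>R b))"
    using assms by (simp add: frechet_derivative_works)
  have "((\<lambda>s. x + s *\<^sub>R b) has_derivative (\<lambda>s. s *\<^sub>R b)) (at 0)"
    by (auto intro!: derivative_eq_intros)
  from has_derivative_compose[OF this f]
  have "((\<lambda>s. f (x + s *\<^sub>R b)) has_derivative (\<lambda>s. frechet_derivative f (at x) (s *\<^sub>R b))) (at 0)" .
  moreover have "frechet_derivative f (at x) (s *\<^sub>R b) = s *\<^sub>R frechet_derivative f (at x) b" for s
    using linear_frechet_derivative[OF assms] by (simp add: linear_cmul)
  ultimately show ?thesis by (simp add: has_vector_derivative_def)
qed

lemma radial_directional:
  fixes V :: "real \<Rightarrow> complex" and x b :: "'a::euclidean_space"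
  assumes "(V has_vector_derivative D) (at ((norm x)\<^sup>2))"
  shows "((\<lambda>s. V ((norm (x + s *\<^sub>R b))\<^sup>2)) has_vector_derivative of_real (2 * (x \<bullet> b)) * D) (at 0)"
proof -
  have "((\<lambda>s. (x + s *\<^sub>R b) \<bullet> (x + s *\<^sub>R b)) has_vector_derivative 2 * (x \<bullet> b)) (at 0)"
    unfolding has_vector_derivative_def
    by (auto intro!: derivative_eq_intros simp: inner_commute algebra_simps)
  then have s: "((\<lambda>s. (norm (x + s *\<^sub>R b))\<^sup>2) has_vector_derivative 2 * (x \<bullet> b)) (at 0)"
    by (simp only: power2_norm_eq_inner)
  have "((V \<circ> (\<lambda>s. (norm (x + s *\<^sub>R b))\<^sup>2)) has_vector_derivative (2 * (x \<bullet> b)) *\<^sub>R D) (at 0)"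
    by (rule vector_diff_chain_at[OF s]) (use assms in simp)
  then show ?thesis by (simp add: comp_def scaleR_conv_of_real)
qed

lemma continuous_radial:
  "continuous_on UNIV V \<Longrightarrow> continuous_on UNIV (\<lambda>x::'a::real_normed_vector. V ((norm x)\<^sup>2))"
  by (rule continuous_on_compose2[of UNIV V]) (auto intro!: continuous_intros)

text \<open>
  The function \<open>4 (s V'' + V')\<close> of \<open>s = |x|\<^sup>2\<close> is the Laplacian of the radial function \<open>V(|x|\<^sup>2)\<close> in
  the plane. For each coordinate direction \<open>b\<close> the difference of the two integrands is the
  derivative along \<open>b\<close> of \<open>(\<partial>\<^sub>b V) \<phi> - V \<partial>\<^sub>b \<phi>\<close>.
\<close>

lemma green_radial:
  fixes V V1 V2 :: "real \<Rightarrow> complex" and \<phi> :: "real ^ 2 \<Rightarrow> complex"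
  assumes V: "\<And>s. (V has_vector_derivative V1 s) (at s)" "\<And>s. (V1 has_vector_derivative V2 s) (at s)"
    and cV2: "continuous_on UNIV V2" and \<phi>: "test_fun \<phi>"
  shows "(\<integral>x. V ((norm x)\<^sup>2) * laplacian \<phi> x \<partial>plane)
     = (\<integral>x. 4 * (of_real ((norm x)\<^sup>2) * V2 ((norm x)\<^sup>2) + V1 ((norm x)\<^sup>2)) * \<phi> x \<partial>plane)"
proof -
  have cV: "continuous_on UNIV V" and cV1: "continuous_on UNIV V1"
    using V by (auto intro!: continuous_at_imp_continuous_on has_vector_derivative_continuous)
  obtain R where R: "0 < R" "\<And>x. R < norm x \<Longrightarrow> \<phi> x = 0"
    "\<And>x v. R < norm x \<Longrightarrow> frechet_derivative \<phi> (at x) v = 0"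
    "\<And>x v w. R < norm x \<Longrightarrow> frechet_derivative (\<lambda>y. frechet_derivative \<phi> (at y) v) (at x) w = 0"
    using test_fun_support[OF \<phi>] by blast
  have C: "C1_fun \<phi>" "C1_fun (\<lambda>x. frechet_derivative \<phi> (at x) v)" for v
    using \<phi> unfolding test_fun_def C2_fun_def by auto
  have d: "\<phi> differentiable at x" "(\<lambda>x. frechet_derivative \<phi> (at x) v) differentiable at x" for x v
    using C unfolding C1_fun_def by auto
  have c: "continuous_on UNIV \<phi>" "continuous_on UNIV (\<lambda>x. frechet_derivative \<phi> (at x) v)"
    "continuous_on UNIV (\<lambda>x. frechet_derivative (\<lambda>y. frechet_derivative \<phi> (at y) v) (at x) v)" for v
    using C1_fun_continuous[OF C(1)] C1_fun_continuous[OF C(2)] C(2) unfolding C1_fun_def by auto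
  note cont = continuous_radial[OF cV] continuous_radial[OF cV1] continuous_radial[OF cV2] c
  \<comment> \<open>The first and second derivatives of \<open>V(|x|\<^sup>2)\<close> along \<open>b\<close>.\<close>
  define W1 where "W1 b x = of_real (2 * (x \<bullet> b)) * V1 ((norm x)\<^sup>2)" for b x :: "real^2"
  define W2 where "W2 b x = of_real (2 * (b \<bullet> b)) * V1 ((norm x)\<^sup>2) + of_real (4 * (x \<bullet> b)\<^sup>2) * V2 ((norm x)\<^sup>2)" for b x :: "real^2"
  define \<phi>2 where "\<phi>2 b x = frechet_derivative (\<lambda>y. frechet_derivative \<phi> (at y) b) (at x) b" for b x
  have cW: "continuous_on UNIV (W1 b)" "continuous_on UNIV (W2 b)" "continuous_on UNIV (\<phi>2 b)" for b
    unfolding W1_def[abs_def] W2_def[abs_def] \<phi>2_def[abs_def] by (intro continuous_intros cont)+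
  have dW: "((\<lambda>s. W1 b (x + s *\<^sub>R b)) has_vector_derivative W2 b x) (at 0)" for b x
  proof -
    have 1: "((\<lambda>s. complex_of_real (2 * ((x + s *\<^sub>R b) \<bullet> b))) has_vector_derivative of_real (2 * (b \<bullet> b))) (at 0)"
      by (intro has_vector_derivative_of_real) (auto intro!: derivative_eq_intros simp: inner_add_left)
    show ?thesis
      unfolding W1_def
      by (rule has_vector_derivative_eq_rhs[OF has_vector_derivative_mult[OF 1 radial_directional[OF V(2)]]])
         (simp add: W2_def power2_eq_square algebra_simps)
  qed
  have by_parts: "(\<integral>x. W2 b x * \<phi> x - V ((norm x)\<^sup>2) * \<phi>2 b x \<partial>plane) = 0" for b
  proof (rule integral_directional_derivative_zero[where R = R])
    show "continuous_on UNIV (\<lambda>x. W1 b x * \<phi> x - V ((norm x)\<^sup>2) * frechet_derivative \<phi> (at x) b)"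
      by (intro continuous_intros cW cont)
    show "continuous_on UNIV (\<lambda>x. W2 b x * \<phi> x - V ((norm x)\<^sup>2) * \<phi>2 b x)"
      by (intro continuous_intros cW cont)
    show "((\<lambda>s. W1 b (x + s *\<^sub>R b) * \<phi> (x + s *\<^sub>R b) - V ((norm (x + s *\<^sub>R b))\<^sup>2) * frechet_derivative \<phi> (at (x + s *\<^sub>R b)) b)
      has_vector_derivative W2 b x * \<phi> x - V ((norm x)\<^sup>2) * \<phi>2 b x) (at 0)" for x
      by (rule has_vector_derivative_eq_rhs[OF has_vector_derivative_diff[OF
            has_vector_derivative_mult[OF dW directional_frechet[OF d(1)]]
            has_vector_derivative_mult[OF radial_directional[OF V(1)] directional_frechet[OF d(2)]]]])
         (simp add: W1_def \<phi>2_def)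
  qed (simp_all add: R \<phi>2_def)
  have box: "f x = 0" if "\<And>x. R < norm x \<Longrightarrow> f x = 0" "x \<notin> cbox (- R *\<^sub>R One) (R *\<^sub>R One)" for f :: "real^2 \<Rightarrow> complex" and x
    using that norm_le_imp_cbox[of x R] by (meson not_le)
  have int: "integrable plane (\<lambda>x. W2 b x * \<phi> x)" "integrable plane (\<lambda>x. V ((norm x)\<^sup>2) * \<phi>2 b x)" for b
    by (rule integral_lborel_cbox(1), intro continuous_intros cW cont, rule box, simp_all add: R \<phi>2_def)+
  have "(\<integral>x. V ((norm x)\<^sup>2) * laplacian \<phi> x \<partial>plane) = (\<integral>x. (\<Sum>b\<in>Basis. V ((norm x)\<^sup>2) * \<phi>2 b x) \<partial>plane)"
    by (simp add: laplacian_def \<phi>2_def sum_distrib_left)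
  also have "\<dots> = (\<Sum>b\<in>Basis. \<integral>x. V ((norm x)\<^sup>2) * \<phi>2 b x \<partial>plane)"
    by (rule Bochner_Integration.integral_sum) (rule int)
  also have "\<dots> = (\<Sum>b\<in>Basis. \<integral>x. W2 b x * \<phi> x \<partial>plane)"
    using by_parts by (intro sum.cong refl) (simp add: Bochner_Integration.integral_diff[OF int])
  also have "\<dots> = (\<integral>x. (\<Sum>b\<in>Basis. W2 b x * \<phi> x) \<partial>plane)"
    by (rule Bochner_Integration.integral_sum[symmetric]) (rule int)
  also have "\<dots> = (\<integral>x. 4 * (of_real ((norm x)\<^sup>2) * V2 ((norm x)\<^sup>2) + V1 ((norm x)\<^sup>2)) * \<phi> x \<partial>plane)"
  proof (intro Bochner_Integration.integral_cong refl)
    fix x :: "real^2"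
    have "(\<Sum>b\<in>Basis. W2 b x) = of_real (2 * (\<Sum>b\<in>(Basis :: (real^2) set). b \<bullet> b)) * V1 ((norm x)\<^sup>2)
       + of_real (4 * (\<Sum>b\<in>Basis. (x \<bullet> b) * (x \<bullet> b))) * V2 ((norm x)\<^sup>2)"
      unfolding W2_def power2_eq_square by (simp only: sum.distrib sum_distrib_right of_real_sum sum_distrib_left)
    also have "(\<Sum>b\<in>Basis. (x \<bullet> b) * (x \<bullet> b)) = (norm x)\<^sup>2"
      unfolding power2_norm_eq_inner by (rule euclidean_inner[symmetric])
    also have "(\<Sum>b\<in>(Basis :: (real^2) set). b \<bullet> b) = 2" by simp
    finally show "(\<Sum>b\<in>Basis. W2 b x * \<phi> x) = 4 * (of_real ((norm x)\<^sup>2) * V2 ((norm x)\<^sup>2) + V1 ((norm x)\<^sup>2)) * \<phi> x"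
      unfolding sum_distrib_right[symmetric] by (simp add: algebra_simps)
  qed
  finally show ?thesis .
qed

section \<open>Explicit solutions\<close>

text \<open>
  The solution with the initial value \<open>\<phi>\<^sub>n(|x|\<^sup>2)\<close>, as a function of \<open>s = |x|\<^sup>2\<close> and \<open>t\<close>. With
  \<open>p = 1 + 2\<i>t\<close> and \<open>q = 1 - 2\<i>t\<close> it is \<open>p\<^sup>-\<^sup>1 (q/p)\<^sup>n e\<^bsup>-s/(2p)\<^esup> L\<^sub>n(s/(p q))\<close>, a Gaussian wave packet
  times a rescaled Laguerre polynomial.
\<close>

definition mode :: "nat \<Rightarrow> real \<Rightarrow> real \<Rightarrow> complex" where
  "mode n s t = inverse (1 + 2 * \<i> * of_real t) * ((1 - 2 * \<i> * of_real t) * inverse (1 + 2 * \<i> * of_real t)) ^ n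
     * exp (- of_real s * inverse (2 * (1 + 2 * \<i> * of_real t))) * of_real (poly (laguerre n) (s / (1 + 4 * t\<^sup>2)))"

lemma p_nonzero: "1 + 2 * \<i> * of_real t \<noteq> (0::complex)" "1 - 2 * \<i> * of_real t \<noteq> (0::complex)"
  by (simp_all add: complex_eq_iff)

lemma pq_eq: "(1 + 2 * \<i> * of_real t) * (1 - 2 * \<i> * of_real t) = complex_of_real (1 + 4 * t\<^sup>2)"
  by (simp add: algebra_simps power2_eq_square complex_eq_iff)

lemma c_pos: "0 < 1 + 4 * t\<^sup>2" for t :: real
  by (simp add: add_pos_nonneg)

definition mode_factor :: "nat \<Rightarrow> real \<Rightarrow> real \<Rightarrow> complex" where
  "mode_factor n s t = inverse (1 + 2 * \<i> * of_real t) * ((1 - 2 * \<i> * of_real t) * inverse (1 + 2 * \<i> * of_real t)) ^ n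
     * exp (- of_real s * inverse (2 * (1 + 2 * \<i> * of_real t)))"

lemma mode_eq: "mode n s t = mode_factor n s t * of_real (poly (laguerre n) (s / (1 + 4 * t\<^sup>2)))"
  by (simp add: mode_def mode_factor_def)

text \<open>
  The first derivative of \<open>mode\<close> in \<open>s\<close>, and next to it the second, with \<open>mode_factor\<close> split off so
  that they are visibly continuous in both variables.
\<close>

definition mode1 :: "nat \<Rightarrow> real \<Rightarrow> real \<Rightarrow> complex" where
  "mode1 n s t = mode_factor n s t * (- of_real (poly (laguerre n) (s / (1 + 4 * t\<^sup>2))) * inverse (2 * (1 + 2 * \<i> * of_real t))
      + of_real (poly (pderiv (laguerre n)) (s / (1 + 4 * t\<^sup>2))) * of_real (inverse (1 + 4 * t\<^sup>2)))"

definition mode2 :: "nat \<Rightarrow> real \<Rightarrow> real \<Rightarrow> complex" where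
  "mode2 n s t = mode_factor n s t * (of_real (poly (laguerre n) (s / (1 + 4 * t\<^sup>2))) * (inverse (2 * (1 + 2 * \<i> * of_real t)))\<^sup>2
      - 2 * of_real (poly (pderiv (laguerre n)) (s / (1 + 4 * t\<^sup>2))) * of_real (inverse (1 + 4 * t\<^sup>2)) * inverse (2 * (1 + 2 * \<i> * of_real t))
      + of_real (poly (pderiv (pderiv (laguerre n))) (s / (1 + 4 * t\<^sup>2))) * (of_real (inverse (1 + 4 * t\<^sup>2)))\<^sup>2)"

lemma mode_factor_deriv:
  "((\<lambda>s. mode_factor n s t) has_vector_derivative - mode_factor n s t * inverse (2 * (1 + 2 * \<i> * of_real t))) (at s)"
proof -
  define P where "P = inverse (2 * (1 + 2 * \<i> * complex_of_real t))"
  define A where "A = inverse (1 + 2 * \<i> * complex_of_real t) * ((1 - 2 * \<i> * of_real t) * inverse (1 + 2 * \<i> * of_real t)) ^ n"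
  have "((\<lambda>z. A * exp (- z * P)) has_field_derivative - (A * exp (- of_real s * P)) * P) (at (of_real s))"
    by (auto intro!: derivative_eq_intros)
  from has_vector_derivative_real_field[OF this] show ?thesis
    by (simp add: mode_factor_def P_def A_def mult.assoc)
qed

lemma poly_scaled_deriv:
  "((\<lambda>s. complex_of_real (poly p (s / c))) has_vector_derivative of_real (poly (pderiv p) (s / c)) * of_real (inverse c)) (at s)"
proof -
  have "((\<lambda>s. poly p (s / c)) has_real_derivative poly (pderiv p) (s / c) * inverse c) (at s)"
    unfolding divide_inverse by (rule DERIV_chain2[OF poly_DERIV]) (auto intro!: derivative_eq_intros)
  then have "((\<lambda>s. complex_of_real (poly p (s / c))) has_vector_derivative of_real (poly (pderiv p) (s / c) * inverse c)) (at s)"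
    by (rule has_vector_derivative_of_real)
  then show ?thesis by simp
qed

lemma mode_deriv1: "((\<lambda>s. mode n s t) has_vector_derivative mode1 n s t) (at s)"
  unfolding mode_eq mode1_def
  by (rule has_vector_derivative_eq_rhs[OF has_vector_derivative_mult[OF mode_factor_deriv poly_scaled_deriv]])
     (simp add: algebra_simps)

lemma mode_deriv2: "((\<lambda>s. mode1 n s t) has_vector_derivative mode2 n s t) (at s)"
proof -
  define P where "P = inverse (2 * (1 + 2 * \<i> * complex_of_real t))"
  define c where "c = 1 + 4 * t\<^sup>2"
  have "((\<lambda>s. - of_real (poly (laguerre n) (s / c)) * P + of_real (poly (pderiv (laguerre n)) (s / c)) * of_real (inverse c))
    has_vector_derivative - (of_real (poly (pderiv (laguerre n)) (s / c)) * of_real (inverse c)) * P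
      + (of_real (poly (pderiv (pderiv (laguerre n))) (s / c)) * of_real (inverse c)) * of_real (inverse c)) (at s)"
    by (intro has_vector_derivative_add has_vector_derivative_minus has_vector_derivative_mult_left poly_scaled_deriv)
  moreover have "((\<lambda>s. mode_factor n s t) has_vector_derivative - mode_factor n s t * P) (at s)"
    unfolding P_def by (rule mode_factor_deriv)
  ultimately show ?thesis
    unfolding mode1_def mode2_def P_def[symmetric] c_def[symmetric]
    by (intro has_vector_derivative_eq_rhs[OF has_vector_derivative_mult])
       (assumption | simp add: power2_eq_square algebra_simps)+
qed

text \<open>
  In view of \<open>green_radial\<close> this is the Schroedinger equation for the radial function
  \<open>mode n (|x|\<^sup>2) t\<close>. Both sides are expressed through \<open>P = 1/p\<close>, \<open>Q = 1/q\<close> and the values \<open>L0\<close>,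
  \<open>L1\<close>, \<open>L2\<close> of the Laguerre polynomial and its derivatives; Laguerre's equation eliminates \<open>L2\<close>.
\<close>

lemma mode_time_deriv:
  "((\<lambda>t. mode n s t) has_vector_derivative 4 * \<i> * (of_real s * mode2 n s t + mode1 n s t)) (at t)"
proof -
  define p q where "p = 1 + 2 * \<i> * complex_of_real t" and "q = 1 - 2 * \<i> * complex_of_real t"
  define P Q where "P = inverse p" and "Q = inverse q"
  have nz: "p \<noteq> 0" "q \<noteq> 0" unfolding p_def q_def by (rule p_nonzero)+
  then have PQ1: "p * P = 1" "q * Q = 1" by (simp_all add: P_def Q_def)
  have pq: "complex_of_real (inverse (1 + 4 * t\<^sup>2)) = P * Q"
    unfolding P_def Q_def p_def q_def of_real_inverse pq_eq[symmetric] by (rule inverse_mult_distrib)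
  define y where "y = s / (1 + 4 * t\<^sup>2)"
  have y: "complex_of_real y = of_real s * (P * Q)"
    unfolding pq[symmetric] y_def by (simp add: divide_inverse)
  define L0 L1 L2 where "L0 = complex_of_real (poly (laguerre n) y)"
    and "L1 = complex_of_real (poly (pderiv (laguerre n)) y)"
    and "L2 = complex_of_real (poly (pderiv (pderiv (laguerre n))) y)"
  have ode: "of_real y * L2 = - (1 - of_real y) * L1 - of_nat n * L0"
  proof -
    have "poly (pCons 0 (pderiv (pderiv (laguerre n))) + pderiv (laguerre n) - pCons 0 (pderiv (laguerre n))
     + smult (real n) (laguerre n)) y = 0"
      unfolding laguerre_ode by simp
    then have "y * poly (pderiv (pderiv (laguerre n))) y
       = - (1 - y) * poly (pderiv (laguerre n)) y - real n * poly (laguerre n) y"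
      by (simp add: algebra_simps)
    then have "complex_of_real (y * poly (pderiv (pderiv (laguerre n))) y)
       = of_real (- (1 - y) * poly (pderiv (laguerre n)) y - real n * poly (laguerre n) y)" by (rule arg_cong)
    then show ?thesis by (simp add: L0_def L1_def L2_def)
  qed
  have dp: "((\<lambda>z. inverse (1 + 2 * \<i> * z)) has_field_derivative - 2 * \<i> * P\<^sup>2) (at (of_real t))"
    using nz unfolding P_def p_def
    by (auto intro!: derivative_eq_intros simp: power2_eq_square)
  have dpow: "((\<lambda>z. ((1 - 2 * \<i> * z) * inverse (1 + 2 * \<i> * z)) ^ n) has_field_derivative
     (q * P) ^ n * (- 4 * \<i> * of_nat n * P * Q)) (at (of_real t))"
  proof -
    have "((\<lambda>z. (1 - 2 * \<i> * z) * inverse (1 + 2 * \<i> * z)) has_field_derivative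
      q * (- 2 * \<i> * P\<^sup>2) + (- 2 * \<i>) * P) (at (of_real t))"
      unfolding q_def P_def p_def
      by (rule DERIV_cong[OF DERIV_mult[OF _ dp[unfolded P_def p_def]]]) (auto intro!: derivative_eq_intros)
    also have "q * (- 2 * \<i> * P\<^sup>2) + (- 2 * \<i>) * P = - 4 * \<i> * P\<^sup>2"
    proof -
      have "q = 2 - p" by (simp add: p_def q_def)
      then have "q * P = 2 * P - 1" using PQ1(1) by (simp only: left_diff_distrib)
      then have "q * P * P = (2 * P - 1) * P" by (rule arg_cong)
      then have qP2: "q * P\<^sup>2 = 2 * P\<^sup>2 - P" by (simp add: power2_eq_square algebra_simps)
      have "q * (- 2 * \<i> * P\<^sup>2) + (- 2 * \<i>) * P = - 2 * \<i> * (q * P\<^sup>2) - 2 * \<i> * P" by (simp add: mult_ac)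
      then show ?thesis unfolding qP2 by (simp add: algebra_simps)
    qed
    finally have "((\<lambda>z. ((1 - 2 * \<i> * z) * inverse (1 + 2 * \<i> * z)) ^ n) has_field_derivative
      of_nat n * (- 4 * \<i> * P\<^sup>2 * (q * P) ^ (n - Suc 0))) (at (of_real t))"
      using DERIV_power[of "\<lambda>z. (1 - 2 * \<i> * z) * inverse (1 + 2 * \<i> * z)" "- 4 * \<i> * P\<^sup>2" "of_real t" UNIV n]
      by (simp add: P_def p_def q_def)
    moreover have "of_nat n * (- 4 * \<i> * P\<^sup>2 * (q * P) ^ (n - Suc 0)) = (q * P) ^ n * (- 4 * \<i> * of_nat n * P * Q)"
    proof (cases n)
      case (Suc m)
      have "(q * P) ^ n * (- 4 * \<i> * of_nat n * P * Q) = (q * P) ^ m * (- 4 * \<i> * of_nat n * P * P * (q * Q))"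
        by (simp add: Suc mult_ac)
      then show ?thesis unfolding PQ1 by (simp add: Suc power2_eq_square mult_ac)
    qed simp
    ultimately show ?thesis by (simp only:)
  qed
  have dexp: "((\<lambda>z. exp (- of_real s * inverse (2 * (1 + 2 * \<i> * z)))) has_field_derivative
     exp (- of_real s * (P / 2)) * (\<i> * of_real s * P\<^sup>2)) (at (of_real t))"
  proof -
    have "((\<lambda>z. - of_real s * (inverse (1 + 2 * \<i> * z) / 2)) has_field_derivative
      - of_real s * ((- 2 * \<i> * P\<^sup>2) / 2)) (at (of_real t))"
      by (intro DERIV_cmult DERIV_cdivide dp)
    from DERIV_chain2[OF DERIV_exp this]
    show ?thesis by (simp add: P_def p_def field_simps)
  qed
  let ?A = "\<lambda>z. inverse (1 + 2 * \<i> * z) * ((1 - 2 * \<i> * z) * inverse (1 + 2 * \<i> * z)) ^ n * exp (- of_real s * inverse (2 * (1 + 2 * \<i> * z)))"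
  define M where "M = mode_factor n s t"
  have i2: "inverse (2 * (1 + 2 * \<i> * complex_of_real t)) = P / 2"
  proof -
    have "inverse (2 * x) = inverse x / 2" for x :: complex by (cases "x = 0") (simp_all add: field_simps)
    then show ?thesis unfolding P_def p_def .
  qed
  have M: "M = P * (q * P) ^ n * exp (- of_real s * (P / 2))"
    unfolding M_def mode_factor_def i2 unfolding P_def p_def q_def ..
  have dA: "(?A has_field_derivative M * (- 2 * \<i> * P - 4 * \<i> * of_nat n * P * Q + \<i> * of_real s * P\<^sup>2)) (at (of_real t))"
    by (rule DERIV_cong[OF DERIV_mult[OF DERIV_mult[OF dp dpow] dexp]])
       (simp only: i2, simp only: p_def[symmetric] q_def[symmetric], simp only: P_def[symmetric] M,
        simp add: power2_eq_square algebra_simps)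
  have dM: "((\<lambda>t. mode_factor n s t) has_vector_derivative M * (- 2 * \<i> * P - 4 * \<i> * of_nat n * P * Q + \<i> * of_real s * P\<^sup>2)) (at t)"
    unfolding mode_factor_def by (rule has_vector_derivative_real_field[OF dA])
  have dL: "((\<lambda>t. complex_of_real (poly (laguerre n) (s / (1 + 4 * t\<^sup>2)))) has_vector_derivative
      L1 * (- 8 * of_real t * of_real s * (P * Q)\<^sup>2)) (at t)"
  proof -
    have "((\<lambda>t. s / (1 + 4 * t\<^sup>2)) has_real_derivative - 8 * t * s * (inverse (1 + 4 * t\<^sup>2))\<^sup>2) (at t)"
      using c_pos[of t] by (auto intro!: derivative_eq_intros simp: power2_eq_square field_simps)
    from DERIV_chain2[OF poly_DERIV this]
    have "((\<lambda>t. poly (laguerre n) (s / (1 + 4 * t\<^sup>2))) has_real_derivative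
      poly (pderiv (laguerre n)) y * (- 8 * t * s * (inverse (1 + 4 * t\<^sup>2))\<^sup>2)) (at t)" by (simp add: y_def)
    then have "((\<lambda>t. complex_of_real (poly (laguerre n) (s / (1 + 4 * t\<^sup>2)))) has_vector_derivative
      of_real (poly (pderiv (laguerre n)) y * (- 8 * t * s * (inverse (1 + 4 * t\<^sup>2))\<^sup>2))) (at t)"
      by (rule has_vector_derivative_of_real)
    then show ?thesis
      by (simp only: L1_def of_real_mult of_real_power pq of_real_neg_numeral)
  qed
  have t8: "- 8 * complex_of_real t = 4 * \<i> * (1 - q)" by (simp add: q_def)
  have "((\<lambda>t. mode n s t) has_vector_derivative
     M * (L1 * (- 8 * of_real t * of_real s * (P * Q)\<^sup>2))
     + M * (- 2 * \<i> * P - 4 * \<i> * of_nat n * P * Q + \<i> * of_real s * P\<^sup>2) * L0) (at t)"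
    unfolding mode_eq M_def L0_def y_def
    by (rule has_vector_derivative_mult[OF dM[unfolded M_def] dL])
  also have "M * (L1 * (- 8 * of_real t * of_real s * (P * Q)\<^sup>2))
     + M * (- 2 * \<i> * P - 4 * \<i> * of_nat n * P * Q + \<i> * of_real s * P\<^sup>2) * L0
     = 4 * \<i> * (of_real s * mode2 n s t + mode1 n s t)"
  proof -
    have m1: "mode1 n s t = M * (- L0 * (P / 2) + L1 * (P * Q))"
      unfolding mode1_def i2 pq by (simp add: M_def L0_def L1_def y_def)
    have m2: "mode2 n s t = M * (L0 * (P / 2)\<^sup>2 - 2 * L1 * (P * Q) * (P / 2) + L2 * (P * Q)\<^sup>2)"
      unfolding mode2_def i2 pq by (simp add: M_def L0_def L1_def L2_def y_def)
    have sL2: "of_real s * (L2 * (P * Q)\<^sup>2) = (P * Q) * (- (1 - of_real s * (P * Q)) * L1 - of_nat n * L0)"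
      unfolding y[symmetric] ode[symmetric] unfolding y by (simp add: power2_eq_square mult_ac)
    have q1: "(1 - q) * (P * Q)\<^sup>2 = (P * Q)\<^sup>2 - P\<^sup>2 * Q"
    proof -
      have "q * (P * Q)\<^sup>2 = P\<^sup>2 * Q * (q * Q)" by (simp add: power2_eq_square mult_ac)
      then show ?thesis unfolding PQ1 by (simp only: left_diff_distrib mult_1_left mult_1_right)
    qed
    have "L1 * (- 8 * of_real t * of_real s * (P * Q)\<^sup>2) = 4 * \<i> * of_real s * L1 * ((1 - q) * (P * Q)\<^sup>2)"
      unfolding t8 by (simp add: mult_ac)
    then have lhs: "L1 * (- 8 * of_real t * of_real s * (P * Q)\<^sup>2) = 4 * \<i> * of_real s * L1 * ((P * Q)\<^sup>2 - P\<^sup>2 * Q)"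
      unfolding q1 .
    have "of_real s * mode2 n s t + mode1 n s t
      = M * (of_real s * L0 * (P / 2)\<^sup>2 - of_real s * L1 * (P * Q) * P + of_real s * (L2 * (P * Q)\<^sup>2) - L0 * (P / 2) + L1 * (P * Q))"
      unfolding m1 m2 by (simp add: algebra_simps)
    also have "\<dots> = M * (of_real s * L0 * (P / 2)\<^sup>2 - of_real s * L1 * (P * Q) * P
        + (P * Q) * (- (1 - of_real s * (P * Q)) * L1 - of_nat n * L0) - L0 * (P / 2) + L1 * (P * Q))"
      unfolding sL2 ..
    finally have rhs: "of_real s * mode2 n s t + mode1 n s t
      = M * (of_real s * L0 * (P / 2)\<^sup>2 - of_real s * L1 * (P * Q) * P
        + (P * Q) * (- (1 - of_real s * (P * Q)) * L1 - of_nat n * L0) - L0 * (P / 2) + L1 * (P * Q))" .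
    show ?thesis unfolding lhs rhs by (simp add: algebra_simps power2_eq_square)
  qed
  finally show ?thesis .
qed

lemma continuous_inverse_p: "continuous_on UNIV (\<lambda>z::real \<times> real. inverse (1 + 2 * \<i> * complex_of_real (snd z)))"
proof (rule continuous_on_inverse)
  show "continuous_on UNIV (\<lambda>z::real \<times> real. 1 + 2 * \<i> * complex_of_real (snd z))" by (intro continuous_intros)
  show "\<forall>z\<in>UNIV. 1 + 2 * \<i> * complex_of_real (snd z) \<noteq> 0" by (intro ballI p_nonzero)
qed

lemma continuous_inverse_2p: "continuous_on UNIV (\<lambda>z::real \<times> real. inverse (2 * (1 + 2 * \<i> * complex_of_real (snd z))))"
  unfolding inverse_mult_distrib by (intro continuous_on_mult continuous_on_const continuous_inverse_p)

lemma continuous_q: "continuous_on UNIV (\<lambda>z::real \<times> real. 1 - 2 * \<i> * complex_of_real (snd z))"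
  by (intro continuous_intros)

lemma continuous_inverse_c: "continuous_on UNIV (\<lambda>z::real \<times> real. inverse (1 + 4 * (snd z)\<^sup>2))"
proof (rule continuous_on_inverse)
  show "continuous_on UNIV (\<lambda>z::real \<times> real. 1 + 4 * (snd z)\<^sup>2)" by (intro continuous_intros)
  show "\<forall>z\<in>UNIV. 1 + 4 * (snd z)\<^sup>2 \<noteq> (0::real)"
    using c_pos by (metis less_irrefl)
qed

lemma continuous_poly_scaled: "continuous_on UNIV (\<lambda>z::real \<times> real. complex_of_real (poly p (fst z / (1 + 4 * (snd z)\<^sup>2))))"
proof -
  have "continuous_on UNIV (\<lambda>z::real \<times> real. fst z * inverse (1 + 4 * (snd z)\<^sup>2))"
    by (intro continuous_on_mult continuous_inverse_c continuous_on_fst continuous_on_id)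
  then show ?thesis unfolding divide_inverse by (intro continuous_on_of_real continuous_on_poly)
qed

lemmas continuous_mode_intros = continuous_on_mult continuous_on_add continuous_on_diff continuous_on_minus
  continuous_on_power continuous_on_exp continuous_on_const continuous_inverse_p continuous_inverse_2p continuous_q
  continuous_poly_scaled continuous_on_of_real[OF continuous_on_fst[OF continuous_on_id]]
  continuous_on_of_real[OF continuous_inverse_c]

lemma continuous_mode_factor: "continuous_on UNIV (\<lambda>z. mode_factor n (fst z) (snd z))"
  unfolding mode_factor_def by (rule continuous_mode_intros)+

lemma continuous_mode: "continuous_on UNIV (\<lambda>z. mode n (fst z) (snd z))"
  unfolding mode_eq by (rule continuous_mode_factor continuous_mode_intros)+

lemma continuous_mode1: "continuous_on UNIV (\<lambda>z. mode1 n (fst z) (snd z))"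
  unfolding mode1_def by (rule continuous_mode_factor continuous_mode_intros)+

lemma continuous_mode2: "continuous_on UNIV (\<lambda>z. mode2 n (fst z) (snd z))"
  unfolding mode2_def by (rule continuous_mode_factor continuous_mode_intros)+

text \<open>
  Differentiation under the integral sign and Green's formula; the compact support of the test
  function makes all integrals integrals of continuous functions over a box.
\<close>

lemma mode_weak_equation:
  assumes \<phi>: "test_fun \<phi>"
  shows "((\<lambda>\<tau>. \<integral>x. mode n ((norm x)\<^sup>2) \<tau> * \<phi> x \<partial>plane) has_vector_derivative
     \<i> * (\<integral>x. mode n ((norm x)\<^sup>2) t * laplacian \<phi> x \<partial>plane)) (at t)"
proof -
  obtain R where R: "0 < R" "\<And>x. R < norm x \<Longrightarrow> \<phi> x = 0"
    by (rule test_fun_support[OF \<phi>], rule that)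
  have c\<phi>: "continuous_on UNIV \<phi>" by (rule test_fun_continuous(1)[OF \<phi>])
  let ?l = "- R *\<^sub>R One :: real^2" and ?u = "R *\<^sub>R One :: real^2"
  have z: "\<phi> x = 0" if "x \<notin> cbox ?l ?u" for x
    using that norm_le_imp_cbox[of x R] R(2) by (meson not_le)
  define G where "G s t = 4 * \<i> * (of_real s * mode2 n s t + mode1 n s t)" for s t
  have cG: "continuous_on UNIV (\<lambda>z. G (fst z) (snd z))"
    unfolding G_def by (intro continuous_on_mult continuous_on_add continuous_on_const continuous_mode1 continuous_mode2 continuous_on_of_real continuous_on_fst continuous_on_id)
  have cx: "continuous_on UNIV (\<lambda>x::real^2. F ((norm x)\<^sup>2) \<tau>)"
    if "continuous_on UNIV (\<lambda>z::real \<times> real. F (fst z) (snd z))" for F :: "real \<Rightarrow> real \<Rightarrow> complex" and \<tau>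
  proof -
    have "continuous_on UNIV (\<lambda>x::real^2. (\<lambda>z. F (fst z) (snd z)) ((norm x)\<^sup>2, \<tau>))"
      by (rule continuous_on_compose2[OF that]; (intro continuous_intros)?; simp)
    then show ?thesis by simp
  qed
  have i: "(\<integral>x. F ((norm x)\<^sup>2) \<tau> * \<phi> x \<partial>plane) = integral (cbox ?l ?u) (\<lambda>x. F ((norm x)\<^sup>2) \<tau> * \<phi> x)"
    if "continuous_on UNIV (\<lambda>z::real \<times> real. F (fst z) (snd z))" for F :: "real \<Rightarrow> real \<Rightarrow> complex" and \<tau>
    by (rule integral_lborel_cbox(2)[OF continuous_on_mult[OF cx[OF that] c\<phi>]]) (simp add: z)
  have "((\<lambda>\<tau>. integral (cbox ?l ?u) (\<lambda>x. mode n ((norm x)\<^sup>2) \<tau> * \<phi> x)) has_vector_derivative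
     integral (cbox ?l ?u) (\<lambda>x. G ((norm x)\<^sup>2) t * \<phi> x)) (at t within UNIV)"
  proof (rule leibniz_rule_vector_derivative)
    show "((\<lambda>\<tau>. mode n ((norm x)\<^sup>2) \<tau> * \<phi> x) has_vector_derivative G ((norm x)\<^sup>2) \<tau> * \<phi> x) (at \<tau> within UNIV)" for \<tau> x
      unfolding G_def by (intro has_vector_derivative_mult_left mode_time_deriv)
    show "(\<lambda>x. mode n ((norm x)\<^sup>2) \<tau> * \<phi> x) integrable_on cbox ?l ?u" for \<tau>
      by (rule integrable_continuous,
          rule continuous_on_subset[OF continuous_on_mult[OF cx[OF continuous_mode] c\<phi>]]) simp
    have "continuous_on (UNIV \<times> cbox ?l ?u) (\<lambda>z. (\<lambda>z. G (fst z) (snd z)) ((norm (snd z))\<^sup>2, fst z) * \<phi> (snd z))"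
      by (rule continuous_on_mult[OF continuous_on_compose2[OF cG] continuous_on_compose2[OF c\<phi>]];
          (intro continuous_intros)?; simp)
    then show "continuous_on (UNIV \<times> cbox ?l ?u) (\<lambda>(\<tau>, x). G ((norm x)\<^sup>2) \<tau> * \<phi> x)"
      by (simp add: case_prod_unfold)
  qed auto
  then have "((\<lambda>\<tau>. \<integral>x. mode n ((norm x)\<^sup>2) \<tau> * \<phi> x \<partial>plane) has_vector_derivative
     (\<integral>x. G ((norm x)\<^sup>2) t * \<phi> x \<partial>plane)) (at t)"
    by (simp add: i[OF continuous_mode] i[OF cG])
  also have "(\<integral>x. G ((norm x)\<^sup>2) t * \<phi> x \<partial>plane)
     = (\<integral>x. \<i> * (4 * (of_real ((norm x)\<^sup>2) * mode2 n ((norm x)\<^sup>2) t + mode1 n ((norm x)\<^sup>2) t) * \<phi> x) \<partial>plane)"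
    by (intro Bochner_Integration.integral_cong) (simp_all add: G_def mult_ac)
  also have "\<dots> = \<i> * (\<integral>x. 4 * (of_real ((norm x)\<^sup>2) * mode2 n ((norm x)\<^sup>2) t + mode1 n ((norm x)\<^sup>2) t) * \<phi> x \<partial>plane)"
    by (rule integral_mult_right_zero)
  also have "(\<integral>x. 4 * (of_real ((norm x)\<^sup>2) * mode2 n ((norm x)\<^sup>2) t + mode1 n ((norm x)\<^sup>2) t) * \<phi> x \<partial>plane)
     = (\<integral>x. mode n ((norm x)\<^sup>2) t * laplacian \<phi> x \<partial>plane)"
  proof (rule green_radial[OF mode_deriv1 mode_deriv2 _ \<phi>, symmetric])
    have "continuous_on UNIV (\<lambda>s. (\<lambda>z. mode2 n (fst z) (snd z)) (s, t))"
      by (rule continuous_on_compose2[OF continuous_mode2]; (intro continuous_intros)?; simp)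
    then show "continuous_on UNIV (\<lambda>s. mode2 n s t)" by simp
  qed
  finally show ?thesis .
qed

text \<open>
  The lens transform. Apart from a dilation by \<open>c = 1 + 4t\<^sup>2\<close>, an amplitude and a quadratic phase,
  which are the same for all \<open>n\<close>, the evolution multiplies the \<open>n\<close>-th Laguerre function by the
  \<open>n\<close>-th power of a point on the unit circle, as for a harmonic oscillator.
\<close>

lemma mode_lens:
  "mode n s t = inverse (1 + 2 * \<i> * of_real t) * exp (\<i> * of_real (t * s / (1 + 4 * t\<^sup>2)))
     * (((1 - 2 * \<i> * of_real t) * inverse (1 + 2 * \<i> * of_real t)) ^ n * lagfun n (s / (1 + 4 * t\<^sup>2)))"
proof -
  let ?p = "1 + 2 * \<i> * complex_of_real t" and ?q = "1 - 2 * \<i> * complex_of_real t" and ?c = "1 + 4 * t\<^sup>2"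
  have c0: "complex_of_real ?c \<noteq> 0" using c_pos[of t] by (simp only: of_real_eq_0_iff)
  have ip: "inverse ?p = ?q / of_real ?c"
  proof -
    have "inverse p = q / (p * q)" if "q \<noteq> 0" for p q :: complex
      using that by (cases "p = 0") (simp_all add: field_simps)
    from this[OF p_nonzero(2)[of t], of "1 + 2 * \<i> * of_real t"] show ?thesis unfolding pq_eq .
  qed
  have "- of_real s * inverse (2 * ?p) = - of_real s * ?q / (2 * of_real ?c)"
  proof -
    have "- S * (inverse 2 * (Q / C)) = - S * Q / (2 * C)" for S Q C :: complex by simp
    then show ?thesis unfolding inverse_mult_distrib ip .
  qed
  also have "\<dots> = \<i> * of_real (t * s / ?c) + - of_real (s / ?c / 2)"
  proof -
    have "- S * (1 - 2 * \<i> * T) / (2 * C) = \<i> * (T * S / C) + - (S / C / 2)" if "C \<noteq> 0" for S T C :: complex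
      using that by (simp add: field_simps)
    from this[OF c0, of "of_real s" "of_real t"] show ?thesis by (simp only: of_real_divide of_real_mult of_real_numeral)
  qed
  finally have "exp (- of_real s * inverse (2 * ?p)) = exp (\<i> * of_real (t * s / ?c)) * exp (- complex_of_real (s / ?c / 2))"
    by (simp only: exp_add)
  then show ?thesis unfolding mode_def lagfun_def by (simp only: mult_ac)
qed

section \<open>Superpositions of modes\<close>

text \<open>
  As \<open>t\<close> runs through the real line, this point runs once around the unit circle, starting and
  ending at \<open>-1\<close>.
\<close>

definition omega :: "real \<Rightarrow> complex" where
  "omega t = (1 - 2 * \<i> * of_real t) * inverse (1 + 2 * \<i> * of_real t)"

lemma cmod_p: "(cmod (1 + 2 * \<i> * of_real t))\<^sup>2 = 1 + 4 * t\<^sup>2"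
  unfolding cmod_power2 by (simp add: power2_eq_square)

lemma cmod_inverse_p: "(cmod (inverse (1 + 2 * \<i> * of_real t)))\<^sup>2 = inverse (1 + 4 * t\<^sup>2)"
  unfolding norm_inverse power_inverse cmod_p ..

lemma cmod_omega: "cmod (omega t) = 1"
proof -
  have "cmod (1 - 2 * \<i> * of_real t) = cmod (cnj (1 + 2 * \<i> * of_real t))" by simp
  then show ?thesis
    unfolding omega_def norm_mult norm_inverse using p_nonzero[of t] by (simp only: complex_mod_cnj) simp
qed

lemma cmod_omega_power: "cmod (omega t ^ n) = 1"
  by (simp add: norm_power cmod_omega)

lemma mode_sum_lens:
  "(\<Sum>n\<in>J. c n * mode n s t) = inverse (1 + 2 * \<i> * of_real t) * exp (\<i> * of_real (t * s / (1 + 4 * t\<^sup>2)))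
     * (\<Sum>n\<in>J. (c n * omega t ^ n) * lagfun n (s / (1 + 4 * t\<^sup>2)))"
  unfolding mode_lens omega_def[symmetric] sum_distrib_left by (intro sum.cong refl) (simp only: mult_ac)

lemma cmod_mode_sum:
  "(cmod (\<Sum>n\<in>J. c n * mode n s t))\<^sup>2
    = inverse (1 + 4 * t\<^sup>2) * (cmod (\<Sum>n\<in>J. (c n * omega t ^ n) * lagfun n (s / (1 + 4 * t\<^sup>2))))\<^sup>2"
  unfolding mode_sum_lens norm_mult power_mult_distrib cmod_inverse_p by (simp del: of_real_divide of_real_mult)

lemma borel_measurable_mode [measurable]: "(\<lambda>s. mode n s t) \<in> borel_measurable borel"
proof -
  have "continuous_on UNIV (\<lambda>s. (\<lambda>z. mode n (fst z) (snd z)) (s, t))"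
    by (rule continuous_on_compose2[OF continuous_mode]; (intro continuous_intros)?; simp)
  then show ?thesis by (intro borel_measurable_continuous_onI) simp
qed

text \<open>
  Conservation of the norm: the square of the amplitude in the lens transform is \<open>1/c\<close> and cancels
  the Jacobian \<open>c\<close> of the dilation, and the phases \<open>omega t ^ n\<close> do not change the moduli of the
  coefficients.
\<close>

lemma nsq_mode_sum:
  assumes "finite J"
  shows "nsq plane (\<lambda>x. \<Sum>n\<in>J. c n * mode n ((norm x)\<^sup>2) t) = ennreal (pi * (\<Sum>n\<in>J. (cmod (c n))\<^sup>2))"
proof -
  let ?c = "1 + 4 * t\<^sup>2"
  let ?f = "\<lambda>s. \<Sum>n\<in>J. (c n * omega t ^ n) * lagfun n s"
  have "nsq plane (\<lambda>x. \<Sum>n\<in>J. c n * mode n ((norm x)\<^sup>2) t) = ennreal pi * nsq half (\<lambda>s. \<Sum>n\<in>J. c n * mode n s t)"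
    by (rule nsq_norm_sq) measurable
  also have "nsq half (\<lambda>s. \<Sum>n\<in>J. c n * mode n s t)
      = (\<integral>\<^sup>+ s. ennreal (inverse ?c) * ennreal ((cmod (?f (s / ?c)))\<^sup>2) \<partial>half)"
    unfolding nsq_def cmod_mode_sum using c_pos[of t] by (intro nn_integral_cong) (simp add: ennreal_mult)
  also have "\<dots> = ennreal (inverse ?c) * (\<integral>\<^sup>+ s. ennreal ((cmod (?f (s / ?c)))\<^sup>2) \<partial>half)"
    by (rule nn_integral_cmult) measurable
  also have "(\<integral>\<^sup>+ s. ennreal ((cmod (?f (s / ?c)))\<^sup>2) \<partial>half) = ennreal ?c * nsq half ?f"
    unfolding nsq_def by (rule nn_integral_half_scale[OF _ c_pos]) measurable
  also have "nsq half ?f = ennreal (1 * (\<Sum>n\<in>J. (cmod (c n * omega t ^ n))\<^sup>2))"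
    by (rule nsq_orthogonal_sum) (auto simp: nsq_lagfun_finite lagfun_orthonormal[simplified] assms)
  also have "(\<Sum>n\<in>J. (cmod (c n * omega t ^ n))\<^sup>2) = (\<Sum>n\<in>J. (cmod (c n))\<^sup>2)"
    by (simp only: norm_mult cmod_omega_power mult_1_right)
  also have "ennreal (inverse ?c) * (ennreal ?c * ennreal (1 * (\<Sum>n\<in>J. (cmod (c n))\<^sup>2))) = ennreal (\<Sum>n\<in>J. (cmod (c n))\<^sup>2)"
  proof -
    have *: "ennreal (inverse c) * (ennreal c * ennreal (1 * X)) = ennreal X" if "0 < c" "0 \<le> X" for c X :: real
      using that by (simp add: ennreal_mult[symmetric])
    show ?thesis by (rule *[OF c_pos]) (simp add: sum_nonneg)
  qed
  finally show ?thesis by (simp add: ennreal_mult sum_nonneg)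
qed

definition partial :: "(nat \<Rightarrow> complex) \<Rightarrow> nat \<Rightarrow> real ^ 2 \<Rightarrow> real \<Rightarrow> complex" where
  "partial a K x t = (\<Sum>n<K. a n * mode n ((norm x)\<^sup>2) t)"

lemma continuous_partial: "continuous_on UNIV (\<lambda>p. partial a K (fst p) (snd p))"
proof -
  have "continuous_on UNIV (\<lambda>p::(real^2) \<times> real. (\<lambda>z. mode n (fst z) (snd z)) ((norm (fst p))\<^sup>2, snd p))" for n
    by (rule continuous_on_compose2[OF continuous_mode]; (intro continuous_intros)?; simp)
  then have *: "continuous_on UNIV (\<lambda>p::(real^2) \<times> real. mode n ((norm (fst p))\<^sup>2) (snd p))" for n
    unfolding fst_conv snd_conv .
  show ?thesis unfolding partial_def by (rule continuous_on_sum, rule continuous_on_mult, rule continuous_on_const, rule *)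
qed

lemma continuous_partial_time: "continuous_on UNIV (\<lambda>t. partial a K x t)"
proof -
  have "continuous_on UNIV (\<lambda>t. (\<lambda>p. partial a K (fst p) (snd p)) (x, t))"
    by (rule continuous_on_compose2[OF continuous_partial]; (intro continuous_intros)?; simp)
  then show ?thesis by simp
qed

lemma borel_measurable_partial [measurable]: "(\<lambda>p. partial a K (fst p) (snd p)) \<in> borel_measurable borel"
  by (rule borel_measurable_continuous_onI[OF continuous_partial])

lemma borel_measurable_partial_space [measurable]: "(\<lambda>x. partial a K x t) \<in> borel_measurable borel"
  unfolding partial_def by measurable

lemma nsq_partial: "nsq plane (\<lambda>x. partial a K x t) = ennreal (pi * (\<Sum>n<K. (cmod (a n))\<^sup>2))"
  unfolding partial_def by (rule nsq_mode_sum) simp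

lemma partial_diff:
  assumes "K \<le> K'"
  shows "partial a K' x t - partial a K x t = (\<Sum>n\<in>{K..<K'}. a n * mode n ((norm x)\<^sup>2) t)"
proof -
  have "{..<K'} = {..<K} \<union> {K..<K'}" using assms by auto
  then have "partial a K' x t = (\<Sum>n\<in>{..<K} \<union> {K..<K'}. a n * mode n ((norm x)\<^sup>2) t)"
    unfolding partial_def by (rule arg_cong)
  also have "\<dots> = partial a K x t + (\<Sum>n\<in>{K..<K'}. a n * mode n ((norm x)\<^sup>2) t)"
    unfolding partial_def by (rule sum.union_disjoint) auto
  finally have "partial a K' x t = partial a K x t + (\<Sum>n\<in>{K..<K'}. a n * mode n ((norm x)\<^sup>2) t)" .
  then show ?thesis by simp
qed

text \<open>
  The weighted sum \<open>\<Sum> 4\<^sup>j |F\<^sub>j\<^sub>+\<^sub>1 - F\<^sub>j|\<^sup>2\<close> has a finite integral. So it is finite almost everywhere, and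
  there the differences are dominated by a multiple of \<open>2\<^bsup>-j\<^esup>\<close>.
\<close>

lemma AE_convergent_if_fast:
  fixes F :: "nat \<Rightarrow> 'a \<Rightarrow> complex"
  assumes [measurable]: "\<And>j. F j \<in> borel_measurable M" and C: "0 \<le> C"
    and fast: "\<And>j. nsq M (\<lambda>x. F (Suc j) x - F j x) \<le> ennreal (C * (1/8) ^ j)"
  shows "AE x in M. convergent (\<lambda>j. F j x)"
proof -
  define d where "d j x = F (Suc j) x - F j x" for j x
  have [measurable]: "d j \<in> borel_measurable M" for j unfolding d_def by measurable
  define G where "G x = (\<Sum>j. ennreal (4 ^ j * (cmod (d j x))\<^sup>2))" for x
  have "(\<integral>\<^sup>+ x. G x \<partial>M) = (\<Sum>j. \<integral>\<^sup>+ x. ennreal (4 ^ j * (cmod (d j x))\<^sup>2) \<partial>M)"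
    unfolding G_def by (rule nn_integral_suminf) measurable
  also have "\<dots> \<le> (\<Sum>j. ennreal (C * (1/2) ^ j))"
  proof (intro suminf_le summableI)
    fix j
    have "(\<integral>\<^sup>+ x. ennreal (4 ^ j * (cmod (d j x))\<^sup>2) \<partial>M) = ennreal (4 ^ j) * nsq M (d j)"
      by (simp add: nsq_def nn_integral_cmult ennreal_mult)
    also have "\<dots> \<le> ennreal (4 ^ j) * ennreal (C * (1/8) ^ j)"
      using fast[of j] by (intro mult_left_mono) (simp_all add: d_def[abs_def])
    also have "\<dots> = ennreal (4 ^ j * (C * (1/8) ^ j))" using C by (intro ennreal_mult[symmetric]) auto
    also have "4 ^ j * (C * (1/8) ^ j) = C * (1/2) ^ j"
    proof -
      have "(4::real) ^ j * (1/8) ^ j = (1/2) ^ j" by (simp flip: power_mult_distrib)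
      then show ?thesis by simp
    qed
    finally show "(\<integral>\<^sup>+ x. ennreal (4 ^ j * (cmod (d j x))\<^sup>2) \<partial>M) \<le> ennreal (C * (1/2) ^ j)" .
  qed
  also have "\<dots> = ennreal (\<Sum>j. C * (1/2) ^ j)"
    using C by (intro suminf_ennreal2 summable_mult summable_geometric) auto
  finally have "(\<integral>\<^sup>+ x. G x \<partial>M) < \<infinity>" by (rule le_less_trans) simp
  then have "AE x in M. G x \<noteq> \<infinity>"
    unfolding G_def by (intro nn_integral_PInf_AE) auto
  then show ?thesis
  proof eventually_elim
    case (elim x)
    define B where "B = enn2real (G x)"
    have B: "G x = ennreal B" "0 \<le> B" using elim by (simp_all add: B_def less_top)
    have "cmod (d j x) \<le> sqrt B * (1/2) ^ j" for j
    proof -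
      have "ennreal (4 ^ j * (cmod (d j x))\<^sup>2) = (\<Sum>i\<in>{j}. ennreal (4 ^ i * (cmod (d i x))\<^sup>2))" by simp
      also have "\<dots> \<le> G x" unfolding G_def by (rule sum_le_suminf) auto
      finally have "4 ^ j * (cmod (d j x))\<^sup>2 \<le> B" using B by simp
      moreover have "4 ^ j * (cmod (d j x))\<^sup>2 = (2 ^ j * cmod (d j x))\<^sup>2"
      proof -
        have "((2::real) ^ j)\<^sup>2 = 4 ^ j" by (simp add: power2_eq_square flip: power_mult_distrib)
        then show ?thesis by (simp add: power_mult_distrib)
      qed
      ultimately have "2 ^ j * cmod (d j x) \<le> sqrt B" by (simp add: real_le_rsqrt)
      then show ?thesis by (simp add: field_simps power_divide)
    qed
    note le = this
    have "summable (\<lambda>j. sqrt B * (1/2) ^ j)" by (rule summable_mult) (simp add: summable_geometric)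
    then have "summable (\<lambda>j. d j x)"
      by (rule summable_comparison_test'[where N = 0]) (rule le)
    then have "convergent (\<lambda>n. \<Sum>j<n. d j x)" by (simp add: summable_iff_convergent)
    then have "convergent (\<lambda>n. (\<Sum>j<n. d j x) + F 0 x)" by (intro convergent_add convergent_const)
    moreover have "(\<Sum>j<n. d j x) + F 0 x = F n x" for n
      using sum_lessThan_telescope[of "\<lambda>j. F j x" n] by (simp add: d_def)
    ultimately show ?case by simp
  qed
qed

lemma tendsto_ennreal_0I:
  fixes f :: "'a \<Rightarrow> ennreal"
  assumes "\<And>e. 0 < e \<Longrightarrow> \<forall>\<^sub>F x in F. f x \<le> ennreal e"
  shows "(f \<longlongrightarrow> 0) F"
proof (rule order_tendstoI)
  fix e :: ennreal assume "0 < e"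
  then obtain e' where e': "0 < e'" "e' < e" using dense by blast
  then have "e' < top" using less_top_ennreal by (metis less_trans top.not_eq_extremum not_top_less)
  then obtain d where d: "e' = ennreal d" "0 < d" using e'(1) by (cases e') auto
  show "\<forall>\<^sub>F x in F. f x < e"
    using assms[OF d(2)] by eventually_elim (use d e' in auto)
qed simp

section \<open>The solution with given Laguerre coefficients\<close>

text \<open>
  A flow that is a Borel function of \<open>(x, t)\<close> is wanted, while the Laguerre series converges in \<open>L\<^sup>2\<close>
  for each time only. The sequence \<open>r\<close> selects partial sums so quickly convergent that they converge
  almost everywhere as well; \<open>j \<le> r j\<close> ensures that they exhaust the series.
\<close>

locale square_summable =
  fixes a :: "nat \<Rightarrow> complex" and r :: "nat \<Rightarrow> nat"
  assumes summ: "summable (\<lambda>n. (cmod (a n))\<^sup>2)"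
    and r_ge: "\<And>j. j \<le> r j"
    and fast: "\<And>j. (\<Sum>n. (cmod (a (n + r j)))\<^sup>2) \<le> (1/8) ^ j"
begin

definition tail :: "nat \<Rightarrow> real" where
  "tail K = (\<Sum>n. (cmod (a (n + K)))\<^sup>2)"

lemma summ_shift: "summable (\<lambda>n. (cmod (a (n + K)))\<^sup>2)"
  using summ summable_iff_shift[of "\<lambda>n. (cmod (a n))\<^sup>2" K] by simp

lemma tail_nonneg: "0 \<le> tail K"
  unfolding tail_def by (intro suminf_nonneg summ_shift) simp

lemma tail_tendsto: "tail \<longlonglongrightarrow> 0"
  using suminf_exist_split[OF _ summ] unfolding LIMSEQ_iff tail_def by fastforce

lemma sum_le_tail: "(\<Sum>n\<in>{K..<K'}. (cmod (a n))\<^sup>2) \<le> tail K"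
proof (cases "K \<le> K'")
  case True
  have "(\<Sum>n\<in>{K..<K'}. (cmod (a n))\<^sup>2) = (\<Sum>n\<in>{0..<K' - K}. (cmod (a (n + K)))\<^sup>2)"
    using sum.shift_bounds_nat_ivl[of "\<lambda>n. (cmod (a n))\<^sup>2" 0 K "K' - K"] True by simp
  also have "\<dots> \<le> tail K" unfolding tail_def by (intro sum_le_suminf summ_shift) auto
  finally show ?thesis .
qed (simp add: tail_nonneg)

lemma nsq_partial_diff_le:
  assumes "K \<le> K'"
  shows "nsq plane (\<lambda>x. partial a K' x t - partial a K x t) \<le> ennreal (pi * tail K)"
  unfolding partial_diff[OF assms]
  by (subst nsq_mode_sum) (auto intro!: ennreal_leI mult_left_mono sum_le_tail)

text \<open>
  Where the partial sums diverge, a null set for each time, this is an unspecified value that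
  depends measurably on the point, so that the function is Borel on all of space-time.
\<close>

definition flow :: "(real ^ 2) \<times> real \<Rightarrow> complex" where
  "flow p = lim (\<lambda>j. partial a (r j) (fst p) (snd p))"

lemma borel_measurable_flow [measurable]: "flow \<in> borel_measurable borel"
  unfolding flow_def[abs_def] by (rule borel_measurable_lim_metric) measurable

lemma borel_measurable_flow_space [measurable]: "(\<lambda>x. flow (x, t)) \<in> borel_measurable borel"
  by measurable

lemma flow_converges: "AE x in plane. (\<lambda>j. partial a (r j) x t) \<longlonglongrightarrow> flow (x, t)"
proof -
  have "AE x in plane. convergent (\<lambda>j. partial a (r j) x t)"
  proof (rule AE_convergent_if_fast[where C = pi])
    fix j
    have *: "tail (r j) \<le> (1/8) ^ j" "tail (r (Suc j)) \<le> (1/8) ^ j"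
      using fast[of j] fast[of "Suc j"] tail_nonneg[of "r (Suc j)"] unfolding tail_def by auto
    have "nsq plane (\<lambda>x. partial a (r (Suc j)) x t - partial a (r j) x t) \<le> ennreal (pi * tail (min (r j) (r (Suc j))))"
    proof (cases "r j \<le> r (Suc j)")
      case False
      then show ?thesis
        by (subst nsq_diff_commute) (simp add: nsq_partial_diff_le min_def)
    qed (simp add: nsq_partial_diff_le min_def)
    also have "\<dots> \<le> ennreal (pi * (1/8) ^ j)"
      using * by (intro ennreal_leI mult_left_mono) (auto simp: min_def)
    finally show "nsq plane (\<lambda>x. partial a (r (Suc j)) x t - partial a (r j) x t) \<le> ennreal (pi * (1/8) ^ j)" .
  qed simp_all
  then show ?thesis by eventually_elim (simp add: flow_def convergent_LIMSEQ_iff)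
qed

text \<open>
  The bound does not depend on time; the continuity in time and the weak equation for the flow both
  rest on this.
\<close>

lemma nsq_flow_partial: "nsq plane (\<lambda>x. flow (x, t) - partial a K x t) \<le> ennreal (pi * tail K)"
proof (rule nsq_Fatou[where F = "\<lambda>j x. partial a (r j) x t - partial a K x t"])
  show "AE x in plane. (\<lambda>j. partial a (r j) x t - partial a K x t) \<longlonglongrightarrow> flow (x, t) - partial a K x t"
    using flow_converges[of t] by eventually_elim (intro tendsto_intros)
  show "\<forall>\<^sub>F j in sequentially. nsq plane (\<lambda>x. partial a (r j) x t - partial a K x t) \<le> ennreal (pi * tail K)"
    using eventually_ge_at_top[of K]
  proof eventually_elim
    case (elim j)
    then have "K \<le> r j" using r_ge[of j] by linarith
    then show ?case by (rule nsq_partial_diff_le)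
  qed
qed measurable

lemma nsq_flow_finite: "nsq plane (\<lambda>x. flow (x, t)) < top"
  using nsq_flow_partial[of t 0] by (simp add: partial_def le_less_trans)

lemma nsq_partial_finite: "nsq plane (\<lambda>x. partial a K x t) < top"
  by (simp add: nsq_partial)

text \<open>
  Partial sums are pointwise continuous in time and have constant norm.
\<close>

lemma partial_continuous_in_time:
  "((\<lambda>t. nsq plane (\<lambda>x. partial a K x t - partial a K x s)) \<longlongrightarrow> 0) (at s)"
  unfolding tendsto_at_iff_sequentially comp_def
proof (intro allI impI)
  fix T :: "nat \<Rightarrow> real" assume "T \<longlonglongrightarrow> s"
  then show "(\<lambda>j. nsq plane (\<lambda>x. partial a K x (T j) - partial a K x s)) \<longlonglongrightarrow> 0"
    using continuous_partial_time
    by (intro nsq_tendsto_0_if_norms_eq[OF _ _ _ nsq_partial nsq_partial])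
       (auto simp: continuous_on_eq_continuous_at isCont_tendsto_compose)
qed

lemma flow_continuous_in_time:
  "((\<lambda>t. nsq plane (\<lambda>x. flow (x, t) - flow (x, s))) \<longlongrightarrow> 0) (at s)"
proof (rule tendsto_ennreal_0I)
  fix e :: real assume e: "0 < e"
  have "(\<lambda>K. 8 * (pi * tail K)) \<longlonglongrightarrow> 8 * (pi * 0)" by (intro tendsto_intros tail_tendsto)
  then have "\<forall>\<^sub>F K in sequentially. 8 * (pi * tail K) < e / 2"
    using e by (intro order_tendstoD(2)[where y = 0]) auto
  then obtain K where K: "8 * (pi * tail K) < e / 2" by (auto simp: eventually_sequentially)
  \<comment> \<open>The truncation error, uniform in time, uses up at most half of \<open>e\<close>; the rest is continuity of
    one partial sum.\<close>
  have "\<forall>\<^sub>F t in at s. nsq plane (\<lambda>x. partial a K x t - partial a K x s) < ennreal (e / 4)"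
    using e by (intro order_tendstoD(2)[OF partial_continuous_in_time]) simp
  then show "\<forall>\<^sub>F t in at s. nsq plane (\<lambda>x. flow (x, t) - flow (x, s)) \<le> ennreal e"
  proof eventually_elim
    case (elim t)
    have "nsq plane (\<lambda>x. flow (x, t) - flow (x, s))
      = nsq plane (\<lambda>x. (partial a K x t - partial a K x s)
         + ((flow (x, t) - partial a K x t) - (flow (x, s) - partial a K x s)))"
      by (simp add: algebra_simps)
    also have "\<dots> \<le> 2 * nsq plane (\<lambda>x. partial a K x t - partial a K x s)
       + 2 * nsq plane (\<lambda>x. (flow (x, t) - partial a K x t) - (flow (x, s) - partial a K x s))"
      by (rule nsq_add_le) measurable
    also have "\<dots> \<le> 2 * ennreal (e / 4) + 2 * (2 * ennreal (pi * tail K) + 2 * ennreal (pi * tail K))"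
    proof (intro add_mono mult_left_mono)
      have "nsq plane (\<lambda>x. (flow (x, t) - partial a K x t) - (flow (x, s) - partial a K x s))
        \<le> 2 * nsq plane (\<lambda>x. flow (x, t) - partial a K x t) + 2 * nsq plane (\<lambda>x. flow (x, s) - partial a K x s)"
        by (rule nsq_diff_le) measurable
      also have "\<dots> \<le> 2 * ennreal (pi * tail K) + 2 * ennreal (pi * tail K)"
        by (intro add_mono mult_left_mono nsq_flow_partial) auto
      finally show "nsq plane (\<lambda>x. (flow (x, t) - partial a K x t) - (flow (x, s) - partial a K x s))
        \<le> 2 * ennreal (pi * tail K) + 2 * ennreal (pi * tail K)" .
    qed (use elim in auto)
    also have "\<dots> = ennreal (2 * (e / 4) + 2 * (2 * (pi * tail K) + 2 * (pi * tail K)))"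
    proof -
      have m2: "2 * ennreal x = ennreal (2 * x)" for x by (simp add: ennreal_mult')
      define X where "X = pi * tail K"
      have X: "0 \<le> X" by (simp add: X_def tail_nonneg)
      have "2 * ennreal X + 2 * ennreal X = ennreal (2 * X + 2 * X)"
        using X unfolding m2 by (subst ennreal_plus[symmetric]) auto
      then have "2 * ennreal (e / 4) + 2 * (2 * ennreal X + 2 * ennreal X) = ennreal (2 * (e / 4)) + ennreal (2 * (2 * X + 2 * X))"
        by (simp only: m2)
      also have "\<dots> = ennreal (2 * (e / 4) + 2 * (2 * X + 2 * X))"
        using X e by (subst ennreal_plus[symmetric]) auto
      finally show ?thesis unfolding X_def .
    qed
    also have "\<dots> \<le> ennreal e" using K by (intro ennreal_leI) simp
    finally show ?case .
  qed
qed

lemma nsq_compact_support_finite: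
  fixes \<psi> :: "real ^ 2 \<Rightarrow> complex"
  assumes "continuous_on UNIV \<psi>" "\<And>x. R < norm x \<Longrightarrow> \<psi> x = 0"
  shows "nsq plane \<psi> < top"
proof -
  have z: "\<psi> x = 0" if "x \<notin> cbox (- R *\<^sub>R One) (R *\<^sub>R One)" for x
    using that norm_le_imp_cbox[of x R] assms(2) by (meson not_le)
  have "integrable plane (\<lambda>x. \<psi> x * cnj (\<psi> x))"
    by (rule integral_lborel_cbox(1)[of _ "- R *\<^sub>R One" "R *\<^sub>R One"])
       (intro continuous_on_mult continuous_on_cnj assms(1), simp add: z)
  then have "(\<integral>\<^sup>+ x. ennreal (norm (\<psi> x * cnj (\<psi> x))) \<partial>plane) < \<infinity>" by (simp add: integrable_iff_bounded)
  then show ?thesis by (simp add: nsq_def norm_mult power2_eq_square)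
qed

lemma partial_weak_equation:
  assumes \<phi>: "test_fun \<phi>"
  shows "((\<lambda>\<tau>. \<integral>x. partial a K x \<tau> * \<phi> x \<partial>plane) has_vector_derivative
     \<i> * (\<integral>x. partial a K x t * laplacian \<phi> x \<partial>plane)) (at t)"
proof -
  obtain R where R: "0 < R" "\<And>x. R < norm x \<Longrightarrow> \<phi> x = 0"
    "\<And>x v. R < norm x \<Longrightarrow> frechet_derivative \<phi> (at x) v = 0"
    "\<And>x v w. R < norm x \<Longrightarrow> frechet_derivative (\<lambda>y. frechet_derivative \<phi> (at y) v) (at x) w = 0"
    using test_fun_support[OF \<phi>] by blast
  have Rl: "laplacian \<phi> x = 0" if "R < norm x" for x using R(4)[OF that] by (simp add: laplacian_def)
  note c = test_fun_continuous[OF \<phi>]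
  have m: "(\<lambda>x. mode n ((norm x)\<^sup>2) \<tau>) \<in> borel_measurable plane" for n \<tau> by measurable
  have fm: "nsq plane (\<lambda>x. mode n ((norm x)\<^sup>2) \<tau>) < top" for n \<tau>
    using nsq_mode_sum[of "{n}" "\<lambda>_. 1" \<tau>] by simp
  have i: "integrable plane (\<lambda>x. mode n ((norm x)\<^sup>2) \<tau> * \<psi> x)" if "\<psi> \<in> {\<phi>, laplacian \<phi>}" for n \<tau> \<psi>
    using that c R Rl by (intro integrable_mult_nsq fm m nsq_compact_support_finite[of _ R]) (auto intro: borel_measurable_continuous_onI)
  have e: "(\<integral>x. partial a K x \<tau> * \<psi> x \<partial>plane) = (\<Sum>n<K. a n * (\<integral>x. mode n ((norm x)\<^sup>2) \<tau> * \<psi> x \<partial>plane))"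
    if "\<psi> \<in> {\<phi>, laplacian \<phi>}" for \<tau> \<psi>
  proof -
    have "(\<integral>x. partial a K x \<tau> * \<psi> x \<partial>plane) = (\<integral>x. (\<Sum>n<K. a n * (mode n ((norm x)\<^sup>2) \<tau> * \<psi> x)) \<partial>plane)"
      unfolding partial_def sum_distrib_right by (simp only: mult.assoc)
    also have "\<dots> = (\<Sum>n<K. \<integral>x. a n * (mode n ((norm x)\<^sup>2) \<tau> * \<psi> x) \<partial>plane)"
      by (rule Bochner_Integration.integral_sum) (intro integrable_mult_right i that)
    finally show ?thesis by (simp only: integral_mult_right_zero)
  qed
  have "((\<lambda>\<tau>. \<Sum>n<K. a n * (\<integral>x. mode n ((norm x)\<^sup>2) \<tau> * \<phi> x \<partial>plane)) has_vector_derivative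
     (\<Sum>n<K. a n * (\<i> * (\<integral>x. mode n ((norm x)\<^sup>2) t * laplacian \<phi> x \<partial>plane)))) (at t)"
    by (intro has_vector_derivative_sum has_vector_derivative_mult_right mode_weak_equation \<phi>)
  also have "(\<Sum>n<K. a n * (\<i> * (\<integral>x. mode n ((norm x)\<^sup>2) t * laplacian \<phi> x \<partial>plane)))
     = \<i> * (\<integral>x. partial a K x t * laplacian \<phi> x \<partial>plane)"
    unfolding e[of "laplacian \<phi>", simplified] sum_distrib_left by (intro sum.cong refl) (simp only: mult.left_commute)
  finally show ?thesis by (simp add: e)
qed

text \<open>
  The pairings of the partial sums with a test function converge, and their time derivatives
  converge uniformly in time.
\<close>

lemma flow_weak_equation:
  assumes \<phi>: "test_fun \<phi>"
  shows "((\<lambda>\<tau>. \<integral>x. flow (x, \<tau>) * \<phi> x \<partial>plane) has_vector_derivative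
     \<i> * (\<integral>x. flow (x, t) * laplacian \<phi> x \<partial>plane)) (at t)"
proof -
  obtain R where R: "0 < R" "\<And>x. R < norm x \<Longrightarrow> \<phi> x = 0"
    "\<And>x v. R < norm x \<Longrightarrow> frechet_derivative \<phi> (at x) v = 0"
    "\<And>x v w. R < norm x \<Longrightarrow> frechet_derivative (\<lambda>y. frechet_derivative \<phi> (at y) v) (at x) w = 0"
    using test_fun_support[OF \<phi>] by blast
  have Rl: "laplacian \<phi> x = 0" if "R < norm x" for x using R(4)[OF that] by (simp add: laplacian_def)
  note c = test_fun_continuous[OF \<phi>]
  have fin: "nsq plane \<phi> < top" "nsq plane (laplacian \<phi>) < top"
    using c R Rl by (auto intro: nsq_compact_support_finite[of _ R])
  have [measurable]: "\<phi> \<in> borel_measurable borel" "laplacian \<phi> \<in> borel_measurable borel"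
    using c by (auto intro: borel_measurable_continuous_onI)
  have lim0: "(\<lambda>K. nsq plane (\<lambda>x. partial a K x \<tau> - flow (x, \<tau>))) \<longlonglongrightarrow> 0" for \<tau>
  proof (rule tendsto_sandwich[OF _ _ tendsto_const])
    have "(\<lambda>K. ennreal (pi * tail K)) \<longlonglongrightarrow> ennreal (pi * 0)"
      by (intro tendsto_ennrealI tendsto_intros tail_tendsto)
    then show "(\<lambda>K. ennreal (pi * tail K)) \<longlonglongrightarrow> 0" by simp
    show "\<forall>\<^sub>F K in sequentially. nsq plane (\<lambda>x. partial a K x \<tau> - flow (x, \<tau>)) \<le> ennreal (pi * tail K)"
      by (subst nsq_diff_commute) (simp add: nsq_flow_partial)
  qed simp
  have lim: "(\<lambda>K. \<integral>x. partial a K x \<tau> * \<phi> x \<partial>plane) \<longlonglongrightarrow> (\<integral>x. flow (x, \<tau>) * \<phi> x \<partial>plane)" for \<tau>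
    by (rule tendsto_integral_mult_nsq[OF _ _ _ nsq_partial_finite nsq_flow_finite fin(1) lim0]) measurable
  define N where "N = enn2real (nsq plane (laplacian \<phi>))"
  have N: "nsq plane (laplacian \<phi>) = ennreal N" "0 \<le> N" using fin by (simp_all add: N_def)
  have unif: "cmod ((\<integral>x. partial a K x \<tau> * laplacian \<phi> x \<partial>plane) - (\<integral>x. flow (x, \<tau>) * laplacian \<phi> x \<partial>plane))
     \<le> sqrt (pi * tail K * N)" for K \<tau>
  proof -
    have d: "(\<integral>x. partial a K x \<tau> * laplacian \<phi> x \<partial>plane) - (\<integral>x. flow (x, \<tau>) * laplacian \<phi> x \<partial>plane)
      = (\<integral>x. (partial a K x \<tau> - flow (x, \<tau>)) * laplacian \<phi> x \<partial>plane)"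
      unfolding left_diff_distrib
    proof (rule Bochner_Integration.integral_diff[symmetric])
      show "integrable plane (\<lambda>x. partial a K x \<tau> * laplacian \<phi> x)"
        by (rule integrable_mult_nsq[OF _ _ nsq_partial_finite fin(2)]) measurable
      show "integrable plane (\<lambda>x. flow (x, \<tau>) * laplacian \<phi> x)"
        by (rule integrable_mult_nsq[OF _ _ nsq_flow_finite fin(2)]) measurable
    qed
    have "ennreal ((cmod (\<integral>x. (partial a K x \<tau> - flow (x, \<tau>)) * laplacian \<phi> x \<partial>plane))\<^sup>2)
       \<le> nsq plane (\<lambda>x. partial a K x \<tau> - flow (x, \<tau>)) * nsq plane (laplacian \<phi>)"
      by (intro integral_mult_nsq_le nsq_diff_finite nsq_partial_finite nsq_flow_finite fin) measurable
    also have "\<dots> \<le> ennreal (pi * tail K) * ennreal N"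
      unfolding N(1) by (subst nsq_diff_commute) (intro mult_right_mono nsq_flow_partial, simp)
    also have "\<dots> = ennreal (pi * tail K * N)"
      using tail_nonneg[of K] N(2) by (simp add: ennreal_mult)
    finally have "(cmod (\<integral>x. (partial a K x \<tau> - flow (x, \<tau>)) * laplacian \<phi> x \<partial>plane))\<^sup>2 \<le> pi * tail K * N"
      using tail_nonneg[of K] N(2) by (subst (asm) ennreal_le_iff) auto
    then show ?thesis unfolding d by (rule real_le_rsqrt)
  qed
  have "\<exists>g. \<forall>\<tau>\<in>UNIV. (\<lambda>K. \<integral>x. partial a K x \<tau> * \<phi> x \<partial>plane) \<longlonglongrightarrow> g \<tau> \<and>
    (g has_derivative (\<lambda>h. h *\<^sub>R (\<i> * (\<integral>x. flow (x, \<tau>) * laplacian \<phi> x \<partial>plane)))) (at \<tau> within UNIV)"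
  proof (rule has_derivative_sequence)
    show "((\<lambda>\<tau>. \<integral>x. partial a K x \<tau> * \<phi> x \<partial>plane) has_derivative
      (\<lambda>h. h *\<^sub>R (\<i> * (\<integral>x. partial a K x \<tau> * laplacian \<phi> x \<partial>plane)))) (at \<tau> within UNIV)" for K \<tau>
      using partial_weak_equation[OF \<phi>] by (simp add: has_vector_derivative_def)
    show "\<forall>\<^sub>F K in sequentially. \<forall>\<tau>\<in>UNIV. \<forall>h. norm (h *\<^sub>R (\<i> * (\<integral>x. partial a K x \<tau> * laplacian \<phi> x \<partial>plane))
       - h *\<^sub>R (\<i> * (\<integral>x. flow (x, \<tau>) * laplacian \<phi> x \<partial>plane))) \<le> e * norm h" if "0 < e" for e
    proof -
      have "(\<lambda>K. sqrt (pi * tail K * N)) \<longlonglongrightarrow> sqrt (pi * 0 * N)" by (intro tendsto_intros tail_tendsto)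
      then have "\<forall>\<^sub>F K in sequentially. sqrt (pi * tail K * N) < e"
        using that by (intro order_tendstoD(2)) auto
      then show ?thesis
      proof (eventually_elim, intro ballI allI)
        fix K \<tau> h assume K: "sqrt (pi * tail K * N) < e"
        have "h *\<^sub>R (\<i> * (\<integral>x. partial a K x \<tau> * laplacian \<phi> x \<partial>plane)) - h *\<^sub>R (\<i> * (\<integral>x. flow (x, \<tau>) * laplacian \<phi> x \<partial>plane))
          = h *\<^sub>R (\<i> * ((\<integral>x. partial a K x \<tau> * laplacian \<phi> x \<partial>plane) - (\<integral>x. flow (x, \<tau>) * laplacian \<phi> x \<partial>plane)))"
          by (simp add: algebra_simps)
        also have "norm \<dots> = \<bar>h\<bar> * cmod ((\<integral>x. partial a K x \<tau> * laplacian \<phi> x \<partial>plane) - (\<integral>x. flow (x, \<tau>) * laplacian \<phi> x \<partial>plane))"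
          by (simp add: norm_mult)
        also have "\<dots> \<le> \<bar>h\<bar> * e" using unif[of K \<tau>] K by (intro mult_left_mono) auto
        finally show "norm (h *\<^sub>R (\<i> * (\<integral>x. partial a K x \<tau> * laplacian \<phi> x \<partial>plane))
          - h *\<^sub>R (\<i> * (\<integral>x. flow (x, \<tau>) * laplacian \<phi> x \<partial>plane))) \<le> e * norm h" by (simp add: mult.commute)
      qed
    qed
    show "(\<lambda>K. \<integral>x. partial a K x 0 * \<phi> x \<partial>plane) \<longlonglongrightarrow> (\<integral>x. flow (x, 0) * \<phi> x \<partial>plane)" by (rule lim)
  qed auto
  then obtain g where g: "\<And>\<tau>. (\<lambda>K. \<integral>x. partial a K x \<tau> * \<phi> x \<partial>plane) \<longlonglongrightarrow> g \<tau>"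
    "\<And>\<tau>. (g has_vector_derivative \<i> * (\<integral>x. flow (x, \<tau>) * laplacian \<phi> x \<partial>plane)) (at \<tau>)"
    by (auto simp: has_vector_derivative_def)
  have "g = (\<lambda>\<tau>. \<integral>x. flow (x, \<tau>) * \<phi> x \<partial>plane)"
    using LIMSEQ_unique[OF g(1) lim] by blast
  then show ?thesis using g(2)[of t] by simp
qed

theorem flow_solution:
  assumes f: "AE x in plane. flow (x, 0) = f x"
  shows "schroedinger_solution f flow"
  unfolding schroedinger_solution_def
proof (intro conjI allI impI)
  show "flow \<in> borel_measurable borel" by (rule borel_measurable_flow)
  show "(\<lambda>x. flow (x, t)) \<in> Lp_space 2 lebesgue" for t
    by (subst Lp_space_2_iff) (auto intro!: measurable_completion nsq_flow_finite)
  show "((\<lambda>t. Lp_norm 2 lebesgue (\<lambda>x. flow (x, t) - flow (x, s))) \<longlongrightarrow> 0) (at s)" for s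
    unfolding Lp_norm_2_tendsto_0_iff by (rule flow_continuous_in_time)
  show "AE x in lebesgue. flow (x, 0) = f x" using f by (rule AE_completion)
next
  fix \<phi> :: "real ^ 2 \<Rightarrow> complex" and t assume \<phi>: "test_fun \<phi>"
  have [measurable]: "\<phi> \<in> borel_measurable borel" "laplacian \<phi> \<in> borel_measurable borel"
    using test_fun_continuous[OF \<phi>] by (auto intro: borel_measurable_continuous_onI)
  have "(LINT x|lebesgue. flow (x, \<tau>) * \<psi> x) = (\<integral>x. flow (x, \<tau>) * \<psi> x \<partial>plane)"
    if [measurable]: "\<psi> \<in> borel_measurable borel" for \<psi> \<tau>
    by (rule integral_completion) measurable
  then show "((\<lambda>\<tau>. LINT x|lebesgue. flow (x, \<tau>) * \<phi> x) has_vector_derivative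
     \<i> * (LINT x|lebesgue. flow (x, t) * laplacian \<phi> x)) (at t)"
    using flow_weak_equation[OF \<phi>] by simp
qed

text \<open>
  At time 0 the flow is a function of \<open>|x|\<^sup>2\<close> with the Laguerre coefficients of \<open>H\<close>, and
  \<open>lagfun_total\<close> applies to the difference.
\<close>

lemma flow_at_0:
  assumes [measurable]: "H \<in> borel_measurable borel" and fin: "nsq half H < top"
    and a: "\<And>n. a n = (\<integral>s. H s * lagfun n s \<partial>half)"
  shows "AE x in plane. flow (x, 0) = H ((norm x)\<^sup>2)"
proof -
  define P where "P K s = (\<Sum>n<K. a n * lagfun n s)" for K s
  define U where "U s = lim (\<lambda>j. P (r j) s)" for s
  have [measurable]: "P K \<in> borel_measurable borel" for K unfolding P_def by measurable
  have [measurable]: "U \<in> borel_measurable borel" unfolding U_def by (rule borel_measurable_lim_metric) measurable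
  have P: "partial a K x 0 = P K ((norm x)\<^sup>2)" for K x
    by (simp add: partial_def P_def mode_lens)
  have U: "flow (x, 0) = U ((norm x)\<^sup>2)" for x
    by (simp add: flow_def U_def P)
  have PU: "nsq half (\<lambda>s. P K s - U s) \<le> ennreal (tail K)" for K
  proof -
    have "ennreal pi * nsq half (\<lambda>s. P K s - U s) = nsq plane (\<lambda>x. P K ((norm x)\<^sup>2) - U ((norm x)\<^sup>2))"
      by (rule nsq_norm_sq[symmetric]) measurable
    also have "\<dots> \<le> ennreal (pi * tail K)"
      using nsq_flow_partial[of 0 K] by (subst nsq_diff_commute) (simp add: P U)
    also have "\<dots> = ennreal pi * ennreal (tail K)" by (simp add: ennreal_mult tail_nonneg)
    finally show ?thesis by (subst (asm) ennreal_mult_le_mult_iff) auto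
  qed
  have fP: "nsq half (P K) < top" for K
    unfolding P_def[abs_def] by (intro nsq_sum_finite nsq_cmult_finite nsq_lagfun_finite) measurable
  have fU: "nsq half U < top"
  proof -
    have "nsq half (\<lambda>s. P 0 s - U s) < top" using PU[of 0] by (rule le_less_trans) simp
    then show ?thesis by (simp add: P_def nsq_minus)
  qed
  have Ua: "(\<integral>s. U s * lagfun n s \<partial>half) = a n" for n
  proof (rule LIMSEQ_unique)
    have "(\<lambda>K. nsq half (\<lambda>s. P K s - U s)) \<longlonglongrightarrow> 0"
    proof (rule tendsto_sandwich[OF _ _ tendsto_const])
      have "(\<lambda>K. ennreal (tail K)) \<longlonglongrightarrow> ennreal 0" by (intro tendsto_ennrealI tail_tendsto)
      then show "(\<lambda>K. ennreal (tail K)) \<longlonglongrightarrow> 0" by simp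
    qed (use PU in auto)
    then show "(\<lambda>K. \<integral>s. P K s * lagfun n s \<partial>half) \<longlonglongrightarrow> (\<integral>s. U s * lagfun n s \<partial>half)"
      by (intro tendsto_integral_mult_nsq fP fU nsq_lagfun_finite) measurable
    have "\<forall>\<^sub>F K in sequentially. (\<integral>s. P K s * lagfun n s \<partial>half) = a n"
      using eventually_gt_at_top[of n]
    proof eventually_elim
      case (elim K)
      have "(\<integral>s. P K s * lagfun n s \<partial>half) = (\<integral>s. (\<Sum>m<K. a m * (lagfun m s * lagfun n s)) \<partial>half)"
        unfolding P_def sum_distrib_right by (simp only: mult.assoc)
      also have "\<dots> = (\<Sum>m<K. a m * (\<integral>s. lagfun m s * lagfun n s \<partial>half))"
        by (subst Bochner_Integration.integral_sum)
           (auto intro!: integrable_mult_right integrable_mult_nsq nsq_lagfun_finite)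
      also have "\<dots> = (\<Sum>m<K. if m = n then a m else 0)"
        using lagfun_orthonormal[of _ n] by (intro sum.cong refl) simp
      also have "\<dots> = a n" using elim by simp
      finally show ?case .
    qed
    then show "(\<lambda>K. \<integral>s. P K s * lagfun n s \<partial>half) \<longlonglongrightarrow> a n" by (rule tendsto_eventually)
  qed
  have "AE s in half. H s - U s = 0"
  proof (rule lagfun_total)
    show "nsq half (\<lambda>s. H s - U s) < top" by (intro nsq_diff_finite fin fU) measurable
    show "(\<integral>s. (H s - U s) * lagfun n s \<partial>half) = 0" for n
    proof -
      have "integrable half (\<lambda>s. H s * lagfun n s)" "integrable half (\<lambda>s. U s * lagfun n s)"
        by (intro integrable_mult_nsq fin fU nsq_lagfun_finite; measurable)+
      then show ?thesis by (simp add: left_diff_distrib Ua a)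
    qed
  qed measurable
  from AE_norm_sq[OF this] show ?thesis by eventually_elim (simp add: U)
qed

end

lemma square_summable_exists:
  assumes "summable (\<lambda>n. (cmod (a n))\<^sup>2)"
  obtains r where "square_summable a r"
proof -
  have "\<exists>K\<ge>j. (\<Sum>n. (cmod (a (n + K)))\<^sup>2) \<le> (1/8) ^ j" for j
  proof -
    obtain N where N: "\<And>n. n \<ge> N \<Longrightarrow> norm (\<Sum>i. (cmod (a (i + n)))\<^sup>2) < (1/8) ^ j"
      using suminf_exist_split[OF _ assms, of "(1/8) ^ j"] by auto
    show ?thesis using N[of "max N j"] by (intro exI[of _ "max N j"]) auto
  qed
  then obtain r where "\<And>j. j \<le> r j \<and> (\<Sum>n. (cmod (a (n + r j)))\<^sup>2) \<le> (1/8) ^ j" by metis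
  then show thesis using assms by (intro that[of r]) (simp add: square_summable_def)
qed

section \<open>The space-time integral of the fourth power\<close>

lemma continuous_omega: "continuous_on UNIV omega"
proof -
  have "continuous_on UNIV (\<lambda>t::real. 1 + 2 * \<i> * complex_of_real t)" by (intro continuous_intros)
  moreover have "\<forall>t\<in>UNIV. 1 + 2 * \<i> * complex_of_real t \<noteq> 0" by (intro ballI p_nonzero)
  ultimately have "continuous_on UNIV (\<lambda>t::real. inverse (1 + 2 * \<i> * complex_of_real t))"
    by (rule continuous_on_inverse)
  moreover have "continuous_on UNIV (\<lambda>t::real. 1 - 2 * \<i> * complex_of_real t)" by (intro continuous_intros)
  ultimately show ?thesis unfolding omega_def[abs_def] by (intro continuous_on_mult)
qed

lemma borel_measurable_omega [measurable]: "omega \<in> borel_measurable borel"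
  by (rule borel_measurable_continuous_onI[OF continuous_omega])

lemma omega_cnj: "omega t * cnj (omega t) = 1"
  using complex_norm_square[of "omega t"] by (simp add: cmod_omega)

lemma inverse_p_tendsto_0:
  assumes "F = at_top \<or> F = at_bot"
  shows "((\<lambda>t::real. inverse (1 + 2 * \<i> * complex_of_real t)) \<longlongrightarrow> 0) F"
proof (rule tendsto_norm_zero_cancel, rule tendsto_sandwich[OF _ _ tendsto_const])
  have "((\<lambda>t::real. inverse t) \<longlongrightarrow> 0) F"
    using assms tendsto_mono[OF at_top_le_at_infinity tendsto_inverse_0]
      tendsto_mono[OF at_bot_le_at_infinity tendsto_inverse_0] by auto
  then show "((\<lambda>t::real. \<bar>inverse t\<bar>) \<longlongrightarrow> 0) F" by (rule tendsto_rabs_zero)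
  have "cmod (inverse (1 + 2 * \<i> * complex_of_real t)) \<le> \<bar>inverse t\<bar>" if "t \<noteq> 0" for t
  proof -
    have "\<bar>t\<bar> \<le> \<bar>Im (1 + 2 * \<i> * complex_of_real t)\<bar>" by simp
    also have "\<dots> \<le> cmod (1 + 2 * \<i> * complex_of_real t)" by (rule abs_Im_le_cmod)
    finally show ?thesis using that unfolding norm_inverse abs_inverse by (intro le_imp_inverse_le) auto
  qed
  moreover have "\<forall>\<^sub>F t::real in F. t \<noteq> 0"
    using assms eventually_mono[OF eventually_gt_at_top[of "0::real"], of "\<lambda>t. t \<noteq> 0"]
      eventually_mono[OF eventually_gt_at_bot[of "0::real"], of "\<lambda>t. t \<noteq> 0"] by auto
  ultimately show "\<forall>\<^sub>F t in F. cmod (inverse (1 + 2 * \<i> * complex_of_real t)) \<le> \<bar>inverse t\<bar>"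
    by (rule eventually_mono[rotated]) blast
qed simp

lemma omega_tendsto:
  assumes "F = at_top \<or> F = at_bot"
  shows "(omega \<longlongrightarrow> - 1) F"
proof -
  have o: "omega = (\<lambda>t. 2 * inverse (1 + 2 * \<i> * complex_of_real t) - 1)"
  proof
    fix t
    have "1 - 2 * \<i> * complex_of_real t = 2 - (1 + 2 * \<i> * complex_of_real t)" by simp
    then show "omega t = 2 * inverse (1 + 2 * \<i> * complex_of_real t) - 1" unfolding omega_def
      by (simp only: left_diff_distrib right_inverse[OF p_nonzero(1)[of t]])
  qed
  have "((\<lambda>t. 2 * inverse (1 + 2 * \<i> * complex_of_real t) - 1) \<longlongrightarrow> 2 * 0 - 1) F"
    by (intro tendsto_intros inverse_p_tendsto_0 assms)
  then show ?thesis unfolding o by simp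
qed

lemma omega_deriv:
  "(omega has_vector_derivative - 4 * \<i> * omega t * of_real (inverse (1 + 4 * t\<^sup>2))) (at t)"
proof -
  define p q where "p = 1 + 2 * \<i> * complex_of_real t" and "q = 1 - 2 * \<i> * complex_of_real t"
  have nz: "p \<noteq> 0" "q \<noteq> 0" unfolding p_def q_def by (rule p_nonzero)+
  have "((\<lambda>z. (1 - 2 * \<i> * z) * inverse (1 + 2 * \<i> * z)) has_field_derivative
      q * (- (inverse p * (2 * \<i>) * inverse p)) + (- 2 * \<i>) * inverse p) (at (of_real t))"
    using nz unfolding p_def q_def by (auto intro!: derivative_eq_intros)
  from has_vector_derivative_real_field[OF this]
  have "(omega has_vector_derivative q * (- (inverse p * (2 * \<i>) * inverse p)) + (- 2 * \<i>) * inverse p) (at t)"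
    unfolding omega_def[abs_def] .
  moreover have "q * (- (inverse p * (2 * \<i>) * inverse p)) + (- 2 * \<i>) * inverse p
     = - 4 * \<i> * omega t * of_real (inverse (1 + 4 * t\<^sup>2))"
  proof -
    have c: "complex_of_real (inverse (1 + 4 * t\<^sup>2)) = inverse p * inverse q"
      unfolding p_def q_def of_real_inverse pq_eq[symmetric] by (rule inverse_mult_distrib)
    have o: "omega t = q * inverse p" by (simp add: omega_def p_def q_def)
    have q: "q = 2 - p" by (simp add: p_def q_def)
    have "q * (- (inverse p * (2 * \<i>) * inverse p)) + (- 2 * \<i>) * inverse p
        = - 2 * \<i> * inverse p * ((2 - p) * inverse p + 1)"
      unfolding q by (simp add: algebra_simps)
    also have "(2 - p) * inverse p + 1 = 2 * inverse p"
      using nz(1) by (simp add: left_diff_distrib)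
    also have "- 2 * \<i> * inverse p * (2 * inverse p) = - 4 * \<i> * (q * inverse p) * (inverse p * inverse q)"
      using nz by simp
    finally show ?thesis unfolding c o .
  qed
  ultimately show ?thesis by simp
qed

lemma nn_integral_inverse_c:
  "(\<integral>\<^sup>+ t. ennreal (inverse (1 + 4 * t\<^sup>2)) \<partial>lborel) = ennreal (pi / 2)"
proof -
  have i: "integrable lborel (\<lambda>x::real. inverse (1 + x\<^sup>2))"
    using integrable_inverse_1_plus_square by (simp add: set_integrable_def)
  have "(\<integral>x. inverse (1 + x\<^sup>2) \<partial>lborel) = pi"
    using LBINT_inverse_1_plus_square
    by (simp add: interval_lebesgue_integral_def set_lebesgue_integral_def)
  then have "ennreal pi = (\<integral>\<^sup>+ x. ennreal (inverse (1 + x\<^sup>2)) \<partial>lborel)"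
    using nn_integral_eq_integral[OF i] by simp
  also have "\<dots> = ennreal \<bar>2\<bar> * (\<integral>\<^sup>+ t. ennreal (inverse (1 + (0 + 2 * t)\<^sup>2)) \<partial>lborel)"
    by (rule nn_integral_real_affine) auto
  also have "\<dots> = ennreal 2 * (\<integral>\<^sup>+ t. ennreal (inverse (1 + 4 * t\<^sup>2)) \<partial>lborel)"
    by (simp add: power_mult_distrib)
  finally have "ennreal pi = ennreal 2 * (\<integral>\<^sup>+ t. ennreal (inverse (1 + 4 * t\<^sup>2)) \<partial>lborel)" .
  moreover have "ennreal 2 * ennreal (pi / 2) = ennreal pi"
    by (subst ennreal_mult[symmetric]) simp_all
  ultimately have "ennreal 2 * ennreal (pi / 2) = ennreal 2 * (\<integral>\<^sup>+ t. ennreal (inverse (1 + 4 * t\<^sup>2)) \<partial>lborel)"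
    by (simp only:)
  then show ?thesis by (subst (asm) ennreal_mult_cancel_left) auto
qed

text \<open>
  The map \<open>omega\<close> takes this measure to a quarter of the arc length on the unit circle, which is why
  it makes the powers of \<open>omega\<close> orthogonal.
\<close>

definition circ :: "real measure" where
  "circ = density lborel (\<lambda>t. ennreal (inverse (1 + 4 * t\<^sup>2)))"

lemma sets_circ [simp, measurable_cong]: "sets circ = sets borel"
  by (simp add: circ_def)

lemma integrable_inverse_c: "integrable lborel (\<lambda>t::real. inverse (1 + 4 * t\<^sup>2))"
  using nn_integral_inverse_c c_pos by (intro integrableI_bounded) (auto simp: less_imp_le)

text \<open>
  By \<open>omega_deriv\<close> a multiple of the power itself is a primitive, and it has the same limit at both
  ends of the real line.
\<close>

lemma omega_power_integral:
  assumes "0 < k"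
  shows "(\<integral>t. omega t ^ k \<partial>circ) = 0"
proof -
  define f where "f t = omega t ^ k * of_real (inverse (1 + 4 * t\<^sup>2))" for t
  define F where "F t = \<i> / (4 * of_nat k) * omega t ^ k" for t
  have [measurable]: "f \<in> borel_measurable borel" unfolding f_def by measurable
  have int: "integrable lborel f"
  proof (rule Bochner_Integration.integrable_bound[OF integrable_inverse_c])
    show "AE t in lborel. norm (f t) \<le> norm (inverse (1 + 4 * t\<^sup>2))"
      unfolding f_def norm_mult cmod_omega_power norm_of_real by simp
  qed simp
  have cf: "continuous_on UNIV f"
  proof -
    have "continuous_on UNIV (\<lambda>t::real. inverse (1 + 4 * t\<^sup>2))"
      using c_pos by (intro continuous_on_inverse continuous_intros) (metis less_irrefl)
    then show ?thesis unfolding f_def[abs_def]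
      by (intro continuous_on_mult continuous_on_power continuous_omega continuous_on_of_real)
  qed
  have "(LBINT t=-\<infinity>..\<infinity>. f t) = \<i> / (4 * of_nat k) * (- 1) ^ k - \<i> / (4 * of_nat k) * (- 1) ^ k"
  proof (rule interval_integral_FTC_integrable)
    fix t :: real
    have "((\<lambda>t. omega t ^ k) has_vector_derivative (of_nat k * omega t ^ (k - 1)) * (- 4 * \<i> * omega t * of_real (inverse (1 + 4 * t\<^sup>2)))) (at t)"
    proof -
      have "((\<lambda>z::complex. z ^ k) has_field_derivative of_nat k * omega t ^ (k - 1)) (at (omega t))"
        by (auto intro!: derivative_eq_intros)
      from field_vector_diff_chain_at[OF omega_deriv this]
      show ?thesis by (simp add: comp_def mult_ac)
    qed
    then have "(F has_vector_derivative \<i> / (4 * of_nat k) * ((of_nat k * omega t ^ (k - 1)) * (- 4 * \<i> * omega t * of_real (inverse (1 + 4 * t\<^sup>2))))) (at t)"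
      unfolding F_def by (rule has_vector_derivative_mult_right)
    also have "\<i> / (4 * of_nat k) * ((of_nat k * omega t ^ (k - 1)) * (- 4 * \<i> * omega t * of_real (inverse (1 + 4 * t\<^sup>2)))) = f t"
    proof -
      obtain j where k: "k = Suc j" using assms by (cases k) auto
      have "\<i> / (4 * K) * ((K * W) * (- 4 * \<i> * w * C)) = (w * W) * C" if "K \<noteq> 0" for K W w C :: complex
        using that by (simp add: field_simps)
      from this[of "of_nat k"] show ?thesis
        using assms unfolding f_def by (simp add: k del: of_nat_Suc of_real_inverse)
    qed
    finally show "(F has_vector_derivative f t) (at t)" .
    show "isCont f t" using cf by (simp add: continuous_on_eq_continuous_at)
  next
    show "set_integrable lborel (einterval (-\<infinity>) \<infinity>) f" using int by (simp add: set_integrable_def)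
    have lim: "(F \<longlongrightarrow> \<i> / (4 * of_nat k) * (- 1) ^ k) G" if "G = at_top \<or> G = at_bot" for G
      unfolding F_def by (intro tendsto_intros omega_tendsto that)
    show "((F \<circ> real_of_ereal) \<longlongrightarrow> \<i> / (4 * of_nat k) * (- 1) ^ k) (at_right (-\<infinity>))"
      unfolding comp_def at_right_MInf filterlim_filtermap real_of_ereal.simps by (rule lim) simp
    show "((F \<circ> real_of_ereal) \<longlongrightarrow> \<i> / (4 * of_nat k) * (- 1) ^ k) (at_left \<infinity>)"
      unfolding comp_def at_left_PInf filterlim_filtermap real_of_ereal.simps by (rule lim) simp
  qed simp
  then have "(\<integral>t. f t \<partial>lborel) = 0"
    by (simp add: interval_lebesgue_integral_def set_lebesgue_integral_def)
  moreover have "(\<integral>t. omega t ^ k \<partial>circ) = (\<integral>t. f t \<partial>lborel)"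
    unfolding circ_def f_def using c_pos
    by (subst integral_density) (auto simp: scaleR_conv_of_real mult.commute less_imp_le)
  ultimately show ?thesis by simp
qed

lemma nsq_circ_finite: "nsq circ (\<lambda>t. omega t ^ n) < top"
  unfolding nsq_def cmod_omega_power circ_def
  by (subst nn_integral_density) (simp_all add: nn_integral_inverse_c)

lemma omega_orthogonal:
  "(\<integral>t. omega t ^ m * cnj (omega t ^ n) \<partial>circ) = (if m = n then of_real (pi / 2) else 0)"
proof -
  have osplit: "omega t ^ (j + n) * cnj (omega t ^ n) = omega t ^ j" for j n t
  proof -
    have "omega t ^ (j + n) * cnj (omega t ^ n) = omega t ^ j * (omega t * cnj (omega t)) ^ n"
      by (simp add: power_add power_mult_distrib)
    then show ?thesis by (simp add: omega_cnj)
  qed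
  consider "m = n" | j where "0 < j" "m = j + n" | j where "0 < j" "n = j + m"
    by (metis less_imp_add_positive add.commute linorder_neqE_nat)
  then show ?thesis
  proof cases
    case 1
    have "complex_of_real (enn2real (nsq circ (\<lambda>t. omega t ^ n))) = (\<integral>t. omega t ^ n * cnj (omega t ^ n) \<partial>circ)"
      by (rule nsq_eq_integral[OF _ nsq_circ_finite]) measurable
    moreover have "nsq circ (\<lambda>t. omega t ^ n) = ennreal (pi / 2)"
      unfolding nsq_def cmod_omega_power circ_def
      by (subst nn_integral_density) (simp_all add: nn_integral_inverse_c)
    ultimately show ?thesis using 1 by simp
  next
    case (2 j)
    then show ?thesis using omega_power_integral[of j] by (simp add: osplit del: complex_cnj_power)
  next
    case (3 j)
    have "(\<integral>t. omega t ^ m * cnj (omega t ^ n) \<partial>circ) = (\<integral>t. cnj (omega t ^ (j + m) * cnj (omega t ^ m)) \<partial>circ)"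
      by (simp add: 3 mult.commute)
    also have "\<dots> = (\<integral>t. cnj (omega t ^ j) \<partial>circ)" unfolding osplit ..
    also have "\<dots> = cnj (\<integral>t. omega t ^ j \<partial>circ)" by (rule Bochner_Integration.integral_cnj)
    also have "\<dots> = 0" using omega_power_integral[OF 3(1)] by simp
    finally show ?thesis using 3 by simp
  qed
qed

lemma omega_parseval:
  "(\<integral>\<^sup>+ t. ennreal (inverse (1 + 4 * t\<^sup>2) * (cmod (\<Sum>N<M. q N * omega t ^ N))\<^sup>2) \<partial>lborel)
    = ennreal (pi / 2 * (\<Sum>N<M. (cmod (q N))\<^sup>2))"
proof -
  have "nsq circ (\<lambda>t. \<Sum>N\<in>{..<M}. q N * omega t ^ N) = ennreal (pi / 2 * (\<Sum>N\<in>{..<M}. (cmod (q N))\<^sup>2))"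
    by (rule nsq_orthogonal_sum[OF _ nsq_circ_finite omega_orthogonal]) simp_all
  moreover have "nsq circ (\<lambda>t. \<Sum>N\<in>{..<M}. q N * omega t ^ N)
     = (\<integral>\<^sup>+ t. ennreal (inverse (1 + 4 * t\<^sup>2) * (cmod (\<Sum>N<M. q N * omega t ^ N))\<^sup>2) \<partial>lborel)"
    unfolding nsq_def circ_def using c_pos
    by (subst nn_integral_density) (auto simp: ennreal_mult less_imp_le)
  ultimately show ?thesis by simp
qed

text \<open>
  The Cauchy product of a finite sum with itself. The coefficients vanish beyond \<open>K\<close> so that the
  inner sum may run over all \<open>k \<le> N\<close>; this is the purpose of \<open>trunc\<close> below.
\<close>

lemma square_of_sum:
  fixes x :: "nat \<Rightarrow> 'a::field"
  assumes "\<And>n. K \<le> n \<Longrightarrow> x n = 0"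
  shows "(\<Sum>n<K. x n * z ^ n)\<^sup>2 = (\<Sum>N<2 * K. (\<Sum>k\<le>N. x k * x (N - k)) * z ^ N)"
proof -
  define p where "p = (\<Sum>n<K. monom (x n) n)"
  have c: "coeff p n = x n" for n
  proof -
    have "coeff p n = (\<Sum>i<K. if i = n then x i else 0)"
      unfolding p_def coeff_sum by (intro sum.cong) (auto simp: coeff_monom)
    then show ?thesis using assms[of n] by (cases "n < K") auto
  qed
  have pz: "poly p z = (\<Sum>n<K. x n * z ^ n)"
    unfolding p_def poly_sum by (simp add: poly_monom)
  have c2: "coeff (p * p) N = (\<Sum>k\<le>N. x k * x (N - k))" for N
    by (simp add: coeff_mult c)
  have z: "coeff (p * p) N = 0" if "2 * K \<le> N" for N
    unfolding c2
  proof (rule sum.neutral, intro ballI)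
    fix k assume "k \<in> {..N}"
    then have "K \<le> k \<or> K \<le> N - k" using that by auto
    then show "x k * x (N - k) = 0" using assms by auto
  qed
  have "poly (p * p) z = (\<Sum>N\<le>degree (p * p). coeff (p * p) N * z ^ N)" by (rule poly_altdef)
  also have "\<dots> = (\<Sum>N<max (2 * K) (Suc (degree (p * p))). coeff (p * p) N * z ^ N)"
    by (intro sum.mono_neutral_left) (auto simp: coeff_eq_0)
  also have "\<dots> = (\<Sum>N<2 * K. coeff (p * p) N * z ^ N)"
    by (intro sum.mono_neutral_right) (auto simp: z)
  finally show ?thesis using pz by (simp add: c2 power2_eq_square)
qed

text \<open>
  The part of degree \<open>N\<close> in the square of the Laguerre series with coefficients \<open>b\<close>.
\<close>

definition lagprod :: "(nat \<Rightarrow> complex) \<Rightarrow> nat \<Rightarrow> real \<Rightarrow> complex" where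
  "lagprod b N s = (\<Sum>k\<le>N. (b k * lagfun k s) * (b (N - k) * lagfun (N - k) s))"

lemma borel_measurable_lagprod [measurable]: "lagprod b N \<in> borel_measurable borel"
  unfolding lagprod_def by measurable

text \<open>
  At \<open>s/2\<close> the two exponential factors combine to the factor \<open>e\<^bsup>-s/2\<^esup>\<close> of Laguerre functions at \<open>s\<close>.
  Hence the halved argument in the product formula.
\<close>

lemma lagprod_expand: "lagprod b N (s / 2) = (\<Sum>m\<le>N. linprod b N m * lagfun m s)"
proof -
  have ee: "exp (- complex_of_real (s / 2 / 2)) * exp (- complex_of_real (s / 2 / 2)) = exp (- of_real (s / 2))"
    by (rule exp_half_sq)
  have L: "poly (laguerre k) (s / 2) * poly (laguerre (N - k)) (s / 2) = (\<Sum>m\<le>N. linco k (N - k) m * poly (laguerre m) s)"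
    if "k \<le> N" for k
  proof -
    have "poly (laguerre k) (s / 2) * poly (laguerre (N - k)) (s / 2)
        = poly (pcompose (laguerre k * laguerre (N - k)) [:0, 1/2:]) s" by (simp add: poly_pcompose)
    also have "\<dots> = poly (linsum k (N - k)) s" by (simp only: laguerre_product)
    also have "\<dots> = (\<Sum>m\<le>N. linco k (N - k) m * poly (laguerre m) s)"
      using that by (simp add: linsum_def poly_sum)
    finally show ?thesis .
  qed
  have "lagprod b N (s / 2) = (\<Sum>k\<le>N. (b k * b (N - k)) * (exp (- of_real (s / 2)) *
      of_real (poly (laguerre k) (s / 2) * poly (laguerre (N - k)) (s / 2))))"
    unfolding lagprod_def lagfun_def ee[symmetric] of_real_mult
    by (intro sum.cong refl) (simp only: mult_ac)
  also have "\<dots> = (\<Sum>k\<le>N. \<Sum>m\<le>N. (of_real (linco k (N - k) m) * (b k * b (N - k))) * lagfun m s)"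
  proof (intro sum.cong refl)
    fix k assume "k \<in> {..N}"
    then have k: "k \<le> N" by simp
    show "(b k * b (N - k)) * (exp (- of_real (s / 2)) * of_real (poly (laguerre k) (s / 2) * poly (laguerre (N - k)) (s / 2)))
      = (\<Sum>m\<le>N. (of_real (linco k (N - k) m) * (b k * b (N - k))) * lagfun m s)"
      unfolding L[OF k] lagfun_def of_real_sum of_real_mult sum_distrib_left
      by (intro sum.cong refl) (simp only: mult_ac)
  qed
  also have "\<dots> = (\<Sum>m\<le>N. linprod b N m * lagfun m s)"
    unfolding linprod_def sum_distrib_right by (rule sum.swap)
  finally show ?thesis .
qed

lemma nsq_lagprod: "nsq half (lagprod b N) = ennreal ((\<Sum>m\<le>N. (cmod (linprod b N m))\<^sup>2) / 2)"
proof -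
  have "ennreal 2 * nsq half (lagprod b N) = (\<integral>\<^sup>+ s. ennreal ((cmod (lagprod b N (s / 2)))\<^sup>2) \<partial>half)"
    unfolding nsq_def by (rule nn_integral_half_scale[symmetric]) auto
  also have "\<dots> = nsq half (\<lambda>s. \<Sum>m\<in>{..N}. linprod b N m * lagfun m s)"
    by (simp add: nsq_def lagprod_expand)
  also have "\<dots> = ennreal (1 * (\<Sum>m\<in>{..N}. (cmod (linprod b N m))\<^sup>2))"
    by (rule nsq_orthogonal_sum) (auto simp: nsq_lagfun_finite lagfun_orthonormal[simplified])
  also have "\<dots> = ennreal 2 * ennreal ((\<Sum>m\<le>N. (cmod (linprod b N m))\<^sup>2) / 2)"
    by (subst ennreal_mult[symmetric]) (auto intro!: sum_nonneg)
  finally show ?thesis by (subst (asm) ennreal_mult_cancel_left) auto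
qed

definition trunc :: "(nat \<Rightarrow> complex) \<Rightarrow> nat \<Rightarrow> nat \<Rightarrow> complex" where
  "trunc a K n = (if n < K then a n else 0)"

text \<open>
  The square of the sum in the lens transform, sorted by powers of \<open>omega\<close>.
\<close>

lemma cmod_partial_pow4:
  "(cmod (partial a K x t)) ^ 4 = (inverse (1 + 4 * t\<^sup>2))\<^sup>2
     * (cmod (\<Sum>N<2 * K. lagprod (trunc a K) N ((norm x)\<^sup>2 / (1 + 4 * t\<^sup>2)) * omega t ^ N))\<^sup>2"
proof -
  let ?y = "(norm x)\<^sup>2 / (1 + 4 * t\<^sup>2)"
  have tr: "(\<Sum>n\<in>{..<K}. (a n * omega t ^ n) * lagfun n ?y) = (\<Sum>n<K. (trunc a K n * lagfun n ?y) * omega t ^ n)"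
    by (intro sum.cong refl) (simp add: trunc_def)
  have "(\<Sum>n\<in>{..<K}. (a n * omega t ^ n) * lagfun n ?y)\<^sup>2 = (\<Sum>N<2 * K. lagprod (trunc a K) N ?y * omega t ^ N)"
    unfolding lagprod_def tr by (rule square_of_sum) (simp add: trunc_def)
  then have "(cmod (\<Sum>n\<in>{..<K}. (a n * omega t ^ n) * lagfun n ?y))\<^sup>2 = cmod (\<Sum>N<2 * K. lagprod (trunc a K) N ?y * omega t ^ N)"
    by (simp only: norm_power[symmetric])
  then have "(cmod (partial a K x t))\<^sup>2 = inverse (1 + 4 * t\<^sup>2) * cmod (\<Sum>N<2 * K. lagprod (trunc a K) N ?y * omega t ^ N)"
    unfolding partial_def cmod_mode_sum by simp
  then have "((cmod (partial a K x t))\<^sup>2)\<^sup>2 = (inverse (1 + 4 * t\<^sup>2) * cmod (\<Sum>N<2 * K. lagprod (trunc a K) N ?y * omega t ^ N))\<^sup>2"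
    by (rule arg_cong)
  then show ?thesis by (simp add: power_mult_distrib flip: power_mult)
qed

lemma nn_integral_spacetime:
  fixes f :: "'a::euclidean_space \<times> real \<Rightarrow> ennreal"
  assumes [measurable]: "f \<in> borel_measurable borel"
  shows "(\<integral>\<^sup>+ p. f p \<partial>lborel) = (\<integral>\<^sup>+ t. (\<integral>\<^sup>+ x. f (x, t) \<partial>lborel) \<partial>lborel)"
proof -
  have "f \<in> borel_measurable (lborel \<Otimes>\<^sub>M lborel)" unfolding lborel_prod by simp
  from lborel_pair.nn_integral_snd[OF this] show ?thesis by (simp add: lborel_prod)
qed

text \<open>
  Rescaling space by \<open>c = 1 + 4t\<^sup>2\<close> turns the factor \<open>c\<^bsup>-2\<^esup>\<close> into \<open>c\<^bsup>-1\<^esup>\<close>, the density that makes the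
  powers of \<open>omega\<close> orthogonal. Parseval's identity in time separates the degrees \<open>N\<close>, and
  Parseval's identity in \<open>s\<close> evaluates each of them. The constant is \<open>\<pi>\<close> from the plane, \<open>\<pi>/2\<close> from
  time, and \<open>1/2\<close> from the halved argument.
\<close>

theorem partial_L4:
  "(\<integral>\<^sup>+ p. ennreal ((cmod (partial a K (fst p) (snd p))) ^ 4) \<partial>lborel)
    = ennreal (pi\<^sup>2 / 4 * (\<Sum>N<2 * K. \<Sum>m\<le>N. (cmod (linprod (trunc a K) N m))\<^sup>2))"
proof -
  interpret half: sigma_finite_measure half by (rule sigma_finite_half)
  interpret hl: pair_sigma_finite half lborel ..
  define G where "G s t = (cmod (\<Sum>N<2 * K. lagprod (trunc a K) N s * omega t ^ N))\<^sup>2" for s t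
  have [measurable]: "case_prod G \<in> borel_measurable (borel \<Otimes>\<^sub>M borel)" unfolding G_def by measurable
  have "(\<integral>\<^sup>+ p. ennreal ((cmod (partial a K (fst p) (snd p))) ^ 4) \<partial>lborel)
      = (\<integral>\<^sup>+ t. (\<integral>\<^sup>+ x. ennreal ((cmod (partial a K x t)) ^ 4) \<partial>plane) \<partial>lborel)"
    by (subst nn_integral_spacetime) simp_all
  also have "\<dots> = (\<integral>\<^sup>+ t. (\<integral>\<^sup>+ s. ennreal pi * ennreal (inverse (1 + 4 * t\<^sup>2) * G s t) \<partial>half) \<partial>lborel)"
  proof (rule nn_integral_cong)
    fix t :: real
    let ?c = "1 + 4 * t\<^sup>2"
    have "(\<integral>\<^sup>+ x. ennreal ((cmod (partial a K x t)) ^ 4) \<partial>plane)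
        = (\<integral>\<^sup>+ x. ennreal ((inverse ?c)\<^sup>2) * ennreal (G ((norm x)\<^sup>2 / ?c) t) \<partial>plane)"
      unfolding cmod_partial_pow4 by (intro nn_integral_cong) (simp add: G_def ennreal_mult)
    also have "\<dots> = ennreal ((inverse ?c)\<^sup>2) * (\<integral>\<^sup>+ x. ennreal (G ((norm x)\<^sup>2 / ?c) t) \<partial>plane)"
      by (rule nn_integral_cmult) measurable
    also have "(\<integral>\<^sup>+ x. ennreal (G ((norm x)\<^sup>2 / ?c) t) \<partial>plane) = ennreal pi * (\<integral>\<^sup>+ s. ennreal (G (s / ?c) t) \<partial>half)"
      by (rule nn_integral_norm_sq) measurable
    also have "(\<integral>\<^sup>+ s. ennreal (G (s / ?c) t) \<partial>half) = ennreal ?c * (\<integral>\<^sup>+ s. ennreal (G s t) \<partial>half)"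
      by (rule nn_integral_half_scale[OF _ c_pos]) measurable
    also have "ennreal ((inverse ?c)\<^sup>2) * (ennreal pi * (ennreal ?c * (\<integral>\<^sup>+ s. ennreal (G s t) \<partial>half)))
       = ennreal pi * (ennreal (inverse ?c) * (\<integral>\<^sup>+ s. ennreal (G s t) \<partial>half))"
    proof -
      have "ennreal ((inverse c)\<^sup>2) * (ennreal pi * (ennreal c * I)) = ennreal pi * (ennreal (inverse c) * I)"
        if "0 < c" for c :: real and I :: ennreal
      proof -
        have "ennreal ((inverse c)\<^sup>2) * (ennreal pi * (ennreal c * I)) = ennreal pi * ((ennreal ((inverse c)\<^sup>2) * ennreal c) * I)"
          by (simp only: mult_ac)
        also have "ennreal ((inverse c)\<^sup>2) * ennreal c = ennreal (inverse c)"
          using that by (simp add: ennreal_mult[symmetric] power2_eq_square)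
        finally show ?thesis .
      qed
      from this[OF c_pos] show ?thesis .
    qed
    also have "\<dots> = (\<integral>\<^sup>+ s. ennreal pi * ennreal (inverse ?c * G s t) \<partial>half)"
      using c_pos[of t] by (simp add: nn_integral_cmult ennreal_mult G_def less_imp_le)
    finally show "(\<integral>\<^sup>+ x. ennreal ((cmod (partial a K x t)) ^ 4) \<partial>plane)
      = (\<integral>\<^sup>+ s. ennreal pi * ennreal (inverse ?c * G s t) \<partial>half)" .
  qed
  also have "\<dots> = (\<integral>\<^sup>+ s. (\<integral>\<^sup>+ t. ennreal pi * ennreal (inverse (1 + 4 * t\<^sup>2) * G s t) \<partial>lborel) \<partial>half)"
    by (rule hl.Fubini') measurable
  also have "\<dots> = (\<integral>\<^sup>+ s. ennreal (pi * (pi / 2)) * (\<Sum>N<2 * K. ennreal ((cmod (lagprod (trunc a K) N s))\<^sup>2)) \<partial>half)"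
  proof (rule nn_integral_cong)
    fix s
    have "(\<integral>\<^sup>+ t. ennreal pi * ennreal (inverse (1 + 4 * t\<^sup>2) * G s t) \<partial>lborel)
       = ennreal pi * (\<integral>\<^sup>+ t. ennreal (inverse (1 + 4 * t\<^sup>2) * G s t) \<partial>lborel)"
      by (rule nn_integral_cmult) measurable
    also have "(\<integral>\<^sup>+ t. ennreal (inverse (1 + 4 * t\<^sup>2) * G s t) \<partial>lborel)
       = ennreal (pi / 2 * (\<Sum>N<2 * K. (cmod (lagprod (trunc a K) N s))\<^sup>2))"
      unfolding G_def by (rule omega_parseval)
    also have "ennreal pi * \<dots> = ennreal (pi * (pi / 2)) * ennreal (\<Sum>N<2 * K. (cmod (lagprod (trunc a K) N s))\<^sup>2)"
      by (simp add: ennreal_mult[symmetric] sum_nonneg mult.assoc)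
    finally show "(\<integral>\<^sup>+ t. ennreal pi * ennreal (inverse (1 + 4 * t\<^sup>2) * G s t) \<partial>lborel)
       = ennreal (pi * (pi / 2)) * (\<Sum>N<2 * K. ennreal ((cmod (lagprod (trunc a K) N s))\<^sup>2))"
      by (simp add: sum_ennreal)
  qed
  also have "\<dots> = ennreal (pi * (pi / 2)) * (\<integral>\<^sup>+ s. (\<Sum>N<2 * K. ennreal ((cmod (lagprod (trunc a K) N s))\<^sup>2)) \<partial>half)"
    by (rule nn_integral_cmult) measurable
  also have "(\<integral>\<^sup>+ s. (\<Sum>N<2 * K. ennreal ((cmod (lagprod (trunc a K) N s))\<^sup>2)) \<partial>half)
     = (\<Sum>N<2 * K. nsq half (lagprod (trunc a K) N))"
    unfolding nsq_def by (rule nn_integral_sum) measurable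
  also have "ennreal (pi * (pi / 2)) * \<dots> = ennreal (pi * (pi / 2)) * ennreal (\<Sum>N<2 * K. (\<Sum>m\<le>N. (cmod (linprod (trunc a K) N m))\<^sup>2) / 2)"
    unfolding nsq_lagprod by (subst sum_ennreal) (auto intro!: sum_nonneg)
  also have "\<dots> = ennreal ((pi * (pi / 2)) * (\<Sum>N<2 * K. (\<Sum>m\<le>N. (cmod (linprod (trunc a K) N m))\<^sup>2) / 2))"
    by (intro ennreal_mult[symmetric] sum_nonneg) (auto intro!: sum_nonneg)
  also have "(pi * (pi / 2)) * (\<Sum>N<2 * K. (\<Sum>m\<le>N. (cmod (linprod (trunc a K) N m))\<^sup>2) / 2)
     = pi\<^sup>2 / 4 * (\<Sum>N<2 * K. \<Sum>m\<le>N. (cmod (linprod (trunc a K) N m))\<^sup>2)"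
    by (simp add: power2_eq_square flip: sum_divide_distrib)
  finally show ?thesis .
qed

lemma sum_squares_products:
  "(\<Sum>N<2 * K. \<Sum>k\<le>N. (cmod (trunc a K k * trunc a K (N - k)))\<^sup>2) = (\<Sum>n<K. (cmod (a n))\<^sup>2)\<^sup>2"
proof -
  have "(\<Sum>n<K. (cmod (a n))\<^sup>2)\<^sup>2 = (\<Sum>n<K. (cmod (trunc a K n))\<^sup>2 * 1 ^ n)\<^sup>2"
    by (simp add: trunc_def)
  also have "\<dots> = (\<Sum>N<2 * K. (\<Sum>k\<le>N. (cmod (trunc a K k))\<^sup>2 * (cmod (trunc a K (N - k)))\<^sup>2) * 1 ^ N)"
    by (rule square_of_sum) (simp add: trunc_def)
  finally show ?thesis by (simp add: norm_mult power_mult_distrib)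
qed

lemma linprod_trunc:
  assumes "N < K" shows "linprod (trunc a K) N m = linprod a N m"
  unfolding linprod_def using assms by (intro sum.cong refl) (simp add: trunc_def)

text \<open>
  The loss in a single degree \<open>N\<close> is kept. It is not affected by a truncation beyond \<open>N\<close> and so
  survives the limit \<open>K \<rightarrow> \<infinity>\<close>.
\<close>

lemma partial_L4_le_deficit:
  assumes "N < K"
  shows "(\<integral>\<^sup>+ p. ennreal ((cmod (partial a K (fst p) (snd p))) ^ 4) \<partial>lborel)
    \<le> ennreal (pi\<^sup>2 / 4 * ((\<Sum>n<K. (cmod (a n))\<^sup>2)\<^sup>2
       - ((\<Sum>k\<le>N. (cmod (a k * a (N - k)))\<^sup>2) - (\<Sum>m\<le>N. (cmod (linprod a N m))\<^sup>2))))"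
  unfolding partial_L4
proof (intro ennreal_leI mult_left_mono)
  let ?b = "trunc a K"
  define E where "E M = (\<Sum>m\<le>M. (cmod (linprod ?b M m))\<^sup>2)" for M
  define G where "G M = (\<Sum>k\<le>M. (cmod (?b k * ?b (M - k)))\<^sup>2)" for M
  have EG: "E M \<le> G M" for M unfolding E_def G_def by (rule linprod_le)
  have N: "N \<in> {..<2 * K}" using assms by simp
  have "(\<Sum>M<2 * K. E M) = E N + (\<Sum>M\<in>{..<2 * K} - {N}. E M)" using N by (intro sum.remove) auto
  also have "\<dots> \<le> E N + (\<Sum>M\<in>{..<2 * K} - {N}. G M)" by (intro add_left_mono sum_mono EG)
  also have "\<dots> = (\<Sum>M<2 * K. G M) - (G N - E N)"
    using sum.remove[OF _ N, of G] by simp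
  also have "(\<Sum>M<2 * K. G M) = (\<Sum>n<K. (cmod (a n))\<^sup>2)\<^sup>2" unfolding G_def by (rule sum_squares_products)
  also have "G N = (\<Sum>k\<le>N. (cmod (a k * a (N - k)))\<^sup>2)"
    unfolding G_def using assms by (intro sum.cong refl) (simp add: trunc_def)
  also have "E N = (\<Sum>m\<le>N. (cmod (linprod a N m))\<^sup>2)"
    unfolding E_def by (simp add: linprod_trunc assms)
  finally show "(\<Sum>M<2 * K. \<Sum>m\<le>M. (cmod (linprod ?b M m))\<^sup>2)
     \<le> (\<Sum>n<K. (cmod (a n))\<^sup>2)\<^sup>2 - ((\<Sum>k\<le>N. (cmod (a k * a (N - k)))\<^sup>2) - (\<Sum>m\<le>N. (cmod (linprod a N m))\<^sup>2))"
    unfolding E_def .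
qed simp

lemma partial_L4_le:
  "(\<integral>\<^sup>+ p. ennreal ((cmod (partial a K (fst p) (snd p))) ^ 4) \<partial>lborel) \<le> ennreal (pi\<^sup>2 / 4 * (\<Sum>n<K. (cmod (a n))\<^sup>2)\<^sup>2)"
  unfolding partial_L4 sum_squares_products[symmetric]
  by (intro ennreal_leI mult_left_mono sum_mono linprod_le) simp

text \<open>
  Truncation at \<open>2K\<close> leaves the degrees below \<open>2K\<close> intact, where a geometric sequence suffers no
  loss.
\<close>

lemma partial_L4_geometric_ge:
  assumes a: "\<And>n. a n = c * z ^ n"
  shows "ennreal (pi\<^sup>2 / 4 * (\<Sum>n<K. (cmod (a n))\<^sup>2)\<^sup>2)
    \<le> (\<integral>\<^sup>+ p. ennreal ((cmod (partial a (2 * K) (fst p) (snd p))) ^ 4) \<partial>lborel)"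
  unfolding partial_L4
proof (intro ennreal_leI mult_left_mono)
  have "(\<Sum>n<K. (cmod (a n))\<^sup>2)\<^sup>2 = (\<Sum>N<2 * K. \<Sum>k\<le>N. (cmod (trunc a K k * trunc a K (N - k)))\<^sup>2)"
    by (rule sum_squares_products[symmetric])
  also have "\<dots> \<le> (\<Sum>N<2 * K. \<Sum>k\<le>N. (cmod (a k * a (N - k)))\<^sup>2)"
    by (intro sum_mono power_mono) (auto simp: trunc_def)
  also have "\<dots> = (\<Sum>N<2 * K. \<Sum>m\<le>N. (cmod (linprod a N m))\<^sup>2)"
    using linprod_geometric[of c z] by (simp add: a a[abs_def])
  also have "\<dots> = (\<Sum>N<2 * K. \<Sum>m\<le>N. (cmod (linprod (trunc a (2 * K)) N m))\<^sup>2)"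
    by (simp add: linprod_trunc)
  also have "\<dots> \<le> (\<Sum>N<2 * (2 * K). \<Sum>m\<le>N. (cmod (linprod (trunc a (2 * K)) N m))\<^sup>2)"
    by (intro sum_mono2) (auto intro!: sum_nonneg)
  finally show "(\<Sum>n<K. (cmod (a n))\<^sup>2)\<^sup>2 \<le> (\<Sum>N<2 * (2 * K). \<Sum>m\<le>N. (cmod (linprod (trunc a (2 * K)) N m))\<^sup>2)" .
qed simp

lemma nn_integral_pow4: "(\<integral>\<^sup>+ x. ennreal ((cmod (f x)) ^ 4) \<partial>M) = nsq M (\<lambda>x. (f x)\<^sup>2)"
  unfolding nsq_def by (simp add: norm_power flip: power_mult)

lemma pow4_Fatou:
  assumes [measurable]: "\<And>j. F j \<in> borel_measurable M" "f \<in> borel_measurable M"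
    and lim: "AE x in M. (\<lambda>j. F j x) \<longlonglongrightarrow> f x"
    and bound: "eventually (\<lambda>j. (\<integral>\<^sup>+ x. ennreal ((cmod (F j x)) ^ 4) \<partial>M) \<le> C) sequentially"
  shows "(\<integral>\<^sup>+ x. ennreal ((cmod (f x)) ^ 4) \<partial>M) \<le> C"
  unfolding nn_integral_pow4
proof (rule nsq_Fatou[where F = "\<lambda>j x. (F j x)\<^sup>2"])
  show "AE x in M. (\<lambda>j. (F j x)\<^sup>2) \<longlonglongrightarrow> (f x)\<^sup>2"
    using lim by eventually_elim (intro tendsto_intros)
  show "\<forall>\<^sub>F j in sequentially. nsq M (\<lambda>x. (F j x)\<^sup>2) \<le> C"
    using bound unfolding nn_integral_pow4 .
qed measurable

lemma square_convex:
  fixes u v l :: real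
  assumes "0 < l" "l < 1"
  shows "(u + v)\<^sup>2 \<le> u\<^sup>2 / (1 - l) + v\<^sup>2 / l"
proof -
  have "u\<^sup>2 / (1 - l) + v\<^sup>2 / l - (u + v)\<^sup>2 = (l * u - (1 - l) * v)\<^sup>2 / (l * (1 - l))"
    using assms by (simp add: field_simps power2_eq_square)
  also have "\<dots> \<ge> 0" using assms by simp
  finally show ?thesis by simp
qed

text \<open>
  Convexity of the fourth power, for \<open>x = (1 - l) (y/(1 - l)) + l ((x - y)/l)\<close>. The constant at
  \<open>|y|\<^sup>4\<close> tends to 1 as \<open>l \<rightarrow> 0\<close>.
\<close>

lemma pow4_convex:
  assumes l: "0 < l" "l < 1"
  shows "(cmod x) ^ 4 \<le> (cmod y) ^ 4 / (1 - l) ^ 3 + (cmod (x - y)) ^ 4 / l ^ 3"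
proof -
  define u v where "u = cmod y" and "v = cmod (x - y)"
  have uv: "0 \<le> u" "0 \<le> v" by (simp_all add: u_def v_def)
  have "cmod x \<le> u + v" using norm_triangle_ineq[of y "x - y"] by (simp add: u_def v_def)
  then have "(cmod x)\<^sup>2 \<le> (u + v)\<^sup>2" by (intro power_mono) auto
  also have "\<dots> \<le> u\<^sup>2 / (1 - l) + v\<^sup>2 / l" by (rule square_convex[OF l])
  finally have "((cmod x)\<^sup>2)\<^sup>2 \<le> (u\<^sup>2 / (1 - l) + v\<^sup>2 / l)\<^sup>2" by (intro power_mono) auto
  also have "\<dots> \<le> (u\<^sup>2 / (1 - l))\<^sup>2 / (1 - l) + (v\<^sup>2 / l)\<^sup>2 / l" by (rule square_convex[OF l])
  also have "\<dots> = u ^ 4 / (1 - l) ^ 3 + v ^ 4 / l ^ 3"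
  proof -
    have "(w\<^sup>2 / m)\<^sup>2 / m = w ^ 4 / m ^ 3" for w m :: real
      by (simp add: power_divide flip: power_mult) (simp add: power2_eq_square power3_eq_cube)
    then show ?thesis by simp
  qed
  finally show ?thesis by (simp add: u_def v_def flip: power_mult)
qed

context square_summable
begin

definition mass :: real where "mass = (\<Sum>n. (cmod (a n))\<^sup>2)"

lemma sum_le_mass: "(\<Sum>n<K. (cmod (a n))\<^sup>2) \<le> mass"
  unfolding mass_def by (rule sum_le_suminf[OF summ]) auto

lemma mass_nonneg: "0 \<le> mass"
  unfolding mass_def by (rule suminf_nonneg[OF summ]) simp

lemma sum_tendsto_mass: "(\<lambda>K. \<Sum>n<K. (cmod (a n))\<^sup>2) \<longlonglongrightarrow> mass"
  unfolding mass_def by (rule summable_LIMSEQ[OF summ])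

text \<open>
  The exceptional sets of the single times form a null set in space-time. The Cauchy property is
  used in place of the limit because it is a measurable condition in terms of the partial sums
  alone.
\<close>

lemma flow_converges_spacetime:
  "AE p in lborel. (\<lambda>j. partial a (r j) (fst p) (snd p)) \<longlonglongrightarrow> flow p"
proof -
  have m: "{p \<in> space (lborel \<Otimes>\<^sub>M lborel). Cauchy (\<lambda>j. partial a (r j) (fst p) (snd p))} \<in> sets ((lborel :: (real^2) measure) \<Otimes>\<^sub>M lborel)"
    by (rule sets_Collect_Cauchy) (simp add: lborel_prod)
  have "AE t in lborel. AE x in plane. Cauchy (\<lambda>j. partial a (r j) x t)"
  proof (rule AE_I2)
    fix t :: real
    show "AE x in plane. Cauchy (\<lambda>j. partial a (r j) x t)"
      using flow_converges[of t] by eventually_elim (rule LIMSEQ_imp_Cauchy)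
  qed
  then have "AE x in plane. AE t in lborel. Cauchy (\<lambda>j. partial a (r j) x t)"
    by (subst lborel_pair.AE_commute[where P = "\<lambda>x t. Cauchy (\<lambda>j. partial a (r j) x t)", OF m])
  then have "AE p in lborel \<Otimes>\<^sub>M lborel. Cauchy (\<lambda>j. partial a (r j) (fst p) (snd p))"
    by (intro lborel_pair.AE_pair_measure m) simp
  then have "AE p in lborel. Cauchy (\<lambda>j. partial a (r j) (fst p) (snd p))"
    unfolding lborel_prod .
  then show ?thesis
    by eventually_elim (simp add: flow_def Cauchy_convergent_iff convergent_LIMSEQ_iff)
qed

lemma flow_L4_le_deficit:
  "(\<integral>\<^sup>+ p. ennreal ((cmod (flow p)) ^ 4) \<partial>lborel)
    \<le> ennreal (pi\<^sup>2 / 4 * (mass\<^sup>2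
       - ((\<Sum>k\<le>N. (cmod (a k * a (N - k)))\<^sup>2) - (\<Sum>m\<le>N. (cmod (linprod a N m))\<^sup>2))))"
proof (rule pow4_Fatou[OF _ _ flow_converges_spacetime])
  let ?D = "(\<Sum>k\<le>N. (cmod (a k * a (N - k)))\<^sup>2) - (\<Sum>m\<le>N. (cmod (linprod a N m))\<^sup>2)"
  show "\<forall>\<^sub>F j in sequentially. (\<integral>\<^sup>+ p. ennreal ((cmod (partial a (r j) (fst p) (snd p))) ^ 4) \<partial>lborel)
     \<le> ennreal (pi\<^sup>2 / 4 * (mass\<^sup>2 - ?D))"
    using eventually_gt_at_top[of N]
  proof eventually_elim
    case (elim j)
    then have "N < r j" using r_ge[of j] by linarith
    then have "(\<integral>\<^sup>+ p. ennreal ((cmod (partial a (r j) (fst p) (snd p))) ^ 4) \<partial>lborel)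
      \<le> ennreal (pi\<^sup>2 / 4 * ((\<Sum>n<r j. (cmod (a n))\<^sup>2)\<^sup>2 - ?D))"
      by (rule partial_L4_le_deficit)
    also have "\<dots> \<le> ennreal (pi\<^sup>2 / 4 * (mass\<^sup>2 - ?D))"
      by (intro ennreal_leI mult_left_mono diff_mono power_mono sum_le_mass order_refl sum_nonneg) auto
    finally show ?case .
  qed
qed measurable

lemma flow_L4_le:
  "(\<integral>\<^sup>+ p. ennreal ((cmod (flow p)) ^ 4) \<partial>lborel) \<le> ennreal (pi\<^sup>2 / 4 * mass\<^sup>2)"
proof (rule order_trans[OF flow_L4_le_deficit[of 0]])
  show "ennreal (pi\<^sup>2 / 4 * (mass\<^sup>2 - ((\<Sum>k\<le>0. (cmod (a k * a (0 - k)))\<^sup>2) - (\<Sum>m\<le>0. (cmod (linprod a 0 m))\<^sup>2))))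
    \<le> ennreal (pi\<^sup>2 / 4 * mass\<^sup>2)"
    using linprod_le[of a 0] by (intro ennreal_leI mult_left_mono) auto
qed

text \<open>
  The estimate for finite sums, applied to the coefficients from \<open>K\<close> on.
\<close>

lemma flow_partial_L4_le:
  "(\<integral>\<^sup>+ p. ennreal ((cmod (flow p - partial a K (fst p) (snd p))) ^ 4) \<partial>lborel) \<le> ennreal (pi\<^sup>2 / 4 * (tail K)\<^sup>2)"
proof (rule pow4_Fatou[where F = "\<lambda>j p. partial a (r j) (fst p) (snd p) - partial a K (fst p) (snd p)"])
  show "AE p in lborel. (\<lambda>j. partial a (r j) (fst p) (snd p) - partial a K (fst p) (snd p))
      \<longlonglongrightarrow> flow p - partial a K (fst p) (snd p)"
    using flow_converges_spacetime by eventually_elim (intro tendsto_intros)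
  \<comment> \<open>The difference of two partial sums is a partial sum for the coefficients with the first \<open>K\<close> set
    to 0.\<close>
  define a' where "a' n = (if n < K then 0 else a n)" for n
  show "\<forall>\<^sub>F j in sequentially. (\<integral>\<^sup>+ p. ennreal ((cmod (partial a (r j) (fst p) (snd p) - partial a K (fst p) (snd p))) ^ 4) \<partial>lborel)
     \<le> ennreal (pi\<^sup>2 / 4 * (tail K)\<^sup>2)"
    using eventually_ge_at_top[of K]
  proof eventually_elim
    case (elim j)
    then have K: "K \<le> r j" using r_ge[of j] by linarith
    have e1: "(\<Sum>n\<in>{K..<r j}. a n * m n) = (\<Sum>n<r j. a' n * m n)" for m :: "nat \<Rightarrow> complex"
      by (intro sum.mono_neutral_cong_left) (auto simp: a'_def)
    have e2: "(\<Sum>n<r j. (cmod (a' n))\<^sup>2) = (\<Sum>n\<in>{K..<r j}. (cmod (a n))\<^sup>2)"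
      by (intro sum.mono_neutral_cong_right) (auto simp: a'_def)
    have "partial a (r j) x t - partial a K x t = partial a' (r j) x t" for x t
      unfolding partial_diff[OF K] unfolding partial_def by (rule e1)
    then have "(\<integral>\<^sup>+ p. ennreal ((cmod (partial a (r j) (fst p) (snd p) - partial a K (fst p) (snd p))) ^ 4) \<partial>lborel)
      = (\<integral>\<^sup>+ p. ennreal ((cmod (partial a' (r j) (fst p) (snd p))) ^ 4) \<partial>lborel)" by simp
    also have "\<dots> \<le> ennreal (pi\<^sup>2 / 4 * (\<Sum>n<r j. (cmod (a' n))\<^sup>2)\<^sup>2)" by (rule partial_L4_le)
    also have "(\<Sum>n<r j. (cmod (a' n))\<^sup>2) = (\<Sum>n\<in>{K..<r j}. (cmod (a n))\<^sup>2)"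
      by (rule e2)
    also have "ennreal (pi\<^sup>2 / 4 * (\<Sum>n\<in>{K..<r j}. (cmod (a n))\<^sup>2)\<^sup>2) \<le> ennreal (pi\<^sup>2 / 4 * (tail K)\<^sup>2)"
      by (intro ennreal_leI mult_left_mono power_mono sum_le_tail sum_nonneg) auto
    finally show ?case .
  qed
qed measurable

text \<open>
  Fatou's lemma gives one inequality. For the other, the flow is compared in \<open>L\<^sup>4\<close> with partial sums,
  for which there is no loss in low degrees: \<open>pow4_convex\<close> plays the role of the triangle
  inequality, first with \<open>K \<rightarrow> \<infinity>\<close> for fixed \<open>l\<close> and then with \<open>l \<rightarrow> 0\<close>.
\<close>

lemma flow_L4_geometric:
  assumes geo: "\<And>n. a n = c * z ^ n"
  shows "(\<integral>\<^sup>+ p. ennreal ((cmod (flow p)) ^ 4) \<partial>lborel) = ennreal (pi\<^sup>2 / 4 * mass\<^sup>2)"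
proof (rule antisym[OF flow_L4_le])
  define i where "i = enn2real (\<integral>\<^sup>+ p. ennreal ((cmod (flow p)) ^ 4) \<partial>lborel)"
  have i: "(\<integral>\<^sup>+ p. ennreal ((cmod (flow p)) ^ 4) \<partial>lborel) = ennreal i" "0 \<le> i"
    using flow_L4_le by (auto simp: i_def intro!: ennreal_enn2real[symmetric] le_less_trans[OF flow_L4_le])
  have conv: "pi\<^sup>2 / 4 * mass\<^sup>2 \<le> i / (1 - l) ^ 3" if l: "0 < l" "l < 1" for l
  proof (rule LIMSEQ_le)
    show "(\<lambda>K. pi\<^sup>2 / 4 * (\<Sum>n<K. (cmod (a n))\<^sup>2)\<^sup>2) \<longlonglongrightarrow> pi\<^sup>2 / 4 * mass\<^sup>2"
      by (intro tendsto_intros sum_tendsto_mass)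
    have "(\<lambda>K. tail (2 * K)) \<longlonglongrightarrow> 0"
      using LIMSEQ_subseq_LIMSEQ[OF tail_tendsto, of "\<lambda>K. 2 * K"] by (simp add: comp_def strict_mono_def)
    then have "(\<lambda>K. i / (1 - l) ^ 3 + (pi\<^sup>2 / 4 * (tail (2 * K))\<^sup>2) / l ^ 3) \<longlonglongrightarrow> i / (1 - l) ^ 3 + (pi\<^sup>2 / 4 * 0\<^sup>2) / l ^ 3"
      using l by (intro tendsto_intros) auto
    then show "(\<lambda>K. i / (1 - l) ^ 3 + (pi\<^sup>2 / 4 * (tail (2 * K))\<^sup>2) / l ^ 3) \<longlonglongrightarrow> i / (1 - l) ^ 3" by simp
    have "pi\<^sup>2 / 4 * (\<Sum>n<K. (cmod (a n))\<^sup>2)\<^sup>2 \<le> i / (1 - l) ^ 3 + (pi\<^sup>2 / 4 * (tail (2 * K))\<^sup>2) / l ^ 3" for K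
    proof -
      let ?S = "\<lambda>p. partial a (2 * K) (fst p) (snd p)"
      have "ennreal (pi\<^sup>2 / 4 * (\<Sum>n<K. (cmod (a n))\<^sup>2)\<^sup>2) \<le> (\<integral>\<^sup>+ p. ennreal ((cmod (?S p)) ^ 4) \<partial>lborel)"
        by (rule partial_L4_geometric_ge[OF geo])
      also have "\<dots> \<le> (\<integral>\<^sup>+ p. ennreal (1 / (1 - l) ^ 3) * ennreal ((cmod (flow p)) ^ 4)
          + ennreal (1 / l ^ 3) * ennreal ((cmod (flow p - ?S p)) ^ 4) \<partial>lborel)"
      proof (rule nn_integral_mono)
        fix p
        have "ennreal ((cmod (?S p)) ^ 4) \<le> ennreal ((cmod (flow p)) ^ 4 / (1 - l) ^ 3 + (cmod (flow p - ?S p)) ^ 4 / l ^ 3)"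
          using pow4_convex[OF l, of "?S p" "flow p"] by (intro ennreal_leI) (simp add: norm_minus_commute)
        also have "\<dots> = ennreal (1 / (1 - l) ^ 3 * (cmod (flow p)) ^ 4 + 1 / l ^ 3 * (cmod (flow p - ?S p)) ^ 4)" by simp
        also have "\<dots> = ennreal (1 / (1 - l) ^ 3) * ennreal ((cmod (flow p)) ^ 4) + ennreal (1 / l ^ 3) * ennreal ((cmod (flow p - ?S p)) ^ 4)"
          using l by (subst ennreal_plus) (auto simp: ennreal_mult[symmetric])
        finally show "ennreal ((cmod (?S p)) ^ 4) \<le> ennreal (1 / (1 - l) ^ 3) * ennreal ((cmod (flow p)) ^ 4)
          + ennreal (1 / l ^ 3) * ennreal ((cmod (flow p - ?S p)) ^ 4)" .
      qed
      also have "\<dots> = ennreal (1 / (1 - l) ^ 3) * (\<integral>\<^sup>+ p. ennreal ((cmod (flow p)) ^ 4) \<partial>lborel)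
          + ennreal (1 / l ^ 3) * (\<integral>\<^sup>+ p. ennreal ((cmod (flow p - ?S p)) ^ 4) \<partial>lborel)"
        by (subst nn_integral_add) (simp_all add: nn_integral_cmult)
      also have "\<dots> \<le> ennreal (1 / (1 - l) ^ 3) * ennreal i + ennreal (1 / l ^ 3) * ennreal (pi\<^sup>2 / 4 * (tail (2 * K))\<^sup>2)"
        unfolding i(1) by (intro add_left_mono mult_left_mono flow_partial_L4_le) simp
      also have "\<dots> = ennreal (i / (1 - l) ^ 3 + (pi\<^sup>2 / 4 * (tail (2 * K))\<^sup>2) / l ^ 3)"
        using l i(2) by (subst ennreal_plus) (auto simp: ennreal_mult[symmetric])
      finally show ?thesis
        using l i(2) by (subst (asm) ennreal_le_iff) auto
    qed
    then show "\<exists>N. \<forall>K\<ge>N. pi\<^sup>2 / 4 * (\<Sum>n<K. (cmod (a n))\<^sup>2)\<^sup>2 \<le> i / (1 - l) ^ 3 + (pi\<^sup>2 / 4 * (tail (2 * K))\<^sup>2) / l ^ 3"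
      by blast
  qed
  have "pi\<^sup>2 / 4 * mass\<^sup>2 \<le> i"
  proof (rule LIMSEQ_le_const)
    have "(\<lambda>n. i / (1 - 1 / real (n + 2)) ^ 3) \<longlonglongrightarrow> i / (1 - 0) ^ 3"
    proof (intro tendsto_intros)
      show "(\<lambda>n. 1 / real (n + 2)) \<longlonglongrightarrow> 0"
        using LIMSEQ_ignore_initial_segment[OF lim_1_over_n, of 2] by simp
    qed simp
    then show "(\<lambda>n. i / (1 - 1 / real (n + 2)) ^ 3) \<longlonglongrightarrow> i" by simp
    show "\<exists>N. \<forall>n\<ge>N. pi\<^sup>2 / 4 * mass\<^sup>2 \<le> i / (1 - 1 / real (n + 2)) ^ 3"
      using conv by (intro exI[of _ 0] allI impI) auto
  qed
  then show "ennreal (pi\<^sup>2 / 4 * mass\<^sup>2) \<le> (\<integral>\<^sup>+ p. ennreal ((cmod (flow p)) ^ 4) \<partial>lborel)"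
    unfolding i(1) by (rule ennreal_leI)
qed

text \<open>
  Equality leaves no room for a loss in any degree \<open>N\<close>.
\<close>

lemma geometric_if_flow_L4_eq:
  assumes "(\<integral>\<^sup>+ p. ennreal ((cmod (flow p)) ^ 4) \<partial>lborel) = ennreal (pi\<^sup>2 / 4 * mass\<^sup>2)"
  obtains c z where "\<And>n. a n = c * z ^ n"
proof (rule geometric_if_products_eq[of a])
  fix N k :: nat assume k: "k \<le> N"
  let ?G = "\<Sum>k\<le>N. (cmod (a k * a (N - k)))\<^sup>2" and ?E = "\<Sum>m\<le>N. (cmod (linprod a N m))\<^sup>2"
  have EG: "?E \<le> ?G" by (rule linprod_le)
  have "?G = ?E"
  \<comment> \<open>Negative numbers become 0 in the extended nonnegative reals, so the inequality with the loss is
    informative only for positive mass.\<close>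
  proof (cases "mass = 0")
    case True
    have "a n = 0" for n
    proof -
      have "0 \<le> (\<Sum>n<n. (cmod (a n))\<^sup>2)" by (intro sum_nonneg) simp
      then have "(cmod (a n))\<^sup>2 \<le> 0"
        using True sum_le_mass[of "Suc n"] unfolding sum.lessThan_Suc by linarith
      then show ?thesis by simp
    qed
    then show ?thesis by (simp add: linprod_def)
  next
    case False
    have "ennreal (pi\<^sup>2 / 4 * mass\<^sup>2) \<le> ennreal (pi\<^sup>2 / 4 * (mass\<^sup>2 - (?G - ?E)))"
      using flow_L4_le_deficit[of N] unfolding assms .
    moreover have "0 < pi\<^sup>2 / 4 * mass\<^sup>2" using False by simp
    ultimately have "pi\<^sup>2 / 4 * mass\<^sup>2 \<le> pi\<^sup>2 / 4 * (mass\<^sup>2 - (?G - ?E))"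
      by (meson ennreal_le_iff2 not_less)
    then have "mass\<^sup>2 \<le> mass\<^sup>2 - (?G - ?E)" by (subst (asm) mult_le_cancel_left_pos) simp_all
    then show ?thesis using EG by simp
  qed
  then show "a k * a (N - k) = a 0 * a N" by (intro linprod_eqD[OF _ k]) simp
qed (rule that)

text \<open>
  Parseval's identity. Bessel's identity gives the distance of \<open>H\<close> from its partial sums, and by
  \<open>flow_at_0\<close> this distance is bounded by the tail.
\<close>

lemma mass_eq_nsq:
  assumes [measurable]: "H \<in> borel_measurable borel" and fin: "nsq half H < top"
    and a: "\<And>n. a n = (\<integral>s. H s * lagfun n s \<partial>half)"
  shows "nsq half H = ennreal mass"
proof -
  have bessel: "nsq half (\<lambda>s. H s - (\<Sum>n<K. a n * lagfun n s)) = ennreal (enn2real (nsq half H) - (\<Sum>n<K. (cmod (a n))\<^sup>2))"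
    "(\<Sum>n<K. (cmod (a n))\<^sup>2) \<le> enn2real (nsq half H)" for K
    by (rule bessel_identity[where e = lagfun]; simp add: nsq_lagfun_finite fin lagfun_orthonormal[simplified] a)+
  have "enn2real (nsq half H) - (\<Sum>n<K. (cmod (a n))\<^sup>2) \<le> tail K" for K
  proof -
    have "ennreal pi * nsq half (\<lambda>s. H s - (\<Sum>n<K. a n * lagfun n s))
        = nsq plane (\<lambda>x. H ((norm x)\<^sup>2) - (\<Sum>n<K. a n * lagfun n ((norm x)\<^sup>2)))"
      by (rule nsq_norm_sq[symmetric]) measurable
    also have "\<dots> = nsq plane (\<lambda>x. flow (x, 0) - partial a K x 0)"
      using flow_at_0[OF assms] by (intro nsq_cong_AE) (auto simp: partial_def mode_lens elim: eventually_mono)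
    also have "\<dots> \<le> ennreal (pi * tail K)" by (rule nsq_flow_partial)
    also have "\<dots> = ennreal pi * ennreal (tail K)" by (simp add: ennreal_mult tail_nonneg)
    finally have "nsq half (\<lambda>s. H s - (\<Sum>n<K. a n * lagfun n s)) \<le> ennreal (tail K)"
      by (subst (asm) ennreal_mult_le_mult_iff) auto
    then show ?thesis unfolding bessel(1) by (simp add: ennreal_le_iff tail_nonneg)
  qed
  then have "enn2real (nsq half H) - mass \<le> 0"
    by (intro LIMSEQ_le[OF tendsto_diff[OF tendsto_const sum_tendsto_mass] tail_tendsto]) auto
  moreover have "mass \<le> enn2real (nsq half H)"
    by (rule LIMSEQ_le_const2[OF sum_tendsto_mass]) (use bessel(2) in auto)
  ultimately have "enn2real (nsq half H) = mass" by simp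
  then show ?thesis using fin by (metis ennreal_enn2real)
qed

end

section \<open>The sharp inequality\<close>

lemma Lp_norm_4_lebesgue:
  assumes "(\<integral>\<^sup>+ p. ennreal ((cmod (u p)) ^ 4) \<partial>lborel) = ennreal i" "0 \<le> i"
  shows "Lp_norm 4 lebesgue u = ennreal (i powr (1 / 4))"
proof -
  have "norm z powr 4 = (norm z) ^ 4" for z :: complex
    by (cases "z = 0") (simp_all add: powr_numeral)
  then show ?thesis
    using assms unfolding Lp_norm_def nn_integral_completion by (simp add: Let_def)
qed

text \<open>
  With \<open>m = \<Sum>|a\<^sub>n|\<^sup>2\<close> the squared norm of the datum is \<open>\<pi> m\<close> and the bound for the fourth power is
  \<open>\<pi>\<^sup>2 m\<^sup>2/4\<close>; this is the origin of the constant.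
\<close>

lemma powr_quarter:
  assumes "0 \<le> m"
  shows "(pi\<^sup>2 / 4 * m\<^sup>2) powr (1 / 4) = 2 powr (- 1 / 2) * sqrt (pi * m)"
proof -
  have "(pi\<^sup>2 / 4 * m\<^sup>2) = (pi * m / 2)\<^sup>2" by (simp add: power_divide power_mult_distrib)
  also have "(pi * m / 2)\<^sup>2 powr (1 / 4) = (pi * m / 2) powr (1 / 2)"
    using assms by (cases "m = 0") (simp_all add: powr_powr flip: powr_numeral)
  also have "\<dots> = (pi * m) powr (1 / 2) * (1 / 2) powr (1 / 2)"
    using assms powr_mult[of "pi * m" "1 / 2" "1 / 2"] by simp
  also have "(1 / 2 :: real) powr (1 / 2) = 2 powr (- 1 / 2)"
    by (simp add: powr_minus_divide powr_divide)
  also have "(pi * m) powr (1 / 2) = sqrt (pi * m)" using assms by (intro powr_half_sqrt) simp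
  finally show ?thesis by simp
qed

text \<open>
  The flow is replaced by the Laguerre series of the profile of \<open>f\<close>. Then the inequality is
  \<open>flow_L4_le\<close>, and equality means that the Laguerre coefficients are geometric, that is, that the
  profile is an exponential.
\<close>

theorem corollary7:
  fixes f :: "real ^ 2 \<Rightarrow> complex"
  assumes "f \<in> Lp_space 2 lebesgue"
    and "radial f"
  shows "Lp_norm 4 lebesgue (schroedinger_flow f)
           \<le> ennreal (2 powr (- 1 / 2)) * Lp_norm 2 lebesgue f
       \<and> (Lp_norm 4 lebesgue (schroedinger_flow f)
           = ennreal (2 powr (- 1 / 2)) * Lp_norm 2 lebesgue f
          \<longleftrightarrow> (\<exists>A B :: complex. Re B > 0 \<and>
                (AE x in lebesgue. f x = A * exp (- B * of_real ((norm x)\<^sup>2)))))"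
proof -
  have fm: "f \<in> borel_measurable lebesgue" and fL: "Lp_norm 2 lebesgue f < \<infinity>"
    using assms(1) by (auto simp: Lp_space_def)
  obtain H where [measurable]: "H \<in> borel_measurable borel" and H: "AE x in plane. f x = H ((norm x)\<^sup>2)"
    using radial_profile[OF fm assms(2)] by blast
  have "nsq plane f = nsq plane (\<lambda>x. H ((norm x)\<^sup>2))" by (rule nsq_cong_AE[OF H])
  also have "\<dots> = ennreal pi * nsq half H" by (rule nsq_norm_sq) measurable
  finally have nf: "nsq plane f = ennreal pi * nsq half H" .
  have "nsq plane f < top"
    using fL Lp_space_2_iff[OF fm] assms(1) by simp
  then have Hfin: "nsq half H < top" unfolding nf by (auto simp: ennreal_mult_less_top)
  define a where "a n = (\<integral>s. H s * lagfun n s \<partial>half)" for n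
  have "(\<Sum>n<K. (cmod (a n))\<^sup>2) \<le> enn2real (nsq half H)" for K
    by (rule bessel_identity(2)[where e = lagfun]; simp add: nsq_lagfun_finite Hfin lagfun_orthonormal[simplified] a_def)
  then have "summable (\<lambda>n. (cmod (a n))\<^sup>2)" by (intro summableI_nonneg_bounded) auto
  then obtain r where "square_summable a r" by (rule square_summable_exists)
  then interpret square_summable a r .
  note mass = mass_eq_nsq[OF \<open>H \<in> borel_measurable borel\<close> Hfin a_def]
  have f0: "AE x in plane. flow (x, 0) = f x"
    using flow_at_0[OF \<open>H \<in> borel_measurable borel\<close> Hfin a_def] H by eventually_elim simp
  have sol: "schroedinger_solution f flow" by (rule flow_solution[OF f0])
  then have sol': "schroedinger_solution f (schroedinger_flow f)"
    unfolding schroedinger_flow_def by (rule someI[of "schroedinger_solution f"])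
  define i where "i = enn2real (\<integral>\<^sup>+ p. ennreal ((cmod (flow p)) ^ 4) \<partial>lborel)"
  have i: "(\<integral>\<^sup>+ p. ennreal ((cmod (flow p)) ^ 4) \<partial>lborel) = ennreal i" "0 \<le> i"
    using flow_L4_le by (auto simp: i_def intro!: ennreal_enn2real[symmetric] le_less_trans[OF flow_L4_le])
  have i_le: "i \<le> pi\<^sup>2 / 4 * mass\<^sup>2"
    using flow_L4_le unfolding i(1) by (subst (asm) ennreal_le_iff) auto
  have "(\<integral>\<^sup>+ p. ennreal ((cmod (schroedinger_flow f p)) ^ 4) \<partial>lborel) = ennreal i"
    unfolding i(1)[symmetric] using weak_solution_unique_spacetime[OF sol' sol]
    by (intro nn_integral_cong_AE) (auto elim: eventually_mono)
  then have L4: "Lp_norm 4 lebesgue (schroedinger_flow f) = ennreal (i powr (1 / 4))"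
    by (rule Lp_norm_4_lebesgue) (rule i(2))
  have L2: "Lp_norm 2 lebesgue f = ennreal (sqrt (pi * mass))"
    unfolding Lp_norm_2_lebesgue nf mass using mass_nonneg by (simp add: ennreal_mult[symmetric])
  have rhs: "ennreal (2 powr (- 1 / 2)) * Lp_norm 2 lebesgue f = ennreal ((pi\<^sup>2 / 4 * mass\<^sup>2) powr (1 / 4))"
    unfolding L2 powr_quarter[OF mass_nonneg] using mass_nonneg by (intro ennreal_mult[symmetric]) auto
  have eq_iff: "Lp_norm 4 lebesgue (schroedinger_flow f) = ennreal (2 powr (- 1 / 2)) * Lp_norm 2 lebesgue f
     \<longleftrightarrow> i = pi\<^sup>2 / 4 * mass\<^sup>2"
  proof -
    have "x powr (1 / 4) = y powr (1 / 4) \<longleftrightarrow> x = y" if "0 \<le> x" "0 \<le> y" for x y :: real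
      using that powr_less_mono2[of "1/4" x y] powr_less_mono2[of "1/4" y x] by (metis linorder_neqE_linordered_idom less_irrefl zero_less_divide_1_iff zero_less_numeral)
    then show ?thesis unfolding L4 rhs using i(2) by simp
  qed
  have le: "Lp_norm 4 lebesgue (schroedinger_flow f) \<le> ennreal (2 powr (- 1 / 2)) * Lp_norm 2 lebesgue f"
    unfolding L4 rhs using i(2) i_le by (intro ennreal_leI powr_mono2) auto
  have gm[measurable]: "(\<lambda>s. exp (- (B * complex_of_real s))) \<in> borel_measurable borel" for B
    by (intro borel_measurable_continuous_onI continuous_intros)
  have coeff: "(\<integral>s. (A * exp (- (B * of_real s))) * lagfun n s \<partial>half) = A / (B + 1/2) * ((B - 1/2) / (B + 1/2)) ^ n"
    if "0 < Re B" for A B n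
    using exp_lagfun_coeff[OF that, of n] by (simp add: mult.assoc)
  have "i = pi\<^sup>2 / 4 * mass\<^sup>2 \<longleftrightarrow> (\<exists>A B :: complex. Re B > 0 \<and>
                (AE x in lebesgue. f x = A * exp (- B * of_real ((norm x)\<^sup>2))))"
  proof
    assume "i = pi\<^sup>2 / 4 * mass\<^sup>2"
    then have "(\<integral>\<^sup>+ p. ennreal ((cmod (flow p)) ^ 4) \<partial>lborel) = ennreal (pi\<^sup>2 / 4 * mass\<^sup>2)"
      by (simp only: i(1))
    then obtain c z where geo: "\<And>n. a n = c * z ^ n" using geometric_if_flow_L4_eq by blast
    have "\<exists>A B. Re B > 0 \<and> (\<forall>n. a n = A / (B + 1/2) * ((B - 1/2) / (B + 1/2)) ^ n)"
    proof (cases "c = 0")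
      case True
      then show ?thesis using geo by (intro exI[of _ 0] exI[of _ 1]) simp
    next
      case False
      \<comment> \<open>Square summability puts the ratio into the open unit disc.\<close>
      have "summable (\<lambda>n. (cmod c)\<^sup>2 * ((cmod z)\<^sup>2) ^ n)"
        using summ unfolding geo by (simp add: norm_mult norm_power power_mult_distrib flip: power_mult) (simp add: mult.commute)
      then have "summable (\<lambda>n. ((cmod z)\<^sup>2) ^ n)" using False by (simp add: summable_cmult_iff)
      then have z1: "cmod z < 1" by (simp add: summable_geometric_iff abs_square_less_1)
      then have nz: "1 - z \<noteq> 0" by auto
      \<comment> \<open>The solution of \<open>(B - 1/2) / (B + 1/2) = z\<close>; it lies in the right half-plane because
        \<open>|z| < 1\<close>.\<close>
      define B where "B = (1 + z) / (2 * (1 - z))"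
      have B1: "B + 1/2 = 1 / (1 - z)" and B2: "B - 1/2 = z / (1 - z)"
        using nz by (simp_all add: B_def field_simps)
      have "Re B = (1 - (cmod z)\<^sup>2) / (2 * (cmod (1 - z))\<^sup>2)"
      proof -
        have "B = (1 + z) * cnj (1 - z) / (2 * of_real ((cmod (1 - z))\<^sup>2))"
        proof -
          have "x / (2 * w) = x * v / (2 * (w * v))" if "v \<noteq> 0" for x w v :: complex
            using that by simp
          from this[of "cnj (1 - z)"] show ?thesis
            unfolding B_def complex_norm_square using nz by (metis complex_cnj_zero_iff)
        qed
        also have "\<dots> = (1 + z) * cnj (1 - z) / of_real (2 * (cmod (1 - z))\<^sup>2)" by simp
        finally have "Re B = Re ((1 + z) * cnj (1 - z)) / (2 * (cmod (1 - z))\<^sup>2)"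
          by (simp only: Re_divide_of_real)
        also have "Re ((1 + z) * cnj (1 - z)) = 1 - (cmod z)\<^sup>2"
          unfolding cmod_power2 by (simp add: algebra_simps power2_eq_square)
        finally show ?thesis .
      qed
      also have "\<dots> > 0" using z1 nz by (intro divide_pos_pos) (auto simp: abs_square_less_1)
      finally have "Re B > 0" .
      moreover have "a n = (c / (1 - z)) / (B + 1/2) * ((B - 1/2) / (B + 1/2)) ^ n" for n
        unfolding B1 B2 using nz by (simp add: geo)
      ultimately show ?thesis by blast
    qed
    then obtain A B where B: "Re B > 0" and aB: "\<And>n. a n = A / (B + 1/2) * ((B - 1/2) / (B + 1/2)) ^ n" by blast
    have gfin: "nsq half (\<lambda>s. A * exp (- (B * of_real s))) < top"
      by (rule nsq_cmult_finite) (simp_all add: nsq_exp[OF B])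
    have "AE s in half. H s - A * exp (- (B * of_real s)) = 0"
    proof (rule lagfun_total)
      show "nsq half (\<lambda>s. H s - A * exp (- (B * of_real s))) < top"
        by (intro nsq_diff_finite Hfin gfin) measurable
      show "(\<integral>s. (H s - A * exp (- (B * of_real s))) * lagfun n s \<partial>half) = 0" for n
      proof -
        have "integrable half (\<lambda>s. H s * lagfun n s)" "integrable half (\<lambda>s. (A * exp (- (B * of_real s))) * lagfun n s)"
          by (intro integrable_mult_nsq Hfin gfin nsq_lagfun_finite; measurable)+
        then have "(\<integral>s. (H s - A * exp (- (B * of_real s))) * lagfun n s \<partial>half)
          = (\<integral>s. H s * lagfun n s \<partial>half) - (\<integral>s. (A * exp (- (B * of_real s))) * lagfun n s \<partial>half)"
          unfolding left_diff_distrib by (rule Bochner_Integration.integral_diff)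
        then show ?thesis unfolding coeff[OF B] a_def[symmetric] aB by simp
      qed
    qed measurable
    from AE_norm_sq[OF this] H have "AE x in plane. f x = A * exp (- B * of_real ((norm x)\<^sup>2))"
      by eventually_elim simp
    then show "\<exists>A B :: complex. Re B > 0 \<and> (AE x in lebesgue. f x = A * exp (- B * of_real ((norm x)\<^sup>2)))"
      using B AE_completion by blast
  next
    assume "\<exists>A B :: complex. Re B > 0 \<and> (AE x in lebesgue. f x = A * exp (- B * of_real ((norm x)\<^sup>2)))"
    then obtain A B :: complex where B: "Re B > 0" and "AE x in plane. f x = A * exp (- B * of_real ((norm x)\<^sup>2))"
      by (auto simp: AE_completion_iff)
    with H have "AE x in plane. H ((norm x)\<^sup>2) = A * exp (- (B * of_real ((norm x)\<^sup>2)))"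
      by (auto elim: eventually_elim2)
    then have "AE s in half. H s = A * exp (- (B * of_real s))"
      by (rule AE_half_if_AE_norm_sq[rotated]) measurable
    then have "a n = (\<integral>s. (A * exp (- (B * of_real s))) * lagfun n s \<partial>half)" for n
      unfolding a_def by (intro integral_cong_AE) (measurable, auto elim: eventually_mono)
    then have "a n = A / (B + 1/2) * ((B - 1/2) / (B + 1/2)) ^ n" for n
      unfolding coeff[OF B] .
    from flow_L4_geometric[OF this] show "i = pi\<^sup>2 / 4 * mass\<^sup>2"
      unfolding i(1) using i(2) by (subst (asm) ennreal_inj) auto
  qed
  with le eq_iff show ?thesis by blast
qed

end
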